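(* Let $\mathbf b>0$ be fixed and let the kernel $\mathcal K$ satisfy, in addition to the kernel assumption of the context, $\int z^j\mathcal K(z)\,dz=0$ for all $j=1,\dots,m_{\mathbf b}$. Then for any $L>0$, $p\in(1,\infty)$, $p^{-1}<\beta\le\mathbf b$ and $r\ge1$ there is a constant $\varkappa_3$, independent of $n$, such that for all $n\ge n_0\vee n_1$ (where $n_0$ is computed with any fixed $\beta_0\in(0,1)$, $M>0$ for which $\mathbb{N}_p(\beta,L)\subseteq\mathbb{F}(\beta_0,M)$) $$\sup_{F\in\mathbb{F}_{2,p}(\beta,L)}\mathcal R^{(n)}_r\big(\widehat F_{(\hat\theta,\hat h)},F\big)\le\varkappa_3\,\varphi_n(\beta,L,p),$$ where $$\varphi_n(\beta,L,p)=\begin{cases}L^{1/(2\beta+1)}\big(n^{-1}\ln(n)\big)^{\beta/(2\beta+1)},&(2\beta+1)p>r,\\[2pt] L^{1/(2\beta+1)}\big(n^{-1}\ln(n)\big)^{\beta/(2\beta+1)}\ln^{1/r}(n),&(2\beta+1)p=r,\\[2pt] L^{\frac{1/2-1/r}{\beta-1/p+1/2}}\big(n^{-1}\ln(n)\big)^{\frac{\beta-1/p+1/r}{2\beta-2/p+1}},&(2\beta+1)p<r.\end{cases}$$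
   Context: **Model.** One observes $(X_1,Y_1),\dots,(X_n,Y_n)\in\mathbb{R}^2\times\mathbb{R}$ with $Y_i=F(X_i)+\varepsilon_i$, where $F(x)=f(x^\top\theta^* )$ with unknown $f:\mathbb{R}\to\mathbb{R}$ and unknown $\theta^*\in\mathbb{S}^1$ (unit sphere of $\mathbb{R}^2$). The $X_i$ are i.i.d. with known Lebesgue density $g$, the $\varepsilon_i$ are i.i.d. centered, and the sequences $(X_i)$, $(\varepsilon_i)$ are independent. $\mathbb{E}^{(n)}_F$ is expectation under the law of $\{(X_i,Y_i)\}_{i=1}^n$. The global risk is $\mathcal R^{(n)}_{r}(\widehat F,F)=\mathbb{E}^{(n)}_F\|\widehat F-F\|_r$, with $\|\cdot\|_r$ the $L_r$ norm on $[-1/2,1/2]^2$. **Standing assumptions.** (Noise) $\varepsilon_1$ has a symmetric distribution with density in $\mathfrak P=\{\ell:\mathbb{R}\to\mathbb{R}_+ : \int_x^\infty \ell(y)\,dy\le\Upsilon e^{-\Omega x^\omega}\ \forall x\ge0\}$, where $\Upsilon>0,\Omega\in(0,1],\omega>0$ are fixed. (Design) There is $\underline g\in(0,1)$ with $\inf_{x\in[-3,3]^2}g(x)\ge\underline g$. (Kernel) $\mathcal K:\mathbb{R}\to\mathbb{R}$ is symmetric, $\mathrm{supp}(\mathcal K)\subseteq[-1/2,1/2]$, $\int\mathcal K=1$, and $|\mathcal K(u)-\mathcal K(v)|\le Q|u-v|$ for all $u,v$, for some $Q>0$. Put $K(u,v)=\mathcal K(u)\mathcal K(v)$; $\|\mathcal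 K\|_q$ is the $L_q(\mathbb{R})$ norm. **Function classes.** For $a>0$, $m_a$ is the maximal integer strictly less than $a$. The Nikol'skii class $\mathbb{N}_p(\beta,L)$ ($\beta,L>0$, $p\in[1,\infty)$) is the set of $m_\beta$-times continuously differentiable $\ell:\mathbb{R}\to\mathbb{R}$ with $\big(\int_{\mathbb{R}}|\ell^{(m)}(t)|^pdt\big)^{1/p}\le L$ for all $m=0,\dots,m_\beta$ and $\big(\int_{\mathbb{R}}|\ell^{(m_\beta)}(t+h)-\ell^{(m_\beta)}(t)|^pdt\big)^{1/p}\le Lh^{\beta-m_\beta}$ for all $h>0$. $\mathbb{F}_{2,p}(\beta,L)=\{F:\mathbb{R}^2\to\mathbb{R}: F(z)=f(z^\top\theta),\ f\in\mathbb{N}_p(\beta,L),\ \theta\in\mathbb{S}^1\}$. For $\beta_0\in(0,1),M>0$: $\mathbb{F}(\beta_0,M)=\{U:\mathbb{R}\to\mathbb{R}: \|U\|_\infty+\sup_{y_1\neq y_2}|U(y_1)-U(y_2)|/|y_1-y_2|^{\beta_0}\le M\}$. **Sample size.** $h_{\min}=n^{-1}\ln^{1+2/\omega}(n)$, $\mathfrak h=\sqrt{n^{-1}\ln^{1+1/\omega}(n)}$; $n_0=\inf\{m\in\mathbb{N}^*: (M\vee1)\max\{\mathfrak h^{\beta_0},\ln^{1/\omega}(n)h_{\min}^{\beta_0}\}\le1\ \forall n\ge m\}$; $n_1=\inf\{m\in\mathbb{N}^*: (n\mathfrak h^2)^{-1/2}C_3(n)\le1/2\ \forall n\ge m\}$.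 **Constants.** $\tau=(\Omega^{-1}(4r+1)\ln(n))^{1/\omega}$, $\sigma^2=\sup\int x^2\ell(x)\,dx$ over symmetric probability densities $\ell\in\mathfrak P$, $c_1(n)=730\ln(16n^2\underline g^{-1/2}[12Q+\sqrt2])+8r\ln(n)+394$, $c_2(n)=730\ln(16n^2\tau\underline g^{-1/2}[12Q+\sqrt2])+8r\ln(n)+394$, $c_3(n)=365\ln(5n^2Q\underline g^{-1/2})+8r\ln(n)+197$, $c_4(n)=365\ln(5n^2\tau Q\underline g^{-1/2})+8r\ln(n)+197$, $C_1(n)=2\sqrt2\,\underline g^{-1/2}\|\mathcal K\|_\infty^2\sqrt{c_1(n)}+\frac83c_1(n)(\ln n)^{-(2+\omega)/(2\omega)}\underline g^{-1}\|\mathcal K\|^2_\infty$, $C_2(n)=2\sqrt2(\sigma\vee1)\underline g^{-1/2}\|\mathcal K\|_\infty^2\sqrt{c_2(n)}+\frac83c_2(n)(\ln n)^{-1/2}\underline g^{-1}\|\mathcal K\|_\infty^2(\Omega^{-1}(4r+1))^{1/\omega}$, $C_3(n)=2\sqrt2\,\underline g^{-1/2}\|\mathcal K\|_\infty^2\sqrt{c_3(n)}+\frac83\underline g^{-1}\|\mathcal K\|_\infty^2c_3(n)(n\mathfrak h^2)^{-1/2}$, $C_4(n)=2\sqrt2(\sigma\vee1)\underline g^{-1/2}\|\mathcal K\|_\infty^2\sqrt{c_4(n)}+\frac83\tau c_4(n)(n\mathfrak h^2)^{-1/2}\underline g^{-1}\|\mathcal K\|_\infty^2$, $C_5(n)=\|\mathcal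 K\|_1^2+(n\mathfrak h^2)^{-1/2}C_4(n)+1/2$. **Estimator** (here $r$ is the index of the risk; the estimator does not depend on $\beta,L,p,\beta_0,M$). For a $2\times2$ matrix $E$ put $\widehat F(E,t)=\frac{\det(E)}n\sum_{i=1}^n\frac{K(E(X_i-t))}{g(X_i)}Y_i$. For $\theta,\nu\in\mathbb{S}^1$, $h>0$ let $E_{(\theta,h)}=\begin{pmatrix}h^{-1}\theta_1&h^{-1}\theta_2\\-\theta_2&\theta_1\end{pmatrix}$, $\overline E_{(\theta,h)(\nu,h)}=\begin{pmatrix}\frac{\theta_1+\nu_1}{2h(1+|\nu^\top\theta|)}&\frac{\theta_2+\nu_2}{2h(1+|\nu^\top\theta|)}\\-\frac{\theta_2+\nu_2}{2(1+|\nu^\top\theta|)}&\frac{\theta_1+\nu_1}{2(1+|\nu^\top\theta|)}\end{pmatrix}$, and $E_{(\theta,h)(\nu,h)}=\overline E_{(\theta,h)(\nu,h)}$ if $\nu^\top\theta\ge0$, $=\overline E_{(-\theta,h)(\nu,h)}$ if $\nu^\top\theta<0$. Write $\widehat F_{(\theta,h)}(t)=\widehat F(E_{(\theta,h)},t)$ and $\widehat F_{(\theta,h)(\nu,h)}(t)=\widehat F(E_{(\theta,h)(\nu,h)},t)$. Let $K_{\mathfrak h}(u_1,u_2)=\mathfrak h^{-2}\mathcal K(u_1/\mathfrak h)\mathcal K(u_2/\mathfrak h)$ and $\widehat F_\infty=2\sup_{v\in[-5/2,5/2]^2}\big|n^{-1}\sum_{i=1}^ng^{-1}(X_i)K_{\mathfrak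 h}(X_i-v)Y_i\big|+2C_5(n)$. For $\eta\in(0,1]$ let $\mathrm{TH}(\eta)=2\big[\|\mathcal K\|_\infty^2\sqrt{\ln(n)}+\widehat F_\infty C_1(n)+C_2(n)\big](\eta n)^{-1/2}$. Let $\mathcal H_n=\{2^{-k}:k=0,1,2,\dots\}\cap[2^{-1}h_{\min},1]$ and, for $\theta\in\mathbb{S}^1,h\in\mathcal H_n$, $R^{(1)}_t(\theta,h)=\sup_{\eta\in\mathcal H_n,\eta\le h}\big[\sup_{\nu\in\mathbb{S}^1}|\widehat F_{(\theta,\eta)(\nu,\eta)}(t)-\widehat F_{(\nu,\eta)}(t)|-\mathrm{TH}(\eta)\big]_+$, $R^{(2)}_t(h)=\sup_{\eta\in\mathcal H_n,\eta\le h}\big[\sup_{\theta\in\mathbb{S}^1}|\widehat F_{(\theta,h)}(t)-\widehat F_{(\theta,\eta)}(t)|-\mathrm{TH}(\eta)\big]_+$. $(\hat\theta,\hat h)$ (depending on $t$) is a measurable minimizer of $R^{(1)}_t(\theta,h)+R^{(2)}_t(h)+\mathrm{TH}(h)$ over $\mathbb{S}^1\times\mathcal H_n$, and the estimator is $t\mapsto\widehat F_{(\hat\theta,\hat h)}(t)$. *)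

theory Defs
  imports "HOL-Probability.Probability"
begin

text \<open>Values are taken in \<^typ>\<open>ennreal\<close>, so that a function outside
  the space has norm \<^term>\<open>\<infinity>\<close>.\<close>

definition L_norm :: "real \<Rightarrow> 'a measure \<Rightarrow> ('a \<Rightarrow> real) \<Rightarrow> ennreal" where
  "L_norm q M f =
     (let I = (\<integral>\<^sup>+ x. ennreal (\<bar>f x\<bar> powr q) \<partial>M)
      in if I = \<infinity> then \<infinity> else ennreal (enn2real I powr (1 / q)))"

definition L_inf_norm :: "'a measure \<Rightarrow> ('a \<Rightarrow> real) \<Rightarrow> ennreal" where
  "L_inf_norm M f = esssup M (\<lambda>x. ennreal \<bar>f x\<bar>)"

definition cube :: "real \<Rightarrow> (real^2) set" where
  "cube a = {x. \<forall>i. \<bar>x $ i\<bar> \<le> a}"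

abbreviation unit_circle :: "(real^2) set" where
  "unit_circle \<equiv> sphere 0 1"

definition strict_floor :: "real \<Rightarrow> nat" where
  "strict_floor a = (GREATEST m. real m < a)"

definition times_cont_diff :: "nat \<Rightarrow> (real \<Rightarrow> real) \<Rightarrow> bool" where
  "times_cont_diff m f \<longleftrightarrow>
     (\<forall>k<m. \<forall>x. (deriv ^^ k) f differentiable (at x)) \<and>
     continuous_on UNIV ((deriv ^^ m) f)"

definition nikolskii :: "real \<Rightarrow> real \<Rightarrow> real \<Rightarrow> (real \<Rightarrow> real) set" where
  "nikolskii p \<beta> L = {f.
     times_cont_diff (strict_floor \<beta>) f \<and>
     (\<forall>m\<le>strict_floor \<beta>. L_norm p lborel ((deriv ^^ m) f) \<le> ennreal L) \<and>
     (\<forall>h>0. L_norm p lborel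
              (\<lambda>t. (deriv ^^ strict_floor \<beta>) f (t + h) - (deriv ^^ strict_floor \<beta>) f t)
            \<le> ennreal (L * h powr (\<beta> - real (strict_floor \<beta>))))}"

definition single_index_class :: "real \<Rightarrow> real \<Rightarrow> real \<Rightarrow> (real^2 \<Rightarrow> real) set" where
  "single_index_class p \<beta> L =
     {F. \<exists>f \<in> nikolskii p \<beta> L. \<exists>\<theta> \<in> unit_circle. \<forall>z. F z = f (z \<bullet> \<theta>)}"

definition holder_class :: "real \<Rightarrow> real \<Rightarrow> (real \<Rightarrow> real) set" where
  "holder_class \<beta>0 M = {U.
     (SUP y. ennreal \<bar>U y\<bar>) +
     (SUP (y1, y2) \<in> {(y1, y2). y1 \<noteq> y2}. ennreal (\<bar>U y1 - U y2\<bar> / \<bar>y1 - y2\<bar> powr \<beta>0))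
     \<le> ennreal M}"

definition noise_class :: "real \<Rightarrow> real \<Rightarrow> real \<Rightarrow> (real \<Rightarrow> real) set" where
  "noise_class Up Om om = {l \<in> borel_measurable borel.
     (\<forall>y. 0 \<le> l y) \<and>
     (\<forall>x\<ge>0. (\<integral>\<^sup>+ y\<in>{x..}. ennreal (l y) \<partial>lborel) \<le> ennreal (Up * exp (- Om * x powr om)))}"

text \<open>The noise density \<open>l\<close> itself need only be symmetric almost everywhere;
  it is the distribution that is symmetric.\<close>

locale regression_model = prob_space P for P :: "'a measure" +
  fixes X :: "nat \<Rightarrow> 'a \<Rightarrow> real^2" and \<epsilon> :: "nat \<Rightarrow> 'a \<Rightarrow> real"
    and g :: "real^2 \<Rightarrow> real" and l :: "real \<Rightarrow> real"
  assumes g_nonneg: "\<And>x. 0 \<le> g x"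
    and X_density: "\<And>i. 1 \<le> i \<Longrightarrow> distributed P lborel (X i) (\<lambda>x. ennreal (g x))"
    and X_indep: "indep_vars (\<lambda>_. borel) X {1..}"
    and noise_density: "\<And>i. 1 \<le> i \<Longrightarrow> distributed P lborel (\<epsilon> i) (\<lambda>y. ennreal (l y))"
    and noise_indep: "indep_vars (\<lambda>_. borel) \<epsilon> {1..}"
    and noise_symmetric: "\<And>i. 1 \<le> i \<Longrightarrow> distr P borel (\<lambda>w. - \<epsilon> i w) = distr P borel (\<epsilon> i)"
    and noise_centered: "\<And>i. 1 \<le> i \<Longrightarrow> integrable P (\<epsilon> i) \<and> expectation (\<epsilon> i) = 0"
    and sequences_indep:
      "indep_set {(\<lambda>w. \<lambda>i\<in>{1..}. X i w) -` A \<inter> space P |A. A \<in> sets (\<Pi>\<^sub>M i\<in>{1..}. borel)}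
                 {(\<lambda>w. \<lambda>i\<in>{1..}. \<epsilon> i w) -` A \<inter> space P |A. A \<in> sets (\<Pi>\<^sub>M i\<in>{1..}. borel)}"

text \<open>A sample \<open>z\<close> of size \<open>n\<close> has the pairs \<open>z i = (X\<^sub>i, Y\<^sub>i)\<close> for \<open>i \<in> {1..n}\<close>.\<close>

type_synonym sample = "nat \<Rightarrow> (real^2) \<times> real"

definition sample_space :: "nat \<Rightarrow> sample measure" where
  "sample_space n = (\<Pi>\<^sub>M i\<in>{1..n}. borel)"

definition observations ::
    "(nat \<Rightarrow> 'a \<Rightarrow> real^2) \<Rightarrow> (nat \<Rightarrow> 'a \<Rightarrow> real) \<Rightarrow> nat \<Rightarrow> (real^2 \<Rightarrow> real) \<Rightarrow> 'a \<Rightarrow> sample" where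
  "observations X \<epsilon> n F w = (\<lambda>i\<in>{1..n}. (X i w, F (X i w) + \<epsilon> i w))"

definition risk ::
    "'a measure \<Rightarrow> (nat \<Rightarrow> 'a \<Rightarrow> real^2) \<Rightarrow> (nat \<Rightarrow> 'a \<Rightarrow> real) \<Rightarrow> real \<Rightarrow> nat
      \<Rightarrow> (sample \<Rightarrow> real^2 \<Rightarrow> real) \<Rightarrow> (real^2 \<Rightarrow> real) \<Rightarrow> ennreal" where
  "risk P X \<epsilon> r n est F =
     (\<integral>\<^sup>+ w. L_norm r (restrict_space lborel (cube (1/2)))
               (\<lambda>t. est (observations X \<epsilon> n F w) t - F t) \<partial>P)"

text \<open>\<open>kern\<close> is the one-dimensional kernel with Lipschitz constant \<open>lip\<close>, \<open>dens\<close> the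
  design density with lower bound \<open>dens_low\<close> on \<^term>\<open>cube 3\<close>, and \<open>Ups\<close>, \<open>Omg\<close>, \<open>omg\<close> are the
  parameters of \<^const>\<open>noise_class\<close> in this order.\<close>

record setting =
  kern :: "real \<Rightarrow> real"
  lip :: real
  dens :: "real^2 \<Rightarrow> real"
  dens_low :: real
  Ups :: real
  Omg :: real
  omg :: real

definition h_min :: "setting \<Rightarrow> nat \<Rightarrow> real" where
  "h_min S n = ln (real n) powr (1 + 2 / omg S) / real n"

definition h_pilot :: "setting \<Rightarrow> nat \<Rightarrow> real" where
  "h_pilot S n = sqrt (ln (real n) powr (1 + 1 / omg S) / real n)"

definition tau :: "setting \<Rightarrow> real \<Rightarrow> nat \<Rightarrow> real" where
  "tau S r n = ((4 * r + 1) / Omg S * ln (real n)) powr (1 / omg S)"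

definition sigma :: "setting \<Rightarrow> real" where
  "sigma S = sqrt (enn2real
     (SUP l \<in> {l \<in> noise_class (Ups S) (Omg S) (omg S).
                  (\<forall>x. l (- x) = l x) \<and> (\<integral>\<^sup>+ x. ennreal (l x) \<partial>lborel) = 1}.
        \<integral>\<^sup>+ x. ennreal (x^2 * l x) \<partial>lborel))"

definition kern_inf :: "setting \<Rightarrow> real" where
  "kern_inf S = enn2real (L_inf_norm lborel (kern S))"

definition kern_one :: "setting \<Rightarrow> real" where
  "kern_one S = enn2real (L_norm 1 lborel (kern S))"

definition c1 :: "setting \<Rightarrow> real \<Rightarrow> nat \<Rightarrow> real" where
  "c1 S r n = 730 * ln (16 * real n ^ 2 * dens_low S powr (-1/2) * (12 * lip S + sqrt 2))
              + 8 * r * ln (real n) + 394"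

definition c2 :: "setting \<Rightarrow> real \<Rightarrow> nat \<Rightarrow> real" where
  "c2 S r n = 730 * ln (16 * real n ^ 2 * tau S r n * dens_low S powr (-1/2) * (12 * lip S + sqrt 2))
              + 8 * r * ln (real n) + 394"

definition c3 :: "setting \<Rightarrow> real \<Rightarrow> nat \<Rightarrow> real" where
  "c3 S r n = 365 * ln (5 * real n ^ 2 * lip S * dens_low S powr (-1/2))
              + 8 * r * ln (real n) + 197"

definition c4 :: "setting \<Rightarrow> real \<Rightarrow> nat \<Rightarrow> real" where
  "c4 S r n = 365 * ln (5 * real n ^ 2 * tau S r n * lip S * dens_low S powr (-1/2))
              + 8 * r * ln (real n) + 197"

definition C1 :: "setting \<Rightarrow> real \<Rightarrow> nat \<Rightarrow> real" where
  "C1 S r n =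
     2 * sqrt 2 * dens_low S powr (-1/2) * kern_inf S ^ 2 * sqrt (c1 S r n)
     + 8/3 * c1 S r n * ln (real n) powr (- (2 + omg S) / (2 * omg S))
         * inverse (dens_low S) * kern_inf S ^ 2"

definition C2 :: "setting \<Rightarrow> real \<Rightarrow> nat \<Rightarrow> real" where
  "C2 S r n =
     2 * sqrt 2 * max (sigma S) 1 * dens_low S powr (-1/2) * kern_inf S ^ 2 * sqrt (c2 S r n)
     + 8/3 * c2 S r n * ln (real n) powr (-1/2)
         * inverse (dens_low S) * kern_inf S ^ 2 * ((4 * r + 1) / Omg S) powr (1 / omg S)"

definition C3 :: "setting \<Rightarrow> real \<Rightarrow> nat \<Rightarrow> real" where
  "C3 S r n =
     2 * sqrt 2 * dens_low S powr (-1/2) * kern_inf S ^ 2 * sqrt (c3 S r n)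
     + 8/3 * inverse (dens_low S) * kern_inf S ^ 2 * c3 S r n
         * (real n * h_pilot S n ^ 2) powr (-1/2)"

definition C4 :: "setting \<Rightarrow> real \<Rightarrow> nat \<Rightarrow> real" where
  "C4 S r n =
     2 * sqrt 2 * max (sigma S) 1 * dens_low S powr (-1/2) * kern_inf S ^ 2 * sqrt (c4 S r n)
     + 8/3 * tau S r n * c4 S r n * (real n * h_pilot S n ^ 2) powr (-1/2)
         * inverse (dens_low S) * kern_inf S ^ 2"

definition C5 :: "setting \<Rightarrow> real \<Rightarrow> nat \<Rightarrow> real" where
  "C5 S r n = kern_one S ^ 2 + (real n * h_pilot S n ^ 2) powr (-1/2) * C4 S r n + 1/2"

definition n0 :: "setting \<Rightarrow> real \<Rightarrow> real \<Rightarrow> nat" where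
  "n0 S \<beta>0 M = Inf {m. 1 \<le> m \<and> (\<forall>n\<ge>m.
     max M 1 * max (h_pilot S n powr \<beta>0) (ln (real n) powr (1 / omg S) * h_min S n powr \<beta>0) \<le> 1)}"

text \<open>At \<open>n = 1\<close> the factor \<open>(n h\<^sup>2)\<^sup>-\<^sup>1\<^sup>/\<^sup>2\<close> is infinite, whereas
  \<open>powr\<close> returns \<open>0\<close> there. This does not affect \<open>n1\<close>: the kernel conditions
  force \<open>lip \<ge> 4\<close> and \<open>kern_inf \<ge> 1\<close>, hence the inequality fails at \<open>n = 2\<close>
  and \<open>n1 \<ge> 3\<close>.\<close>

definition n1 :: "setting \<Rightarrow> real \<Rightarrow> nat" where
  "n1 S r = Inf {m. 1 \<le> m \<and> (\<forall>n\<ge>m.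
     (real n * h_pilot S n ^ 2) powr (-1/2) * C3 S r n \<le> 1/2)}"

definition kern2 :: "setting \<Rightarrow> real^2 \<Rightarrow> real" where
  "kern2 S u = kern S (u $ 1) * kern S (u $ 2)"

text \<open>The kernel is bounded, so the real suprema below are over bounded nonempty sets as long as
  \<open>h \<in> bandwidths S n\<close>. Division by \<open>dens\<close> is by \<open>0\<close> with probability zero only.\<close>

definition F_hat :: "setting \<Rightarrow> nat \<Rightarrow> sample \<Rightarrow> real^2^2 \<Rightarrow> real^2 \<Rightarrow> real" where
  "F_hat S n z E t =
     det E / real n *
     (\<Sum>i=1..n. kern2 S (E *v (fst (z i) - t)) / dens S (fst (z i)) * snd (z i))"

definition E_one :: "real^2 \<Rightarrow> real \<Rightarrow> real^2^2" where
  "E_one \<theta> h = vector [vector [\<theta> $ 1 / h, \<theta> $ 2 / h],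
                       vector [- (\<theta> $ 2), \<theta> $ 1]]"

definition E_bar :: "real^2 \<Rightarrow> real^2 \<Rightarrow> real \<Rightarrow> real^2^2" where
  "E_bar \<theta> \<nu> h =
     vector [vector [(\<theta> $ 1 + \<nu> $ 1) / (2 * h * (1 + \<bar>\<nu> \<bullet> \<theta>\<bar>)),
                     (\<theta> $ 2 + \<nu> $ 2) / (2 * h * (1 + \<bar>\<nu> \<bullet> \<theta>\<bar>))],
             vector [- ((\<theta> $ 2 + \<nu> $ 2) / (2 * (1 + \<bar>\<nu> \<bullet> \<theta>\<bar>))),
                     (\<theta> $ 1 + \<nu> $ 1) / (2 * (1 + \<bar>\<nu> \<bullet> \<theta>\<bar>))]]"

definition E_two :: "real^2 \<Rightarrow> real^2 \<Rightarrow> real \<Rightarrow> real^2^2" where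
  "E_two \<theta> \<nu> h = (if 0 \<le> \<nu> \<bullet> \<theta> then E_bar \<theta> \<nu> h else E_bar (- \<theta>) \<nu> h)"

definition F_inf :: "setting \<Rightarrow> real \<Rightarrow> nat \<Rightarrow> sample \<Rightarrow> real" where
  "F_inf S r n z =
     2 * (SUP v \<in> cube (5/2).
            \<bar>(\<Sum>i=1..n. inverse (dens S (fst (z i)))
                 * (kern2 S ((1 / h_pilot S n) *\<^sub>R (fst (z i) - v)) / h_pilot S n ^ 2)
                 * snd (z i)) / real n\<bar>)
     + 2 * C5 S r n"

definition TH :: "setting \<Rightarrow> real \<Rightarrow> nat \<Rightarrow> sample \<Rightarrow> real \<Rightarrow> real" where
  "TH S r n z \<eta> =
     2 * (kern_inf S ^ 2 * sqrt (ln (real n)) + F_inf S r n z * C1 S r n + C2 S r n)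
       * (\<eta> * real n) powr (-1/2)"

definition bandwidths :: "setting \<Rightarrow> nat \<Rightarrow> real set" where
  "bandwidths S n = range (\<lambda>k::nat. (1/2) ^ k) \<inter> {h_min S n / 2 .. 1}"

definition R_one :: "setting \<Rightarrow> real \<Rightarrow> nat \<Rightarrow> sample \<Rightarrow> real^2 \<Rightarrow> real^2 \<Rightarrow> real \<Rightarrow> real" where
  "R_one S r n z t \<theta> h =
     (SUP \<eta> \<in> {\<eta> \<in> bandwidths S n. \<eta> \<le> h}.
        max 0 ((SUP \<nu> \<in> unit_circle.
                  \<bar>F_hat S n z (E_two \<theta> \<nu> \<eta>) t - F_hat S n z (E_one \<nu> \<eta>) t\<bar>)
               - TH S r n z \<eta>))"

definition R_two :: "setting \<Rightarrow> real \<Rightarrow> nat \<Rightarrow> sample \<Rightarrow> real^2 \<Rightarrow> real \<Rightarrow> real" where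
  "R_two S r n z t h =
     (SUP \<eta> \<in> {\<eta> \<in> bandwidths S n. \<eta> \<le> h}.
        max 0 ((SUP \<theta> \<in> unit_circle.
                  \<bar>F_hat S n z (E_one \<theta> h) t - F_hat S n z (E_one \<theta> \<eta>) t\<bar>)
               - TH S r n z \<eta>))"

definition criterion :: "setting \<Rightarrow> real \<Rightarrow> nat \<Rightarrow> sample \<Rightarrow> real^2 \<Rightarrow> (real^2) \<times> real \<Rightarrow> real" where
  "criterion S r n z t = (\<lambda>(\<theta>, h). R_one S r n z t \<theta> h + R_two S r n z t h + TH S r n z h)"

text \<open>Measurability is joint in the sample and the point \<open>t\<close>, so that the integrals
  in the risk are those of measurable functions.\<close>

definition measurable_minimizer ::
    "setting \<Rightarrow> real \<Rightarrow> nat \<Rightarrow> (sample \<Rightarrow> real^2 \<Rightarrow> (real^2) \<times> real) \<Rightarrow> bool" where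
  "measurable_minimizer S r n sel \<longleftrightarrow>
     (\<lambda>(z, t). sel z t)
       \<in> borel_measurable (sample_space n \<Otimes>\<^sub>M restrict_space borel (cube (1/2))) \<and>
     (\<forall>z \<in> space (sample_space n). \<forall>t \<in> cube (1/2).
        sel z t \<in> unit_circle \<times> bandwidths S n \<and>
        (\<forall>q \<in> unit_circle \<times> bandwidths S n. criterion S r n z t (sel z t) \<le> criterion S r n z t q))"

definition estimator ::
    "setting \<Rightarrow> nat \<Rightarrow> (sample \<Rightarrow> real^2 \<Rightarrow> (real^2) \<times> real) \<Rightarrow> sample \<Rightarrow> real^2 \<Rightarrow> real" where
  "estimator S n sel z t = F_hat S n z (E_one (fst (sel z t)) (snd (sel z t))) t"

definition rate :: "real \<Rightarrow> nat \<Rightarrow> real \<Rightarrow> real \<Rightarrow> real \<Rightarrow> real" where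
  "rate r n \<beta> L p =
     (let x = ln (real n) / real n in
      if (2 * \<beta> + 1) * p > r then
        L powr (1 / (2 * \<beta> + 1)) * x powr (\<beta> / (2 * \<beta> + 1))
      else if (2 * \<beta> + 1) * p = r then
        L powr (1 / (2 * \<beta> + 1)) * x powr (\<beta> / (2 * \<beta> + 1)) * ln (real n) powr (1 / r)
      else
        L powr ((1/2 - 1/r) / (\<beta> - 1/p + 1/2))
          * x powr ((\<beta> - 1/p + 1/r) / (2 * \<beta> - 2/p + 1)))"

end

theory Submission
  imports Defs "HOL-Real_Asymp.Real_Asymp"
begin

text \<open>
  With probability \<open>1 - O(n\<^sup>-\<^sup>4)\<close> all the kernel estimators that enter the selection rule, uniformly
  over directions, bandwidths and points, deviate from their means by at most half of the threshold
  \<open>TH\<close>: Bernstein's inequality for truncated noise on a net of polynomial size, and Lipschitz continuity between the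
  points of the net. On this event the selection rule gives, for every bandwidth \<open>h\<close>, a loss of at
  most \<open>9 \<lambda> + 5 TH(h)\<close> at each point \<open>t\<close> where the one-dimensional kernel biases of \<open>f\<close> near
  \<open>t \<bullet> \<theta>\<close>, for windows up to \<open>2 h\<close>, are bounded by \<open>\<lambda>\<close>.

  The weak type bound for the maximal function, applied to the \<open>p\<close>-th power of the Taylor remainder
  of \<open>f\<close>, shows that this fails on a set of measure \<open>O(h\<^sup>\<beta>\<^sup>p / \<lambda>\<^sup>p)\<close> only, which is empty once \<open>\<lambda>\<close> exceeds
  a multiple of \<open>h\<^sup>\<beta>\<^sup>-\<^sup>1\<^sup>/\<^sup>p\<close>. Taking \<open>h = 2\<^sup>-\<^sup>k\<close>, with \<open>\<lambda>\<close> equal to the stochastic error at \<open>h\<close>, and using at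
  each \<open>t\<close> the largest admissible \<open>h\<close>, bounds the \<open>r\<close>-th power of the \<open>L\<^sub>r\<close> loss by a geometric
  sum over \<open>k\<close>; the three cases of the rate are the cases where its first term, all terms, or its last term dominate.

  Off the event a bound on the loss of order \<open>n\<close> suffices. The event is controlled for large \<open>n\<close> only;
  as \<open>n1 \<ge> 3\<close>, the finitely many other sample sizes are absorbed into the constant.
\<close>

section \<open>Nikol'skii classes\<close>

text \<open>The obstacle is that the direction is unknown, while the loss is pointwise on a square.
  The problem becomes one-dimensional because the mean of each kernel estimator in the rule is an
  iterated average of \<open>f\<close> around \<open>t \<bullet> \<theta>\<close>: an inner one with
  bandwidth h times a cosine, and an outer one over a transverse window proportional to the sine.
  \<open>E_two\<close> is built so that the estimator with both the true direction and \<nu> has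
  exactly the transverse window of the estimator with \<nu> alone; their means differ by inner
  biases only. The outer window has length up to 1 and is not small, which is why a maximal function
  is needed; since all inner bandwidths up to 2 h occur at once, its integrand is a sum over dyadic
  windows. The deviations scale with the supremum of the regression function, which is unknown; for
  large samples the pilot term \<open>F_inf\<close> lies above it on the good event and stays
  bounded, so a computable threshold does the job. The uniform bias of order h^(\<beta> - 1/p) comes
  from telescoping twice smoothed functions, a sum that converges because \<beta> > 1/p.\<close>

definition W :: "real measure" where
  "W = density lborel (\<lambda>u. ennreal (indicator {-1/2..1/2} u))"

lemma sets_W [simp, measurable_cong]: "sets W = sets borel"
  by (simp add: W_def)

lemma space_W [simp]: "space W = UNIV"
  by (simp add: W_def)

lemma nn_integral_W:
  assumes [measurable]: "f \<in> borel_measurable borel"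
  shows "(\<integral>\<^sup>+ u. f u \<partial>W) = (\<integral>\<^sup>+ u. f u * indicator {-1/2..1/2} u \<partial>lborel)"
  by (simp add: W_def nn_integral_density ennreal_indicator mult.commute)

lemma integral_W:
  fixes f :: "real \<Rightarrow> real"
  assumes [measurable]: "f \<in> borel_measurable borel"
  shows "(\<integral> u. f u \<partial>W) = (\<integral> u. indicator {-1/2..1/2} u * f u \<partial>lborel)"
  by (simp add: W_def integral_density)

lemma AE_W: "AE u in W. u \<in> {-1/2..1/2}"
  unfolding W_def by (subst AE_density) (auto simp: indicator_def split: if_splits)

text \<open>The window [-1/2, 1/2] has length one, so integrals over the kernel support are
  expectations and Jensen's inequality needs no normalising factor. \<open>W\<close> is a density
  rather than a restricted space to keep its sigma-algebra equal to \<open>borel\<close>.\<close>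

lemma prob_space_W: "prob_space W"
proof
  show "emeasure W (space W) = 1"
    by (simp add: W_def emeasure_density ennreal_indicator)
qed

interpretation W: prob_space W by (rule prob_space_W)

interpretation WW: pair_prob_space W W ..
interpretation WL: pair_sigma_finite W "lborel :: real measure" ..
interpretation LW: pair_sigma_finite "lborel :: real measure" W ..

lemma powr_above_tangent:
  fixes x c p :: real
  assumes "1 \<le> p" "0 < c" "0 \<le> x"
  shows "c powr p + p * c powr (p - 1) * (x - c) \<le> x powr p"
proof (cases "x = 0")
  case True
  have "c powr p = c * c powr (p - 1)"
    using assms by (simp add: powr_mult_base)
  then show ?thesis using True assms by (simp add: algebra_simps)
next
  case False
  then have x: "x > 0" using assms by simp
  have "p * c powr (p - 1) * (x - c) \<le> x powr p - c powr p"
    by (rule convex_on_imp_above_tangent[OF powr_convex, where f'="p * c powr (p - 1)"])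
       (use assms x in \<open>auto intro!: derivative_eq_intros simp: interior_open\<close>)
  then show ?thesis by simp
qed

text \<open>If \<open>g\<close> is not integrable its Bochner integral is 0, and if the right side
  is infinite nothing is to be shown; otherwise the tangent line of x^p at the mean c lies below x^p
  and integrates to c^p.\<close>

lemma (in prob_space) jensen_powr:
  fixes g :: "'a \<Rightarrow> real"
  assumes g [measurable]: "g \<in> borel_measurable M" and p: "1 \<le> p"
  shows "ennreal ((\<integral>x. \<bar>g x\<bar> \<partial>M) powr p) \<le> (\<integral>\<^sup>+x. ennreal (\<bar>g x\<bar> powr p) \<partial>M)"
proof -
  define c where "c = (\<integral>x. \<bar>g x\<bar> \<partial>M)"
  have "0 \<le> c" by (simp add: c_def)
  show ?thesis
  proof (cases "c = 0 \<or> (\<integral>\<^sup>+x. ennreal (\<bar>g x\<bar> powr p) \<partial>M) = \<infinity>")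
    case True
    then show ?thesis by (auto simp: c_def[symmetric])
  next
    case False
    with \<open>0 \<le> c\<close> have c: "0 < c" by simp
    have ig: "integrable M (\<lambda>x. \<bar>g x\<bar>)"
      using c by (rule contrapos_pp) (simp add: c_def not_integrable_integral_eq)
    have ip: "integrable M (\<lambda>x. \<bar>g x\<bar> powr p)"
    proof (rule integrableI_nonneg)
      show "(\<integral>\<^sup>+x. ennreal (\<bar>g x\<bar> powr p) \<partial>M) < \<infinity>"
        using False by (cases "\<integral>\<^sup>+x. ennreal (\<bar>g x\<bar> powr p) \<partial>M") auto
    qed auto
    have "(\<integral>x. c powr p + p * c powr (p - 1) * (\<bar>g x\<bar> - c) \<partial>M)
        = c powr p + p * c powr (p - 1) * ((\<integral>x. \<bar>g x\<bar> \<partial>M) - c)"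
      using ig by (simp add: prob_space)
    then have "c powr p = (\<integral>x. c powr p + p * c powr (p - 1) * (\<bar>g x\<bar> - c) \<partial>M)"
      by (simp only: c_def[symmetric])  simp
    also have "\<dots> \<le> (\<integral>x. \<bar>g x\<bar> powr p \<partial>M)"
      using ig ip by (intro integral_mono powr_above_tangent p c) auto
    finally have "ennreal (c powr p) \<le> ennreal (\<integral>x. \<bar>g x\<bar> powr p \<partial>M)"
      by (rule ennreal_leI)
    also have "\<dots> = (\<integral>\<^sup>+x. ennreal (\<bar>g x\<bar> powr p) \<partial>M)"
      using ip by (subst nn_integral_eq_integral) auto
    finally show ?thesis by (simp add: c_def)
  qed
qed

lemma L_norm_leD:
  assumes "L_norm p M f \<le> ennreal c" "0 \<le> c" "0 < p"
  shows "(\<integral>\<^sup>+x. ennreal (\<bar>f x\<bar> powr p) \<partial>M) \<le> ennreal (c powr p)"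
proof -
  define I where "I = (\<integral>\<^sup>+x. ennreal (\<bar>f x\<bar> powr p) \<partial>M)"
  have I: "I \<noteq> \<infinity>"
    using assms by (auto simp: L_norm_def I_def[symmetric] Let_def top_unique)
  then have "ennreal (enn2real I powr (1/p)) \<le> ennreal c"
    using assms by (simp add: L_norm_def I_def[symmetric] Let_def)
  then have "enn2real I powr (1/p) \<le> c" using assms by (simp add: ennreal_le_iff)
  then have "(enn2real I powr (1/p)) powr p \<le> c powr p"
    using assms by (intro powr_mono2) auto
  then have "enn2real I \<le> c powr p" using assms by (simp add: powr_powr)
  then have "ennreal (enn2real I) \<le> ennreal (c powr p)" by (rule ennreal_leI)
  moreover have "ennreal (enn2real I) = I" using I by (simp add: less_top)
  ultimately have "I \<le> ennreal (c powr p)" by metis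
  then show ?thesis by (simp add: I_def)
qed

lemma strict_floor_bounds:
  assumes "0 < a"
  shows "real (strict_floor a) < a" "a \<le> real (strict_floor a) + 1"
proof -
  have b: "\<And>y. real y < a \<Longrightarrow> y \<le> nat \<lceil>a\<rceil>" by linarith
  show "real (strict_floor a) < a" unfolding strict_floor_def
    by (rule GreatestI_nat[where k=0]) (use assms b in auto)
  show "a \<le> real (strict_floor a) + 1"
  proof (rule ccontr)
    assume "\<not> ?thesis"
    then have "real (strict_floor a + 1) < a" by simp
    then have "strict_floor a + 1 \<le> strict_floor a"
      unfolding strict_floor_def by (rule Greatest_le_nat) (rule b)
    then show False by simp
  qed
qed

lemma strict_floor_mono: "0 < a \<Longrightarrow> a \<le> b \<Longrightarrow> strict_floor a \<le> strict_floor b"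
  using strict_floor_bounds[of a] strict_floor_bounds[of b] by linarith

text \<open>Taylor remainder with base point \<open>y\<close> and increment \<open>v\<close> as
  separate arguments: the increment will be integrated against the kernel, while the base point
  ranges over the line.\<close>

definition tay :: "nat \<Rightarrow> (real \<Rightarrow> real) \<Rightarrow> real \<Rightarrow> real \<Rightarrow> real" where
  "tay m f y v = f (y + v) - (\<Sum>j\<le>m. (deriv ^^ j) f y * v ^ j / fact j)"

locale nikolskii_fun =
  fixes p \<beta> L :: real and f :: "real \<Rightarrow> real"
  assumes p: "1 \<le> p" and \<beta>: "0 < \<beta>" and L: "0 < L" and f: "f \<in> nikolskii p \<beta> L"
begin

definition m where "m = strict_floor \<beta>"

abbreviation D where "D \<equiv> (deriv ^^ m) f"

lemma deriv_f: "k < m \<Longrightarrow> ((deriv ^^ k) f has_real_derivative (deriv ^^ Suc k) f x) (at x)"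
  using f by (auto simp: nikolskii_def times_cont_diff_def m_def DERIV_deriv_iff_real_differentiable)

lemma cont_deriv: assumes "k \<le> m" shows "continuous_on UNIV ((deriv ^^ k) f)"
proof (cases "k = m")
  case True
  then show ?thesis using f by (auto simp: nikolskii_def times_cont_diff_def m_def)
next
  case False
  with assms have "k < m" by simp
  then show ?thesis
    by (intro continuous_at_imp_continuous_on ballI DERIV_isCont[OF deriv_f])
qed

lemma meas_deriv [measurable]: "k \<le> m \<Longrightarrow> (deriv ^^ k) f \<in> borel_measurable borel"
  by (rule borel_measurable_continuous_onI[OF cont_deriv])

lemma meas_D [measurable]: "D \<in> borel_measurable borel" by simp

lemma meas_f [measurable]: "f \<in> borel_measurable borel"
  using meas_deriv[of 0] by simp

lemma diff_pos: assumes "0 < v"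
  shows "(\<integral>\<^sup>+y. ennreal (\<bar>D (y + v) - D y\<bar> powr p) \<partial>lborel) \<le> ennreal ((L * \<bar>v\<bar> powr (\<beta> - m)) powr p)"
  using f p L assms by (intro L_norm_leD) (auto simp: nikolskii_def m_def)

text \<open>The class is defined through positive increments, but kernel windows are two-sided.
  Translating the integration variable turns a negative increment into a positive one.\<close>

lemma diff_all:
  "(\<integral>\<^sup>+y. ennreal (\<bar>D (y + v) - D y\<bar> powr p) \<partial>lborel) \<le> ennreal ((L * \<bar>v\<bar> powr (\<beta> - m)) powr p)"
proof -
  consider "v > 0" | "v = 0" | "v < 0" by linarith
  then show ?thesis
  proof cases
    case 3
    have "(\<integral>\<^sup>+y. ennreal (\<bar>D (y + v) - D y\<bar> powr p) \<partial>lborel) =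
          (\<integral>\<^sup>+y. ennreal (\<bar>D (y + (- v)) - D y\<bar> powr p) \<partial>lborel)"
      by (subst nn_integral_real_affine[where c=1 and t="-v"]) (auto simp: abs_minus_commute add.commute)
    also have "\<dots> \<le> ennreal ((L * \<bar>- v\<bar> powr (\<beta> - m)) powr p)"
      by (rule diff_pos) (use 3 in simp)
    finally show ?thesis by simp
  qed (auto intro: diff_pos[THEN order.trans])
qed

lemma meas_tay [measurable]: "(\<lambda>(y, v). tay m f y v) \<in> borel_measurable (borel \<Otimes>\<^sub>M borel)"
  unfolding tay_def split_beta' by measurable

text \<open>Taylor's formula of order m - 1 with integral remainder involves D (y + s v) against a
  weight of total mass 1 / m!. Subtracting the term of order m replaces D (y + s v) by the increment
  D (y + s v) - D y; the weight is at most 1, and Jensen's inequality on [0, 1] moves the p-th power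
  inside.\<close>

lemma tay_bound:
  assumes "m \<noteq> 0"
  shows "ennreal (\<bar>tay m f y v\<bar> powr p) \<le> ennreal (\<bar>v\<bar> powr (m * p)) *
    (\<integral>\<^sup>+s. ennreal (\<bar>D (y + s * v) - D y\<bar> powr p) * indicator {0..1} s \<partial>lborel)"
proof -
  interpret I: prob_space "restrict_space lborel {0..1::real}"
    by (rule prob_space_restrict_space) auto
  define Df where "Df i s = v ^ i * (deriv ^^ i) f (y + s * v)" for i s
  define w where "w s = (1 - s) ^ (m - 1) / fact (m - 1)" for s :: real
  have cD: "continuous_on S (\<lambda>s. D (y + s * v))" for S
    by (rule continuous_on_compose2[OF cont_deriv]) (auto intro!: continuous_intros)
  have der: "(Df i has_vector_derivative Df (Suc i) t) (at t within {0..1})" if "i < m" for i t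
    unfolding Df_def has_real_derivative_iff_has_vector_derivative[symmetric]
    by (rule DERIV_subset[where s=UNIV])
       (auto intro!: derivative_eq_intros DERIV_chain2[OF deriv_f[OF that]])
  have 1: "((\<lambda>x. ((1 - x) ^ (m - 1) / fact (m - 1)) *\<^sub>R Df m x) has_integral
        f (y + v) - (\<Sum>i<m. ((1 - 0) ^ i / fact i) *\<^sub>R Df i 0)) {0..1}"
    by (rule Taylor_has_integral[where f="Df 0" and Df=Df, THEN has_integral_eq_rhs])
       (use assms der in \<open>auto simp: Df_def\<close>)
  \<comment> \<open>The conditional is the constant 1 here, so this is the total mass of the weight;
    times v^m D y it is the Taylor term of order m.\<close>
  have 2: "((\<lambda>x. ((1 - x) ^ (m - 1) / fact (m - 1)) *\<^sub>R (if m = 0 then x ^ m else if m = m then (1::real) else 0)) has_integral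
       1 / fact m) {0..1}"
  proof -
    have "((\<lambda>x. (1 - x) ^ (m - 1) / fact (m - 1)) has_integral
        (- ((1 - 1) ^ m / fact m) - (- ((1 - 0) ^ m / fact m)))) {0..1::real}"
    proof (rule fundamental_theorem_of_calculus)
      fix x :: real
      have "real m / fact m = 1 / fact (m - 1)" using assms fact_reduce[of m, where 'a=real] by simp
      then show "((\<lambda>x. - ((1 - x) ^ m / fact m)) has_vector_derivative (1 - x) ^ (m - 1) / fact (m - 1)) (at x within {0..1})"
        unfolding has_real_derivative_iff_has_vector_derivative[symmetric]
        using assms by (auto intro!: derivative_eq_intros simp: field_simps)
    qed simp
    then show ?thesis using assms by (simp add: zero_power)
  qed
  have "((\<lambda>x. w x * v ^ m * (D (y + x * v) - D y)) has_integral
     (f (y + v) - (\<Sum>i<m. Df i 0 / fact i)) - v ^ m * D y * (1 / fact m)) {0..1}"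
    using has_integral_diff[OF 1 has_integral_mult_right[OF 2, of "v ^ m * D y"]] assms
    by (simp add: w_def Df_def algebra_simps diff_divide_distrib)
  also have "(f (y + v) - (\<Sum>i<m. Df i 0 / fact i)) - v ^ m * D y * (1 / fact m) = tay m f y v"
    by (simp add: tay_def lessThan_Suc_atMost[symmetric] Df_def mult.commute)
  finally have hi: "((\<lambda>x. w x * v ^ m * (D (y + x * v) - D y)) has_integral tay m f y v) {0..1}" .
  have si: "set_integrable lborel {0..1} (\<lambda>x. w x * v ^ m * (D (y + x * v) - D y))"
    unfolding set_integrable_def
    by (rule borel_integrable_compact) (auto intro!: continuous_intros cD simp: w_def)
  have si2: "set_integrable lborel {0..1} (\<lambda>x. \<bar>v\<bar> ^ m * \<bar>D (y + x * v) - D y\<bar>)"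
    unfolding set_integrable_def
    by (rule borel_integrable_compact) (auto intro!: continuous_intros cD)
  have "tay m f y v = (LINT x:{0..1}|lborel. w x * v ^ m * (D (y + x * v) - D y))"
    using set_borel_integral_eq_integral(2)[OF si] integral_unique[OF hi] by simp
  then have "\<bar>tay m f y v\<bar> \<le> (LINT x:{0..1}|lborel. \<bar>w x * v ^ m * (D (y + x * v) - D y)\<bar>)"
    using set_integral_norm_bound[OF si] by simp
  also have "\<dots> \<le> (LINT x:{0..1}|lborel. \<bar>v\<bar> ^ m * \<bar>D (y + x * v) - D y\<bar>)"
  proof (rule set_integral_mono[OF set_integrable_abs[OF si] si2])
    fix x :: real assume x: "x \<in> {0..1}"
    have "\<bar>w x\<bar> \<le> 1" using x
      by (auto simp: w_def abs_mult divide_le_eq intro!: order.trans[OF power_le_one fact_ge_1])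
    then show "\<bar>w x * v ^ m * (D (y + x * v) - D y)\<bar> \<le> \<bar>v\<bar> ^ m * \<bar>D (y + x * v) - D y\<bar>"
      by (simp add: abs_mult power_abs mult_left_le_one_le mult.assoc)
  qed
  also have "\<dots> = \<bar>v\<bar> ^ m * (\<integral>x. \<bar>D (y + x * v) - D y\<bar> \<partial>restrict_space lborel {0..1})"
    by (simp add: set_integral_mult_right integral_restrict_space set_lebesgue_integral_def)
  finally have "\<bar>tay m f y v\<bar> powr p \<le> (\<bar>v\<bar> ^ m * (\<integral>x. \<bar>D (y + x * v) - D y\<bar> \<partial>restrict_space lborel {0..1})) powr p"
    using p by (intro powr_mono2) auto
  also have "\<dots> = \<bar>v\<bar> powr (m * p) * (\<integral>x. \<bar>D (y + x * v) - D y\<bar> \<partial>restrict_space lborel {0..1}) powr p"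
    using assms by (cases "v = 0") (auto simp: powr_mult powr_realpow[symmetric] powr_powr)
  finally have "ennreal (\<bar>tay m f y v\<bar> powr p) \<le> ennreal (\<bar>v\<bar> powr (m * p)) *
     ennreal ((\<integral>x. \<bar>D (y + x * v) - D y\<bar> \<partial>restrict_space lborel {0..1}) powr p)"
    by (simp add: ennreal_mult'[symmetric] ennreal_leI)
  also have "\<dots> \<le> ennreal (\<bar>v\<bar> powr (m * p)) *
    (\<integral>\<^sup>+x. ennreal (\<bar>D (y + x * v) - D y\<bar> powr p) \<partial>restrict_space lborel {0..1})"
    by (intro mult_left_mono I.jensen_powr p measurable_restrict_space1) auto
  finally show ?thesis
    by (simp add: nn_integral_restrict_space)
qed

text \<open>Increments of D at steps s v with s in [0, 1] contribute |v|^(\<beta> - m), and the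
  factor |v|^m in front of them restores the full order \<beta>. For m = 0 the remainder is the
  increment itself.\<close>

lemma tay_Lp:
  "(\<integral>\<^sup>+y. ennreal (\<bar>tay m f y v\<bar> powr p) \<partial>lborel) \<le> ennreal ((L * \<bar>v\<bar> powr \<beta>) powr p)"
proof (cases "m = 0")
  case True
  then show ?thesis using diff_all[of v] by (simp add: tay_def)
next
  case False
  have mb: "\<beta> - m > 0" using strict_floor_bounds(1)[OF \<beta>] by (simp add: m_def)
  have "(\<integral>\<^sup>+y. ennreal (\<bar>tay m f y v\<bar> powr p) \<partial>lborel) \<le>
     (\<integral>\<^sup>+y. ennreal (\<bar>v\<bar> powr (m * p)) *
    (\<integral>\<^sup>+s. ennreal (\<bar>D (y + s * v) - D y\<bar> powr p) * indicator {0..1} s \<partial>lborel) \<partial>lborel)"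
    by (intro nn_integral_mono tay_bound False)
  also have "\<dots> = ennreal (\<bar>v\<bar> powr (m * p)) * (\<integral>\<^sup>+y.
    (\<integral>\<^sup>+s. ennreal (\<bar>D (y + s * v) - D y\<bar> powr p) * indicator {0..1} s \<partial>lborel) \<partial>lborel)"
    by (rule nn_integral_cmult) measurable
  also have "(\<integral>\<^sup>+y. (\<integral>\<^sup>+s. ennreal (\<bar>D (y + s * v) - D y\<bar> powr p) * indicator {0..1} s \<partial>lborel) \<partial>lborel)
     = (\<integral>\<^sup>+s. (\<integral>\<^sup>+y. ennreal (\<bar>D (y + s * v) - D y\<bar> powr p) * indicator {0..1} s \<partial>lborel) \<partial>lborel)"
    by (rule lborel_pair.Fubini') measurable
  also have "\<dots> \<le> (\<integral>\<^sup>+s. ennreal ((L * \<bar>v\<bar> powr (\<beta> - m)) powr p) * indicator {0..1} s \<partial>(lborel :: real measure))"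
  proof (rule nn_integral_mono)
    fix s :: real
    show "(\<integral>\<^sup>+y. ennreal (\<bar>D (y + s * v) - D y\<bar> powr p) * indicator {0..1} s \<partial>lborel) \<le>
        ennreal ((L * \<bar>v\<bar> powr (\<beta> - m)) powr p) * indicator {0..1} s"
    proof (cases "s \<in> {0..1}")
      case True
      have "(\<integral>\<^sup>+y. ennreal (\<bar>D (y + s * v) - D y\<bar> powr p) \<partial>lborel) \<le> ennreal ((L * \<bar>s * v\<bar> powr (\<beta> - m)) powr p)"
        by (rule diff_all)
      also have "\<dots> \<le> ennreal ((L * \<bar>v\<bar> powr (\<beta> - m)) powr p)"
        using True L p mb by (intro ennreal_leI powr_mono2 mult_left_mono) (auto simp: abs_mult mult_left_le_one_le)
      finally show ?thesis using True by simp
    qed simp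
  qed
  also have "\<dots> = ennreal ((L * \<bar>v\<bar> powr (\<beta> - m)) powr p)"
    by (simp add: nn_integral_cmult)
  finally have "(\<integral>\<^sup>+y. ennreal (\<bar>tay m f y v\<bar> powr p) \<partial>lborel) \<le> ennreal (\<bar>v\<bar> powr (m * p)) * ennreal ((L * \<bar>v\<bar> powr (\<beta> - m)) powr p)"
    by (meson mult_left_mono order_trans zero_le)
  also have "\<dots> = ennreal ((L * \<bar>v\<bar> powr \<beta>) powr p)"
    using L by (simp add: ennreal_mult'[symmetric] powr_mult powr_powr powr_add[symmetric] algebra_simps)
  finally show ?thesis .
qed

end

section \<open>Maximal function and kernel bias\<close>

text \<open>Rescaling u costs the factor h / d <= 2 and can only shrink the range of u. It serves to
  replace an arbitrary window by a dyadic one at most twice as long.\<close>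

lemma W_affine:
  assumes [measurable]: "\<phi> \<in> borel_measurable borel" and d: "0 < d" "d \<le> h" "h \<le> 2 * d"
  shows "(\<integral>\<^sup>+u. \<phi> (d * u) \<partial>W) \<le> 2 * (\<integral>\<^sup>+u. \<phi> (h * u) \<partial>W)"
proof -
  have hd: "h / d \<noteq> 0" using d by auto
  have "(\<integral>\<^sup>+u. \<phi> (d * u) \<partial>W) = (\<integral>\<^sup>+u. \<phi> (d * u) * indicator {-1/2..1/2} u \<partial>lborel)"
    by (rule nn_integral_W) measurable
  also have "\<dots> = ennreal \<bar>h / d\<bar> * (\<integral>\<^sup>+u. \<phi> (d * (0 + h / d * u)) * indicator {-1/2..1/2} (0 + h / d * u) \<partial>lborel)"
    by (rule nn_integral_real_affine) (use hd in auto)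
  also have "\<dots> \<le> 2 * (\<integral>\<^sup>+u. \<phi> (h * u) * indicator {-1/2..1/2} u \<partial>lborel)"
  proof (rule mult_mono[OF _ nn_integral_mono])
    show "ennreal \<bar>h / d\<bar> \<le> 2"
      using d by (auto simp: divide_le_eq ennreal_le_iff2 simp flip: ennreal_numeral)
    fix u :: real
    have "\<bar>u\<bar> \<le> \<bar>h / d * u\<bar>" using d by (simp add: abs_mult mult_left_le_one_le field_simps mult_right_mono)
    then have *: "z \<in> {-1/2..1/2} \<Longrightarrow> u \<in> {-1/2..1/2}" "d * z = h * u"
      if "z = 0 + h / d * u" for z using that d unfolding atLeastAtMost_iff by (linarith, simp)
    have "\<phi> (d * z) * indicator {-1/2..1/2} z \<le> \<phi> (h * u) * indicator {-1/2..1/2} u"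
      if "z = 0 + h / d * u" for z using *[OF that] by (auto simp: indicator_def)
    from this[OF refl]
    show "\<phi> (d * (0 + h / d * u)) * indicator {-1/2..1/2} (0 + h / d * u) \<le> \<phi> (h * u) * indicator {-1/2..1/2} u" .
  qed auto
  also have "\<dots> = 2 * (\<integral>\<^sup>+u. \<phi> (h * u) \<partial>W)"
    by (subst nn_integral_W) auto
  finally show ?thesis .
qed

text \<open>Weak type (1,1) of the maximal function; the Vitali covering makes the exceptional set measurable.\<close>

lemma window_average_level_set:
  fixes H :: "real \<Rightarrow> ennreal" and \<mu> :: real
  assumes [measurable]: "H \<in> borel_measurable borel" and \<mu>: "0 < \<mu>"
  shows "\<exists>U \<in> sets borel. emeasure lborel U \<le> ennreal (6 / \<mu>) * (\<integral>\<^sup>+y. H y \<partial>lborel) \<and>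
    (\<forall>y. y \<notin> U \<longrightarrow> (\<forall>s. \<bar>s\<bar> \<le> 1 \<longrightarrow> (\<integral>\<^sup>+u. H (y + s * u) \<partial>W) \<le> ennreal \<mu>))"
proof -
  \<comment> \<open>A ball is bad if the mean of \<open>H\<close> over it exceeds \<mu>. Radii up to
    1/2 suffice, since a window with |s| <= 1 covers the ball of radius |s| / 2.\<close>
  define bad where "bad y r \<longleftrightarrow> 0 < r \<and> r \<le> 1/2 \<and> ennreal (\<mu> * (2 * r)) < (\<integral>\<^sup>+v. H v * indicator (cball y r) v \<partial>lborel)" for y r
  define B where "B = {y. \<exists>r. bad y r}"
  define r where "r y = (SOME r. bad y r)" for y
  have r: "bad y (r y)" if "y \<in> B" for y
    using that unfolding B_def r_def by (auto intro: someI)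
  obtain C where C: "countable C" "C \<subseteq> B" "pairwise (\<lambda>i j. disjnt (cball i (r i)) (cball j (r j))) C"
     "B \<subseteq> (\<Union>i\<in>C. cball i (5 * r i))"
    by (rule Vitali_covering_lemma_cballs[of B "\<lambda>y. y" r B "1/2"])
       (use r in \<open>force simp: bad_def\<close>)+
  define V where "V = (\<Union>i\<in>C. cball i (5 * r i))"
  \<comment> \<open>For s = 0 the window average is the value \<open>H y\<close> itself, which
    averages over balls do not control directly; these points are removed separately by Chebyshev's
    inequality.\<close>
  define A where "A = {y. ennreal \<mu> < H y}"
  have Vm [measurable]: "V \<in> sets borel" unfolding V_def using C(1) by auto
  have Am [measurable]: "A \<in> sets borel" unfolding A_def by measurable
  have em_ball: "emeasure lborel (cball x (d::real)) = ennreal (2 * d)" if "d \<ge> 0" for x d :: real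
    using that by (simp add: cball_eq_atLeastAtMost)
  have "emeasure lborel V \<le> (\<integral>\<^sup>+i. emeasure lborel (cball i (5 * r i)) \<partial>count_space C)"
  proof -
    have "emeasure lborel V = (\<integral>\<^sup>+x. indicator V x \<partial>lborel)" by simp
    also have "\<dots> \<le> (\<integral>\<^sup>+x. (\<integral>\<^sup>+i. indicator (cball i (5 * r i)) x \<partial>count_space C) \<partial>lborel)"
    proof (rule nn_integral_mono)
      fix x
      show "indicator V x \<le> (\<integral>\<^sup>+i. indicator (cball i (5 * r i)) x \<partial>count_space C)"
      proof (cases "x \<in> V")
        case True
        then obtain i where i: "i \<in> C" "x \<in> cball i (5 * r i)" by (auto simp: V_def)
        have "indicator (cball i (5 * r i)) x \<le> (\<integral>\<^sup>+i. indicator (cball i (5 * r i)) x \<partial>count_space C)"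
          by (rule nn_integral_ge_point) (rule i(1))
        then show ?thesis using i(2) True by simp
      qed simp
    qed
    also have "\<dots> = (\<integral>\<^sup>+i. (\<integral>\<^sup>+x. indicator (cball i (5 * r i)) x \<partial>lborel) \<partial>count_space C)"
      by (intro nn_integral_count_space_nn_integral C(1) borel_measurable_indicator) simp
    finally show ?thesis by simp
  qed
  also have "\<dots> \<le> (\<integral>\<^sup>+i. ennreal (5 / \<mu>) * emeasure (density lborel H) (cball i (r i)) \<partial>count_space C)"
  proof (rule nn_integral_mono)
    fix i assume "i \<in> space (count_space C)"
    then have b: "bad i (r i)" using C(2) r by auto
    then have ri: "0 < r i" by (simp add: bad_def)
    \<comment> \<open>Vitali's dilation factor 5 acts on lengths; together with the factor 1 for
      \<open>A\<close> it gives the 6 of the statement.\<close>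
    have "emeasure lborel (cball i (5 * r i)) = ennreal (5 / \<mu>) * ennreal (\<mu> * (2 * r i))"
      using ri \<mu> by (simp add: em_ball ennreal_mult'[symmetric] field_simps)
    also have "\<dots> \<le> ennreal (5 / \<mu>) * emeasure (density lborel H) (cball i (r i))"
      using b by (intro mult_left_mono) (auto simp: bad_def emeasure_density)
    finally show "emeasure lborel (cball i (5 * r i)) \<le> ennreal (5 / \<mu>) * emeasure (density lborel H) (cball i (r i))" .
  qed
  also have "\<dots> = ennreal (5 / \<mu>) * (\<integral>\<^sup>+i. emeasure (density lborel H) (cball i (r i)) \<partial>count_space C)"
    by (rule nn_integral_cmult) simp
  also have "(\<integral>\<^sup>+i. emeasure (density lborel H) (cball i (r i)) \<partial>count_space C) = emeasure (density lborel H) (\<Union>i\<in>C. cball i (r i))"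
    by (rule emeasure_UN_countable[symmetric])
       (use C in \<open>auto simp: disjoint_family_on_def pairwise_def disjnt_def\<close>)
  also have "\<dots> \<le> emeasure (density lborel H) UNIV"
    by (rule emeasure_mono) auto
  also have "\<dots> = (\<integral>\<^sup>+y. H y \<partial>lborel)" by (simp add: emeasure_density)
  finally have V: "emeasure lborel V \<le> ennreal (5 / \<mu>) * (\<integral>\<^sup>+y. H y \<partial>lborel)"
    by (simp add: mult_left_mono)
  have "emeasure lborel A = (\<integral>\<^sup>+y. indicator A y \<partial>lborel)" by simp
  also have "\<dots> \<le> (\<integral>\<^sup>+y. ennreal (1 / \<mu>) * H y \<partial>lborel)"
  proof (rule nn_integral_mono)
    fix y
    have "1 = ennreal (1 / \<mu>) * ennreal \<mu>" using \<mu> by (simp add: ennreal_mult'[symmetric])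
    moreover have "y \<in> A \<Longrightarrow> ennreal (1 / \<mu>) * ennreal \<mu> \<le> ennreal (1 / \<mu>) * H y"
      by (intro mult_left_mono) (auto simp: A_def)
    ultimately have "y \<in> A \<Longrightarrow> 1 \<le> ennreal (1 / \<mu>) * H y" by simp
    then show "indicator A y \<le> ennreal (1 / \<mu>) * H y" by (auto simp: indicator_def)
  qed
  also have "\<dots> = ennreal (1 / \<mu>) * (\<integral>\<^sup>+y. H y \<partial>lborel)" by (rule nn_integral_cmult) measurable
  finally have A: "emeasure lborel A \<le> ennreal (1 / \<mu>) * (\<integral>\<^sup>+y. H y \<partial>lborel)" .
  have "emeasure lborel (A \<union> V) \<le> emeasure lborel A + emeasure lborel V"
    by (rule emeasure_subadditive) auto
  also have "\<dots> \<le> ennreal (1 / \<mu>) * (\<integral>\<^sup>+y. H y \<partial>lborel) + ennreal (5 / \<mu>) * (\<integral>\<^sup>+y. H y \<partial>lborel)"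
    by (rule add_mono[OF A V])
  also have "\<dots> = ennreal (6 / \<mu>) * (\<integral>\<^sup>+y. H y \<partial>lborel)"
    using \<mu> by (simp add: distrib_right[symmetric] ennreal_plus[symmetric] add_divide_distrib[symmetric] del: ennreal_plus)
  finally have U: "emeasure lborel (A \<union> V) \<le> ennreal (6 / \<mu>) * (\<integral>\<^sup>+y. H y \<partial>lborel)" .
  have "(\<integral>\<^sup>+u. H (y + s * u) \<partial>W) \<le> ennreal \<mu>" if y: "y \<notin> A \<union> V" and s: "\<bar>s\<bar> \<le> 1" for y s
  proof (cases "s = 0")
    case True
    then show ?thesis using y by (simp add: A_def not_less W.emeasure_space_1[simplified])
  next
    case False
    have "y \<notin> B" using y C(4) by (auto simp: V_def)
    then have "\<not> bad y (\<bar>s\<bar> / 2)" by (auto simp: B_def)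
    then have nb: "(\<integral>\<^sup>+v. H v * indicator (cball y (\<bar>s\<bar> / 2)) v \<partial>lborel) \<le> ennreal (\<mu> * \<bar>s\<bar>)"
      using False s by (auto simp: bad_def)
    have "ennreal \<bar>s\<bar> * (\<integral>\<^sup>+u. H (y + s * u) \<partial>W) = ennreal \<bar>s\<bar> * (\<integral>\<^sup>+u. H (y + s * u) * indicator (cball y (\<bar>s\<bar> / 2)) (y + s * u) \<partial>lborel)"
      using False by (subst nn_integral_W)
        (auto intro!: arg_cong2[where f="(*)"] nn_integral_cong simp: indicator_def dist_real_def abs_mult abs_le_iff)
    also have "\<dots> = (\<integral>\<^sup>+v. H v * indicator (cball y (\<bar>s\<bar> / 2)) v \<partial>lborel)"
      using False by (subst (2) nn_integral_real_affine[where c=s and t=y])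
        (auto intro!: borel_measurable_times_ennreal borel_measurable_indicator)
    also note nb
    finally have "ennreal \<bar>s\<bar> * (\<integral>\<^sup>+u. H (y + s * u) \<partial>W) \<le> ennreal \<bar>s\<bar> * ennreal \<mu>"
      using \<mu> by (simp add: ennreal_mult'[symmetric] mult.commute)
    then show ?thesis
      using False by (subst (asm) ennreal_mult_le_mult_iff) auto
  qed
  then show ?thesis using U by (intro bexI[of _ "A \<union> V"]) auto
qed

section \<open>Kernel averages on the line\<close>

locale kernel_fun =
  fixes K :: "real \<Rightarrow> real" and k :: real and mk :: nat
  assumes K_meas [measurable]: "K \<in> borel_measurable borel"
    and K_le: "\<bar>K u\<bar> \<le> k" and K_sym: "K (- u) = K u"
    and K_int: "(\<integral>u. K u \<partial>W) = 1"
    and K_mom: "j \<in> {1..mk} \<Longrightarrow> (\<integral>u. u ^ j * K u \<partial>W) = 0"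
begin

text \<open>The window length \<open>d\<close> may be negative or 0, since it will be a bandwidth
  times an inner product of two directions; \<open>avg 0\<close> is the identity because the kernel
  integrates to 1.\<close>

definition avg :: "real \<Rightarrow> (real \<Rightarrow> real) \<Rightarrow> real \<Rightarrow> real" where
  "avg d g y = (\<integral>u. K u * g (y + d * u) \<partial>W)"

lemma k0: "0 \<le> k" using K_le[of 0] by simp

lemma K_integrable: "integrable W K"
  by (rule W.integrable_const_bound[where B=k]) (auto simp: K_le)

lemma k1: "1 \<le> k"
proof -
  have "(\<integral>u. K u \<partial>W) \<le> (\<integral>u. k \<partial>W)"
    by (intro integral_mono K_integrable) (auto intro: abs_le_D1[OF K_le])
  then show ?thesis by (simp add: K_int W.prob_space[simplified])
qed

lemma avg_integrable:
  assumes [measurable]: "g \<in> borel_measurable borel" and g: "\<And>x. \<bar>g x\<bar> \<le> B"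
  shows "integrable W (\<lambda>u. K u * g (y + d * u))"
  by (rule W.integrable_const_bound[where B="k * B"])
     (auto simp: abs_mult intro!: mult_mono K_le g k0)

lemma integral_W_le:
  fixes g :: "real \<Rightarrow> real"
  assumes "\<And>u. u \<in> {-1/2..1/2} \<Longrightarrow> \<bar>g u\<bar> \<le> B"  "g \<in> borel_measurable borel"
  shows "\<bar>\<integral>u. g u \<partial>W\<bar> \<le> B"
proof -
  have B: "0 \<le> B" using order.trans[OF abs_ge_zero assms(1)[of 0, simplified]] by simp
  have ae: "AE u in W. \<bar>g u\<bar> \<le> B" using AE_W by eventually_elim (auto intro: assms)
  have "integrable W g"
    using ae assms(2) by (intro W.integrable_const_bound[where B=B]) auto
  then have "\<bar>\<integral>u. g u \<partial>W\<bar> \<le> (\<integral>u. B \<partial>W)"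
    by (intro order.trans[OF integral_abs_bound] integral_mono_AE) (use ae in auto)
  then show ?thesis by (simp add: W.prob_space[simplified])
qed

lemma avg_meas [measurable]:
  assumes [measurable]: "g \<in> borel_measurable borel" shows "avg d g \<in> borel_measurable borel"
  unfolding avg_def by measurable

lemma avg_le:
  assumes [measurable]: "g \<in> borel_measurable borel" and g: "\<And>x. \<bar>g x\<bar> \<le> B"
  shows "\<bar>avg d g y\<bar> \<le> k * B"
  unfolding avg_def
  by (rule integral_W_le) (auto simp: abs_mult intro!: mult_mono K_le g k0)

lemma avg_diff:
  assumes [measurable]: "g \<in> borel_measurable borel" "g' \<in> borel_measurable borel"
    and g: "\<And>x. \<bar>g x\<bar> \<le> B" "\<And>x. \<bar>g' x\<bar> \<le> B'"
  shows "avg d (\<lambda>x. g x - g' x) y = avg d g y - avg d g' y"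
  unfolding avg_def right_diff_distrib
  by (rule Bochner_Integration.integral_diff) (rule avg_integrable[OF _ g(1)] avg_integrable[OF _ g(2)]; measurable)+

lemma integral_W_minus:
  fixes g :: "real \<Rightarrow> real"
  assumes [measurable]: "g \<in> borel_measurable borel"
  shows "(\<integral>u. g (- u) \<partial>W) = (\<integral>u. g u \<partial>W)"
  apply (subst (1 2) integral_W, measurable)
  apply (subst (2) lborel_integral_real_affine[where c="-1" and t=0], simp)
  by (auto intro!: Bochner_Integration.integral_cong simp: indicator_def)

lemma avg_minus:
  assumes [measurable]: "g \<in> borel_measurable borel"
  shows "avg (- d) g y = avg d g y"
  unfolding avg_def
  by (subst integral_W_minus[symmetric], measurable) (simp add: K_sym)

lemma avg_abs:
  assumes [measurable]: "g \<in> borel_measurable borel"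
  shows "avg \<bar>d\<bar> g y = avg d g y"
  using avg_minus[OF assms, of d y] by (auto simp: abs_if)

lemma avg_zero: "avg 0 g y = g y"
  by (simp add: avg_def K_int)

text \<open>Fubini's theorem on \<open>W\<close> times \<open>W\<close>. Commutation is what lets
  the mixed terms cancel when twice smoothed functions at two scales are compared.\<close>

lemma avg_commute:
  assumes [measurable]: "g \<in> borel_measurable borel" and g: "\<And>x. \<bar>g x\<bar> \<le> B"
  shows "avg d (avg d' g) y = avg d' (avg d g) y"
proof -
  have B: "0 \<le> B" using g[of 0] by simp
  have "avg d (avg d' g) y = (\<integral>u. (\<integral>w. K u * (K w * g (y + d * u + d' * w)) \<partial>W) \<partial>W)"
    unfolding avg_def by simp
  also have "\<dots> = (\<integral>w. (\<integral>u. K u * (K w * g (y + d * u + d' * w)) \<partial>W) \<partial>W)"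
  proof (rule WW.Fubini_integral[symmetric])
    show "integrable (W \<Otimes>\<^sub>M W) (\<lambda>(u, w). K u * (K w * g (y + d * u + d' * w)))"
      by (rule WW.P.integrable_const_bound[where B="k * (k * B)"])
         (auto simp: abs_mult split_beta' intro!: mult_mono K_le g k0)
  qed
  also have "\<dots> = avg d' (avg d g) y"
    unfolding avg_def by (simp add: ac_simps flip: integral_mult_right_zero)
  finally show ?thesis .
qed

text \<open>Jensen's inequality after |K| <= k; a non-integrable product has Bochner integral 0, so
  every Borel function is covered.\<close>

lemma powr_abs_integral_le:
  assumes [measurable]: "g \<in> borel_measurable borel" and p: "1 \<le> p"
  shows "ennreal (\<bar>\<integral>u. K u * g u \<partial>W\<bar> powr p) \<le> ennreal (k powr p) * (\<integral>\<^sup>+u. ennreal (\<bar>g u\<bar> powr p) \<partial>W)"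
proof (cases "integrable W (\<lambda>u. K u * g u)")
  case True
  have "ennreal (\<bar>\<integral>u. K u * g u \<partial>W\<bar> powr p) \<le> ennreal ((\<integral>u. \<bar>K u * g u\<bar> \<partial>W) powr p)"
    using p by (intro ennreal_leI powr_mono2 integral_abs_bound) auto
  also have "\<dots> \<le> (\<integral>\<^sup>+u. ennreal (\<bar>K u * g u\<bar> powr p) \<partial>W)"
    by (rule W.jensen_powr[OF _ p]) measurable
  also have "\<dots> \<le> (\<integral>\<^sup>+u. ennreal (k powr p) * ennreal (\<bar>g u\<bar> powr p) \<partial>W)"
  proof (rule nn_integral_mono)
    fix u
    have "\<bar>K u * g u\<bar> powr p \<le> (k * \<bar>g u\<bar>) powr p"
      using p by (intro powr_mono2) (auto simp: abs_mult intro!: mult_right_mono K_le)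
    then show "ennreal (\<bar>K u * g u\<bar> powr p) \<le> ennreal (k powr p) * ennreal (\<bar>g u\<bar> powr p)"
      using k0 by (simp add: powr_mult ennreal_mult'[symmetric] ennreal_leI)
  qed
  also have "\<dots> = ennreal (k powr p) * (\<integral>\<^sup>+u. ennreal (\<bar>g u\<bar> powr p) \<partial>W)"
    by (rule nn_integral_cmult) measurable
  finally show ?thesis .
qed (use p in \<open>simp add: not_integrable_integral_eq\<close>)

text \<open>Enlarging the window to the whole line and undoing the scaling by d turns an L_p bound
  into a uniform one. The Jacobian 1 / d under the p-th root is the loss d^(-1/p) that lowers the
  order from \<beta> to \<beta> - 1/p below.\<close>

lemma avg_sup_le:
  assumes [measurable]: "g \<in> borel_measurable borel" and p: "1 \<le> p" and d: "0 < d" and N: "0 \<le> N"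
    and g: "(\<integral>\<^sup>+x. ennreal (\<bar>g x\<bar> powr p) \<partial>lborel) \<le> ennreal (N powr p)"
  shows "\<bar>avg d g y\<bar> \<le> k * (N * d powr (- 1 / p))"
proof -
  have "ennreal (\<bar>avg d g y\<bar> powr p) \<le> ennreal (k powr p) * (\<integral>\<^sup>+u. ennreal (\<bar>g (y + d * u)\<bar> powr p) \<partial>W)"
    unfolding avg_def by (rule powr_abs_integral_le[OF _ p]) measurable
  also have "\<dots> \<le> ennreal (k powr p) * (\<integral>\<^sup>+u. ennreal (\<bar>g (y + d * u)\<bar> powr p) \<partial>lborel)"
    by (subst nn_integral_W) (auto intro!: mult_left_mono nn_integral_mono simp: indicator_def)
  also have "(\<integral>\<^sup>+u. ennreal (\<bar>g (y + d * u)\<bar> powr p) \<partial>lborel) =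
      ennreal (1 / d) * (ennreal \<bar>d\<bar> * (\<integral>\<^sup>+u. ennreal (\<bar>g (y + d * u)\<bar> powr p) \<partial>lborel))"
    using d by (simp add: mult.assoc[symmetric] ennreal_mult'[symmetric])
  also have "(ennreal \<bar>d\<bar> * (\<integral>\<^sup>+u. ennreal (\<bar>g (y + d * u)\<bar> powr p) \<partial>lborel)) = (\<integral>\<^sup>+x. ennreal (\<bar>g x\<bar> powr p) \<partial>lborel)"
    using d by (subst (2) nn_integral_real_affine[where c=d and t=y]) auto
  also have "ennreal (k powr p) * (ennreal (1 / d) * \<dots>) \<le> ennreal (k powr p) * (ennreal (1 / d) * ennreal (N powr p))"
    by (intro mult_left_mono g) auto
  also have "\<dots> = ennreal ((k * (N * d powr (- 1 / p))) powr p)"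
    using d k0 N p by (simp add: powr_mult powr_powr powr_divide ennreal_mult'[symmetric] powr_minus_divide ac_simps)
  finally have "\<bar>avg d g y\<bar> powr p \<le> (k * (N * d powr (- 1 / p))) powr p"
    by (simp add: ennreal_le_iff)
  then show ?thesis
    using powr_less_mono2[of p "k * (N * d powr (- 1 / p))" "\<bar>avg d g y\<bar>"] p k0 N by (auto simp: not_le[symmetric])
qed

lemma avg_Holder:
  assumes [measurable]: "g \<in> borel_measurable borel" and g: "\<And>x. \<bar>g x\<bar> \<le> B"
    and b: "0 < b" and H: "\<And>x v. \<bar>g (x + v) - g x\<bar> \<le> M * \<bar>v\<bar> powr b"
  shows "\<bar>avg d g y - g y\<bar> \<le> k * (M * \<bar>d\<bar> powr b)"
proof -
  have M: "0 \<le> M" using H[of 0 1] by simp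
  have "avg d g y - g y = avg d g y - (\<integral>u. K u * g y \<partial>W)" by (simp add: K_int)
  also have "\<dots> = (\<integral>u. K u * g (y + d * u) - K u * g y \<partial>W)"
    unfolding avg_def using avg_integrable[OF assms(1) g, where d=d and y=y] avg_integrable[OF assms(1) g, where d=0 and y=y] K_integrable
    by (subst Bochner_Integration.integral_diff) auto
  also have "\<bar>\<dots>\<bar> \<le> k * (M * \<bar>d\<bar> powr b)"
  proof (rule integral_W_le)
    fix u :: real assume u: "u \<in> {-1/2..1/2}"
    have "\<bar>K u * g (y + d * u) - K u * g y\<bar> = \<bar>K u\<bar> * \<bar>g (y + d * u) - g y\<bar>"
      by (simp add: abs_mult right_diff_distrib[symmetric])
    also have "\<dots> \<le> k * (M * \<bar>d * u\<bar> powr b)"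
      by (intro mult_mono K_le H k0) auto
    also have "\<dots> \<le> k * (M * \<bar>d\<bar> powr b)"
      using u b by (intro mult_left_mono powr_mono2 M k0) (auto simp: abs_mult intro!: mult_left_le)
    finally show "\<bar>K u * g (y + d * u) - K u * g y\<bar> \<le> k * (M * \<bar>d\<bar> powr b)" .
  qed measurable
  finally show ?thesis .
qed

end

section \<open>Bias of kernel averages of a Nikol'skii function\<close>

locale nik_kernel = nikolskii_fun p \<beta> L f + kernel_fun K k mk
  for p \<beta> L f K k mk +
  fixes b M :: real
  assumes mk: "m \<le> mk" and b: "0 < b" and f_le: "\<And>x. \<bar>f x\<bar> \<le> M"
    and f_Holder: "\<And>x v. \<bar>f (x + v) - f x\<bar> \<le> M * \<bar>v\<bar> powr b"
    and \<beta>p: "1 / p < \<beta>"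
begin

lemma M0: "0 \<le> M" using order.trans[OF abs_ge_zero f_le[of 0]] .

text \<open>The vanishing moments remove the Taylor terms of order 1 to m and the unit integral
  removes \<open>f y\<close>, so the bias is the kernel average of the remainder alone. This is
  where \<open>m \<le> mk\<close> enters.\<close>

lemma avg_tay:
  "avg d f y - f y = (\<integral>u. K u * tay m f y (d * u) \<partial>W)"
proof -
  have ij: "integrable W (\<lambda>u. u ^ j * K u)" for j
  proof (rule W.integrable_const_bound[where B=k])
    show "AE u in W. norm (u ^ j * K u) \<le> k"
      using AE_W
    proof eventually_elim
      fix u :: real assume "u \<in> {-1/2..1/2}"
      then have "\<bar>u\<bar> ^ j \<le> 1" by (intro power_le_one) auto
      then have "\<bar>u\<bar> ^ j * \<bar>K u\<bar> \<le> 1 * k" by (intro mult_mono K_le) auto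
      then show "norm (u ^ j * K u) \<le> k" by (simp add: abs_mult power_abs)
    qed
  qed measurable
  have mom: "(\<integral>u. u ^ j * K u \<partial>W) = (if j = 0 then 1 else 0)" if "j \<le> m" for j
    using that mk K_mom[of j] by (auto simp: K_int)
  have "(\<integral>u. K u * tay m f y (d * u) \<partial>W) =
     (\<integral>u. K u * f (y + d * u) - (\<Sum>j\<le>m. (deriv ^^ j) f y * d ^ j / fact j * (u ^ j * K u)) \<partial>W)"
    by (intro Bochner_Integration.integral_cong refl)
       (simp add: tay_def right_diff_distrib sum_distrib_left power_mult_distrib mult_ac)
  also have "\<dots> = avg d f y - (\<Sum>j\<le>m. (deriv ^^ j) f y * d ^ j / fact j * (\<integral>u. u ^ j * K u \<partial>W))"
    using ij avg_integrable[OF meas_f f_le, where d=d and y=y]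
    by (simp add: avg_def Bochner_Integration.integral_sum)
  also have "(\<Sum>j\<le>m. (deriv ^^ j) f y * d ^ j / fact j * (\<integral>u. u ^ j * K u \<partial>W)) =
      (\<Sum>j\<le>m. if j = 0 then f y else 0)"
    by (intro sum.cong refl) (auto simp: mom)
  finally show ?thesis by simp
qed

lemma meas_tay1 [measurable]: "(\<lambda>v. tay m f y v) \<in> borel_measurable borel"
  using measurable_compose[OF measurable_Pair1' meas_tay, of y] by simp

text \<open>One integrand that dominates the biases of all windows |d| <= h simultaneously. The
  supremum over d is replaced by a sum over dyadic windows, which costs only a geometric series when
  integrated.\<close>

definition H :: "real \<Rightarrow> real \<Rightarrow> ennreal" where
  "H h y = (\<Sum>i. \<integral>\<^sup>+u. ennreal (\<bar>tay m f y (h * (1/2) ^ i * u)\<bar> powr p) \<partial>W)"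

lemma H_meas [measurable]: "H h \<in> borel_measurable borel"
proof -
  have "(\<lambda>(y, u). tay m f y (h * (1/2) ^ i * u)) \<in> borel_measurable (borel \<Otimes>\<^sub>M borel)" for i
    using measurable_compose[OF _ meas_tay, of "\<lambda>(y, u). (y, h * (1/2) ^ i * u)" "borel \<Otimes>\<^sub>M borel"]
    by (simp add: split_beta')
  note [measurable] = this
  show ?thesis unfolding H_def by measurable
qed

lemma avg_bias_W:
  "ennreal (\<bar>avg d f y - f y\<bar> powr p) \<le> ennreal (k powr p) * (\<integral>\<^sup>+u. ennreal (\<bar>tay m f y (d * u)\<bar> powr p) \<partial>W)"
  unfolding avg_tay by (rule powr_abs_integral_le[OF _ p]) measurable

lemma avg_bias_H:
  assumes d: "\<bar>d\<bar> \<le> h"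
  shows "ennreal (\<bar>avg d f y - f y\<bar> powr p) \<le> ennreal (2 * k powr p) * H h y"
proof (cases "d = 0")
  case True
  then show ?thesis using p by (simp add: avg_zero)
next
  case False
  \<comment> \<open>The index with |d| <= h / 2^i <= 2 |d|; only this term of the sum is
    kept.\<close>
  define i where "i = nat \<lfloor>log 2 (h / \<bar>d\<bar>)\<rfloor>"
  have hd: "1 \<le> h / \<bar>d\<bar>" using d False by simp
  then have l0: "0 \<le> log 2 (h / \<bar>d\<bar>)" by simp
  have "real i \<le> log 2 (h / \<bar>d\<bar>)" "log 2 (h / \<bar>d\<bar>) \<le> real i + 1"
    using l0 unfolding i_def by linarith+
  then have "2 powr i \<le> h / \<bar>d\<bar>" "h / \<bar>d\<bar> \<le> 2 powr (real i + 1)"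
    using hd by (simp_all add: le_log_iff log_le_iff)
  then have i: "\<bar>d\<bar> \<le> h * (1/2) ^ i" "h * (1/2) ^ i \<le> 2 * \<bar>d\<bar>"
    using False by (simp_all add: powr_add powr_realpow field_simps power_one_over)
  have "ennreal (\<bar>avg d f y - f y\<bar> powr p) = ennreal (\<bar>avg \<bar>d\<bar> f y - f y\<bar> powr p)"
    by (simp add: avg_abs)
  also have "\<dots> \<le> ennreal (k powr p) * (\<integral>\<^sup>+u. ennreal (\<bar>tay m f y (\<bar>d\<bar> * u)\<bar> powr p) \<partial>W)"
    by (rule avg_bias_W)
  also have "\<dots> \<le> ennreal (k powr p) * (2 * (\<integral>\<^sup>+u. ennreal (\<bar>tay m f y (h * (1/2) ^ i * u)\<bar> powr p) \<partial>W))"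
    using W_affine[of "\<lambda>v. ennreal (\<bar>tay m f y v\<bar> powr p)" "\<bar>d\<bar>" "h * (1/2) ^ i"] i False
    by (intro mult_left_mono) auto
  also have "\<dots> = ennreal (2 * k powr p) * (\<integral>\<^sup>+u. ennreal (\<bar>tay m f y (h * (1/2) ^ i * u)\<bar> powr p) \<partial>W)"
    by (simp add: ennreal_mult' mult_ac)
  also have "\<dots> \<le> ennreal (2 * k powr p) * H h y"
    unfolding H_def
    using sum_le_suminf[of "\<lambda>i. \<integral>\<^sup>+u. ennreal (\<bar>tay m f y (h * (1/2) ^ i * u)\<bar> powr p) \<partial>W" "{i}"]
    by (intro mult_left_mono) auto
  finally show ?thesis .
qed

lemma tay_window_Lp:
  "(\<integral>\<^sup>+y. (\<integral>\<^sup>+u. ennreal (\<bar>tay m f y (d * u)\<bar> powr p) \<partial>W) \<partial>lborel) \<le> ennreal ((L * \<bar>d\<bar> powr \<beta>) powr p)"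
proof -
  have "(\<lambda>(y, u). tay m f y (d * u)) \<in> borel_measurable (borel \<Otimes>\<^sub>M borel)"
    using measurable_compose[OF _ meas_tay, of "\<lambda>(y, u). (y, d * u)" "borel \<Otimes>\<^sub>M borel"]
    by (simp add: split_beta')
  note [measurable] = this
  have "(\<integral>\<^sup>+y. (\<integral>\<^sup>+u. ennreal (\<bar>tay m f y (d * u)\<bar> powr p) \<partial>W) \<partial>lborel) =
    (\<integral>\<^sup>+u. (\<integral>\<^sup>+y. ennreal (\<bar>tay m f y (d * u)\<bar> powr p) \<partial>lborel) \<partial>W)"
    by (rule WL.Fubini') measurable
  also have "\<dots> \<le> (\<integral>\<^sup>+u. ennreal ((L * \<bar>d * u\<bar> powr \<beta>) powr p) \<partial>W)"
    by (intro nn_integral_mono tay_Lp)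
  also have "\<dots> \<le> (\<integral>\<^sup>+u. ennreal ((L * \<bar>d\<bar> powr \<beta>) powr p) \<partial>W)"
  proof (rule nn_integral_mono_AE)
    show "AE u in W. ennreal ((L * \<bar>d * u\<bar> powr \<beta>) powr p) \<le> ennreal ((L * \<bar>d\<bar> powr \<beta>) powr p)"
      using AE_W
    proof eventually_elim
      fix u :: real assume "u \<in> {-1/2..1/2}"
      then show "ennreal ((L * \<bar>d * u\<bar> powr \<beta>) powr p) \<le> ennreal ((L * \<bar>d\<bar> powr \<beta>) powr p)"
        using L p \<beta> by (intro ennreal_leI powr_mono2 mult_left_mono) (auto simp: abs_mult intro!: mult_left_le)
    qed
  qed
  also have "\<dots> = ennreal ((L * \<bar>d\<bar> powr \<beta>) powr p)" by (simp add: W.emeasure_space_1[simplified])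
  finally show ?thesis .
qed

lemma H_integral:
  assumes h: "0 < h"
  shows "(\<integral>\<^sup>+y. H h y \<partial>lborel) \<le> ennreal ((L * h powr \<beta>) powr p / (1 - 2 powr (- \<beta> * p)))"
proof -
  have [measurable]: "(\<lambda>(y, u). tay m f y (h * (1/2) ^ i * u)) \<in> borel_measurable (borel \<Otimes>\<^sub>M borel)" for i
    using measurable_compose[OF _ meas_tay, of "\<lambda>(y, u). (y, h * (1/2) ^ i * u)" "borel \<Otimes>\<^sub>M borel"]
    by (simp add: split_beta')
  have q: "2 powr (- \<beta> * p) < 1" using \<beta> p by (simp add: powr_less_one)
  have "(\<integral>\<^sup>+y. H h y \<partial>lborel) = (\<Sum>i. \<integral>\<^sup>+y. (\<integral>\<^sup>+u. ennreal (\<bar>tay m f y (h * (1/2) ^ i * u)\<bar> powr p) \<partial>W) \<partial>lborel)"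
    unfolding H_def by (rule nn_integral_suminf) measurable
  also have "\<dots> \<le> (\<Sum>i. ennreal ((L * h powr \<beta>) powr p * (2 powr (- \<beta> * p)) ^ i))"
  proof (rule suminf_le)
    fix i
    have "(L * \<bar>h * (1/2) ^ i\<bar> powr \<beta>) powr p = (L * h powr \<beta>) powr p * ((1/2) ^ i) powr (\<beta> * p)"
      using L h by (simp add: abs_mult powr_mult powr_powr mult_ac)
    also have "((1/2) ^ i) powr (\<beta> * p) = (2 powr (- \<beta> * p)) ^ i"
      by (simp add: powr_realpow[symmetric] powr_powr powr_divide powr_minus_divide mult_ac)
    finally show "(\<integral>\<^sup>+y. (\<integral>\<^sup>+u. ennreal (\<bar>tay m f y (h * (1/2) ^ i * u)\<bar> powr p) \<partial>W) \<partial>lborel) \<le>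
        ennreal ((L * h powr \<beta>) powr p * (2 powr (- \<beta> * p)) ^ i)"
      using tay_window_Lp[of "h * (1/2) ^ i"] by simp
  qed auto
  also have "\<dots> = ennreal ((L * h powr \<beta>) powr p * (1 / (1 - 2 powr (- \<beta> * p))))"
    using q by (intro suminf_ennreal_eq sums_mult geometric_sums) auto
  finally show ?thesis by simp
qed

lemma avg_bias_Lp:
  "(\<integral>\<^sup>+y. ennreal (\<bar>avg d f y - f y\<bar> powr p) \<partial>lborel) \<le> ennreal ((k * (L * \<bar>d\<bar> powr \<beta>)) powr p)"
proof -
  have "(\<lambda>(y, u). tay m f y (d * u)) \<in> borel_measurable (borel \<Otimes>\<^sub>M borel)"
    using measurable_compose[OF _ meas_tay, of "\<lambda>(y, u). (y, d * u)" "borel \<Otimes>\<^sub>M borel"]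
    by (simp add: split_beta')
  note [measurable] = this
  have "(\<integral>\<^sup>+y. ennreal (\<bar>avg d f y - f y\<bar> powr p) \<partial>lborel) \<le>
     (\<integral>\<^sup>+y. ennreal (k powr p) * (\<integral>\<^sup>+u. ennreal (\<bar>tay m f y (d * u)\<bar> powr p) \<partial>W) \<partial>lborel)"
    by (intro nn_integral_mono avg_bias_W)
  also have "\<dots> = ennreal (k powr p) * (\<integral>\<^sup>+y. (\<integral>\<^sup>+u. ennreal (\<bar>tay m f y (d * u)\<bar> powr p) \<partial>W) \<partial>lborel)"
    by (rule nn_integral_cmult) measurable
  also have "\<dots> \<le> ennreal (k powr p) * ennreal ((L * \<bar>d\<bar> powr \<beta>) powr p)"
    by (intro mult_left_mono tay_window_Lp) auto
  also have "\<dots> = ennreal ((k * (L * \<bar>d\<bar> powr \<beta>)) powr p)"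
    using k0 L by (simp add: ennreal_mult'[symmetric] powr_mult)
  finally show ?thesis .
qed

lemma bias_meas [measurable]: "(\<lambda>y. avg d f y - f y) \<in> borel_measurable borel"
  by measurable

text \<open>An L_p bound controls uniformly the smoothed bias, not the bias; the following lemmas
  recover the bias from smoothed ones.\<close>

lemma avg_of_bias_le:
  assumes "0 < e" "0 < d"
  shows "\<bar>avg e (\<lambda>x. avg d f x - f x) y\<bar> \<le> k * (k * (L * d powr \<beta>) * e powr (- 1 / p))"
  by (rule avg_sup_le) (use p assms k0 L avg_bias_Lp[of d] in auto)

text \<open>Write A and B for averaging at d/2 and d. They commute, so A^2 - B^2 = A (A - B) + B (A
  - B), and A - B applied to f is a difference of two biases. This gives four smoothed biases, each
  at most 2 k^2 L d^(\<beta> - 1/p) with the 2 bounding 2^(1/p), hence the 8.\<close>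

lemma sq_avg_step:
  assumes d: "0 < d"
  shows "\<bar>avg (d/2) (avg (d/2) f) y - avg d (avg d f) y\<bar> \<le> 8 * k\<^sup>2 * L * d powr (\<beta> - 1 / p)"
proof -
  have bd: "\<And>e x. \<bar>avg e f x\<bar> \<le> k * M" by (rule avg_le[OF meas_f f_le])
  have *: "\<bar>avg e (avg (d/2) f) y - avg e (avg d f) y\<bar> \<le> 4 * k\<^sup>2 * L * d powr (\<beta> - 1 / p)"
    if e: "e = d \<or> e = d / 2" for e
  proof -
    have e0: "0 < e" "d / 2 \<le> e" using e d by auto
    have "avg e (avg (d/2) f) y - avg e (avg d f) y =
       avg e (\<lambda>x. avg (d/2) f x - f x) y - avg e (\<lambda>x. avg d f x - f x) y"
      by (simp add: avg_diff[OF avg_meas[OF meas_f] meas_f bd f_le])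
    also have "\<bar>\<dots>\<bar> \<le> k * (k * (L * (d/2) powr \<beta>) * e powr (- 1 / p)) + k * (k * (L * d powr \<beta>) * e powr (- 1 / p))"
      by (rule order.trans[OF abs_triangle_ineq4 add_mono]; rule avg_of_bias_le) (use e0 d in auto)
    also have "\<dots> \<le> k * (k * (L * d powr \<beta>) * (2 * d powr (- 1 / p))) + k * (k * (L * d powr \<beta>) * (2 * d powr (- 1 / p)))"
    proof -
      have "e powr (- 1 / p) \<le> (d/2) powr (- 1 / p)" using e0 d p by (intro powr_mono2') auto
      also have "\<dots> = 2 powr (1/p) * d powr (- 1 / p)" using d by (simp add: powr_divide powr_minus_divide)
      also have "\<dots> \<le> 2 powr 1 * d powr (- 1 / p)" using p by (intro mult_right_mono powr_mono) auto
      finally have 1: "e powr (- 1 / p) \<le> 2 * d powr (- 1 / p)" by simp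
      have 2: "(d/2) powr \<beta> \<le> d powr \<beta>" using d \<beta> by (intro powr_mono2) auto
      show ?thesis
        using k0 L by (intro add_mono mult_left_mono mult_mono 1 2) auto
    qed
    also have "\<dots> = 4 * k\<^sup>2 * L * (d powr \<beta> * d powr (- 1 / p))" by (simp add: power2_eq_square)
    also have "d powr \<beta> * d powr (- 1 / p) = d powr (\<beta> - 1 / p)" by (simp add: powr_add[symmetric])
    finally show ?thesis .
  qed
  have "avg (d/2) (avg (d/2) f) y - avg d (avg d f) y =
     (avg (d/2) (avg (d/2) f) y - avg (d/2) (avg d f) y) + (avg d (avg (d/2) f) y - avg d (avg d f) y)"
    using avg_commute[OF meas_f f_le, of d "d/2" y] by simp
  then show ?thesis using *[of d] *[of "d/2"] by simp
qed

text \<open>The twice smoothed values at scales d / 2^i telescope to \<open>f y\<close>; the steps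
  decay like 2^(-i (\<beta> - 1/p)), which is summable. Hoelder continuity of f identifies the limit
  and leaves no trace in the bound.\<close>

lemma sq_avg_bias:
  assumes d: "0 < d"
  shows "\<bar>f y - avg d (avg d f) y\<bar> \<le> 8 * k\<^sup>2 * L / (1 - 2 powr (- (\<beta> - 1 / p))) * d powr (\<beta> - 1 / p)"
proof -
  define c where "c = 2 powr (- (\<beta> - 1 / p))"
  have c: "0 < c" "c < 1" using \<beta>p by (auto simp: c_def powr_less_one)
  define B where "B i = avg (d * (1/2)^i) (avg (d * (1/2)^i) f) y" for i
  define A where "A = 8 * k\<^sup>2 * L * d powr (\<beta> - 1 / p)"
  have A0: "0 \<le> A" using L by (simp add: A_def)
  have step: "\<bar>B (Suc i) - B i\<bar> \<le> A * c ^ i" for i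
  proof -
    have "\<bar>B (Suc i) - B i\<bar> \<le> 8 * k\<^sup>2 * L * (d * (1/2)^i) powr (\<beta> - 1 / p)"
      using sq_avg_step[of "d * (1/2)^i" y] d by (simp add: B_def field_simps)
    also have "(d * (1/2)^i) powr (\<beta> - 1 / p) = d powr (\<beta> - 1 / p) * ((1/2)^i) powr (\<beta> - 1 / p)"
      using d by (simp add: powr_mult)
    also have "((1/2)^i) powr (\<beta> - 1 / p) = c ^ i"
      by (simp add: c_def powr_realpow[symmetric] powr_powr powr_divide mult_ac right_diff_distrib powr_diff)
    finally show ?thesis by (simp add: A_def mult_ac)
  qed
  have tele: "\<bar>B n - B 0\<bar> \<le> A / (1 - c)" for n
  proof -
    have "\<bar>B n - B 0\<bar> \<le> (\<Sum>i<n. \<bar>B (Suc i) - B i\<bar>)"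
      by (subst sum_lessThan_telescope[symmetric]) (rule sum_abs)
    also have "\<dots> \<le> (\<Sum>i<n. A * c ^ i)" by (intro sum_mono step)
    also have "\<dots> = A * ((1 - c ^ n) / (1 - c))" using c by (simp add: sum_distrib_left[symmetric] sum_gp_strict)
    also have "\<dots> \<le> A * (1 / (1 - c))" using c A0 by (intro mult_left_mono divide_right_mono) auto
    finally show ?thesis by simp
  qed
  have bd: "\<And>e x. \<bar>avg e f x\<bar> \<le> k * M" by (rule avg_le[OF meas_f f_le])
  have close: "\<bar>avg e (avg e f) y - f y\<bar> \<le> (k * k * M + k * M) * \<bar>e\<bar> powr b" for e
  proof -
    have "avg e (avg e f) y - f y = avg e (\<lambda>x. avg e f x - f x) y + (avg e f y - f y)"
      by (simp add: avg_diff[OF avg_meas[OF meas_f] meas_f bd f_le])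
    also have "\<bar>\<dots>\<bar> \<le> k * (k * (M * \<bar>e\<bar> powr b)) + k * (M * \<bar>e\<bar> powr b)"
      by (intro order.trans[OF abs_triangle_ineq add_mono] avg_le avg_Holder[OF meas_f f_le b f_Holder]) auto
    finally show ?thesis by (simp add: algebra_simps)
  qed
  have "(\<lambda>i. (k * k * M + k * M) * \<bar>d * (1/2)^i\<bar> powr b) \<longlonglongrightarrow> (k * k * M + k * M) * (\<bar>d * 0\<bar> powr b)"
    by (intro tendsto_intros LIMSEQ_power_zero) (use b in auto)
  then have lim: "(\<lambda>i. (k * k * M + k * M) * \<bar>d * (1/2)^i\<bar> powr b) \<longlonglongrightarrow> 0" using b by simp
  have "norm (B i - f y) \<le> (k * k * M + k * M) * \<bar>d * (1/2)^i\<bar> powr b" for i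
    unfolding B_def real_norm_def by (rule close)
  then have "(\<lambda>i. B i - f y) \<longlonglongrightarrow> 0"
    by (intro Lim_null_comparison[OF always_eventually lim] allI)
  then have "B \<longlonglongrightarrow> f y" by (simp add: LIM_zero_iff)
  then have "(\<lambda>n. \<bar>B n - B 0\<bar>) \<longlonglongrightarrow> \<bar>f y - B 0\<bar>" by (intro tendsto_intros)
  then have "\<bar>f y - B 0\<bar> \<le> A / (1 - c)"
    by (rule Lim_bounded) (use tele in auto)
  then show ?thesis by (simp add: B_def A_def c_def)
qed

definition sup_const :: real where
  "sup_const = (1 + k) * (8 * k\<^sup>2 * L / (1 - 2 powr (- (\<beta> - 1 / p)))) + k ^ 3 * L"

text \<open>With A for averaging at d, A f - f = -(f - A^2 f) + A (f - A^2 f) + A^2 (A f - f). The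
  first two terms are covered by \<open>sq_avg_bias\<close>, the last one is a smoothed
  bias.\<close>

lemma avg_bias_sup:
  assumes d: "0 < d"
  shows "\<bar>avg d f y - f y\<bar> \<le> sup_const * d powr (\<beta> - 1 / p)"
proof -
  define C where "C = 8 * k\<^sup>2 * L / (1 - 2 powr (- (\<beta> - 1 / p))) * d powr (\<beta> - 1 / p)"
  have bd: "\<And>e x. \<bar>avg e f x\<bar> \<le> k * M" by (rule avg_le[OF meas_f f_le])
  have bd2: "\<And>x. \<bar>avg d (avg d f) x\<bar> \<le> k * (k * M)" by (rule avg_le[OF _ bd]) measurable
  have bd3: "\<And>x. \<bar>avg d (\<lambda>x. avg d f x - f x) x\<bar> \<le> k * (k * (L * d powr \<beta>) * d powr (- 1 / p))"
    by (rule avg_of_bias_le[OF d d])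
  have s: "\<bar>f x - avg d (avg d f) x\<bar> \<le> C" for x using sq_avg_bias[OF d, of x] by (simp add: C_def)
  have 1: "avg d (\<lambda>x. f x - avg d (avg d f) x) y = avg d f y - avg d (avg d (avg d f)) y"
    by (rule avg_diff[OF _ _ f_le bd2]) measurable
  have 2: "avg d (\<lambda>x. avg d f x - f x) x = avg d (avg d f) x - avg d f x" for x
    by (rule avg_diff[OF _ _ bd f_le]) measurable
  have 3: "avg d (\<lambda>x. avg d (avg d f) x - avg d f x) y = avg d (avg d (avg d f)) y - avg d (avg d f) y"
    by (rule avg_diff[OF _ _ bd2 bd]) measurable
  have "avg d f y - f y = - (f y - avg d (avg d f) y) + avg d (\<lambda>x. f x - avg d (avg d f) x) y
     + avg d (avg d (\<lambda>x. avg d f x - f x)) y"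
    unfolding 1 2 3 by simp
  also have "\<bar>\<dots>\<bar> \<le> C + k * C + k * (k * (k * (L * d powr \<beta>) * d powr (- 1 / p)))"
  proof -
    have "\<bar>- (f y - avg d (avg d f) y)\<bar> \<le> C" using s[of y] by simp
    moreover have "\<bar>avg d (\<lambda>x. f x - avg d (avg d f) x) y\<bar> \<le> k * C"
      by (rule avg_le[OF _ s]) measurable
    moreover have "\<bar>avg d (avg d (\<lambda>x. avg d f x - f x)) y\<bar> \<le> k * (k * (k * (L * d powr \<beta>) * d powr (- 1 / p)))"
      by (rule avg_le[OF _ bd3]) measurable
    ultimately show ?thesis by linarith
  qed
  also have "k * (k * (k * (L * d powr \<beta>) * d powr (- 1 / p))) = k ^ 3 * L * (d powr \<beta> * d powr (- 1 / p))"
    by (simp add: power3_eq_cube)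
  also have "d powr \<beta> * d powr (- 1 / p) = d powr (\<beta> - 1 / p)" by (simp add: powr_add[symmetric])
  also have "C + k * C + k ^ 3 * L * d powr (\<beta> - 1 / p) = sup_const * d powr (\<beta> - 1 / p)"
    unfolding C_def sup_const_def by (simp only: distrib_right mult_1_left mult.assoc)
  finally show ?thesis .
qed

lemma sup_const_nonneg: "0 \<le> sup_const"
proof -
  have "2 powr (- (\<beta> - 1 / p)) < 1" using \<beta>p by (simp add: powr_less_one)
  then show ?thesis unfolding sup_const_def using k0 L by (intro add_nonneg_nonneg mult_nonneg_nonneg) auto
qed

text \<open>The first summand is the constant of the weak type bound for \<open>H (2 * h)\<close>,
  the second that of the uniform bias at 2 h. A common constant gives both conclusions of
  \<open>bias_level_set\<close> the same form.\<close>

definition bias_const :: real where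
  "bias_const = 6 * (k powr p * 2 powr p * (2 * k powr p)) * (L powr p * 2 powr (\<beta> * p)) / (1 - 2 powr (- \<beta> * p))
     + 2 * k * sup_const * 2 powr (\<beta> - 1 / p)"

lemma bias_const_nonneg: "0 \<le> bias_const"
proof -
  have "2 powr (- \<beta> * p) < 1" using \<beta> p by (simp add: powr_less_one)
  then show ?thesis unfolding bias_const_def using k0 L sup_const_nonneg
    by (intro add_nonneg_nonneg mult_nonneg_nonneg divide_nonneg_nonneg) auto
qed

text \<open>Windows reach 2 h because the two-direction estimators have effective bandwidth \<eta>
  (1 + |cosine|); the average over \<open>y + s * u\<close> is the transverse window of a kernel
  estimator. Above the uniform bias no point is exceptional. Below it the exceptional set is the one
  where some local average of \<open>H (2 * h)\<close> exceeds a multiple of \<xi>^p.\<close>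

lemma bias_level_set:
  assumes h: "0 < h" and \<xi>: "0 < \<xi>"
  shows "\<exists>U \<in> sets borel. emeasure lborel U \<le> ennreal (bias_const * h powr (\<beta> * p) / \<xi> powr p) \<and>
    (bias_const * h powr (\<beta> - 1 / p) \<le> \<xi> \<longrightarrow> U = {}) \<and>
    (\<forall>y s d d'. y \<notin> U \<longrightarrow> \<bar>s\<bar> \<le> 1 \<longrightarrow> \<bar>d\<bar> \<le> 2 * h \<longrightarrow> \<bar>d'\<bar> \<le> 2 * h \<longrightarrow>
       \<bar>\<integral>u. K u * (avg d f (y + s * u) - avg d' f (y + s * u)) \<partial>W\<bar> \<le> \<xi>)"
proof (cases "bias_const * h powr (\<beta> - 1 / p) \<le> \<xi>")
  case True
  have q: "2 powr (- \<beta> * p) < 1" using \<beta> p by (simp add: powr_less_one)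
  have E: "\<bar>avg d f x - f x\<bar> \<le> sup_const * (2 * h) powr (\<beta> - 1 / p)" if "\<bar>d\<bar> \<le> 2 * h" for d x
  proof (cases "d = 0")
    case False
    have "\<bar>avg \<bar>d\<bar> f x - f x\<bar> \<le> sup_const * \<bar>d\<bar> powr (\<beta> - 1 / p)"
      by (rule avg_bias_sup) (use False in simp)
    also have "\<dots> \<le> sup_const * (2 * h) powr (\<beta> - 1 / p)"
      using that \<beta>p by (intro mult_left_mono powr_mono2 sup_const_nonneg) auto
    finally show ?thesis by (simp add: avg_abs)
  qed (simp add: avg_zero sup_const_nonneg)
  have "\<bar>\<integral>u. K u * (avg d f (y + s * u) - avg d' f (y + s * u)) \<partial>W\<bar> \<le> \<xi>"
    if "\<bar>d\<bar> \<le> 2 * h" "\<bar>d'\<bar> \<le> 2 * h" for y s d d'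
  proof -
    have "\<bar>\<integral>u. K u * (avg d f (y + s * u) - avg d' f (y + s * u)) \<partial>W\<bar> \<le> k * (2 * (sup_const * (2 * h) powr (\<beta> - 1 / p)))"
    proof (rule integral_W_le)
      fix u :: real
      have "\<bar>avg d f (y + s * u) - avg d' f (y + s * u)\<bar> \<le> 2 * (sup_const * (2 * h) powr (\<beta> - 1 / p))"
        using E[OF that(1), of "y + s * u"] E[OF that(2), of "y + s * u"] by linarith
      then show "\<bar>K u * (avg d f (y + s * u) - avg d' f (y + s * u))\<bar> \<le> k * (2 * (sup_const * (2 * h) powr (\<beta> - 1 / p)))"
        unfolding abs_mult by (intro mult_mono K_le k0) auto
    qed measurable
    also have "\<dots> = (2 * k * sup_const * 2 powr (\<beta> - 1 / p)) * h powr (\<beta> - 1 / p)"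
      using h by (simp add: powr_mult)
    also have "\<dots> \<le> bias_const * h powr (\<beta> - 1 / p)"
      using q k0 L unfolding bias_const_def by (intro mult_right_mono) auto
    finally show ?thesis using True by simp
  qed
  then show ?thesis by (intro bexI[of _ "{}"]) auto
next
  case False
  define c where "c = k powr p * 2 powr p * (2 * k powr p)"
  have k1: "0 < k" using k1 by simp
  then have c: "0 < c" by (simp add: c_def)
  define \<mu> where "\<mu> = \<xi> powr p / c"
  have \<mu>: "0 < \<mu>" using \<xi> c by (simp add: \<mu>_def)
  obtain U where U: "U \<in> sets borel" "emeasure lborel U \<le> ennreal (6 / \<mu>) * (\<integral>\<^sup>+y. H (2 * h) y \<partial>lborel)"
    and ok: "\<And>y s. y \<notin> U \<Longrightarrow> \<bar>s\<bar> \<le> 1 \<Longrightarrow> (\<integral>\<^sup>+u. H (2 * h) (y + s * u) \<partial>W) \<le> ennreal \<mu>"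
    using window_average_level_set[OF H_meas \<mu>, of "2 * h"] by blast
  have "emeasure lborel U \<le> ennreal (6 / \<mu>) * ennreal ((L * (2 * h) powr \<beta>) powr p / (1 - 2 powr (- \<beta> * p)))"
    by (rule order.trans[OF U(2) mult_left_mono[OF H_integral]]) (use h in auto)
  also have "\<dots> = ennreal ((6 * c * (L powr p * 2 powr (\<beta> * p)) / (1 - 2 powr (- \<beta> * p))) * h powr (\<beta> * p) / \<xi> powr p)"
    using \<mu> L h c by (subst ennreal_mult'[symmetric]) (auto simp: \<mu>_def powr_mult powr_powr field_simps)
  also have "\<dots> \<le> ennreal (bias_const * h powr (\<beta> * p) / \<xi> powr p)"
    using k0 sup_const_nonneg unfolding bias_const_def c_def
    by (intro ennreal_leI divide_right_mono mult_right_mono) auto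
  finally have 1: "emeasure lborel U \<le> ennreal (bias_const * h powr (\<beta> * p) / \<xi> powr p)" .
  have 2: "\<bar>\<integral>u. K u * (avg d f (y + s * u) - avg d' f (y + s * u)) \<partial>W\<bar> \<le> \<xi>"
    if y: "y \<notin> U" and s: "\<bar>s\<bar> \<le> 1" and d: "\<bar>d\<bar> \<le> 2 * h" "\<bar>d'\<bar> \<le> 2 * h" for y s d d'
  proof -
    have G: "ennreal (\<bar>avg d f x - avg d' f x\<bar> powr p) \<le> ennreal (2 powr p * (2 * k powr p)) * H (2 * h) x" for x
    proof -
      \<comment> \<open>The window with the larger bias; twice that bias bounds the difference, so
        only one p-th power has to be compared with \<open>H\<close>.\<close>
      define e where "e = (if \<bar>avg d f x - f x\<bar> \<ge> \<bar>avg d' f x - f x\<bar> then d else d')"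
      have "\<bar>avg d f x - avg d' f x\<bar> \<le> 2 * \<bar>avg e f x - f x\<bar>"
      proof -
        have "\<bar>avg d f x - avg d' f x\<bar> \<le> \<bar>avg d f x - f x\<bar> + \<bar>avg d' f x - f x\<bar>" by linarith
        also have "\<dots> \<le> 2 * \<bar>avg e f x - f x\<bar>" unfolding e_def by auto
        finally show ?thesis .
      qed
      then have "\<bar>avg d f x - avg d' f x\<bar> powr p \<le> (2 * \<bar>avg e f x - f x\<bar>) powr p"
        using p by (intro powr_mono2) auto
      then have "ennreal (\<bar>avg d f x - avg d' f x\<bar> powr p) \<le> ennreal (2 powr p) * ennreal (\<bar>avg e f x - f x\<bar> powr p)"
        by (simp add: powr_mult ennreal_mult'[symmetric] ennreal_leI)
      also have "\<dots> \<le> ennreal (2 powr p) * (ennreal (2 * k powr p) * H (2 * h) x)"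
        by (intro mult_left_mono avg_bias_H) (use d in \<open>auto simp: e_def\<close>)
      finally show ?thesis by (simp add: ennreal_mult' mult.assoc)
    qed
    have "ennreal (\<bar>\<integral>u. K u * (avg d f (y + s * u) - avg d' f (y + s * u)) \<partial>W\<bar> powr p) \<le>
       ennreal (k powr p) * (\<integral>\<^sup>+u. ennreal (\<bar>avg d f (y + s * u) - avg d' f (y + s * u)\<bar> powr p) \<partial>W)"
      by (rule powr_abs_integral_le[OF _ p]) measurable
    also have "\<dots> \<le> ennreal (k powr p) * (\<integral>\<^sup>+u. ennreal (2 powr p * (2 * k powr p)) * H (2 * h) (y + s * u) \<partial>W)"
      by (intro mult_left_mono nn_integral_mono G) auto
    also have "\<dots> = ennreal (k powr p) * (ennreal (2 powr p * (2 * k powr p)) * (\<integral>\<^sup>+u. H (2 * h) (y + s * u) \<partial>W))"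
      by (subst nn_integral_cmult) auto
    also have "\<dots> \<le> ennreal (k powr p) * (ennreal (2 powr p * (2 * k powr p)) * ennreal \<mu>)"
      by (intro mult_left_mono ok y s) auto
    also have "\<dots> = ennreal (c * \<mu>)" using \<mu> by (simp add: c_def ennreal_mult'[symmetric] mult.assoc)
    also have "c * \<mu> = \<xi> powr p" using c by (simp add: \<mu>_def)
    finally have "\<bar>\<integral>u. K u * (avg d f (y + s * u) - avg d' f (y + s * u)) \<partial>W\<bar> powr p \<le> \<xi> powr p"
      by (simp add: ennreal_le_iff)
    then show ?thesis
      using powr_less_mono2[of p \<xi> "\<bar>\<integral>u. K u * (avg d f (y + s * u) - avg d' f (y + s * u)) \<partial>W\<bar>"] p \<xi>
      by (auto simp: not_le[symmetric])
  qed
  show ?thesis using U(1) 1 2 False by (intro bexI[of _ U]) auto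
qed

end

section \<open>Bernstein's inequality for design and noise\<close>

text \<open>For negative y, 1 - y <= exp (-y) gives (1 - y) exp y <= 1, and 1 <= 1 - y^3 = (1 - y)
  (1 + y + y^2).\<close>

lemma exp_le_quadratic:
  fixes y :: real
  assumes "\<bar>y\<bar> \<le> 1"
  shows "exp y \<le> 1 + y + y\<^sup>2"
proof (cases "0 \<le> y")
  case True
  then show ?thesis using exp_bound[of y] assms by simp
next
  case False
  have "(1 - y) * exp y \<le> exp (- y) * exp y"
    using exp_ge_add_one_self[of "- y"] by (intro mult_right_mono) auto
  then have "(1 - y) * exp y \<le> 1" by (simp add: exp_minus)
  also have "1 \<le> (1 - y) * (1 + y + y\<^sup>2)"
  proof -
    have "(1 - y) * (1 + y + y\<^sup>2) = 1 + (- y) * y\<^sup>2" by (simp add: power2_eq_square algebra_simps)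
    moreover have "0 \<le> (- y) * y\<^sup>2" using False by (intro mult_nonneg_nonneg) auto
    ultimately show ?thesis by linarith
  qed
  finally show ?thesis by (rule mult_left_le_imp_le) (use False in simp)
qed

lemma prod_le_ennreal:
  fixes f h :: "'i \<Rightarrow> ennreal"
  assumes "finite A" "\<And>i. i \<in> A \<Longrightarrow> f i \<le> h i"
  shows "prod f A \<le> prod h A"
  using assms by (induction A rule: finite_induct) (auto intro: mult_mono)

lemma Int_stable_vimage: "Int_stable {f -` A \<inter> S |A. A \<in> sets N}"
proof (rule Int_stableI)
  fix a b assume "a \<in> {f -` A \<inter> S |A. A \<in> sets N}" "b \<in> {f -` A \<inter> S |A. A \<in> sets N}"
  then obtain A B where "a = f -` A \<inter> S" "b = f -` B \<inter> S" "A \<in> sets N" "B \<in> sets N" by blast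
  then have "a \<inter> b = f -` (A \<inter> B) \<inter> S" "A \<inter> B \<in> sets N" by auto
  then show "a \<inter> b \<in> {f -` A \<inter> S |A. A \<in> sets N}" by blast
qed

text \<open>Keeps the index sets \<open>{1..n}\<close> in this form.\<close>

declare One_nat_def [simp del]

section \<open>Independence of the design and noise sequences\<close>

context regression_model
begin

text \<open>The restriction to {1..} matches the form in which the model states the independence of
  the two sequences.\<close>

definition Xs :: "'a \<Rightarrow> nat \<Rightarrow> real^2" where "Xs w = (\<lambda>i\<in>{1..}. X i w)"
definition Es :: "'a \<Rightarrow> nat \<Rightarrow> real" where "Es w = (\<lambda>i\<in>{1..}. \<epsilon> i w)"

lemma X_meas [measurable]: "1 \<le> i \<Longrightarrow> X i \<in> borel_measurable P"
  and \<epsilon>_meas [measurable]: "1 \<le> i \<Longrightarrow> \<epsilon> i \<in> borel_measurable P"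
  using X_density[of i] noise_density[of i] by (auto simp: distributed_def)

lemma g_meas [measurable]: "g \<in> borel_measurable borel"
proof -
  have "(\<lambda>x. enn2real (ennreal (g x))) \<in> borel_measurable borel"
    using X_density[of 1] by (intro borel_measurable_enn2real) (auto simp: distributed_def)
  then show ?thesis using g_nonneg by simp
qed

lemma Xs_meas: "Xs \<in> P \<rightarrow>\<^sub>M (\<Pi>\<^sub>M i\<in>{1..}. borel)" unfolding Xs_def
  by (rule measurable_restrict) (use X_meas in simp)

lemma Es_meas: "Es \<in> P \<rightarrow>\<^sub>M (\<Pi>\<^sub>M i\<in>{1..}. borel)" unfolding Es_def
  by (rule measurable_restrict) (use \<epsilon>_meas in simp)

lemma Xs_Es_prob:
  assumes "A \<in> sets (\<Pi>\<^sub>M i\<in>{1..}. borel)" "B \<in> sets (\<Pi>\<^sub>M i\<in>{1..}. borel)"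
  shows "prob ((Xs -` A \<inter> space P) \<inter> (Es -` B \<inter> space P)) = prob (Xs -` A \<inter> space P) * prob (Es -` B \<inter> space P)"
  by (rule indep_setD[OF sequences_indep]) (use assms in \<open>auto simp: Xs_def[abs_def] Es_def[abs_def]\<close>)

lemma Xs_Es_distr:
  "distr P (\<Pi>\<^sub>M i\<in>{1..}. borel) Xs \<Otimes>\<^sub>M distr P (\<Pi>\<^sub>M i\<in>{1..}. borel) Es =
   distr P ((\<Pi>\<^sub>M i\<in>{1..}. borel) \<Otimes>\<^sub>M (\<Pi>\<^sub>M i\<in>{1..}. borel)) (\<lambda>w. (Xs w, Es w))"
proof -
  note Xs_meas [measurable] Es_meas [measurable]
  interpret dX: prob_space "distr P (\<Pi>\<^sub>M i\<in>{1..}. borel) Xs" by (rule prob_space_distr) measurable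
  interpret dE: prob_space "distr P (\<Pi>\<^sub>M i\<in>{1..}. borel) Es" by (rule prob_space_distr) measurable
  show ?thesis
  proof (rule pair_measure_eqI[OF dX.sigma_finite_measure_axioms dE.sigma_finite_measure_axioms])
    fix A B assume "A \<in> sets (distr P (\<Pi>\<^sub>M i\<in>{1..}. borel) Xs)" "B \<in> sets (distr P (\<Pi>\<^sub>M i\<in>{1..}. borel) Es)"
    then have A [measurable]: "A \<in> sets (\<Pi>\<^sub>M i\<in>{1..}. borel)" and B [measurable]: "B \<in> sets (\<Pi>\<^sub>M i\<in>{1..}. borel)"
      by auto
    have "(\<lambda>w. (Xs w, Es w)) -` (A \<times> B) \<inter> space P = (Xs -` A \<inter> space P) \<inter> (Es -` B \<inter> space P)" by auto
    then show "emeasure (distr P (\<Pi>\<^sub>M i\<in>{1..}. borel) Xs) A * emeasure (distr P (\<Pi>\<^sub>M i\<in>{1..}. borel) Es) B =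
       emeasure (distr P ((\<Pi>\<^sub>M i\<in>{1..}. borel) \<Otimes>\<^sub>M (\<Pi>\<^sub>M i\<in>{1..}. borel)) (\<lambda>w. (Xs w, Es w))) (A \<times> B)"
      using Xs_Es_prob[OF A B] emeasure_distr[OF Xs_meas A] emeasure_distr[OF Es_meas B]
        emeasure_distr[OF measurable_Pair[OF Xs_meas Es_meas] pair_measureI[OF A B]]
      by (simp only: emeasure_eq_measure ennreal_mult' measure_nonneg)
  qed (simp cong: sets_pair_measure_cong)
qed

text \<open>The joint law of the two sequences is a product law. Writing it as a double integral
  over \<open>P\<close> itself realises an independent copy of the noise without a new probability
  space.\<close>

lemma nn_integral_decouple:
  assumes \<psi> [measurable]: "\<And>i. i \<in> J \<Longrightarrow> \<psi> i \<in> borel_measurable (borel \<Otimes>\<^sub>M borel)"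
    and J: "finite J" "J \<subseteq> {1..}"
  shows "(\<integral>\<^sup>+w. (\<Prod>i\<in>J. \<psi> i (X i w, \<epsilon> i w)) \<partial>P) = (\<integral>\<^sup>+v. (\<integral>\<^sup>+w. (\<Prod>i\<in>J. \<psi> i (X i v, \<epsilon> i w)) \<partial>P) \<partial>P)"
proof -
  let ?P = "\<Pi>\<^sub>M i\<in>{1::nat..}. (borel :: (real^2) measure)"
  let ?Q = "\<Pi>\<^sub>M i\<in>{1::nat..}. (borel :: real measure)"
  note mX = Xs_meas and mE = Es_meas and d = Xs_Es_distr
  note mX [measurable] mE [measurable]
  interpret dE: prob_space "distr P ?Q Es" by (rule prob_space_distr) measurable
  have comp: "(\<lambda>(x, e). \<Prod>i\<in>J. \<psi> i (x i, e i)) \<in> borel_measurable (?P \<Otimes>\<^sub>M ?Q)"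
  proof -
    have "(\<lambda>(x, e). \<psi> i (x i, e i)) \<in> borel_measurable (?P \<Otimes>\<^sub>M ?Q)" if "i \<in> J" for i
    proof -
      have "i \<in> {1..}" using that J by auto
      then have "(\<lambda>(x, e). (x i, e i)) \<in> (?P \<Otimes>\<^sub>M ?Q) \<rightarrow>\<^sub>M (borel \<Otimes>\<^sub>M borel)"
        by measurable
      from measurable_compose[OF this \<psi>[OF that]] show ?thesis by (simp add: split_beta')
    qed
    then show ?thesis by (simp add: split_beta' borel_measurable_prod_ennreal)
  qed
  have JX: "\<And>i. i \<in> J \<Longrightarrow> Xs w i = X i w \<and> Es w i = \<epsilon> i w" for w
    using J by (auto simp: Xs_def Es_def)
  have "(\<integral>\<^sup>+w. (\<Prod>i\<in>J. \<psi> i (X i w, \<epsilon> i w)) \<partial>P) = (\<integral>\<^sup>+w. (case (Xs w, Es w) of (x, e) \<Rightarrow> \<Prod>i\<in>J. \<psi> i (x i, e i)) \<partial>P)"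
    by (intro nn_integral_cong) (auto intro!: prod.cong simp: JX)
  also have "\<dots> = (\<integral>\<^sup>+z. (case z of (x, e) \<Rightarrow> \<Prod>i\<in>J. \<psi> i (x i, e i)) \<partial>(distr P ?P Xs \<Otimes>\<^sub>M distr P ?Q Es))"
    unfolding d by (rule nn_integral_distr[symmetric]) (use comp in measurable)
  also have "\<dots> = (\<integral>\<^sup>+x. (\<integral>\<^sup>+e. (\<Prod>i\<in>J. \<psi> i (x i, e i)) \<partial>distr P ?Q Es) \<partial>distr P ?P Xs)"
    by (subst dE.nn_integral_fst[symmetric]) (use comp in \<open>auto cong: measurable_cong_sets sets_pair_measure_cong\<close>)
  also have "\<dots> = (\<integral>\<^sup>+v. (\<integral>\<^sup>+e. (\<Prod>i\<in>J. \<psi> i (Xs v i, e i)) \<partial>distr P ?Q Es) \<partial>P)"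
  proof (rule nn_integral_distr[OF mX])
    have "(\<lambda>(x, e). \<Prod>i\<in>J. \<psi> i (x i, e i)) \<in> borel_measurable (?P \<Otimes>\<^sub>M distr P ?Q Es)"
      using comp by (auto cong: measurable_cong_sets sets_pair_measure_cong)
    from dE.borel_measurable_nn_integral_fst[OF this]
    show "(\<lambda>x. \<integral>\<^sup>+e. (\<Prod>i\<in>J. \<psi> i (x i, e i)) \<partial>distr P ?Q Es) \<in> borel_measurable (distr P ?P Xs)" by simp
  qed
  also have "\<dots> = (\<integral>\<^sup>+v. (\<integral>\<^sup>+w. (\<Prod>i\<in>J. \<psi> i (Xs v i, Es w i)) \<partial>P) \<partial>P)"
  proof (rule nn_integral_cong)
    fix v assume "v \<in> space P"
    then have "Xs v \<in> space ?P" by (rule measurable_space[OF mX])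
    from measurable_compose[OF measurable_Pair1'[OF this] comp]
    have "(\<lambda>e. \<Prod>i\<in>J. \<psi> i (Xs v i, e i)) \<in> borel_measurable ?Q" by simp
    then show "(\<integral>\<^sup>+e. (\<Prod>i\<in>J. \<psi> i (Xs v i, e i)) \<partial>distr P ?Q Es) = (\<integral>\<^sup>+w. (\<Prod>i\<in>J. \<psi> i (Xs v i, Es w i)) \<partial>P)"
      by (intro nn_integral_distr[OF mE]) simp
  qed
  also have "\<dots> = (\<integral>\<^sup>+v. (\<integral>\<^sup>+w. (\<Prod>i\<in>J. \<psi> i (X i v, \<epsilon> i w)) \<partial>P) \<partial>P)"
    by (intro nn_integral_cong prod.cong refl) (auto simp: JX)
  finally show ?thesis .
qed

text \<open>The model states independence within the design, within the noise and between the two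
  sequences, but not directly for the pairs. After decoupling, the noise integrals factorise for a
  fixed design, then the resulting functions of the X_i factorise, and decoupling a single index
  backwards restores each pair.\<close>

lemma nn_integral_prod_sample:
  assumes \<psi> [measurable]: "\<And>i. i \<in> J \<Longrightarrow> \<psi> i \<in> borel_measurable (borel \<Otimes>\<^sub>M borel)"
    and J: "finite J" "J \<subseteq> {1..}"
  shows "(\<integral>\<^sup>+w. (\<Prod>i\<in>J. \<psi> i (X i w, \<epsilon> i w)) \<partial>P) = (\<Prod>i\<in>J. (\<integral>\<^sup>+w. \<psi> i (X i w, \<epsilon> i w) \<partial>P))"
proof -
  have i1: "1 \<le> i" if "i \<in> J" for i using that J by auto
  have iE: "indep_vars (\<lambda>_. borel) (\<lambda>i w. \<psi> i (x i, \<epsilon> i w)) J" for x :: "nat \<Rightarrow> real^2"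
    by (rule indep_vars_compose2[OF indep_vars_subset[OF noise_indep J(2)]])
       (use measurable_compose[OF measurable_Pair1' \<psi>] in simp)
  have \<Psi>: "(\<lambda>x. \<integral>\<^sup>+w. \<psi> i (x, \<epsilon> i w) \<partial>P) \<in> borel_measurable borel" if i: "i \<in> J" for i
  proof -
    have [measurable]: "\<epsilon> i \<in> borel_measurable P" using i1[OF i] by simp
    have "(\<lambda>(x, w). (x, \<epsilon> i w)) \<in> (borel \<Otimes>\<^sub>M P) \<rightarrow>\<^sub>M (borel \<Otimes>\<^sub>M borel)" by measurable
    from measurable_compose[OF this \<psi>[OF i]]
    have "(\<lambda>(x, w). \<psi> i (x, \<epsilon> i w)) \<in> borel_measurable (borel \<Otimes>\<^sub>M P)" by (simp add: split_beta')
    from borel_measurable_nn_integral_fst[OF this] show ?thesis by simp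
  qed
  have iX: "indep_vars (\<lambda>_. borel) (\<lambda>i v. \<integral>\<^sup>+w. \<psi> i (X i v, \<epsilon> i w) \<partial>P) J"
    by (rule indep_vars_compose2[OF indep_vars_subset[OF X_indep J(2)]]) (rule \<Psi>)
  have "(\<integral>\<^sup>+w. (\<Prod>i\<in>J. \<psi> i (X i w, \<epsilon> i w)) \<partial>P) = (\<integral>\<^sup>+v. (\<integral>\<^sup>+w. (\<Prod>i\<in>J. \<psi> i (X i v, \<epsilon> i w)) \<partial>P) \<partial>P)"
    by (rule nn_integral_decouple[OF \<psi> J])
  also have "\<dots> = (\<integral>\<^sup>+v. (\<Prod>i\<in>J. \<integral>\<^sup>+w. \<psi> i (X i v, \<epsilon> i w) \<partial>P) \<partial>P)"
    by (intro nn_integral_cong indep_vars_nn_integral[OF J(1) iE]) simp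
  also have "\<dots> = (\<Prod>i\<in>J. \<integral>\<^sup>+v. (\<integral>\<^sup>+w. \<psi> i (X i v, \<epsilon> i w) \<partial>P) \<partial>P)"
    by (rule indep_vars_nn_integral[OF J(1) iX]) simp
  also have "\<dots> = (\<Prod>i\<in>J. (\<integral>\<^sup>+w. \<psi> i (X i w, \<epsilon> i w) \<partial>P))"
  proof (rule prod.cong[OF refl])
    fix i assume "i \<in> J"
    then show "(\<integral>\<^sup>+v. (\<integral>\<^sup>+w. \<psi> i (X i v, \<epsilon> i w) \<partial>P) \<partial>P) = (\<integral>\<^sup>+w. \<psi> i (X i w, \<epsilon> i w) \<partial>P)"
      using nn_integral_decouple[of "{i}" \<psi>] \<psi> i1 by simp
  qed
  finally show ?thesis .
qed

text \<open>Needed for product expectations with factors of both signs, which the product formula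
  for nonnegative integrands does not give.\<close>

lemma X_\<epsilon>_indep:
  fixes \<phi> :: "real^2 \<Rightarrow> real" and \<zeta> :: "real \<Rightarrow> real"
  assumes i: "1 \<le> i" and [measurable]: "\<phi> \<in> borel_measurable borel" "\<zeta> \<in> borel_measurable borel"
  shows "indep_var borel (\<lambda>w. \<phi> (X i w)) borel (\<lambda>w. \<zeta> (\<epsilon> i w))"
  unfolding indep_var_eq
proof (intro conjI indep_set_sigma_sets)
  have [measurable]: "X i \<in> borel_measurable P" "\<epsilon> i \<in> borel_measurable P" using i by auto
  have [simp]: "i \<in> {1..}" using i by simp
  show mX: "(\<lambda>w. \<phi> (X i w)) \<in> borel_measurable P" and mE: "(\<lambda>w. \<zeta> (\<epsilon> i w)) \<in> borel_measurable P"
    by measurable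
  show "Int_stable {(\<lambda>w. \<phi> (X i w)) -` A \<inter> space P |A. A \<in> sets borel}"
    by (rule Int_stable_vimage)
  show "Int_stable {(\<lambda>w. \<zeta> (\<epsilon> i w)) -` A \<inter> space P |A. A \<in> sets borel}"
    by (rule Int_stable_vimage)
  show "indep_set {(\<lambda>w. \<phi> (X i w)) -` A \<inter> space P |A. A \<in> sets borel} {(\<lambda>w. \<zeta> (\<epsilon> i w)) -` A \<inter> space P |A. A \<in> sets borel}"
  proof (rule indep_setI)
    show "{(\<lambda>w. \<phi> (X i w)) -` A \<inter> space P |A. A \<in> sets borel} \<subseteq> events" using mX by auto
    show "{(\<lambda>w. \<zeta> (\<epsilon> i w)) -` A \<inter> space P |A. A \<in> sets borel} \<subseteq> events" using mE by auto
    fix a b assume "a \<in> {(\<lambda>w. \<phi> (X i w)) -` A \<inter> space P |A. A \<in> sets borel}"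
      "b \<in> {(\<lambda>w. \<zeta> (\<epsilon> i w)) -` A \<inter> space P |A. A \<in> sets borel}"
    then obtain A B where A: "a = (\<lambda>w. \<phi> (X i w)) -` A \<inter> space P" "A \<in> sets borel"
      and B: "b = (\<lambda>w. \<zeta> (\<epsilon> i w)) -` B \<inter> space P" "B \<in> sets borel" by blast
    let ?P = "\<Pi>\<^sub>M i\<in>{1::nat..}. (borel :: (real^2) measure)"
    let ?Q = "\<Pi>\<^sub>M i\<in>{1::nat..}. (borel :: real measure)"
    have cX: "(\<lambda>x. \<phi> (x i)) \<in> borel_measurable ?P"
      by (rule measurable_compose[OF measurable_component_singleton]) (use i in auto)
    have cE: "(\<lambda>x. \<zeta> (x i)) \<in> borel_measurable ?Q"
      by (rule measurable_compose[OF measurable_component_singleton]) (use i in auto)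
    have spX: "\<And>w. w \<in> space P \<Longrightarrow> Xs w \<in> space ?P" by (rule measurable_space[OF Xs_meas])
    have spE: "\<And>w. w \<in> space P \<Longrightarrow> Es w \<in> space ?Q" by (rule measurable_space[OF Es_meas])
    have eX: "\<And>w. Xs w i = X i w" and eE: "\<And>w. Es w i = \<epsilon> i w" using i by (simp_all add: Xs_def Es_def)
    have "a = Xs -` ((\<lambda>x. \<phi> (x i)) -` A \<inter> space ?P) \<inter> space P"
      unfolding A(1) using eX by (auto simp del: space_PiM intro: spX)
    moreover have "b = Es -` ((\<lambda>x. \<zeta> (x i)) -` B \<inter> space ?Q) \<inter> space P"
      unfolding B(1) using eE by (auto simp del: space_PiM intro: spE)
    ultimately show "prob (a \<inter> b) = prob a * prob b"
      by (simp only: Xs_Es_prob[OF measurable_sets[OF cX A(2)] measurable_sets[OF cE B(2)]])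
  qed
qed

text \<open>Chernoff's method with exp y <= 1 + y + y^2, which is available because
  \<open>lam\<close> is at most 1 / c. The value sqrt (x / (n V)) is taken when this constraint
  allows it and produces the square root term; otherwise \<open>lam\<close> is 1 / c and the linear
  term takes over.\<close>

lemma chernoff_sample:
  fixes n :: nat and x V c :: real
  assumes Y [measurable]: "Y \<in> borel_measurable (borel \<Otimes>\<^sub>M borel)" and bound: "\<And>z. \<bar>Y z\<bar> \<le> c"
    and mean: "\<And>i. 1 \<le> i \<Longrightarrow> expectation (\<lambda>w. Y (X i w, \<epsilon> i w)) = 0"
    and var: "\<And>i. 1 \<le> i \<Longrightarrow> expectation (\<lambda>w. (Y (X i w, \<epsilon> i w))\<^sup>2) \<le> V"
    and c: "0 < c" and x: "0 < x" and n: "0 < n" and V: "0 \<le> V"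
  shows "prob {w \<in> space P. 2 * sqrt (x * n * V) + 2 * c * x \<le> (\<Sum>i=1..n. Y (X i w, \<epsilon> i w))} \<le> exp (- x)"
proof -
  define lam where "lam = (if x * c\<^sup>2 \<le> n * V then sqrt (x / (n * V)) else 1 / c)"
  define s where "s = 2 * sqrt (x * n * V) + 2 * c * x"
  have lam0: "0 < lam"
  proof -
    have "0 < x * c\<^sup>2" using x c by simp
    then have "x * c\<^sup>2 \<le> n * V \<Longrightarrow> 0 < n * V" by linarith
    then show ?thesis using x c by (auto simp: lam_def)
  qed
  have lam1: "lam * c \<le> 1"
  proof (cases "x * c\<^sup>2 \<le> n * V")
    case True
    moreover have "0 < x * c\<^sup>2" using x c by simp
    ultimately have nV: "0 < n * V" by linarith
    have "sqrt (x / (n * V)) * c = sqrt (x * c\<^sup>2 / (n * V))"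
      using c by (simp add: real_sqrt_mult real_sqrt_divide)
    also have "\<dots> \<le> sqrt 1" using True nV by (intro real_sqrt_le_mono) (simp add: divide_le_eq)
    finally show ?thesis using True by (simp add: lam_def)
  qed (use c in \<open>simp add: lam_def\<close>)
  have key: "n * (lam\<^sup>2 * V) - lam * s \<le> - x"
  proof (cases "x * c\<^sup>2 \<le> n * V")
    case True
    moreover have "0 < x * c\<^sup>2" using x c by simp
    ultimately have nV: "0 < n * V" by linarith
    have l: "lam = sqrt (x / (n * V))" using True by (simp add: lam_def)
    have "V \<noteq> 0" using nV by auto
    then have "n * (lam\<^sup>2 * V) = x" using nV x n by (simp add: l)
    moreover have "lam * (2 * sqrt (x * n * V)) = 2 * x"
    proof -
      have q: "x / q * (x * q) = x\<^sup>2" if "q \<noteq> 0" for q :: real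
        using that by (simp add: power2_eq_square)
      have "lam * sqrt (x * n * V) = sqrt (x / (n * V) * (x * (n * V)))"
        unfolding l real_sqrt_mult[symmetric] by (simp add: mult.assoc)
      also have "\<dots> = sqrt (x\<^sup>2)" using nV n by (subst q) auto
      finally show ?thesis using x by simp
    qed
    moreover have "0 \<le> lam * (2 * c * x)" using lam0 c x by simp
    ultimately show ?thesis unfolding s_def distrib_left by linarith
  next
    case False
    have l: "lam = 1 / c" using False by (simp add: lam_def)
    have "n * (lam\<^sup>2 * V) \<le> x" using False c by (simp add: l power_divide divide_le_eq mult.commute)
    moreover have "lam * (2 * c * x) = 2 * x" using c by (simp add: l)
    moreover have "0 \<le> lam * (2 * sqrt (x * n * V))" using lam0 x V by simp
    ultimately show ?thesis unfolding s_def distrib_left by linarith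
  qed
  have mgf: "(\<integral>\<^sup>+w. ennreal (exp (lam * Y (X i w, \<epsilon> i w))) \<partial>P) \<le> ennreal (exp (lam\<^sup>2 * V))" if i: "1 \<le> i" for i
  proof -
    have [measurable]: "X i \<in> borel_measurable P" "\<epsilon> i \<in> borel_measurable P" using i by auto
    have bd: "\<bar>lam * Y z\<bar> \<le> 1" for z
    proof -
      have "\<bar>lam * Y z\<bar> = lam * \<bar>Y z\<bar>" using lam0 by (simp add: abs_mult)
      also have "\<dots> \<le> lam * c" using lam0 by (intro mult_left_mono bound) auto
      finally show ?thesis using lam1 by simp
    qed
    have iY: "integrable P (\<lambda>w. Y (X i w, \<epsilon> i w))"
      by (rule integrable_const_bound[where B=c]) (auto simp: bound)
    have iY2: "integrable P (\<lambda>w. (Y (X i w, \<epsilon> i w))\<^sup>2)"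
      by (rule integrable_const_bound[where B="c\<^sup>2"]) (use c in \<open>auto simp: abs_le_square_iff[symmetric] bound\<close>)
    have "(\<integral>\<^sup>+w. ennreal (exp (lam * Y (X i w, \<epsilon> i w))) \<partial>P) \<le>
       (\<integral>\<^sup>+w. ennreal (1 + lam * Y (X i w, \<epsilon> i w) + lam\<^sup>2 * (Y (X i w, \<epsilon> i w))\<^sup>2) \<partial>P)"
      using exp_le_quadratic[OF bd] by (intro nn_integral_mono ennreal_leI) (simp add: power_mult_distrib)
    also have "\<dots> = ennreal (expectation (\<lambda>w. 1 + lam * Y (X i w, \<epsilon> i w) + lam\<^sup>2 * (Y (X i w, \<epsilon> i w))\<^sup>2))"
    proof (rule nn_integral_eq_integral)
      show "AE w in P. 0 \<le> 1 + lam * Y (X i w, \<epsilon> i w) + lam\<^sup>2 * (Y (X i w, \<epsilon> i w))\<^sup>2"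
      proof (rule AE_I2)
        fix w
        have "- 1 \<le> lam * Y (X i w, \<epsilon> i w)" using bd[of "(X i w, \<epsilon> i w)"] by linarith
        moreover have "0 \<le> lam\<^sup>2 * (Y (X i w, \<epsilon> i w))\<^sup>2" by simp
        ultimately show "0 \<le> 1 + lam * Y (X i w, \<epsilon> i w) + lam\<^sup>2 * (Y (X i w, \<epsilon> i w))\<^sup>2" by linarith
      qed
    qed (use iY iY2 in auto)
    also have "expectation (\<lambda>w. 1 + lam * Y (X i w, \<epsilon> i w) + lam\<^sup>2 * (Y (X i w, \<epsilon> i w))\<^sup>2)
       = 1 + lam\<^sup>2 * expectation (\<lambda>w. (Y (X i w, \<epsilon> i w))\<^sup>2)"
      using iY iY2 by (simp add: mean[OF i] prob_space)
    also have "ennreal \<dots> \<le> ennreal (1 + lam\<^sup>2 * V)"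
      by (intro ennreal_leI add_left_mono mult_left_mono var[OF i]) auto
    also have "\<dots> \<le> ennreal (exp (lam\<^sup>2 * V))" by (intro ennreal_leI exp_ge_add_one_self)
    finally show ?thesis .
  qed
  let ?A = "{w \<in> space P. s \<le> (\<Sum>i=1..n. Y (X i w, \<epsilon> i w))}"
  have [measurable]: "(\<lambda>w. \<Sum>i=1..n. Y (X i w, \<epsilon> i w)) \<in> borel_measurable P"
    by (intro borel_measurable_sum measurable_compose[OF measurable_Pair Y]) auto
  have A: "?A \<in> sets P" by measurable
  have "ennreal (exp (lam * s)) * emeasure P ?A = (\<integral>\<^sup>+w. ennreal (exp (lam * s)) * indicator ?A w \<partial>P)"
    using A by (rule nn_integral_cmult_indicator[symmetric])
  also have "\<dots> \<le> (\<integral>\<^sup>+w. (\<Prod>i\<in>{1..n}. ennreal (exp (lam * Y (X i w, \<epsilon> i w)))) \<partial>P)"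
  proof (rule nn_integral_mono)
    fix w
    have "(\<Prod>i\<in>{1..n}. ennreal (exp (lam * Y (X i w, \<epsilon> i w)))) = ennreal (exp (lam * (\<Sum>i=1..n. Y (X i w, \<epsilon> i w))))"
      by (simp add: prod_ennreal exp_sum[symmetric] sum_distrib_left)
    then show "ennreal (exp (lam * s)) * indicator ?A w \<le> (\<Prod>i\<in>{1..n}. ennreal (exp (lam * Y (X i w, \<epsilon> i w))))"
      using lam0 by (auto simp: indicator_def intro!: ennreal_leI)
  qed
  also have "\<dots> = (\<Prod>i\<in>{1..n}. (\<integral>\<^sup>+w. ennreal (exp (lam * Y (X i w, \<epsilon> i w))) \<partial>P))"
    using nn_integral_prod_sample[of "{1..n}" "\<lambda>i z. ennreal (exp (lam * Y z))"] by auto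
  also have "\<dots> \<le> (\<Prod>i\<in>{1..n}. ennreal (exp (lam\<^sup>2 * V)))"
    by (rule prod_le_ennreal) (use mgf in auto)
  also have "\<dots> = ennreal (exp (n * (lam\<^sup>2 * V)))"
    by (simp add: prod_ennreal exp_of_nat_mult ennreal_power)
  finally have "ennreal (exp (lam * s)) * ennreal (prob ?A) \<le> ennreal (exp (n * (lam\<^sup>2 * V)))"
    by (simp add: emeasure_eq_measure)
  then have "exp (lam * s) * prob ?A \<le> exp (n * (lam\<^sup>2 * V))"
    by (simp add: ennreal_mult'[symmetric] ennreal_le_iff)
  then have "prob ?A \<le> exp (n * (lam\<^sup>2 * V)) / exp (lam * s)"
    by (simp add: pos_le_divide_eq mult.commute)
  also have "\<dots> = exp (n * (lam\<^sup>2 * V) - lam * s)" by (simp add: exp_diff)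
  also have "\<dots> \<le> exp (- x)" using key by simp
  finally show ?thesis by (simp add: s_def)
qed

text \<open>The centred variables are bounded by 2 c, which turns 2 c x of the one-sided bound into
  4 c x; applying that bound to both signs gives the factor 2. Centring only lowers the second
  moment, so V may bound the uncentred one.\<close>

lemma bernstein_sample:
  fixes n :: nat and x V c :: real
  assumes Z [measurable]: "Z \<in> borel_measurable (borel \<Otimes>\<^sub>M borel)" and bound: "\<And>z. \<bar>Z z\<bar> \<le> c"
    and mean: "\<And>i. 1 \<le> i \<Longrightarrow> expectation (\<lambda>w. Z (X i w, \<epsilon> i w)) = \<mu>"
    and var: "\<And>i. 1 \<le> i \<Longrightarrow> expectation (\<lambda>w. (Z (X i w, \<epsilon> i w))\<^sup>2) \<le> V"
    and c: "0 < c" and x: "0 < x" and n: "0 < n" and V: "0 \<le> V"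
  shows "prob {w \<in> space P. 2 * sqrt (x * V / n) + 4 * c * x / n < \<bar>(\<Sum>i=1..n. Z (X i w, \<epsilon> i w)) / n - \<mu>\<bar>} \<le> 2 * exp (- x)"
proof -
  have iZ: "integrable P (\<lambda>w. Z (X i w, \<epsilon> i w))" "integrable P (\<lambda>w. (Z (X i w, \<epsilon> i w))\<^sup>2)" if i: "1 \<le> i" for i
  proof -
    have [measurable]: "X i \<in> borel_measurable P" "\<epsilon> i \<in> borel_measurable P" using i by auto
    show "integrable P (\<lambda>w. Z (X i w, \<epsilon> i w))"
      by (rule integrable_const_bound[where B=c]) (auto simp: bound)
    show "integrable P (\<lambda>w. (Z (X i w, \<epsilon> i w))\<^sup>2)"
      by (rule integrable_const_bound[where B="c\<^sup>2"]) (use c in \<open>auto simp: abs_le_square_iff[symmetric] bound\<close>)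
  qed
  have \<mu>: "\<bar>\<mu>\<bar> \<le> c"
  proof -
    have "\<bar>\<mu>\<bar> \<le> expectation (\<lambda>w. \<bar>Z (X 1 w, \<epsilon> 1 w)\<bar>)"
      unfolding mean[of 1, symmetric, simplified] by (rule integral_abs_bound)
    also have "\<dots> \<le> expectation (\<lambda>w. c)" using iZ[of 1] by (intro integral_mono) (auto simp: bound)
    finally show ?thesis by (simp add: prob_space)
  qed
  have nn: "0 < real n" using n by simp
  define s where "s = 2 * sqrt (x * n * V) + 2 * (2 * c) * x"
  have s: "s / n = 2 * sqrt (x * V / n) + 4 * c * x / n"
  proof -
    have "sqrt (x * n * V) / n = sqrt (x * V / n)"
      using nn by (simp add: real_sqrt_mult real_sqrt_divide real_div_sqrt field_simps)
    then show ?thesis by (simp add: s_def add_divide_distrib)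
  qed
  have one: "prob {w \<in> space P. s \<le> (\<Sum>i=1..n. sg * (Z (X i w, \<epsilon> i w) - \<mu>))} \<le> exp (- x)" if sg: "sg = 1 \<or> sg = - 1" for sg
    unfolding s_def
  proof (rule chernoff_sample[where Y="\<lambda>z. sg * (Z z - \<mu>)" and c="2 * c", OF _ _ _ _ _ x n V])
    show "\<bar>sg * (Z z - \<mu>)\<bar> \<le> 2 * c" for z using bound[of z] \<mu> sg by (auto simp: abs_mult)
    fix i :: nat assume i: "1 \<le> i"
    show "expectation (\<lambda>w. sg * (Z (X i w, \<epsilon> i w) - \<mu>)) = 0" using iZ(1)[OF i] mean[OF i] by (simp add: prob_space)
    have "expectation (\<lambda>w. (sg * (Z (X i w, \<epsilon> i w) - \<mu>))\<^sup>2) = expectation (\<lambda>w. (Z (X i w, \<epsilon> i w))\<^sup>2 - 2 * \<mu> * Z (X i w, \<epsilon> i w) + \<mu>\<^sup>2)"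
      using sg by (intro Bochner_Integration.integral_cong refl) (auto simp: power2_eq_square algebra_simps)
    also have "\<dots> = expectation (\<lambda>w. (Z (X i w, \<epsilon> i w))\<^sup>2) - \<mu>\<^sup>2"
      using iZ[OF i] by (simp add: mean[OF i] prob_space power2_eq_square)
    also have "\<dots> \<le> V" using var[OF i] zero_le_power2[of \<mu>] by linarith
    finally show "expectation (\<lambda>w. (sg * (Z (X i w, \<epsilon> i w) - \<mu>))\<^sup>2) \<le> V" .
  qed (use c in auto)
  have [measurable]: "(\<lambda>w. \<Sum>i=1..n. sg * (Z (X i w, \<epsilon> i w) - \<mu>)) \<in> borel_measurable P" for sg
    by (intro borel_measurable_sum borel_measurable_times borel_measurable_diff measurable_compose[OF measurable_Pair Z]) auto
  have "{w \<in> space P. s / n < \<bar>(\<Sum>i=1..n. Z (X i w, \<epsilon> i w)) / n - \<mu>\<bar>} \<subseteq>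
     {w \<in> space P. s \<le> (\<Sum>i=1..n. 1 * (Z (X i w, \<epsilon> i w) - \<mu>))} \<union> {w \<in> space P. s \<le> (\<Sum>i=1..n. (- 1) * (Z (X i w, \<epsilon> i w) - \<mu>))}"
  proof safe
    fix w assume w: "s / n < \<bar>(\<Sum>i=1..n. Z (X i w, \<epsilon> i w)) / n - \<mu>\<bar>"
      and no: "\<not> s \<le> (\<Sum>i=1..n. (- 1) * (Z (X i w, \<epsilon> i w) - \<mu>))"
    define T where "T = (\<Sum>i=1..n. Z (X i w, \<epsilon> i w))"
    have e: "(\<Sum>i=1..n. sg * (Z (X i w, \<epsilon> i w) - \<mu>)) = sg * (T - n * \<mu>)" for sg
      by (simp add: T_def sum_distrib_left[symmetric] sum_subtractf)
    have "T / n - \<mu> = (T - n * \<mu>) / n" using nn by (simp add: field_simps)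
    then have "s / n < \<bar>T - n * \<mu>\<bar> / n" using w nn by (simp add: T_def[symmetric] abs_divide)
    then have "s < \<bar>T - n * \<mu>\<bar>" using nn by (simp add: divide_less_cancel)
    then show "s \<le> (\<Sum>i=1..n. 1 * (Z (X i w, \<epsilon> i w) - \<mu>))" using no unfolding e by auto
  qed
  then have "prob {w \<in> space P. s / n < \<bar>(\<Sum>i=1..n. Z (X i w, \<epsilon> i w)) / n - \<mu>\<bar>} \<le>
     prob ({w \<in> space P. s \<le> (\<Sum>i=1..n. 1 * (Z (X i w, \<epsilon> i w) - \<mu>))} \<union> {w \<in> space P. s \<le> (\<Sum>i=1..n. (- 1) * (Z (X i w, \<epsilon> i w) - \<mu>))})"
    by (rule finite_measure_mono) measurable
  also have "\<dots> \<le> prob {w \<in> space P. s \<le> (\<Sum>i=1..n. 1 * (Z (X i w, \<epsilon> i w) - \<mu>))} + prob {w \<in> space P. s \<le> (\<Sum>i=1..n. (- 1) * (Z (X i w, \<epsilon> i w) - \<mu>))}"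
    by (rule measure_Un_le) measurable
  also have "\<dots> \<le> exp (- x) + exp (- x)" by (intro add_mono one) auto
  finally show ?thesis unfolding s by simp
qed

end

section \<open>Anisotropic windows in the plane\<close>

text \<open>The rows are \<open>a\<close> and its quarter turn, scaled by 1 / \<eta> and 1 /
  \<zeta>, so the kernel window is an oriented rectangle. \<open>a\<close> may be shorter than a
  unit vector, which covers the bisectors in \<open>E_two\<close>.\<close>

definition E3 :: "real^2 \<Rightarrow> real \<Rightarrow> real \<Rightarrow> real^2^2" where
  "E3 a \<eta> \<zeta> = vector [vector [a $ 1 / \<eta>, a $ 2 / \<eta>], vector [- (a $ 2) / \<zeta>, a $ 1 / \<zeta>]]"

definition cross :: "real^2 \<Rightarrow> real^2 \<Rightarrow> real" where
  "cross a x = a $ 1 * x $ 2 - a $ 2 * x $ 1"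

lemma inner_2: "(x :: real^2) \<bullet> y = x $ 1 * y $ 1 + x $ 2 * y $ 2"
  by (simp add: inner_vec_def sum_2)

lemma det_E3: "det (E3 a \<eta> \<zeta>) = (a \<bullet> a) / (\<eta> * \<zeta>)"
  by (simp add: E3_def det_2 inner_2 add_divide_distrib mult.commute)

lemma E3_mult:
  "(E3 a \<eta> \<zeta> *v x) $ 1 = (a \<bullet> x) / \<eta>" "(E3 a \<eta> \<zeta> *v x) $ 2 = cross a x / \<zeta>"
  by (simp_all add: E3_def matrix_vector_mult_def sum_2 inner_2 cross_def add_divide_distrib diff_divide_distrib)

lemma inner_cross_sq: "(a \<bullet> x)\<^sup>2 + (cross a x)\<^sup>2 = (a \<bullet> a) * (x \<bullet> x)"
  by (simp add: inner_2 cross_def power2_eq_square algebra_simps)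

text \<open>Expansion of an inner product in the orthogonal basis formed by \<open>a\<close> and its
  quarter turn.\<close>

lemma inner_cross_inner: "(a \<bullet> x) * (a \<bullet> \<theta>) + cross a x * cross a \<theta> = (a \<bullet> a) * (x \<bullet> \<theta>)"
  by (simp add: inner_2 cross_def algebra_simps)

lemma meas_matrix_vector [measurable]: "(\<lambda>x. (E :: real^2^2) *v x) \<in> borel_measurable borel"
  by (intro borel_measurable_continuous_onI linear_continuous_on) (simp add: matrix_vector_mul_bounded_linear)

lemma meas_component [measurable]: "(\<lambda>x. (x :: real^2) $ i) \<in> borel_measurable borel"
  by (intro borel_measurable_continuous_onI continuous_intros)

text \<open>Boxes determine Lebesgue measure. The preimage of a box under E is its image under the
  inverse matrix, whose measure is known.\<close>

lemma lborel_linear_2: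
  fixes E :: "real^2^2"
  assumes E: "det E \<noteq> 0"
  shows "lborel = density (distr lborel borel ((*v) E)) (\<lambda>_. ennreal \<bar>det E\<bar>)"
proof (rule lborel_eqI)
  fix l u :: "real^2" assume lu: "\<And>b. b \<in> Basis \<Longrightarrow> l \<bullet> b \<le> u \<bullet> b"
  have "invertible E" using E by (simp add: invertible_det_nz)
  then obtain B where EB: "E ** B = mat 1" "B ** E = mat 1"
    unfolding invertible_def by blast
  have im: "(*v) E -` box l u = (*v) B ` box l u"
  proof (rule set_eqI)
    fix x
    have 1: "x = B *v (E *v x)" by (simp add: matrix_vector_mul_assoc EB)
    have 2: "E *v (B *v y) = y" for y by (simp add: matrix_vector_mul_assoc EB)
    show "x \<in> (*v) E -` box l u \<longleftrightarrow> x \<in> (*v) B ` box l u"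
    proof
      assume "x \<in> (*v) E -` box l u"
      then have "E *v x \<in> box l u" by (rule vimageD)
      with 1 have "\<exists>y\<in>box l u. x = B *v y" by (rule bexI)
      then show "x \<in> (*v) B ` box l u" unfolding image_iff .
    next
      assume "x \<in> (*v) B ` box l u"
      then obtain y where "y \<in> box l u" "x = B *v y" by (rule imageE)
      then show "x \<in> (*v) E -` box l u" by (intro vimageI2) (simp only: 2)
    qed
  qed
  have lm: "box l u \<in> lmeasurable" by simp
  have lin: "linear ((*v) B)" by simp
  have ms: "(*v) E -` box l u \<in> sets borel"
    using measurable_sets[OF meas_matrix_vector, of "box l u" E] by simp
  have "emeasure lborel ((*v) E -` box l u) = emeasure lebesgue ((*v) B ` box l u)"
    unfolding im[symmetric] using ms by simp
  also have "\<dots> = ennreal (measure lebesgue ((*v) B ` box l u))"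
    by (rule emeasure_eq_measure2[OF measurable_linear_image[OF lin lm]])
  also have "measure lebesgue ((*v) B ` box l u) = \<bar>det B\<bar> * measure lebesgue (box l u)"
    using measure_linear_image[OF lin lm] by (simp add: matrix_of_matrix_vector_mul)
  also have "measure lebesgue (box l u) = (\<Prod>b\<in>Basis. (u - l) \<bullet> b)"
    using lu by (simp add: measure_lborel_box_eq)
  finally have e: "emeasure lborel ((*v) E -` box l u) = ennreal (\<bar>det B\<bar> * (\<Prod>b\<in>Basis. (u - l) \<bullet> b))" .
  have d: "\<bar>det E\<bar> * \<bar>det B\<bar> = 1"
    using arg_cong[OF EB(1), of det] by (simp add: det_mul abs_mult[symmetric])
  have "emeasure (density (distr lborel borel ((*v) E)) (\<lambda>_. ennreal \<bar>det E\<bar>)) (box l u)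
    = ennreal \<bar>det E\<bar> * emeasure lborel ((*v) E -` box l u)"
    by (subst emeasure_density) (auto simp: nn_integral_cmult_indicator emeasure_distr)
  also have "\<dots> = ennreal (\<bar>det E\<bar> * \<bar>det B\<bar> * (\<Prod>b\<in>Basis. (u - l) \<bullet> b))"
    unfolding e by (subst ennreal_mult'[symmetric]) (auto simp: mult.assoc)
  finally show "emeasure (density (distr lborel borel ((*v) E)) (\<lambda>_. ennreal \<bar>det E\<bar>)) (box l u) = (\<Prod>b\<in>Basis. (u - l) \<bullet> b)"
    by (simp add: d)
qed simp

lemma integral_linear_2:
  fixes E :: "real^2^2" and G :: "real^2 \<Rightarrow> real"
  assumes E: "det E \<noteq> 0" and [measurable]: "G \<in> borel_measurable borel"
  shows "(\<integral>x. \<bar>det E\<bar> * G (E *v x) \<partial>lborel) = (\<integral>w. G w \<partial>lborel)"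
  by (subst (2) lborel_linear_2[OF E]) (simp add: integral_density integral_distr)

lemma nn_integral_linear_2:
  fixes E :: "real^2^2"
  assumes E: "det E \<noteq> 0" and [measurable]: "G \<in> borel_measurable borel"
  shows "(\<integral>\<^sup>+x. ennreal \<bar>det E\<bar> * G (E *v x) \<partial>lborel) = (\<integral>\<^sup>+w. G w \<partial>lborel)"
  by (subst (2) lborel_linear_2[OF E]) (simp add: nn_integral_density nn_integral_distr)

definition vec2 :: "real \<times> real \<Rightarrow> real^2" where
  "vec2 z = fst z *\<^sub>R axis 1 1 + snd z *\<^sub>R axis 2 1"

lemma vec2_nth [simp]: "vec2 z $ 1 = fst z" "vec2 z $ 2 = snd z"
  by (simp_all add: vec2_def axis_def)

lemma vec2_meas [measurable]: "vec2 \<in> borel_measurable borel"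
  unfolding vec2_def by (intro borel_measurable_continuous_onI continuous_intros)

lemma vec2_meas' [measurable]: "vec2 \<in> borel_measurable (borel \<Otimes>\<^sub>M borel)"
  using vec2_meas by (simp add: borel_prod)

lemma lborel_vec2: "lborel = distr (lborel \<Otimes>\<^sub>M lborel) borel vec2"
proof (rule lborel_eqI)
  fix l u :: "real^2" assume lu: "\<And>b. b \<in> Basis \<Longrightarrow> l \<bullet> b \<le> u \<bullet> b"
  have le: "l $ i \<le> u $ i" for i
    using lu[of "axis i 1"] by (simp add: inner_axis)
  have "vec2 -` box l u = {l $ 1 <..< u $ 1} \<times> {l $ 2 <..< u $ 2}"
    by (auto simp: mem_box_cart forall_2)
  then have "emeasure (distr (lborel \<Otimes>\<^sub>M lborel) borel vec2) (box l u) = emeasure (lborel \<Otimes>\<^sub>M lborel) ({l $ 1 <..< u $ 1} \<times> {l $ 2 <..< u $ 2})"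
    by (subst emeasure_distr) (auto simp: space_pair_measure)
  also have "\<dots> = ennreal (u $ 1 - l $ 1) * ennreal (u $ 2 - l $ 2)"
    using le by (subst lborel.emeasure_pair_measure_Times) auto
  also have "\<dots> = ennreal (\<Prod>i\<in>UNIV. u $ i - l $ i)"
    using le by (simp add: ennreal_mult'[symmetric] UNIV_2)
  also have "(\<Prod>i\<in>UNIV. u $ i - l $ i) = measure lborel (cbox l u)"
    using le by (subst content_cbox_cart) (auto simp: interval_ne_empty_cart)
  also have "\<dots> = (\<Prod>b\<in>Basis. (u - l) \<bullet> b)"
    using lu by (simp add: measure_lborel_cbox_eq)
  finally show "emeasure (distr (lborel \<Otimes>\<^sub>M lborel) borel vec2) (box l u) = (\<Prod>b\<in>Basis. (u - l) \<bullet> b)" .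
qed simp

lemma nn_integral_vec2:
  assumes [measurable]: "G \<in> borel_measurable borel"
  shows "(\<integral>\<^sup>+w. G w \<partial>lborel) = (\<integral>\<^sup>+x. (\<integral>\<^sup>+y. G (vec2 (x, y)) \<partial>lborel) \<partial>lborel)"
  by (subst lborel_vec2) (simp add: nn_integral_distr lborel.nn_integral_fst[symmetric])

text \<open>Rotate \<theta> to the first axis. Points of the cube have norm at most 1, so their
  second coordinate lies in [-1, 1], whence the factor 2. This carries exceptional sets of the line
  over to the square.\<close>

lemma strip_measure:
  assumes \<theta>: "\<theta> \<in> unit_circle" and [measurable]: "U \<in> sets borel"
  shows "emeasure lborel {t \<in> cube (1/2). t \<bullet> \<theta> \<in> U} \<le> 2 * emeasure lborel U"
proof -
  have nt: "\<theta> \<bullet> \<theta> = 1" using \<theta> by (simp add: dot_square_norm)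
  define Q where "Q = E3 \<theta> 1 1"
  have dQ: "det Q = 1" by (simp add: Q_def det_E3 nt)
  define S where "S = {w :: real^2. w $ 1 \<in> U \<and> w $ 2 \<in> {-1..1}}"
  have [measurable]: "S \<in> sets borel" unfolding S_def by measurable
  have "{t \<in> cube (1/2). t \<bullet> \<theta> \<in> U} \<subseteq> {x. Q *v x \<in> S}"
  proof (rule subsetI)
    fix t :: "real^2" assume "t \<in> {t \<in> cube (1/2). t \<bullet> \<theta> \<in> U}"
    then have t: "t \<in> cube (1/2)" "t \<bullet> \<theta> \<in> U" by auto
    have 1: "(Q *v t) $ 1 \<in> U" using t(2) by (simp add: Q_def E3_mult inner_commute)
    have "\<bar>t $ 1\<bar> \<le> 1/2" "\<bar>t $ 2\<bar> \<le> 1/2" using t(1) by (auto simp: cube_def)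
    then have "(t $ 1)\<^sup>2 \<le> (1/2)\<^sup>2" "(t $ 2)\<^sup>2 \<le> (1/2)\<^sup>2"
      using power_mono[of "\<bar>t $ 1\<bar>" "1/2" 2] power_mono[of "\<bar>t $ 2\<bar>" "1/2" 2] by simp_all
    then have "t \<bullet> t \<le> 1" by (simp add: inner_2 power2_eq_square)
    then have "(cross \<theta> t)\<^sup>2 \<le> 1" using inner_cross_sq[of \<theta> t] nt zero_le_power2[of "\<theta> \<bullet> t"]  \<open>t \<bullet> t \<le> 1\<close> by (simp only: mult_1_left)
    then have "\<bar>cross \<theta> t\<bar> \<le> 1" by (simp add: abs_square_le_1)
    then have "(Q *v t) $ 2 \<in> {-1..1}" by (auto simp: Q_def E3_mult)
    then show "t \<in> {x. Q *v x \<in> S}" using 1 by (simp add: S_def)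
  qed
  then have "emeasure lborel {t \<in> cube (1/2). t \<bullet> \<theta> \<in> U} \<le> emeasure lborel {x. Q *v x \<in> S}"
    by (rule emeasure_mono) measurable
  also have "\<dots> = (\<integral>\<^sup>+x. ennreal \<bar>det Q\<bar> * indicator S (Q *v x) \<partial>lborel)"
  proof -
    have "{x. Q *v x \<in> S} \<in> sets lborel" by measurable
    then have "emeasure lborel {x. Q *v x \<in> S} =
       (\<integral>\<^sup>+x. indicator {x. Q *v x \<in> S} x \<partial>lborel)"
      by (rule nn_integral_indicator[symmetric])
    also have "\<dots> = (\<integral>\<^sup>+x. ennreal \<bar>det Q\<bar> * indicator S (Q *v x) \<partial>lborel)"
      by (intro nn_integral_cong) (simp add: dQ indicator_def)
    finally show ?thesis .
  qed
  also have "\<dots> = (\<integral>\<^sup>+w. indicator S w \<partial>lborel)"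
    by (rule nn_integral_linear_2) (auto simp: dQ)
  also have "\<dots> = (\<integral>\<^sup>+x. (\<integral>\<^sup>+y. indicator U x * indicator {-1..1::real} y \<partial>lborel) \<partial>lborel)"
    by (subst nn_integral_vec2) (auto simp: S_def indicator_def intro!: nn_integral_cong)
  also have "\<dots> = 2 * emeasure lborel U"
    by (simp add: nn_integral_cmult nn_integral_multc mult.commute)
  finally show ?thesis .
qed

section \<open>Means of kernel estimators of single-index functions\<close>

locale kernel_supp = kernel_fun +
  assumes K_supp: "\<And>u. \<not> \<bar>u\<bar> \<le> 1/2 \<Longrightarrow> K u = 0"
begin

lemma integral_K_W:
  assumes [measurable]: "h \<in> borel_measurable borel"
  shows "(\<integral>u. K u * h u \<partial>lborel) = (\<integral>u. K u * h u \<partial>W)"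
proof (subst integral_W)
  show "(\<integral>u. K u * h u \<partial>lborel) = (\<integral>u. indicator {-1/2..1/2} u * (K u * h u) \<partial>lborel)"
  proof (rule Bochner_Integration.integral_cong[OF refl])
    fix u show "K u * h u = indicator {-1/2..1/2} u * (K u * h u)"
      using K_supp[of u] by (cases "\<bar>u\<bar> \<le> 1/2") (auto simp: indicator_def abs_le_iff)
  qed
qed measurable

lemma kern2_integral:
  fixes h :: "real^2 \<Rightarrow> real"
  assumes [measurable]: "h \<in> borel_measurable borel" and h: "\<And>w. \<bar>h w\<bar> \<le> B"
  shows "(\<integral>w. K (w $ 1) * K (w $ 2) * h w \<partial>lborel) = (\<integral>y. K y * (\<integral>x. K x * h (vec2 (x, y)) \<partial>W) \<partial>W)"
proof -
  have B: "0 \<le> B" using order.trans[OF abs_ge_zero h] .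
  have int: "integrable (lborel \<Otimes>\<^sub>M lborel) (\<lambda>(x, y). K x * K y * h (vec2 (x, y)))"
  proof (rule integrableI_bounded_set[where A="{-1/2..1/2} \<times> {-1/2..1/2}" and B="k * k * B"])
    show "emeasure (lborel \<Otimes>\<^sub>M lborel) ({-1/2..1/2::real} \<times> {-1/2..1/2::real}) < \<infinity>"
      by (subst lborel.emeasure_pair_measure_Times) auto
    show "AE z in lborel \<Otimes>\<^sub>M lborel. z \<in> {-1/2..1/2} \<times> {-1/2..1/2} \<longrightarrow> norm (case z of (x, y) \<Rightarrow> K x * K y * h (vec2 (x, y))) \<le> k * k * B"
      using k0 B by (auto simp: abs_mult intro!: AE_I2 mult_mono K_le h)
    have "K x * K y = 0" if "(x, y) \<notin> {-1/2..1/2} \<times> {-1/2..1/2}" for x y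
      using that K_supp[of x] K_supp[of y] by (auto simp: abs_le_iff)
    then have "z \<notin> {-1/2..1/2} \<times> {-1/2..1/2} \<longrightarrow> (case z of (x, y) \<Rightarrow> K x * K y * h (vec2 (x, y))) = 0" for z
      using mult_eq_0_iff by (cases z) fastforce
    then show "AE z in lborel \<Otimes>\<^sub>M lborel. z \<notin> {-1/2..1/2} \<times> {-1/2..1/2} \<longrightarrow> (case z of (x, y) \<Rightarrow> K x * K y * h (vec2 (x, y))) = 0"
      by (intro AE_I2)
  qed auto
  have "(\<integral>w. K (w $ 1) * K (w $ 2) * h w \<partial>lborel) = (\<integral>z. (case z of (x, y) \<Rightarrow> K x * K y * h (vec2 (x, y))) \<partial>(lborel \<Otimes>\<^sub>M lborel))"
    by (subst lborel_vec2) (auto simp: integral_distr split_beta' intro!: Bochner_Integration.integral_cong)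
  also have "\<dots> = (\<integral>y. (\<integral>x. K x * K y * h (vec2 (x, y)) \<partial>lborel) \<partial>lborel)"
    by (rule lborel_pair.integral_snd[symmetric]) (use int in simp)
  also have "\<dots> = (\<integral>y. K y * (\<integral>x. K x * h (vec2 (x, y)) \<partial>lborel) \<partial>lborel)"
    by (simp add: mult_ac flip: integral_mult_right_zero)
  also have "\<dots> = (\<integral>y. K y * (\<integral>x. K x * h (vec2 (x, y)) \<partial>W) \<partial>lborel)"
    by (subst integral_K_W) auto
  also have "\<dots> = (\<integral>y. K y * (\<integral>x. K x * h (vec2 (x, y)) \<partial>W) \<partial>W)"
    by (rule integral_K_W) measurable
  finally show ?thesis .
qed

text \<open>In the coordinates w = E (x - t) the index is the value at t plus (\<eta> w_1 (a
  \<bullet> \<theta>) + \<zeta> w_2 cross a \<theta>) / (a \<bullet> a). The first coordinate yields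
  a kernel average whose bandwidth carries the cosine between a and \<theta>, the second an average
  over a transverse window carrying the sine. From here on every bias is one-dimensional.\<close>

lemma mean_formula:
  fixes a \<theta> t :: "real^2"
  assumes [measurable]: "f \<in> borel_measurable borel" and f: "\<And>x. \<bar>f x\<bar> \<le> B"
    and a: "a \<noteq> 0" and \<eta>: "0 < \<eta>" and \<zeta>: "0 < \<zeta>"
  shows "(\<integral>x. det (E3 a \<eta> \<zeta>) * (K ((E3 a \<eta> \<zeta> *v (x - t)) $ 1) * K ((E3 a \<eta> \<zeta> *v (x - t)) $ 2)) * f (x \<bullet> \<theta>) \<partial>lborel) =
    (\<integral>y. K y * avg (\<eta> * (a \<bullet> \<theta>) / (a \<bullet> a)) f (t \<bullet> \<theta> + \<zeta> * cross a \<theta> / (a \<bullet> a) * y) \<partial>W)"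
proof -
  let ?E = "E3 a \<eta> \<zeta>"
  have aa: "0 < a \<bullet> a" using a by simp
  have dE: "0 < det ?E" using aa \<eta> \<zeta> by (simp add: det_E3)
  define G where "G w = f (t \<bullet> \<theta> + (\<eta> * w $ 1 * (a \<bullet> \<theta>) + \<zeta> * w $ 2 * cross a \<theta>) / (a \<bullet> a))" for w :: "real^2"
  have [measurable]: "G \<in> borel_measurable borel" unfolding G_def by measurable
  have [measurable]: "(\<lambda>x :: real^2. x \<bullet> \<theta>) \<in> borel_measurable borel" by measurable
  have fG: "f ((t + x) \<bullet> \<theta>) = G (?E *v x)" for x
  proof -
    have "(\<eta> * (?E *v x) $ 1 * (a \<bullet> \<theta>) + \<zeta> * (?E *v x) $ 2 * cross a \<theta>) = (a \<bullet> a) * (x \<bullet> \<theta>)"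
      unfolding E3_mult inner_cross_inner[symmetric] using \<eta> \<zeta> by simp
    then show ?thesis using aa by (simp add: G_def inner_add_left)
  qed
  have "(\<integral>x. det ?E * (K ((?E *v (x - t)) $ 1) * K ((?E *v (x - t)) $ 2)) * f (x \<bullet> \<theta>) \<partial>lborel) =
     (\<integral>x. det ?E * (K ((?E *v (x - t)) $ 1) * K ((?E *v (x - t)) $ 2)) * f (x \<bullet> \<theta>) \<partial>distr lborel borel ((+) t))"
    by (simp add: lborel_distr_plus)
  also have "\<dots> = (\<integral>x. det ?E * (K ((?E *v (t + x - t)) $ 1) * K ((?E *v (t + x - t)) $ 2)) * f ((t + x) \<bullet> \<theta>) \<partial>lborel)"
    by (rule integral_distr) measurable
  also have "\<dots> = (\<integral>x. \<bar>det ?E\<bar> * (\<lambda>w. K (w $ 1) * K (w $ 2) * G w) (?E *v x) \<partial>lborel)"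
    using dE by (simp add: fG mult.assoc)
  also have "\<dots> = (\<integral>w. K (w $ 1) * K (w $ 2) * G w \<partial>lborel)"
    by (rule integral_linear_2) (use dE in auto)
  also have "\<dots> = (\<integral>y. K y * (\<integral>x. K x * G (vec2 (x, y)) \<partial>W) \<partial>W)"
    by (rule kern2_integral[where B=B]) (auto simp: G_def f)
  also have "\<dots> = (\<integral>y. K y * avg (\<eta> * (a \<bullet> \<theta>) / (a \<bullet> a)) f (t \<bullet> \<theta> + \<zeta> * cross a \<theta> / (a \<bullet> a) * y) \<partial>W)"
    unfolding avg_def G_def by (simp add: add_divide_distrib algebra_simps)
  finally show ?thesis .
qed

end

section \<open>Kernel and noise\<close>

locale single_index_model = regression_model P X \<epsilon> "dens S" l
  for P :: "'a measure" and X :: "nat \<Rightarrow> 'a \<Rightarrow> real^2" and \<epsilon> :: "nat \<Rightarrow> 'a \<Rightarrow> real"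
    and l :: "real \<Rightarrow> real" and S :: setting +
  fixes b r :: real
  assumes noise_params: "0 < Ups S" "0 < Omg S" "Omg S \<le> 1" "0 < omg S"
    and noise: "l \<in> noise_class (Ups S) (Omg S) (omg S)"
    and design: "0 < dens_low S" "dens_low S < 1" "\<And>x. x \<in> cube 3 \<Longrightarrow> dens_low S \<le> dens S x"
    and kernel_sym: "\<And>u. kern S (- u) = kern S u"
    and kernel_supp: "closure {u. kern S u \<noteq> 0} \<subseteq> {-1/2..1/2}"
    and kernel_int: "(LINT u|lborel. kern S u) = 1"
    and kernel_lip: "0 < lip S" "\<And>u v. \<bar>kern S u - kern S v\<bar> \<le> lip S * \<bar>u - v\<bar>"
    and b: "0 < b"
    and kernel_moments: "\<And>j. j \<in> {1..strict_floor b} \<Longrightarrow> (LINT u|lborel. u ^ j * kern S u) = 0"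
    and r: "1 \<le> r"
begin

lemma kern_supp: "\<not> \<bar>u\<bar> \<le> 1/2 \<Longrightarrow> kern S u = 0"
  using kernel_supp closure_subset[of "{u. kern S u \<noteq> 0}"] by fastforce

lemma kern_le_lip: "\<bar>kern S u\<bar> \<le> 2 * lip S"
proof (cases "\<bar>u\<bar> \<le> 1/2")
  case True
  have "kern S 1 = 0" by (rule kern_supp) simp
  then have "\<bar>kern S u\<bar> \<le> lip S * \<bar>u - 1\<bar>" using kernel_lip(2)[of u 1] by simp
  also have "\<dots> \<le> lip S * 2" using True kernel_lip(1) by (intro mult_left_mono) auto
  finally show ?thesis by simp
qed (use kernel_lip(1) in \<open>simp add: kern_supp\<close>)

lemma kern_cont: "continuous_on UNIV (kern S)"
proof (rule continuous_at_imp_continuous_on, rule ballI, unfold isCont_def, rule LIM_I)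
  fix u and e :: real assume e: "0 < e"
  have "norm (kern S v - kern S u) < e" if "v \<noteq> u \<and> norm (v - u) < e / lip S" for v
    using order.strict_trans1[OF kernel_lip(2)[of v u], of e] that kernel_lip(1)
    by (simp add: less_divide_eq mult.commute)
  then show "\<exists>s>0. \<forall>x. x \<noteq> u \<and> norm (x - u) < s \<longrightarrow> norm (kern S x - kern S u) < e"
    using e kernel_lip(1) by (intro exI[of _ "e / lip S"]) auto
qed

lemma kern_meas [measurable]: "kern S \<in> borel_measurable borel"
  by (rule borel_measurable_continuous_onI[OF kern_cont])

text \<open>\<open>kern_inf\<close> is an essential supremum; it bounds every value because the set
  where it fails is open by continuity and null, hence empty. Its finiteness has to be shown first,
  as \<open>enn2real\<close> maps infinity to 0.\<close>

lemma kern_le: "\<bar>kern S u\<bar> \<le> kern_inf S"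
proof -
  define c where "c = esssup lborel (\<lambda>x. ennreal \<bar>kern S x\<bar>)"
  have "c \<le> ennreal (2 * lip S)" unfolding c_def
    by (rule esssup_I) (auto intro!: AE_I2 ennreal_leI kern_le_lip)
  then have fin: "c < top" by (simp add: order.strict_trans1)
  have k: "kern_inf S = enn2real c" by (simp add: kern_inf_def L_inf_norm_def c_def)
  have "AE x in lborel. ennreal \<bar>kern S x\<bar> \<le> c" unfolding c_def by (rule esssup_AE)
  then have ae: "AE x in lborel. \<not> kern_inf S < \<bar>kern S x\<bar>"
  proof eventually_elim
    fix x assume "ennreal \<bar>kern S x\<bar> \<le> c"
    then have "enn2real (ennreal \<bar>kern S x\<bar>) \<le> enn2real c" using fin by (intro enn2real_mono) auto
    then show "\<not> kern_inf S < \<bar>kern S x\<bar>" by (simp add: k)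
  qed
  have op: "open {x. kern_inf S < \<bar>kern S x\<bar>}"
    by (rule open_Collect_less) (auto intro!: continuous_intros kern_cont)
  have "{x. kern_inf S < \<bar>kern S x\<bar>} \<in> null_sets lborel"
    by (subst AE_iff_null_sets) (use ae op in \<open>auto simp: borel_open\<close>)
  then have "negligible {x. kern_inf S < \<bar>kern S x\<bar>}"
    by (simp add: negligible_iff_null_sets null_sets_completionI)
  then have "{x. kern_inf S < \<bar>kern S x\<bar>} = {}"
    using open_not_negligible op by blast
  then show ?thesis by (auto simp: not_less)
qed

lemma integral_kern_W:
  assumes [measurable]: "h \<in> borel_measurable borel"
  shows "(\<integral>u. h u * kern S u \<partial>W) = (LINT u|lborel. h u * kern S u)"
proof (subst integral_W)
  show "(\<integral>u. indicator {-1/2..1/2} u * (h u * kern S u) \<partial>lborel) = (\<integral>u. h u * kern S u \<partial>lborel)"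
  proof (rule Bochner_Integration.integral_cong[OF refl])
    fix u show "indicator {-1/2..1/2} u * (h u * kern S u) = h u * kern S u"
      using kern_supp[of u] by (cases "\<bar>u\<bar> \<le> 1/2") (auto simp: indicator_def abs_le_iff)
  qed
qed measurable

sublocale kernel_supp "kern S" "kern_inf S" "strict_floor b"
proof
  show "(\<integral>u. kern S u \<partial>W) = 1" using integral_kern_W[of "\<lambda>_. 1"] kernel_int by simp
  show "(\<integral>u. u ^ j * kern S u \<partial>W) = 0" if "j \<in> {1..strict_floor b}" for j
    using integral_kern_W[of "\<lambda>u. u ^ j"] kernel_moments[OF that] by simp
qed (use kern_le kernel_sym kern_supp in auto)

lemma kern_inf_le: "kern_inf S \<le> 2 * lip S"
proof -
  have "esssup lborel (\<lambda>x. ennreal \<bar>kern S x\<bar>) \<le> ennreal (2 * lip S)"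
    by (rule esssup_I) (auto intro!: AE_I2 ennreal_leI kern_le_lip)
  then show ?thesis using kernel_lip(1)
    by (simp add: kern_inf_def L_inf_norm_def enn2real_leI)
qed

section \<open>Truncated noise and its moments\<close>

lemma l_props [measurable]: "l \<in> borel_measurable borel" and l_nonneg: "\<And>y. 0 \<le> l y"
  and l_tail: "\<And>x. 0 \<le> x \<Longrightarrow> (\<integral>\<^sup>+ y\<in>{x..}. ennreal (l y) \<partial>lborel) \<le> ennreal (Ups S * exp (- Omg S * x powr omg S))"
  using noise by (auto simp: noise_class_def)

lemma noise_nn:
  assumes "1 \<le> i" "h \<in> borel_measurable borel"
  shows "(\<integral>\<^sup>+w. h (\<epsilon> i w) \<partial>P) = (\<integral>\<^sup>+y. ennreal (l y) * h y \<partial>lborel)"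
  using distributed_nn_integral[OF noise_density[OF assms(1)]] assms(2) by simp

lemma noise_flip:
  assumes i: "1 \<le> i" and [measurable]: "h \<in> borel_measurable borel"
  shows "(\<integral>\<^sup>+w. h (- \<epsilon> i w) \<partial>P) = (\<integral>\<^sup>+w. h (\<epsilon> i w) \<partial>P)"
proof -
  have [measurable]: "\<epsilon> i \<in> borel_measurable P" using i by simp
  have "(\<integral>\<^sup>+w. h (- \<epsilon> i w) \<partial>P) = (\<integral>\<^sup>+y. h y \<partial>distr P borel (\<lambda>w. - \<epsilon> i w))"
    by (simp add: nn_integral_distr)
  also have "\<dots> = (\<integral>\<^sup>+w. h (\<epsilon> i w) \<partial>P)"
    unfolding noise_symmetric[OF i] by (simp add: nn_integral_distr)
  finally show ?thesis .
qed

lemma noise_flip_real: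
  fixes h :: "real \<Rightarrow> real"
  assumes i: "1 \<le> i" and [measurable]: "h \<in> borel_measurable borel"
  shows "expectation (\<lambda>w. h (- \<epsilon> i w)) = expectation (\<lambda>w. h (\<epsilon> i w))"
proof -
  have [measurable]: "\<epsilon> i \<in> borel_measurable P" using i by simp
  have "expectation (\<lambda>w. h (- \<epsilon> i w)) = (\<integral>y. h y \<partial>distr P borel (\<lambda>w. - \<epsilon> i w))"
    by (simp add: integral_distr)
  also have "\<dots> = expectation (\<lambda>w. h (\<epsilon> i w))"
    unfolding noise_symmetric[OF i] by (simp add: integral_distr)
  finally show ?thesis .
qed

text \<open>An odd function, so symmetric noise stays centred after truncation; on the event that no
  noise exceeds c in absolute value it changes nothing.\<close>

definition trunc :: "real \<Rightarrow> real \<Rightarrow> real" where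
  "trunc c e = (if \<bar>e\<bar> \<le> c then e else 0)"

lemma trunc_meas [measurable]: "trunc c \<in> borel_measurable borel"
  unfolding trunc_def by measurable

lemma trunc_le: "0 \<le> c \<Longrightarrow> \<bar>trunc c e\<bar> \<le> c"
  by (simp add: trunc_def)

lemma expectation_trunc:
  assumes i: "1 \<le> i"
  shows "expectation (\<lambda>w. trunc c (\<epsilon> i w)) = 0"
proof -
  have "trunc c (- e) = - trunc c e" for e by (simp add: trunc_def)
  then have "- expectation (\<lambda>w. trunc c (\<epsilon> i w)) = expectation (\<lambda>w. trunc c (\<epsilon> i w))"
    using noise_flip_real[OF i, of "trunc c"] by simp
  then show ?thesis by simp
qed

lemma noise_tail:
  assumes i: "1 \<le> i" and x: "0 \<le> x"
  shows "prob {w \<in> space P. x < \<bar>\<epsilon> i w\<bar>} \<le> 2 * Ups S * exp (- Omg S * x powr omg S)"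
proof -
  have [measurable]: "\<epsilon> i \<in> borel_measurable P" using i by simp
  let ?B = "Ups S * exp (- Omg S * x powr omg S)"
  have 1: "(\<integral>\<^sup>+w. indicator {x..} (\<epsilon> i w) \<partial>P) \<le> ennreal ?B"
    using l_tail[OF x] noise_nn[OF i, of "indicator {x..}"] by simp
  have "emeasure P {w \<in> space P. x < \<bar>\<epsilon> i w\<bar>} = (\<integral>\<^sup>+w. indicator {w \<in> space P. x < \<bar>\<epsilon> i w\<bar>} w \<partial>P)"
    by (rule nn_integral_indicator[symmetric]) measurable
  also have "\<dots> \<le> (\<integral>\<^sup>+w. indicator {x..} (\<epsilon> i w) + indicator {x..} (- \<epsilon> i w) \<partial>P)"
    by (intro nn_integral_mono) (auto simp: indicator_def)
  also have "\<dots> = (\<integral>\<^sup>+w. indicator {x..} (\<epsilon> i w) \<partial>P) + (\<integral>\<^sup>+w. indicator {x..} (- \<epsilon> i w) \<partial>P)"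
    by (rule nn_integral_add) measurable
  also have "\<dots> \<le> ennreal ?B + ennreal ?B"
    using 1 noise_flip[OF i, of "indicator {x..}"] by (intro add_mono) auto
  also have "\<dots> = ennreal (2 * Ups S * exp (- Omg S * x powr omg S))"
    using noise_params by (simp add: ennreal_plus[symmetric] del: ennreal_plus)
  finally show ?thesis using noise_params by (simp add: emeasure_eq_measure ennreal_le_iff)
qed

lemma sq_le_layers:
  "ennreal (x\<^sup>2) \<le> (\<Sum>j. ennreal ((real j + 1)\<^sup>2) * indicator {real j..} \<bar>x\<bar>)"
proof -
  define j where "j = nat \<lfloor>\<bar>x\<bar>\<rfloor>"
  have j: "real j \<le> \<bar>x\<bar>" "\<bar>x\<bar> \<le> real j + 1" unfolding j_def by linarith+
  have "\<bar>x\<bar>\<^sup>2 \<le> (real j + 1)\<^sup>2" using j by (intro power_mono) auto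
  then have "ennreal (x\<^sup>2) \<le> ennreal ((real j + 1)\<^sup>2) * indicator {real j..} \<bar>x\<bar>"
    using j by (simp add: ennreal_leI)
  also have "\<dots> \<le> (\<Sum>j. ennreal ((real j + 1)\<^sup>2) * indicator {real j..} \<bar>x\<bar>)"
  proof -
    have "h j \<le> suminf h" for h :: "nat \<Rightarrow> ennreal"
      using sum_le_suminf[of h "{j}"] by simp
    then show ?thesis .
  qed
  finally show ?thesis .
qed

lemma moment_series: "summable (\<lambda>j. (real j + 1)\<^sup>2 * (2 * (Ups S * exp (- Omg S * real j powr omg S))))"
proof (rule summable_comparison_test_bigo)
  show "summable (\<lambda>j. norm (1 / real j ^ 2))"
    using inverse_power_summable[of 2, where 'a=real] by (simp add: field_simps)
  have "0 < Omg S" "0 < omg S" "0 < Ups S" using noise_params by auto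
  then show "(\<lambda>j. (real j + 1)\<^sup>2 * (2 * (Ups S * exp (- Omg S * real j powr omg S)))) \<in> O(\<lambda>j. 1 / real j ^ 2)"
    by real_asymp
qed

text \<open>A bound uniform over the class, so that the supremum in \<open>sigma\<close> is finite;
  at an infinite supremum \<open>enn2real\<close> would return 0 and \<open>sigma\<close> would
  bound nothing. The tail bound is summed over the unit layers of |x|.\<close>

lemma second_moment_bound:
  assumes l': "l' \<in> noise_class (Ups S) (Omg S) (omg S)" and sym: "\<And>x. l' (- x) = l' x"
  shows "(\<integral>\<^sup>+x. ennreal (x\<^sup>2 * l' x) \<partial>lborel) \<le> ennreal (\<Sum>j. (real j + 1)\<^sup>2 * (2 * (Ups S * exp (- Omg S * real j powr omg S))))"
proof -
  have [measurable]: "l' \<in> borel_measurable borel" and nn: "\<And>y. 0 \<le> l' y"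
    and tail: "\<And>x. 0 \<le> x \<Longrightarrow> (\<integral>\<^sup>+ y\<in>{x..}. ennreal (l' y) \<partial>lborel) \<le> ennreal (Ups S * exp (- Omg S * x powr omg S))"
    using l' by (auto simp: noise_class_def)
  have two: "(\<integral>\<^sup>+y. ennreal (l' y) * indicator {x..} \<bar>y\<bar> \<partial>lborel) \<le> ennreal (2 * (Ups S * exp (- Omg S * x powr omg S)))"
    if x: "0 \<le> x" for x
  proof -
    have flip: "(\<integral>\<^sup>+y. ennreal (l' y) * indicator {x..} (- y) \<partial>lborel) = (\<integral>\<^sup>+y. ennreal (l' y) * indicator {x..} y \<partial>lborel)"
      by (subst nn_integral_real_affine[where c="-1" and t=0]) (auto simp: sym)
    have "(\<integral>\<^sup>+y. ennreal (l' y) * indicator {x..} \<bar>y\<bar> \<partial>lborel) \<le>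
       (\<integral>\<^sup>+y. ennreal (l' y) * indicator {x..} y + ennreal (l' y) * indicator {x..} (- y) \<partial>lborel)"
      by (intro nn_integral_mono) (auto simp: indicator_def abs_if)
    also have "\<dots> = (\<integral>\<^sup>+y. ennreal (l' y) * indicator {x..} y \<partial>lborel) + (\<integral>\<^sup>+y. ennreal (l' y) * indicator {x..} (- y) \<partial>lborel)"
      by (rule nn_integral_add) measurable
    also have "\<dots> \<le> ennreal (Ups S * exp (- Omg S * x powr omg S)) + ennreal (Ups S * exp (- Omg S * x powr omg S))"
      unfolding flip by (intro add_mono tail x)
    also have "\<dots> = ennreal (2 * (Ups S * exp (- Omg S * x powr omg S)))"
      using noise_params by (simp add: ennreal_plus[symmetric] del: ennreal_plus)
    finally show ?thesis .
  qed
  have "(\<integral>\<^sup>+x. ennreal (x\<^sup>2 * l' x) \<partial>lborel) \<le> (\<integral>\<^sup>+x. (\<Sum>j. ennreal ((real j + 1)\<^sup>2) * (ennreal (l' x) * indicator {real j..} \<bar>x\<bar>)) \<partial>lborel)"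
  proof (rule nn_integral_mono)
    fix x
    have "ennreal (x\<^sup>2 * l' x) = ennreal (l' x) * ennreal (x\<^sup>2)" by (simp add: ennreal_mult' nn mult.commute)
    also have "\<dots> \<le> ennreal (l' x) * (\<Sum>j. ennreal ((real j + 1)\<^sup>2) * indicator {real j..} \<bar>x\<bar>)"
      by (intro mult_left_mono sq_le_layers) auto
    also have "\<dots> = (\<Sum>j. ennreal ((real j + 1)\<^sup>2) * (ennreal (l' x) * indicator {real j..} \<bar>x\<bar>))"
      unfolding ennreal_suminf_cmult[symmetric] by (simp only: mult.left_commute)
    finally show "ennreal (x\<^sup>2 * l' x) \<le> (\<Sum>j. ennreal ((real j + 1)\<^sup>2) * (ennreal (l' x) * indicator {real j..} \<bar>x\<bar>))" .
  qed
  also have "\<dots> = (\<Sum>j. \<integral>\<^sup>+x. ennreal ((real j + 1)\<^sup>2) * (ennreal (l' x) * indicator {real j..} \<bar>x\<bar>) \<partial>lborel)"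
    by (rule nn_integral_suminf) measurable
  also have "\<dots> = (\<Sum>j. ennreal ((real j + 1)\<^sup>2) * (\<integral>\<^sup>+x. ennreal (l' x) * indicator {real j..} \<bar>x\<bar> \<partial>lborel))"
  proof (rule suminf_cong)
    fix j
    show "(\<integral>\<^sup>+x. ennreal ((real j + 1)\<^sup>2) * (ennreal (l' x) * indicator {real j..} \<bar>x\<bar>) \<partial>lborel)
       = ennreal ((real j + 1)\<^sup>2) * (\<integral>\<^sup>+x. ennreal (l' x) * indicator {real j..} \<bar>x\<bar> \<partial>lborel)"
      by (rule nn_integral_cmult) measurable
  qed
  also have "\<dots> \<le> (\<Sum>j. ennreal ((real j + 1)\<^sup>2 * (2 * (Ups S * exp (- Omg S * real j powr omg S)))))"
  proof (rule suminf_le)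
    fix j
    show "ennreal ((real j + 1)\<^sup>2) * (\<integral>\<^sup>+x. ennreal (l' x) * indicator {real j..} \<bar>x\<bar> \<partial>lborel) \<le>
        ennreal ((real j + 1)\<^sup>2 * (2 * (Ups S * exp (- Omg S * real j powr omg S))))"
      unfolding ennreal_mult'[OF zero_le_power2[of "real j + 1"], of "2 * (Ups S * exp (- Omg S * real j powr omg S))"]
      by (rule mult_left_mono[OF two]) auto
  qed auto
  also have "\<dots> = ennreal (\<Sum>j. (real j + 1)\<^sup>2 * (2 * (Ups S * exp (- Omg S * real j powr omg S))))"
    using moment_series noise_params by (intro suminf_ennreal2) auto
  finally show ?thesis .
qed

lemma sigma_nonneg: "0 \<le> sigma S" by (simp add: sigma_def)

text \<open>The density \<open>l\<close> is symmetric only almost everywhere and may lie outside the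
  set over which \<open>sigma\<close> takes its supremum. Its symmetrisation \<open>ls\<close> is
  symmetric at every point and is a density of the same law.\<close>

lemma noise_second_moment:
  assumes i: "1 \<le> i"
  shows "(\<integral>\<^sup>+w. ennreal ((\<epsilon> i w)\<^sup>2) \<partial>P) \<le> ennreal ((sigma S)\<^sup>2)"
proof -
  have [measurable]: "\<epsilon> i \<in> borel_measurable P" using i by simp
  define ls where "ls y = (l y + l (- y)) / 2" for y
  have e_ls: "ennreal (ls y) = ennreal (1/2) * ennreal (l y) + ennreal (1/2) * ennreal (l (- y))" for y
  proof -
    have "ls y = 1/2 * l y + 1/2 * l (- y)" by (simp add: ls_def)
    also have "ennreal \<dots> = ennreal (1/2 * l y) + ennreal (1/2 * l (- y))"
      by (rule ennreal_plus) (simp_all add: l_nonneg)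
    finally show ?thesis by (subst (asm) (1 2) ennreal_mult') simp_all
  qed
  have ls_int: "(\<integral>\<^sup>+y. ennreal (ls y) * h y \<partial>lborel) = (\<integral>\<^sup>+w. h (\<epsilon> i w) \<partial>P)"
    if [measurable]: "h \<in> borel_measurable borel" for h
  proof -
    have flip: "(\<integral>\<^sup>+y. ennreal (l (- y)) * h y \<partial>lborel) = (\<integral>\<^sup>+w. h (\<epsilon> i w) \<partial>P)"
    proof -
      have "(\<integral>\<^sup>+y. ennreal (l (- y)) * h y \<partial>lborel) = (\<integral>\<^sup>+y. ennreal (l y) * h (- y) \<partial>lborel)"
        by (subst nn_integral_real_affine[where c="-1" and t=0]) auto
      also have "\<dots> = (\<integral>\<^sup>+w. h (- \<epsilon> i w) \<partial>P)" by (rule noise_nn[OF i, symmetric]) measurable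
      finally show ?thesis by (simp add: noise_flip[OF i])
    qed
    have "(\<integral>\<^sup>+y. ennreal (ls y) * h y \<partial>lborel) =
       (\<integral>\<^sup>+y. ennreal (1/2) * (ennreal (l y) * h y) + ennreal (1/2) * (ennreal (l (- y)) * h y) \<partial>lborel)"
      unfolding e_ls by (simp add: distrib_right mult.assoc)
    also have "\<dots> = ennreal (1/2) * (\<integral>\<^sup>+y. ennreal (l y) * h y \<partial>lborel) + ennreal (1/2) * (\<integral>\<^sup>+y. ennreal (l (- y)) * h y \<partial>lborel)"
      by (subst nn_integral_add) (auto simp: nn_integral_cmult)
    also have "\<dots> = (ennreal (1/2) + ennreal (1/2)) * (\<integral>\<^sup>+w. h (\<epsilon> i w) \<partial>P)"
      by (simp only: flip noise_nn[OF i, symmetric] that distrib_right)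
    also have "ennreal (1/2) + ennreal (1/2) = 1" by (subst ennreal_plus[symmetric]) auto
    finally show ?thesis by simp
  qed
  have [measurable]: "ls \<in> borel_measurable borel" unfolding ls_def by measurable
  let ?A = "{l \<in> noise_class (Ups S) (Omg S) (omg S). (\<forall>x. l (- x) = l x) \<and> (\<integral>\<^sup>+ x. ennreal (l x) \<partial>lborel) = 1}"
  have "ls \<in> ?A"
  proof (intro CollectI conjI allI)
    show "ls \<in> noise_class (Ups S) (Omg S) (omg S)" unfolding noise_class_def
    proof (intro CollectI conjI allI impI)
      fix x :: real assume x: "0 \<le> x"
      have "(\<integral>\<^sup>+ y\<in>{x..}. ennreal (ls y) \<partial>lborel) = (\<integral>\<^sup>+ y\<in>{x..}. ennreal (l y) \<partial>lborel)"
        using ls_int[of "indicator {x..}"] noise_nn[OF i, of "indicator {x..}"] by simp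
      then show "(\<integral>\<^sup>+ y\<in>{x..}. ennreal (ls y) \<partial>lborel) \<le> ennreal (Ups S * exp (- Omg S * x powr omg S))"
        using l_tail[OF x] by simp
    qed (auto simp: ls_def l_nonneg)
    show "ls (- x) = ls x" for x by (simp add: ls_def)
    show "(\<integral>\<^sup>+ x. ennreal (ls x) \<partial>lborel) = 1" using ls_int[of "\<lambda>_. 1"] by (simp add: emeasure_space_1)
  qed
  define V where "V = (SUP l \<in> ?A. \<integral>\<^sup>+ x. ennreal (x^2 * l x) \<partial>lborel)"
  have "V \<le> ennreal (\<Sum>j. (real j + 1)\<^sup>2 * (2 * (Ups S * exp (- Omg S * real j powr omg S))))"
    unfolding V_def by (intro SUP_least second_moment_bound) auto
  then have fin: "V < top" by (simp add: order.strict_trans1)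
  have "(\<integral>\<^sup>+w. ennreal ((\<epsilon> i w)\<^sup>2) \<partial>P) = (\<integral>\<^sup>+y. ennreal (ls y) * ennreal (y\<^sup>2) \<partial>lborel)"
    by (rule ls_int[symmetric]) measurable
  also have "\<dots> = (\<integral>\<^sup>+y. ennreal (y\<^sup>2 * ls y) \<partial>lborel)"
  proof (rule nn_integral_cong)
    fix y show "ennreal (ls y) * ennreal (y\<^sup>2) = ennreal (y\<^sup>2 * ls y)"
      unfolding ennreal_mult'[OF zero_le_power2[of y], of "ls y"] by (rule mult.commute)
  qed
  also have "\<dots> \<le> V" unfolding V_def by (rule SUP_upper) fact
  also have "\<dots> = ennreal (enn2real V)" using fin by simp
  also have "enn2real V = (sigma S)\<^sup>2" by (simp add: sigma_def V_def)
  finally show ?thesis .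
qed

end

section \<open>Deviation of a single kernel estimator\<close>

text \<open>\<open>(a, t, \<eta>, \<zeta>)\<close> stands for the matrix \<open>E3 a \<eta> \<zeta>\<close> and the point \<open>t\<close>. The matrices \<^const>\<open>E_one\<close> and
  \<^const>\<open>E_two\<close> are of this form with \<open>\<zeta> = 1\<close>, the kernel in \<^const>\<open>F_inf\<close> has \<open>\<eta> = \<zeta> = h_pilot S n\<close>.\<close>

type_synonym param = "(real^2) \<times> (real^2) \<times> real \<times> real"

lemma component_le_of_inner:
  fixes y :: "real^2" assumes "y \<bullet> y \<le> c\<^sup>2" "0 \<le> c" shows "\<bar>y $ i\<bar> \<le> c"
proof -
  have "norm y \<le> c" using assms by (simp add: norm_le_square)
  then show ?thesis using component_le_norm_cart[of y i] by linarith
qed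

lemma cube_mono: "x \<in> cube c \<Longrightarrow> c \<le> d \<Longrightarrow> x \<in> cube d"
  by (auto simp: cube_def intro: order.trans)

context single_index_model
begin

abbreviation K where "K \<equiv> kern S"
abbreviation k where "k \<equiv> kern_inf S"

definition wt :: "param \<Rightarrow> real^2 \<Rightarrow> real" where
  "wt = (\<lambda>(a, t, \<eta>, \<zeta>) x. det (E3 a \<eta> \<zeta>) * kern2 S (E3 a \<eta> \<zeta> *v (x - t)))"

text \<open>Dividing by the design density makes the mean of a weighted sample an integral against
  Lebesgue measure.\<close>

definition phi :: "param \<Rightarrow> real^2 \<Rightarrow> real" where
  "phi s x = wt s x / dens S x"

definition mean :: "param \<Rightarrow> (real^2 \<Rightarrow> real) \<Rightarrow> real" where
  "mean s F = (\<integral>x. wt s x * F x \<partial>lborel)"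

definition scale :: "param \<Rightarrow> real" where
  "scale = (\<lambda>(a, t, \<eta>, \<zeta>). \<eta> * \<zeta>)"

text \<open>Norms from 1/2 to 1 cover the unit vectors of \<open>E_one\<close> and the bisectors of
  \<open>E_two\<close> at once.\<close>

definition main_params :: "nat \<Rightarrow> param set" where
  "main_params n = {(a, t, \<eta>, \<zeta>). 1/2 \<le> norm a \<and> norm a \<le> 1 \<and> t \<in> cube (1/2) \<and> \<eta> \<in> bandwidths S n \<and> \<zeta> = 1}"

definition pilot_params :: "nat \<Rightarrow> param set" where
  "pilot_params n = {(a, t, \<eta>, \<zeta>). a = axis 1 1 \<and> t \<in> cube (5/2) \<and> \<eta> = h_pilot S n \<and> \<zeta> = h_pilot S n}"

text \<open>Scales of at least 1 / n give polynomial bounds for the weights and their Lipschitz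
  constants. A pilot bandwidth below 1 keeps the pilot windows in \<open>cube 3\<close>, where the
  density is bounded below, and separates pilot from main parameters.\<close>

definition large :: "nat \<Rightarrow> bool" where
  "large n \<longleftrightarrow> 2 \<le> n \<and> 2 / n \<le> h_min S n \<and> h_pilot S n < 1 \<and> 1 / n \<le> h_pilot S n \<and> 1 / n \<le> (h_pilot S n)\<^sup>2"

lemma phi_meas [measurable]: "phi s \<in> borel_measurable borel"
  unfolding phi_def wt_def kern2_def split_beta' by measurable

lemma wt_meas [measurable]: "wt s \<in> borel_measurable borel"
  unfolding wt_def kern2_def split_beta' by measurable

lemma F_hat_phi: "F_hat S n z (E3 a \<eta> \<zeta>) t = (\<Sum>i=1..n. phi (a, t, \<eta>, \<zeta>) (fst (z i)) * snd (z i)) / n"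
  by (simp add: F_hat_def phi_def wt_def sum_distrib_left sum_divide_distrib mult_ac)

lemma wt_window:
  assumes "wt (a, t, \<eta>, \<zeta>) x \<noteq> 0" "0 < \<eta>" "0 < \<zeta>"
  shows "\<bar>a \<bullet> (x - t)\<bar> \<le> \<eta> / 2" "\<bar>cross a (x - t)\<bar> \<le> \<zeta> / 2"
proof -
  have "K (a \<bullet> (x - t) / \<eta>) \<noteq> 0" "K (cross a (x - t) / \<zeta>) \<noteq> 0"
    using assms(1) by (auto simp: wt_def kern2_def E3_mult)
  then have "\<bar>a \<bullet> (x - t) / \<eta>\<bar> \<le> 1/2" "\<bar>cross a (x - t) / \<zeta>\<bar> \<le> 1/2"
    using kern_supp by blast+
  then show "\<bar>a \<bullet> (x - t)\<bar> \<le> \<eta> / 2" "\<bar>cross a (x - t)\<bar> \<le> \<zeta> / 2"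
    using assms by (simp_all add: abs_divide divide_le_eq)
qed

lemma bandwidths_pos:
  assumes "large n" "\<eta> \<in> bandwidths S n" shows "1 / n \<le> \<eta>" "\<eta> \<le> 1" "0 < \<eta>"
proof -
  show "1 / n \<le> \<eta>" "\<eta> \<le> 1" using assms by (auto simp: bandwidths_def large_def)
  moreover have "0 < 1 / real n" using assms by (simp add: large_def)
  ultimately show "0 < \<eta>" by linarith
qed

text \<open>For y = x - t both coordinates of the rotated vector are at most 1/2, so |a|^2 |y|^2 <=
  1/2 and |y|^2 <= 2 < (3/2)^2; adding the half cube of t gives 5/2. Over this cube
  \<open>F_inf\<close> takes its supremum, so the pilot controls the regression function on the
  whole window.\<close>

lemma main_window:
  assumes a: "1/2 \<le> norm a" and t: "t \<in> cube (1/2)" and \<eta>: "0 < \<eta>" "\<eta> \<le> 1" and w: "wt (a, t, \<eta>, 1) x \<noteq> 0"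
  shows "x \<in> cube (5/2)"
proof -
  define y where "y = x - t"
  have "\<bar>a \<bullet> y\<bar> \<le> \<eta> / 2" "\<bar>cross a y\<bar> \<le> 1 / 2"
    using wt_window[of a t \<eta> 1 x] w \<eta> by (auto simp: y_def)
  then have "(a \<bullet> y)\<^sup>2 \<le> (1/2)\<^sup>2" "(cross a y)\<^sup>2 \<le> (1/2)\<^sup>2"
    using \<eta> power_mono[of "\<bar>a \<bullet> y\<bar>" "1/2" 2] power_mono[of "\<bar>cross a y\<bar>" "1/2" 2] by simp_all
  then have 1: "(a \<bullet> a) * (y \<bullet> y) \<le> 1/2"
    unfolding inner_cross_sq[symmetric] by (simp add: power2_eq_square)
  have "(1/2)\<^sup>2 \<le> (norm a)\<^sup>2" using a by (intro power_mono) auto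
  then have "(1/2)\<^sup>2 \<le> a \<bullet> a" by (simp only: power2_norm_eq_inner)
  then have "1/4 \<le> a \<bullet> a" by (simp add: power2_eq_square)
  then have "1/4 * (y \<bullet> y) \<le> (a \<bullet> a) * (y \<bullet> y)" by (intro mult_right_mono) auto
  then have "y \<bullet> y \<le> 2" using 1 by linarith
  then have "y \<bullet> y \<le> (3/2)\<^sup>2" by (simp add: power2_eq_square)
  then have y: "\<bar>y $ i\<bar> \<le> 3/2" for i by (rule component_le_of_inner) simp
  have "\<bar>x $ i\<bar> \<le> 5/2" for i
  proof -
    have "\<bar>t $ i\<bar> \<le> 1/2" using t by (simp add: cube_def)
    moreover have "x $ i = t $ i + y $ i" by (simp add: y_def)
    ultimately show ?thesis using y[of i] by linarith
  qed
  then show ?thesis by (simp add: cube_def)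
qed

lemma main_params_window:
  assumes n: "large n" and s: "s \<in> main_params n" and w: "wt s x \<noteq> 0"
  shows "x \<in> cube (5/2)"
proof -
  obtain a t \<eta> where s': "s = (a, t, \<eta>, 1)" "1/2 \<le> norm a" "t \<in> cube (1/2)" "\<eta> \<in> bandwidths S n"
    using s by (auto simp: main_params_def)
  show ?thesis using main_window[OF s'(2,3)] bandwidths_pos[OF n s'(4)] w by (simp add: s'(1))
qed

lemma params_window:
  assumes n: "large n" and s: "s \<in> main_params n \<union> pilot_params n" and w: "wt s x \<noteq> 0"
  shows "x \<in> cube 3"
proof (cases "s \<in> main_params n")
  case True
  have "x \<in> cube (5/2)" by (rule main_params_window[OF n True w])
  then show ?thesis by (rule cube_mono) simp
next
  case False
  then obtain t where s': "s = (axis 1 1, t, h_pilot S n, h_pilot S n)" "t \<in> cube (5/2)"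
    using s by (auto simp: pilot_params_def)
  have "0 < 1 / real n" using n by (simp add: large_def)
  then have h: "0 < h_pilot S n" "h_pilot S n < 1" using n unfolding large_def by linarith+
  have "\<bar>axis 1 1 \<bullet> (x - t)\<bar> \<le> 1/2" "\<bar>cross (axis 1 1) (x - t)\<bar> \<le> 1/2"
    using wt_window[of "axis 1 1" t "h_pilot S n" "h_pilot S n" x] w h by (auto simp: s')
  then have "\<bar>(x - t) $ i\<bar> \<le> 1/2" for i :: 2
    using exhaust_2[of i] by (auto simp: inner_2 cross_def axis_def)
  moreover have "\<bar>t $ i\<bar> \<le> 5/2" for i using s' by (simp add: cube_def)
  ultimately have "\<And>i :: 2. \<bar>x $ i\<bar> \<le> 3"
  proof -
    fix i :: 2
    assume "\<And>i. \<bar>(x - t) $ i\<bar> \<le> 1/2" "\<And>i. \<bar>t $ i\<bar> \<le> 5/2"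
    then have "\<bar>x $ i - t $ i\<bar> \<le> 1/2" "\<bar>t $ i\<bar> \<le> 5/2" by (simp_all flip: vector_minus_component)
    then show "\<bar>x $ i\<bar> \<le> 3" by linarith
  qed
  then show ?thesis by (simp add: cube_def)
qed

lemma params_scale:
  assumes n: "large n" and s: "(a, t, \<eta>, \<zeta>) \<in> main_params n \<union> pilot_params n"
  shows "1 / n \<le> \<eta>" "1 / n \<le> \<zeta>" "0 < \<eta>" "0 < \<zeta>" "\<eta> \<le> 1" "\<zeta> \<le> 1" "1 / n \<le> \<eta> * \<zeta>" "norm a \<le> 1" "a \<noteq> 0"
    "t \<in> cube (5/2)"
proof -
  have n0: "0 < 1 / real n" "1 / real n \<le> 1" using n by (auto simp: large_def)
  have 1: "1 / n \<le> \<eta> \<and> 1 / n \<le> \<zeta> \<and> \<eta> \<le> 1 \<and> \<zeta> \<le> 1 \<and> 1 / n \<le> \<eta> * \<zeta> \<and> norm a \<le> 1 \<and> a \<noteq> 0 \<and> t \<in> cube (5/2)"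
  proof (cases "(a, t, \<eta>, \<zeta>) \<in> main_params n")
    case True
    then have "\<eta> \<in> bandwidths S n" by (simp add: main_params_def)
    note bp = bandwidths_pos[OF n this]
    have m: "1/2 \<le> norm a" "norm a \<le> 1" "t \<in> cube (1/2)" "\<zeta> = 1" using True by (auto simp: main_params_def)
    have "a \<noteq> 0" using m(1) by auto
    moreover have "t \<in> cube (5/2)" using m(3) by (rule cube_mono) simp
    ultimately show ?thesis using bp m n0 by simp
  next
    case False
    then have "(a, t, \<eta>, \<zeta>) \<in> pilot_params n" using s by simp
    moreover have "axis 1 1 \<noteq> (0 :: real^2)" by (simp add: axis_eq_0_iff)
    ultimately show ?thesis using n unfolding large_def by (auto simp: pilot_params_def norm_eq_1 inner_axis_axis power2_eq_square)
  qed
  then show "1 / n \<le> \<eta>" "1 / n \<le> \<zeta>" "\<eta> \<le> 1" "\<zeta> \<le> 1" "1 / n \<le> \<eta> * \<zeta>" "norm a \<le> 1" "a \<noteq> 0" "t \<in> cube (5/2)" by auto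
  show "0 < \<eta>" "0 < \<zeta>" using 1 n0 by linarith+
qed

lemma det_E3_le:
  assumes "norm a \<le> 1" "0 < \<eta>" "0 < \<zeta>"
  shows "0 \<le> det (E3 a \<eta> \<zeta>)" "det (E3 a \<eta> \<zeta>) \<le> 1 / (\<eta> * \<zeta>)"
proof -
  have "(norm a)\<^sup>2 \<le> 1" using assms by (simp add: power_le_one)
  then have "a \<bullet> a \<le> 1" by (simp add: power2_norm_eq_inner)
  then show "0 \<le> det (E3 a \<eta> \<zeta>)" "det (E3 a \<eta> \<zeta>) \<le> 1 / (\<eta> * \<zeta>)"
    unfolding det_E3 using assms by (auto intro!: divide_right_mono)
qed

lemma kern2_le: "\<bar>kern2 S u\<bar> \<le> k\<^sup>2"
  unfolding kern2_def abs_mult power2_eq_square by (intro mult_mono kern_le k0) auto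

lemma phi_le_window:
  assumes a: "norm a \<le> 1" and \<eta>: "0 < \<eta>" and \<zeta>: "0 < \<zeta>" and win: "wt (a, t, \<eta>, \<zeta>) x \<noteq> 0 \<Longrightarrow> x \<in> cube 3"
  shows "\<bar>phi (a, t, \<eta>, \<zeta>) x\<bar> \<le> k\<^sup>2 / (dens_low S * (\<eta> * \<zeta>))"
proof (cases "wt (a, t, \<eta>, \<zeta>) x = 0")
  case False
  then have d: "dens_low S \<le> dens S x" using win design by blast
  have "\<bar>wt (a, t, \<eta>, \<zeta>) x\<bar> \<le> 1 / (\<eta> * \<zeta>) * k\<^sup>2"
    unfolding wt_def prod.case abs_mult using det_E3_le[OF a \<eta> \<zeta>] \<eta> \<zeta>
    by (intro mult_mono kern2_le) auto
  then have "\<bar>phi (a, t, \<eta>, \<zeta>) x\<bar> \<le> 1 / (\<eta> * \<zeta>) * k\<^sup>2 / dens_low S"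
    unfolding phi_def abs_divide using d design \<eta> \<zeta> by (intro frac_le) auto
  then show ?thesis by (simp add: field_simps)
qed (use design \<eta> \<zeta> in \<open>simp add: phi_def\<close>)

lemma phi_le:
  assumes n: "large n" and s: "s \<in> main_params n \<union> pilot_params n"
  shows "\<bar>phi s x\<bar> \<le> k\<^sup>2 / (dens_low S * scale s)"
proof -
  obtain a t \<eta> \<zeta> where s': "s = (a, t, \<eta>, \<zeta>)" by (cases s)
  note sc = params_scale[OF n s[unfolded s']]
  show ?thesis
    using phi_le_window[OF sc(8,3,4), of t x] params_window[OF n s, of x] by (simp add: s' scale_def)
qed

text \<open>The density cancels once, \<open>phi\<close>^2 \<open>dens\<close> = \<open>wt\<close>^2
  / \<open>dens\<close>. Then \<open>wt\<close> is at most det E times k^2, on a window of area 1 /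
  det E.\<close>

lemma wt_sq_integral:
  assumes n: "large n" and s: "s \<in> main_params n \<union> pilot_params n"
  shows "(\<integral>\<^sup>+x. ennreal (dens S x) * ennreal ((phi s x)\<^sup>2) \<partial>lborel) \<le> ennreal (k ^ 4 / (dens_low S * scale s))"
proof -
  obtain a t \<eta> \<zeta> where s': "s = (a, t, \<eta>, \<zeta>)" by (cases s)
  note sc = params_scale[OF n s[unfolded s']]
  let ?E = "E3 a \<eta> \<zeta>"
  have dE: "0 < det ?E" using sc by (simp add: det_E3)
  define R where "R = {w :: real^2. w $ 1 \<in> {-1/2..1/2} \<and> w $ 2 \<in> {-1/2..1/2}}"
  have [measurable]: "R \<in> sets borel" unfolding R_def by measurable
  define c where "c = det ?E * k ^ 4 / dens_low S"
  have c: "0 \<le> c" using dE design by (simp add: c_def)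
  have "(\<integral>\<^sup>+x. ennreal (dens S x) * ennreal ((phi s x)\<^sup>2) \<partial>lborel) \<le>
    (\<integral>\<^sup>+x. ennreal c * (ennreal \<bar>det ?E\<bar> * indicator R (?E *v (x - t))) \<partial>lborel)"
  proof (rule nn_integral_mono)
    fix x
    show "ennreal (dens S x) * ennreal ((phi s x)\<^sup>2) \<le> ennreal c * (ennreal \<bar>det ?E\<bar> * indicator R (?E *v (x - t)))"
    proof (cases "wt s x = 0")
      case False
      then have d: "dens_low S \<le> dens S x" using params_window[OF n s] design by blast
      then have d0: "0 < dens S x" using design by linarith
      have "?E *v (x - t) \<in> R"
      proof -
        have "K ((?E *v (x - t)) $ 1) \<noteq> 0" "K ((?E *v (x - t)) $ 2) \<noteq> 0"
          using False by (auto simp: s' wt_def kern2_def)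
        then have "\<bar>(?E *v (x - t)) $ 1\<bar> \<le> 1/2" "\<bar>(?E *v (x - t)) $ 2\<bar> \<le> 1/2" using kern_supp by blast+
        then show ?thesis by (auto simp: R_def abs_le_iff)
      qed
      moreover have "dens S x * (phi s x)\<^sup>2 \<le> c * \<bar>det ?E\<bar>"
      proof -
        have "(kern2 S (?E *v (x - t)))\<^sup>2 \<le> (k\<^sup>2)\<^sup>2"
          using power_mono[OF kern2_le, of "?E *v (x - t)" 2] by simp
        then have "(wt s x)\<^sup>2 \<le> (det ?E)\<^sup>2 * k ^ 4"
          by (simp add: s' wt_def power_mult_distrib mult_left_mono power_mult[symmetric])
        then have "(wt s x)\<^sup>2 / dens S x \<le> (det ?E)\<^sup>2 * k ^ 4 / dens_low S"
          using d design by (intro frac_le) auto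
        moreover have "dens S x * (phi s x)\<^sup>2 = (wt s x)\<^sup>2 / dens S x"
          using d0 by (simp add: phi_def power2_eq_square)
        ultimately show ?thesis using dE by (simp add: c_def power2_eq_square mult_ac)
      qed
      ultimately show ?thesis
        using c d0 by (simp add: ennreal_mult'[symmetric] ennreal_leI)
    qed (simp add: phi_def)
  qed
  also have "\<dots> = ennreal c * (\<integral>\<^sup>+x. ennreal \<bar>det ?E\<bar> * indicator R (?E *v (x - t)) \<partial>lborel)"
    by (rule nn_integral_cmult) measurable
  also have "(\<integral>\<^sup>+x. ennreal \<bar>det ?E\<bar> * indicator R (?E *v (x - t)) \<partial>lborel) =
     (\<integral>\<^sup>+x. ennreal \<bar>det ?E\<bar> * indicator R (?E *v (x - t)) \<partial>distr lborel borel ((+) t))"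
    by (simp add: lborel_distr_plus)
  also have "\<dots> = (\<integral>\<^sup>+x. ennreal \<bar>det ?E\<bar> * indicator R (?E *v (t + x - t)) \<partial>lborel)"
    by (rule nn_integral_distr) measurable
  also have "\<dots> = (\<integral>\<^sup>+x. ennreal \<bar>det ?E\<bar> * indicator R (?E *v x) \<partial>lborel)" by simp
  also have "\<dots> = (\<integral>\<^sup>+w. indicator R w \<partial>lborel)"
    by (rule nn_integral_linear_2) (use dE in auto)
  also have "\<dots> = (\<integral>\<^sup>+x. (\<integral>\<^sup>+y. indicator {-1/2..1/2::real} x * indicator {-1/2..1/2::real} y \<partial>lborel) \<partial>lborel)"
    by (subst nn_integral_vec2) (auto simp: R_def indicator_def intro!: nn_integral_cong)
  also have "\<dots> = 1" by (simp add: nn_integral_cmult nn_integral_multc)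
  also have "ennreal c * 1 \<le> ennreal (k ^ 4 / (dens_low S * scale s))"
  proof -
    have "c \<le> 1 / (\<eta> * \<zeta>) * k ^ 4 / dens_low S"
      unfolding c_def using det_E3_le[OF sc(8,3,4)] design by (intro divide_right_mono mult_right_mono) auto
    also have "\<dots> = k ^ 4 / (dens_low S * scale s)" by (simp add: s' scale_def field_simps)
    finally show ?thesis by (simp add: ennreal_leI)
  qed
  finally show ?thesis .
qed

lemma expectation_phi:
  assumes n: "large n" and s: "s \<in> main_params n \<union> pilot_params n" and i: "1 \<le> i"
    and [measurable]: "F \<in> borel_measurable borel"
  shows "expectation (\<lambda>w. phi s (X i w) * F (X i w)) = mean s F"
proof -
  have "expectation (\<lambda>w. phi s (X i w) * F (X i w)) = (\<integral>x. dens S x * (phi s x * F x) \<partial>lborel)"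
    by (rule distributed_integral[OF X_density[OF i], symmetric]) (auto simp: g_nonneg)
  also have "\<dots> = mean s F" unfolding mean_def
  proof (rule Bochner_Integration.integral_cong[OF refl])
    fix x show "dens S x * (phi s x * F x) = wt s x * F x"
    proof (cases "wt s x = 0")
      case False
      then have "dens_low S \<le> dens S x" using params_window[OF n s] design by blast
      then show ?thesis using design by (simp add: phi_def)
    qed (simp add: phi_def)
  qed
  finally show ?thesis .
qed

text \<open>Bernstein's bound at level x for a regression function bounded by m on the window and
  noise truncated at \<open>tau\<close>. The 2 under the root stems from (u + v)^2 <= 2 u^2 + 2 v^2,
  separating signal and noise.\<close>

definition dev :: "real \<Rightarrow> nat \<Rightarrow> real \<Rightarrow> param \<Rightarrow> real" where
  "dev x n m s = 2 * sqrt (x * (2 * (k ^ 4 / (dens_low S * scale s)) * (m\<^sup>2 + (sigma S)\<^sup>2)) / n)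
     + 4 * (k\<^sup>2 / (dens_low S * scale s) * (m + tau S r n)) * x / n"

definition truncated_mean :: "nat \<Rightarrow> (real^2 \<Rightarrow> real) \<Rightarrow> param \<Rightarrow> 'a \<Rightarrow> real" where
  "truncated_mean n F s w = (\<Sum>i=1..n. phi s (X i w) * (F (X i w) + trunc (tau S r n) (\<epsilon> i w))) / n"

lemma tau_nonneg: "0 \<le> tau S r n" by (simp add: tau_def)

lemma truncated_mean_meas [measurable]: "F \<in> borel_measurable borel \<Longrightarrow> truncated_mean n F s \<in> borel_measurable P"
  unfolding truncated_mean_def by (intro borel_measurable_divide borel_measurable_sum borel_measurable_times borel_measurable_add
      borel_measurable_const measurable_compose[OF X_meas] measurable_compose[OF \<epsilon>_meas]) auto

lemma phi_noise_expectation: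
  assumes n: "large n" and s: "s \<in> main_params n \<union> pilot_params n" and i: "1 \<le> i"
  shows "expectation (\<lambda>w. phi s (X i w) * trunc c (\<epsilon> i w)) = 0"
    and "0 \<le> c \<Longrightarrow> expectation (\<lambda>w. (phi s (X i w))\<^sup>2 * (trunc c (\<epsilon> i w))\<^sup>2) \<le> k ^ 4 / (dens_low S * scale s) * (sigma S)\<^sup>2"
    and "expectation (\<lambda>w. (phi s (X i w))\<^sup>2) \<le> k ^ 4 / (dens_low S * scale s)"
    and "0 \<le> k ^ 4 / (dens_low S * scale s)"
proof -
  have [measurable]: "X i \<in> borel_measurable P" "\<epsilon> i \<in> borel_measurable P" using i by auto
  obtain a t \<eta> \<zeta> where s': "s = (a, t, \<eta>, \<zeta>)" by (cases s)
  note sc = params_scale[OF n s[unfolded s']]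
  show V: "0 \<le> k ^ 4 / (dens_low S * scale s)" using sc design by (simp add: s' scale_def)
  define B where "B = k\<^sup>2 / (dens_low S * scale s)"
  have bd: "\<bar>phi s x\<bar> \<le> B" for x unfolding B_def by (rule phi_le[OF n s])
  have i1: "integrable P (\<lambda>w. phi s (X i w))"
    by (rule integrable_const_bound[where B=B]) (auto simp: bd)
  have bd2: "\<bar>(phi s x)\<^sup>2\<bar> \<le> B\<^sup>2" for x using power_mono[OF bd, of x 2] by simp
  have i2: "integrable P (\<lambda>w. (phi s (X i w))\<^sup>2)"
    by (rule integrable_const_bound[where B="B\<^sup>2"]) (use bd2 in auto)
  have tb: "\<bar>trunc c e\<bar> \<le> \<bar>c\<bar>" for e by (simp add: trunc_def)
  have tb2: "\<bar>(trunc c e)\<^sup>2\<bar> \<le> c\<^sup>2" for e using power_mono[OF tb, of e 2] by simp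
  have i3: "integrable P (\<lambda>w. trunc c (\<epsilon> i w))"
    by (rule integrable_const_bound[where B="\<bar>c\<bar>"]) (use tb in auto)
  have i4: "integrable P (\<lambda>w. (trunc c (\<epsilon> i w))\<^sup>2)"
    by (rule integrable_const_bound[where B="c\<^sup>2"]) (use tb2 in auto)
  show "expectation (\<lambda>w. phi s (X i w) * trunc c (\<epsilon> i w)) = 0"
    by (subst indep_var_lebesgue_integral[OF X_\<epsilon>_indep[OF i] i1 i3]) (auto simp: expectation_trunc[OF i])
  have "(\<integral>\<^sup>+w. ennreal ((phi s (X i w))\<^sup>2) \<partial>P) \<le> ennreal (k ^ 4 / (dens_low S * scale s))"
    using wt_sq_integral[OF n s] distributed_nn_integral[OF X_density[OF i], of "\<lambda>x. ennreal ((phi s x)\<^sup>2)"] by simp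
  then have e2: "expectation (\<lambda>w. (phi s (X i w))\<^sup>2) \<le> k ^ 4 / (dens_low S * scale s)"
    using i2 V by (subst (asm) nn_integral_eq_integral) (auto simp: ennreal_le_iff)
  then show "expectation (\<lambda>w. (phi s (X i w))\<^sup>2) \<le> k ^ 4 / (dens_low S * scale s)" .
  have "(\<integral>\<^sup>+w. ennreal ((trunc c (\<epsilon> i w))\<^sup>2) \<partial>P) \<le> (\<integral>\<^sup>+w. ennreal ((\<epsilon> i w)\<^sup>2) \<partial>P)"
    by (intro nn_integral_mono ennreal_leI) (simp add: trunc_def)
  also note noise_second_moment[OF i]
  finally have e3: "expectation (\<lambda>w. (trunc c (\<epsilon> i w))\<^sup>2) \<le> (sigma S)\<^sup>2"
    using i4 by (subst (asm) nn_integral_eq_integral) (auto simp: ennreal_le_iff)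
  have "expectation (\<lambda>w. (phi s (X i w))\<^sup>2 * (trunc c (\<epsilon> i w))\<^sup>2) =
     expectation (\<lambda>w. (phi s (X i w))\<^sup>2) * expectation (\<lambda>w. (trunc c (\<epsilon> i w))\<^sup>2)"
    by (rule indep_var_lebesgue_integral[OF X_\<epsilon>_indep[OF i, of "\<lambda>x. (phi s x)\<^sup>2" "\<lambda>e. (trunc c e)\<^sup>2"] i2 i4]) measurable
  also have "\<dots> \<le> k ^ 4 / (dens_low S * scale s) * (sigma S)\<^sup>2"
    by (intro mult_mono e2 e3 V) auto
  finally show "expectation (\<lambda>w. (phi s (X i w))\<^sup>2 * (trunc c (\<epsilon> i w))\<^sup>2) \<le> k ^ 4 / (dens_low S * scale s) * (sigma S)\<^sup>2" .
qed

lemma bernstein_phi: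
  assumes n: "large n" and s: "s \<in> main_params n \<union> pilot_params n"
    and [measurable]: "F \<in> borel_measurable borel" and F: "\<And>x. wt s x \<noteq> 0 \<Longrightarrow> \<bar>F x\<bar> \<le> m"
    and m: "0 \<le> m" and x: "0 < x" and t: "0 < tau S r n"
  shows "prob {w \<in> space P. dev x n m s < \<bar>truncated_mean n F s w - mean s F\<bar>} \<le> 2 * exp (- x)"
proof -
  obtain a t \<eta> \<zeta> where s': "s = (a, t, \<eta>, \<zeta>)" by (cases s)
  note sc = params_scale[OF n s[unfolded s']]
  define V where "V = k ^ 4 / (dens_low S * scale s)"
  define B where "B = k\<^sup>2 / (dens_low S * scale s)"
  have k0': "0 < k" using k1 by simp
  have pos: "0 < dens_low S * scale s" using sc design by (simp add: s' scale_def)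
  have V: "0 \<le> V" and B: "0 < B" using pos k0' by (simp_all add: V_def B_def)
  \<comment> \<open>F is cut off outside the window, so that a bound on the window yields a bounded
    summand.\<close>
  define F' where "F' x = (if wt s x = 0 then 0 else F x)" for x
  have [measurable]: "F' \<in> borel_measurable borel" unfolding F'_def by measurable
  have F': "\<bar>F' x\<bar> \<le> m" for x using F m by (simp add: F'_def)
  have phiF: "phi s x * F' x = phi s x * F x" for x by (simp add: F'_def phi_def)
  define Z where "Z = (\<lambda>(x, e). phi s x * (F' x + trunc (tau S r n) e))"
  have [measurable]: "Z \<in> borel_measurable (borel \<Otimes>\<^sub>M borel)" unfolding Z_def split_beta' by measurable
  have phiB: "\<bar>phi s x\<bar> \<le> B" for x unfolding B_def by (rule phi_le[OF n s])
  have Zb: "\<bar>Z z\<bar> \<le> B * (m + tau S r n)" for z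
  proof -
    have "\<bar>F' (fst z) + trunc (tau S r n) (snd z)\<bar> \<le> m + tau S r n"
      using F'[of "fst z"] trunc_le[OF tau_nonneg, of n "snd z"] by linarith
    then show ?thesis unfolding Z_def split_beta' abs_mult using B by (intro mult_mono phiB) auto
  qed
  have Zsq: "(Z (x, e))\<^sup>2 \<le> 2 * m\<^sup>2 * (phi s x)\<^sup>2 + 2 * ((phi s x)\<^sup>2 * (trunc (tau S r n) e)\<^sup>2)" for x e
  proof -
    have "(F' x + trunc (tau S r n) e)\<^sup>2 \<le> 2 * (F' x)\<^sup>2 + 2 * (trunc (tau S r n) e)\<^sup>2"
      using zero_le_power2[of "F' x - trunc (tau S r n) e"] by (simp add: power2_eq_square algebra_simps)
    also have "\<dots> \<le> 2 * m\<^sup>2 + 2 * (trunc (tau S r n) e)\<^sup>2"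
      using power_mono[OF F', of x 2] by simp
    finally have "(phi s x)\<^sup>2 * (F' x + trunc (tau S r n) e)\<^sup>2 \<le> (phi s x)\<^sup>2 * (2 * m\<^sup>2 + 2 * (trunc (tau S r n) e)\<^sup>2)"
      by (rule mult_left_mono) simp
    moreover have "(Z (x, e))\<^sup>2 = (phi s x)\<^sup>2 * (F' x + trunc (tau S r n) e)\<^sup>2"
      by (simp only: Z_def prod.case power_mult_distrib)
    moreover have "(phi s x)\<^sup>2 * (2 * m\<^sup>2 + 2 * (trunc (tau S r n) e)\<^sup>2) =
        2 * m\<^sup>2 * (phi s x)\<^sup>2 + 2 * ((phi s x)\<^sup>2 * (trunc (tau S r n) e)\<^sup>2)"
      by (simp add: distrib_left mult_ac)
    ultimately show ?thesis by linarith
  qed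
  have "prob {w \<in> space P. 2 * sqrt (x * (2 * V * (m\<^sup>2 + (sigma S)\<^sup>2)) / n) + 4 * (B * (m + tau S r n)) * x / n
      < \<bar>(\<Sum>i=1..n. Z (X i w, \<epsilon> i w)) / n - mean s F\<bar>} \<le> 2 * exp (- x)"
  proof (rule bernstein_sample[OF _ Zb _ _ _ x])
    show "Z \<in> borel_measurable (borel \<Otimes>\<^sub>M borel)" by measurable
    show "0 < B * (m + tau S r n)" using B m t by (intro mult_pos_pos) auto
    show "0 < n" using n by (simp add: large_def)
    show "0 \<le> 2 * V * (m\<^sup>2 + (sigma S)\<^sup>2)" using V by simp
    fix i :: nat assume i: "1 \<le> i"
    have [measurable]: "X i \<in> borel_measurable P" "\<epsilon> i \<in> borel_measurable P" using i by auto
    have int1: "integrable P (\<lambda>w. phi s (X i w) * F' (X i w))"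
      by (rule integrable_const_bound[where B="B * m"]) (use B in \<open>auto simp: abs_mult intro!: mult_mono phiB F'\<close>)
    have int2: "integrable P (\<lambda>w. phi s (X i w) * trunc (tau S r n) (\<epsilon> i w))"
      by (rule integrable_const_bound[where B="B * tau S r n"])
         (use B in \<open>auto simp: abs_mult intro!: mult_mono phiB trunc_le tau_nonneg\<close>)
    show "expectation (\<lambda>w. Z (X i w, \<epsilon> i w)) = mean s F"
    proof -
      have "expectation (\<lambda>w. Z (X i w, \<epsilon> i w)) =
        expectation (\<lambda>w. phi s (X i w) * F' (X i w) + phi s (X i w) * trunc (tau S r n) (\<epsilon> i w))"
        by (simp add: Z_def distrib_left)
      also have "\<dots> = expectation (\<lambda>w. phi s (X i w) * F' (X i w))"
        using int1 int2 phi_noise_expectation(1)[OF n s i] by simp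
      also have "\<dots> = mean s F" unfolding phiF by (rule expectation_phi[OF n s i]) measurable
      finally show ?thesis .
    qed
    have i2: "integrable P (\<lambda>w. (phi s (X i w))\<^sup>2)"
      by (rule integrable_const_bound[where B="B\<^sup>2"]) (use power_mono[OF phiB, of _ 2] in auto)
    have i4: "integrable P (\<lambda>w. (phi s (X i w))\<^sup>2 * (trunc (tau S r n) (\<epsilon> i w))\<^sup>2)"
      by (rule integrable_const_bound[where B="B\<^sup>2 * (tau S r n)\<^sup>2"])
         (use power_mono[OF phiB, of _ 2] power_mono[OF trunc_le[OF tau_nonneg], of n _ 2] in \<open>auto simp: abs_mult intro!: mult_mono\<close>)
    have iZ: "integrable P (\<lambda>w. (Z (X i w, \<epsilon> i w))\<^sup>2)"
      by (rule integrable_const_bound[where B="(B * (m + tau S r n))\<^sup>2"]) (use power_mono[OF Zb, of _ 2] in auto)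
    have "expectation (\<lambda>w. (Z (X i w, \<epsilon> i w))\<^sup>2) \<le>
      expectation (\<lambda>w. 2 * m\<^sup>2 * (phi s (X i w))\<^sup>2 + 2 * ((phi s (X i w))\<^sup>2 * (trunc (tau S r n) (\<epsilon> i w))\<^sup>2))"
      using i2 i4 iZ by (intro integral_mono Zsq) auto
    also have "\<dots> = 2 * m\<^sup>2 * expectation (\<lambda>w. (phi s (X i w))\<^sup>2) + 2 * expectation (\<lambda>w. (phi s (X i w))\<^sup>2 * (trunc (tau S r n) (\<epsilon> i w))\<^sup>2)"
      using i2 i4 by simp
    also have "\<dots> \<le> 2 * m\<^sup>2 * V + 2 * (V * (sigma S)\<^sup>2)"
      unfolding V_def using phi_noise_expectation(2,3)[OF n s i] tau_nonneg
      by (intro add_mono mult_left_mono) auto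
    also have "\<dots> = 2 * V * (m\<^sup>2 + (sigma S)\<^sup>2)" by (simp add: algebra_simps)
    finally show "expectation (\<lambda>w. (Z (X i w, \<epsilon> i w))\<^sup>2) \<le> 2 * V * (m\<^sup>2 + (sigma S)\<^sup>2)" .
  qed
  moreover have "(\<Sum>i=1..n. Z (X i w, \<epsilon> i w)) / n = truncated_mean n F s w" for w
    by (simp add: truncated_mean_def Z_def distrib_left phiF)
  ultimately show ?thesis by (simp add: dev_def V_def B_def)
qed

end

section \<open>Uniform deviation\<close>

lemma abs_mult_diff_le:
  fixes p q p' q' :: real
  shows "\<bar>p * q - p' * q'\<bar> \<le> \<bar>p - p'\<bar> * \<bar>q\<bar> + \<bar>p'\<bar> * \<bar>q - q'\<bar>"
proof -
  have "p * q - p' * q' = (p - p') * q + p' * (q - q')" by (simp add: algebra_simps)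
  then show ?thesis by (metis abs_mult abs_triangle_ineq)
qed

lemma representatives:
  assumes "finite (q ` A)"
  shows "\<exists>N\<subseteq>A. finite N \<and> card N \<le> card (q ` A) \<and> (\<forall>x\<in>A. \<exists>y\<in>N. q y = q x)"
proof (intro exI[of _ "inv_into A q ` (q ` A)"] conjI ballI)
  show "inv_into A q ` q ` A \<subseteq> A" by (auto intro: inv_into_into)
  show "card (inv_into A q ` q ` A) \<le> card (q ` A)" by (rule card_image_le[OF assms])
  show "\<exists>y\<in>inv_into A q ` q ` A. q y = q x" if "x \<in> A" for x
    using that by (intro bexI[of _ "inv_into A q (q x)"]) (auto intro: f_inv_into_f)
qed (use assms in simp)

lemma floor_eq_close:
  fixes x y c :: real
  assumes "\<lfloor>c * x\<rfloor> = \<lfloor>c * y\<rfloor>" "0 < c"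
  shows "\<bar>x - y\<bar> \<le> 1 / c"
proof -
  have "\<bar>c * x - c * y\<bar> < 1" using assms(1) by linarith
  moreover have "\<bar>c * x - c * y\<bar> = c * \<bar>x - y\<bar>" using assms(2) by (simp add: abs_mult right_diff_distrib[symmetric])
  ultimately show ?thesis using assms(2) by (simp add: less_imp_le field_simps)
qed

context single_index_model
begin

definition lip_const :: real where
  "lip_const = (4 * k\<^sup>2 + 28 * k * lip S) / dens_low S"

lemma lip_const_nonneg: "0 \<le> lip_const"
  using k0 kernel_lip(1) design by (simp add: lip_const_def)

text \<open>The scales agree on both sides, since they take finitely many values; only direction and
  point move. A Lipschitz constant polynomial in n is enough, because the net can be made
  polynomially fine.\<close>

lemma phi_close:
  assumes n: "large n" and s: "(a, t, \<eta>, \<zeta>) \<in> main_params n \<union> pilot_params n" and s': "(a', t', \<eta>, \<zeta>) \<in> main_params n \<union> pilot_params n"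
    and d: "0 \<le> d" and ad: "\<And>i. \<bar>a $ i - a' $ i\<bar> \<le> d" and td: "\<And>i. \<bar>t $ i - t' $ i\<bar> \<le> d"
  shows "\<bar>phi (a, t, \<eta>, \<zeta>) x - phi (a', t', \<eta>, \<zeta>) x\<bar> \<le> lip_const * n ^ 3 * d"
proof (cases "x \<in> cube 3")
  case False
  then have "wt (a, t, \<eta>, \<zeta>) x = 0" "wt (a', t', \<eta>, \<zeta>) x = 0"
    using params_window[OF n s] params_window[OF n s'] by auto
  then show ?thesis using lip_const_nonneg d by (simp add: phi_def)
next
  case True
  note sc = params_scale[OF n s] and sc' = params_scale[OF n s']
  have n1: "1 \<le> real n" using n by (simp add: large_def)
  have dl: "dens_low S \<le> dens S x" using True design by blast
  have ai: "\<bar>a $ i\<bar> \<le> 1" "\<bar>a' $ i\<bar> \<le> 1" for i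
    using component_le_norm_cart[of a i] component_le_norm_cart[of a' i] sc(8) sc'(8) by linarith+
  have yi: "\<bar>(x - t) $ i\<bar> \<le> 6" for i
  proof -
    have "\<bar>x $ i\<bar> \<le> 3" "\<bar>t $ i\<bar> \<le> 5/2" using True sc(10) by (auto simp: cube_def)
    then show ?thesis by simp
  qed
  have yd: "\<bar>(x - t) $ i - (x - t') $ i\<bar> \<le> d" for i using td[of i] by (simp add: abs_minus_commute)
  have bil: "\<bar>a $ i * (x - t) $ j - a' $ i * (x - t') $ j\<bar> \<le> 7 * d" for i j
  proof -
    have "\<bar>a $ i * (x - t) $ j - a' $ i * (x - t') $ j\<bar> \<le> \<bar>a $ i - a' $ i\<bar> * \<bar>(x - t) $ j\<bar> + \<bar>a' $ i\<bar> * \<bar>(x - t) $ j - (x - t') $ j\<bar>"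
      by (rule abs_mult_diff_le)
    also have "\<dots> \<le> d * 6 + 1 * d" using d by (intro add_mono mult_mono ad yi ai yd) auto
    finally show ?thesis by simp
  qed
  have i1: "\<bar>a \<bullet> (x - t) - a' \<bullet> (x - t')\<bar> \<le> 14 * d"
    using bil[of 1 1] bil[of 2 2] unfolding inner_2 by linarith
  have i2: "\<bar>cross a (x - t) - cross a' (x - t')\<bar> \<le> 14 * d"
    using bil[of 1 2] bil[of 2 1] unfolding cross_def by linarith
  have scale_K: "\<bar>K (u / c) - K (v / c)\<bar> \<le> lip S * (14 * n * d)" if "\<bar>u - v\<bar> \<le> 14 * d" "1 / n \<le> c" "0 < c" for u v c
  proof -
    have "\<bar>K (u / c) - K (v / c)\<bar> \<le> lip S * \<bar>u / c - v / c\<bar>" by (rule kernel_lip(2))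
    also have "\<bar>u / c - v / c\<bar> = \<bar>u - v\<bar> * (1 / c)" using that by (simp add: diff_divide_distrib[symmetric] abs_divide)
    also have "\<dots> \<le> 14 * d * n"
      using that n1 d by (intro mult_mono) (auto simp: field_simps)
    finally show ?thesis using kernel_lip(1) by (simp add: mult_ac)
  qed
  define P1 where "P1 = K (a \<bullet> (x - t) / \<eta>) * K (cross a (x - t) / \<zeta>)"
  define P2 where "P2 = K (a' \<bullet> (x - t') / \<eta>) * K (cross a' (x - t') / \<zeta>)"
  have P12: "\<bar>P1 - P2\<bar> \<le> lip S * (14 * n * d) * k + k * (lip S * (14 * n * d))"
    unfolding P1_def P2_def using kernel_lip(1) d
    by (intro order.trans[OF abs_mult_diff_le] add_mono mult_mono scale_K[OF i1 sc(1,3)] scale_K[OF i2 sc(2,4)] kern_le) (auto simp: k0)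
  have P1: "\<bar>P1\<bar> \<le> k\<^sup>2" unfolding P1_def abs_mult power2_eq_square by (intro mult_mono kern_le k0) auto
  have sqd: "\<bar>a $ i * a $ i - a' $ i * a' $ i\<bar> \<le> 2 * d" for i
  proof -
    have "\<bar>a $ i * a $ i - a' $ i * a' $ i\<bar> \<le> \<bar>a $ i - a' $ i\<bar> * \<bar>a $ i\<bar> + \<bar>a' $ i\<bar> * \<bar>a $ i - a' $ i\<bar>" by (rule abs_mult_diff_le)
    also have "\<dots> \<le> d * 1 + 1 * d" using d by (intro add_mono mult_mono ad ai) auto
    finally show ?thesis by simp
  qed
  have A: "\<bar>a \<bullet> a - a' \<bullet> a'\<bar> \<le> 4 * d" using sqd[of 1] sqd[of 2] unfolding inner_2 by linarith
  have a1: "\<bar>a' \<bullet> a'\<bar> \<le> 1" using power_le_one[OF norm_ge_zero sc'(8), of 2] by (simp add: power2_norm_eq_inner)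
  have "\<bar>(a \<bullet> a) * P1 - (a' \<bullet> a') * P2\<bar> \<le> \<bar>a \<bullet> a - a' \<bullet> a'\<bar> * \<bar>P1\<bar> + \<bar>a' \<bullet> a'\<bar> * \<bar>P1 - P2\<bar>" by (rule abs_mult_diff_le)
  also have "\<dots> \<le> 4 * d * k\<^sup>2 + 1 * (lip S * (14 * n * d) * k + k * (lip S * (14 * n * d)))"
    using d by (intro add_mono mult_mono A P1 a1 P12) auto
  also have "\<dots> \<le> n * d * (4 * k\<^sup>2 + 28 * k * lip S)"
  proof -
    have "1 * (4 * d * k\<^sup>2) \<le> n * (4 * d * k\<^sup>2)" using d n1 by (intro mult_right_mono) auto
    then show ?thesis by (simp add: algebra_simps)
  qed
  finally have main: "\<bar>(a \<bullet> a) * P1 - (a' \<bullet> a') * P2\<bar> \<le> n * d * (4 * k\<^sup>2 + 28 * k * lip S)" .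
  have ez: "1 / (\<eta> * \<zeta>) \<le> n" using sc(7) sc(3,4) n1 by (simp add: field_simps)
  have "phi (a, t, \<eta>, \<zeta>) x - phi (a', t', \<eta>, \<zeta>) x = ((a \<bullet> a) * P1 - (a' \<bullet> a') * P2) * (1 / (\<eta> * \<zeta>)) * (1 / dens S x)"
    unfolding phi_def wt_def prod.case det_E3 kern2_def E3_mult P1_def P2_def by (simp add: diff_divide_distrib left_diff_distrib)
  also have "\<bar>\<dots>\<bar> = \<bar>(a \<bullet> a) * P1 - (a' \<bullet> a') * P2\<bar> * (1 / (\<eta> * \<zeta>)) * (1 / dens S x)"
    using sc(3,4) dl design by (simp add: abs_mult)
  also have "\<dots> \<le> n * d * (4 * k\<^sup>2 + 28 * k * lip S) * n * (1 / dens_low S)"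
    using sc(3,4) dl design d n1 k0 kernel_lip(1)
    by (intro mult_mono main ez) (auto intro!: frac_le)
  also have "\<dots> = lip_const * n\<^sup>2 * d" by (simp add: lip_const_def power2_eq_square)
  also have "\<dots> \<le> lip_const * n ^ 3 * d"
  proof -
    have "real n ^ 2 \<le> real n ^ 3" by (rule power_increasing) (use n1 in auto)
    then show ?thesis using lip_const_nonneg d by (intro mult_right_mono mult_left_mono) auto
  qed
  finally show ?thesis .
qed

lemma bandwidths_finite:
  assumes n: "large n" shows "finite (bandwidths S n)" "card (bandwidths S n) \<le> n"
proof -
  have sub: "bandwidths S n \<subseteq> (\<lambda>j. (1/2) ^ j) ` {..<n}"
  proof
    fix \<eta> assume e: "\<eta> \<in> bandwidths S n"
    then obtain j where j: "\<eta> = (1/2) ^ j" by (auto simp: bandwidths_def)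
    have "1 / n \<le> (1/2) ^ j" using bandwidths_pos(1)[OF n e] by (simp add: j)
    then have "2 ^ j \<le> real n" using n by (simp add: large_def power_one_over field_simps)
    then have "2 ^ j \<le> n" by (metis of_nat_le_iff of_nat_numeral of_nat_power)
    then have "j < n" using less_exp[of j] by linarith
    then show "\<eta> \<in> (\<lambda>j. (1/2) ^ j) ` {..<n}" using j by auto
  qed
  then show "finite (bandwidths S n)" by (rule finite_subset) simp
  have "card (bandwidths S n) \<le> card ((\<lambda>j. (1/2 :: real) ^ j) ` {..<n})" by (rule card_mono[OF _ sub]) simp
  also have "\<dots> \<le> n" using card_image_le[of "{..<n}" "\<lambda>j. (1/2 :: real) ^ j"] by simp
  finally show "card (bandwidths S n) \<le> n" .
qed

text \<open>Parameters are identified when their four coordinates agree after rounding at resolution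
  n^(-4) and their scales agree exactly. At most 6 n^4 + 1 <= 7 n^4 values per coordinate and n + 1
  <= 2 n pairs of scales give 7^4 * 2 n^17 classes. Taking representatives keeps the net inside the
  parameter set.\<close>

lemma net_exists:
  assumes n: "large n"
  shows "\<exists>N \<subseteq> main_params n \<union> pilot_params n. finite N \<and> real (card N) \<le> 4802 * real n ^ 17 \<and>
    (\<forall>(a, t, \<eta>, \<zeta>) \<in> main_params n \<union> pilot_params n. \<exists>a' t'. (a', t', \<eta>, \<zeta>) \<in> N \<and>
       (\<forall>i. \<bar>a $ i - a' $ i\<bar> \<le> 1 / real n ^ 4) \<and> (\<forall>i. \<bar>t $ i - t' $ i\<bar> \<le> 1 / real n ^ 4))"
proof -
  let ?c = "real n ^ 4"
  have n2: "2 \<le> n" and c: "1 \<le> ?c" using n by (auto simp: large_def)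
  define q where "q = (\<lambda>(a :: real^2, t :: real^2, \<eta> :: real, \<zeta> :: real).
     (\<lfloor>?c * a $ 1\<rfloor>, \<lfloor>?c * a $ 2\<rfloor>, \<lfloor>?c * t $ 1\<rfloor>, \<lfloor>?c * t $ 2\<rfloor>, \<eta>, \<zeta>))"
  define J where "J = {- int (3 * n ^ 4) .. int (3 * n ^ 4)}"
  define B where "B = (\<lambda>\<eta>. (\<eta>, 1 :: real)) ` bandwidths S n \<union> {(h_pilot S n, h_pilot S n)}"
  have fB: "finite B" unfolding B_def using bandwidths_finite[OF n] by simp
  have cB: "card B \<le> n + 1"
    unfolding B_def using card_Un_le[of "(\<lambda>\<eta>. (\<eta>, 1 :: real)) ` bandwidths S n" "{(h_pilot S n, h_pilot S n)}"]
      card_image_le[OF bandwidths_finite(1)[OF n], of "\<lambda>\<eta>. (\<eta>, 1 :: real)"] bandwidths_finite(2)[OF n] by simp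
  have inJ: "\<lfloor>?c * u\<rfloor> \<in> J" if "\<bar>u\<bar> \<le> 5/2" for u
  proof -
    have "\<bar>?c * u\<bar> \<le> ?c * 3" unfolding abs_mult using that c by (intro mult_mono) auto
    then have "- (3 * ?c) \<le> ?c * u" "?c * u \<le> 3 * ?c" by (auto simp: abs_le_iff mult.commute)
    then have "of_int (- int (3 * n ^ 4)) \<le> ?c * u" "?c * u \<le> of_int (int (3 * n ^ 4))" by simp_all
    then show ?thesis unfolding J_def atLeastAtMost_iff by (simp only: le_floor_iff) (meson floor_le_iff floor_mono floor_of_int order.trans of_int_floor_le of_int_le_iff)
  qed
  have sub: "q ` (main_params n \<union> pilot_params n) \<subseteq> J \<times> J \<times> J \<times> J \<times> B"
  proof
    fix z assume "z \<in> q ` (main_params n \<union> pilot_params n)"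
    then obtain a t \<eta> \<zeta> where s: "(a, t, \<eta>, \<zeta>) \<in> main_params n \<union> pilot_params n" and z: "z = q (a, t, \<eta>, \<zeta>)" by (auto simp del: Un_iff)
    note sc = params_scale[OF n s]
    have "\<bar>a $ i\<bar> \<le> 5/2" for i using component_le_norm_cart[of a i] sc(8) by linarith
    moreover have "\<bar>t $ i\<bar> \<le> 5/2" for i using sc(10) by (simp add: cube_def)
    moreover have "(\<eta>, \<zeta>) \<in> B" using s by (auto simp: main_params_def pilot_params_def B_def)
    ultimately show "z \<in> J \<times> J \<times> J \<times> J \<times> B" by (simp add: z q_def inJ)
  qed
  have fJ: "finite (J \<times> J \<times> J \<times> J \<times> B)" using fB by (simp add: J_def)
  have cJ: "card J = 6 * n ^ 4 + 1" using nat_int[of "6 * n ^ 4 + 1"] by (simp add: J_def)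
  have "real (card (J \<times> J \<times> J \<times> J \<times> B)) = (6 * ?c + 1) ^ 4 * real (card B)"
    by (simp add: card_cartesian_product cJ power4_eq_xxxx mult.assoc)
  also have "\<dots> \<le> (7 * ?c) ^ 4 * (2 * real n)"
    using c cB n2 by (intro mult_mono power_mono) auto
  also have "\<dots> = 4802 * real n ^ 17" by (simp add: power_mult_distrib power_mult[symmetric] power_Suc2[symmetric] mult_ac flip: power_Suc)
  finally have cc: "real (card (J \<times> J \<times> J \<times> J \<times> B)) \<le> 4802 * real n ^ 17" .
  have fq: "finite (q ` (main_params n \<union> pilot_params n))" by (rule finite_subset[OF sub fJ])
  obtain N where N: "N \<subseteq> main_params n \<union> pilot_params n" "finite N" "card N \<le> card (q ` (main_params n \<union> pilot_params n))"
    "\<forall>x\<in>main_params n \<union> pilot_params n. \<exists>y\<in>N. q y = q x"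
    using representatives[OF fq] by blast
  have "real (card N) \<le> 4802 * real n ^ 17"
    using N(3) card_mono[OF fJ sub] cc by linarith
  moreover have "\<exists>a' t'. (a', t', \<eta>, \<zeta>) \<in> N \<and>
       (\<forall>i. \<bar>a $ i - a' $ i\<bar> \<le> 1 / ?c) \<and> (\<forall>i. \<bar>t $ i - t' $ i\<bar> \<le> 1 / ?c)"
    if s: "(a, t, \<eta>, \<zeta>) \<in> main_params n \<union> pilot_params n" for a t \<eta> \<zeta>
  proof -
    obtain y where y: "y \<in> N" "q y = q (a, t, \<eta>, \<zeta>)" using N(4) s by blast
    obtain a' t' \<eta>' \<zeta>' where y': "y = (a', t', \<eta>', \<zeta>')" by (cases y)
    have c0: "0 < ?c" using c by linarith
    have "\<bar>a $ i - a' $ i\<bar> \<le> 1 / ?c \<and> \<bar>t $ i - t' $ i\<bar> \<le> 1 / ?c" for i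
      using y(2) exhaust_2[of i] by (auto simp: y' q_def intro!: floor_eq_close[OF _ c0])
    then show ?thesis using y by (intro exI[of _ a'] exI[of _ t']) (auto simp: y' q_def)
  qed
  ultimately show ?thesis using N(1,2) by (intro exI[of _ N]) auto
qed

definition F_hat_at :: "nat \<Rightarrow> (real^2 \<Rightarrow> real) \<Rightarrow> 'a \<Rightarrow> param \<Rightarrow> real" where
  "F_hat_at n F w = (\<lambda>(a, t, \<eta>, \<zeta>). F_hat S n (observations X \<epsilon> n F w) (E3 a \<eta> \<zeta>) t)"

lemma F_hat_at_phi: "F_hat_at n F w s = (\<Sum>i=1..n. phi s (X i w) * (F (X i w) + \<epsilon> i w)) / n"
  by (cases s) (simp add: F_hat_at_def F_hat_phi observations_def)

text \<open>\<open>mean\<close> is an expectation of \<open>phi\<close> times F under the design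
  law, so closeness of the weights passes to the means as well as to the sample averages.\<close>

lemma close_bounds:
  assumes n: "large n" and s: "s \<in> main_params n \<union> pilot_params n" and s': "s' \<in> main_params n \<union> pilot_params n"
    and c: "\<And>x. \<bar>phi s x - phi s' x\<bar> \<le> c"
    and [measurable]: "F \<in> borel_measurable borel" and F: "\<And>x. \<bar>F x\<bar> \<le> M"
  shows "\<bar>truncated_mean n F s w - truncated_mean n F s' w\<bar> \<le> c * (M + tau S r n)" "\<bar>mean s F - mean s' F\<bar> \<le> c * M"
proof -
  have c0: "0 \<le> c" using order.trans[OF abs_ge_zero c] .
  have M0: "0 \<le> M" using order.trans[OF abs_ge_zero F] .
  have n0: "0 < real n" using n by (simp add: large_def)
  have "truncated_mean n F s w - truncated_mean n F s' w = (\<Sum>i=1..n. (phi s (X i w) - phi s' (X i w)) * (F (X i w) + trunc (tau S r n) (\<epsilon> i w))) / n"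
    by (simp add: truncated_mean_def sum_subtractf left_diff_distrib diff_divide_distrib)
  also have "\<bar>\<dots>\<bar> \<le> (\<Sum>i=1..n. c * (M + tau S r n)) / n"
    unfolding abs_divide
  proof (intro divide_mono order.trans[OF sum_abs sum_mono])
    fix i
    have "\<bar>F (X i w) + trunc (tau S r n) (\<epsilon> i w)\<bar> \<le> M + tau S r n"
      using F[of "X i w"] trunc_le[OF tau_nonneg, of n "\<epsilon> i w"] by linarith
    then show "\<bar>(phi s (X i w) - phi s' (X i w)) * (F (X i w) + trunc (tau S r n) (\<epsilon> i w))\<bar> \<le> c * (M + tau S r n)"
      unfolding abs_mult using c0 by (intro mult_mono c) auto
  qed (use n0 c0 M0 tau_nonneg in \<open>auto intro!: mult_nonneg_nonneg\<close>)
  also have "\<dots> = c * (M + tau S r n)" using n0 by simp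
  finally show "\<bar>truncated_mean n F s w - truncated_mean n F s' w\<bar> \<le> c * (M + tau S r n)" .
  have bd: "\<bar>phi s x * F x\<bar> \<le> k\<^sup>2 / (dens_low S * scale s) * M" if "s \<in> main_params n \<union> pilot_params n" for s x
    unfolding abs_mult by (intro mult_mono phi_le[OF n that] F) (use order.trans[OF abs_ge_zero phi_le[OF n that]] in auto)
  have [measurable]: "X 1 \<in> borel_measurable P" by simp
  have int: "integrable P (\<lambda>w. phi s (X 1 w) * F (X 1 w))" if "s \<in> main_params n \<union> pilot_params n" for s
    by (rule integrable_const_bound[where B="k\<^sup>2 / (dens_low S * scale s) * M"]) (use bd[OF that] in auto)
  have "mean s F - mean s' F = expectation (\<lambda>w. phi s (X 1 w) * F (X 1 w) - phi s' (X 1 w) * F (X 1 w))"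
    using expectation_phi[OF n s, of 1 F] expectation_phi[OF n s', of 1 F] int[OF s] int[OF s'] by simp
  also have "\<bar>\<dots>\<bar> \<le> expectation (\<lambda>w. c * M)"
  proof (rule order.trans[OF integral_abs_bound integral_mono])
    fix w
    show "\<bar>phi s (X 1 w) * F (X 1 w) - phi s' (X 1 w) * F (X 1 w)\<bar> \<le> c * M"
      unfolding left_diff_distrib[symmetric] abs_mult using c0 by (intro mult_mono c F) auto
  qed (use int[OF s] int[OF s'] in auto)
  also have "\<dots> = c * M" by (simp add: prob_space)
  finally show "\<bar>mean s F - mean s' F\<bar> \<le> c * M" .
qed

definition net_err :: "nat \<Rightarrow> real \<Rightarrow> real" where
  "net_err n M = 2 * lip_const * (M + tau S r n) / n"

text \<open>Failure has two sources: a noise beyond \<open>tau\<close>, of probability at most n * 2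
  Ups * n^(-5) because Omg tau^omg = (4 r + 1) ln n >= 5 ln n; and a deviation at a net point, with
  exponent 40 ln n against a constant times n^17 points. Main parameters use the bound
  \<open>F_sup\<close> on \<open>cube (5/2)\<close> in place of M, because the threshold contains
  only an estimate of that local supremum.\<close>

lemma good_event:
  assumes n: "large n" and [measurable]: "F \<in> borel_measurable borel" and F: "\<And>x. \<bar>F x\<bar> \<le> M"
    and F_sup: "0 \<le> F_sup" "\<And>x. x \<in> cube (5/2) \<Longrightarrow> \<bar>F x\<bar> \<le> F_sup"
  shows "\<exists>G \<in> events. prob (space P - G) \<le> (2 * Ups S + 9604) / real n ^ 4 \<and>
    (\<forall>w\<in>G. \<forall>s\<in>main_params n. \<bar>F_hat_at n F w s - mean s F\<bar> \<le> dev (40 * ln n) n F_sup s + net_err n M) \<and>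
    (\<forall>w\<in>G. \<forall>s\<in>pilot_params n. \<bar>F_hat_at n F w s - mean s F\<bar> \<le> dev (40 * ln n) n M s + net_err n M)"
proof -
  have n2: "2 \<le> n" using n by (simp add: large_def)
  have ln0: "0 < ln (real n)" using n2 by simp
  have M0: "0 \<le> M" using order.trans[OF abs_ge_zero F] .
  define \<tau> where "\<tau> = tau S r n"
  have r': "0 < 4 * r + 1" using r by simp
  have \<tau>0: "0 < \<tau>" using noise_params r' ln0 by (simp add: \<tau>_def tau_def)
  have \<tau>om: "Omg S * \<tau> powr omg S = (4 * r + 1) * ln n"
    using noise_params r' ln0 by (simp add: \<tau>_def tau_def powr_powr)
  obtain N where N: "N \<subseteq> main_params n \<union> pilot_params n" "finite N" "real (card N) \<le> 4802 * real n ^ 17"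
    and cov: "\<forall>(a, t, \<eta>, \<zeta>) \<in> main_params n \<union> pilot_params n. \<exists>a' t'. (a', t', \<eta>, \<zeta>) \<in> N \<and>
       (\<forall>i. \<bar>a $ i - a' $ i\<bar> \<le> 1 / real n ^ 4) \<and> (\<forall>i. \<bar>t $ i - t' $ i\<bar> \<le> 1 / real n ^ 4)"
    using net_exists[OF n] by blast
  define ms where "ms s = (if s \<in> main_params n then F_sup else M)" for s
  define A where "A i = {w \<in> space P. \<tau> < \<bar>\<epsilon> i w\<bar>}" for i
  define B where "B s = {w \<in> space P. dev (40 * ln n) n (ms s) s < \<bar>truncated_mean n F s w - mean s F\<bar>}" for s
  have Am: "A i \<in> events" if "i \<in> {1..n}" for i
  proof -
    have [measurable]: "\<epsilon> i \<in> borel_measurable P" using that by simp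
    show ?thesis unfolding A_def by measurable
  qed
  have Bm: "B s \<in> events" for s unfolding B_def by measurable
  define bad where "bad = (\<Union>i\<in>{1..n}. A i) \<union> (\<Union>s\<in>N. B s)"
  have UA: "(\<Union>i\<in>{1..n}. A i) \<in> events" using Am by (intro sets.finite_UN) auto
  have UB: "(\<Union>s\<in>N. B s) \<in> events" using Bm N(2) by (intro sets.finite_UN) auto
  have badm: "bad \<in> events" unfolding bad_def using UA UB by blast
  have e5: "exp (- Omg S * \<tau> powr omg S) \<le> 1 / real n ^ 5"
  proof -
    have "5 * ln (real n) \<le> (4 * r + 1) * ln n" using r ln0 by (intro mult_right_mono) auto
    then have "exp (- Omg S * \<tau> powr omg S) \<le> exp (- (5 * ln (real n)))" using \<tau>om by simp
    also have "\<dots> = 1 / exp (ln (real n)) ^ 5" by (simp add: exp_minus exp_of_nat_mult[symmetric] field_simps)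
    finally show ?thesis using n2 by simp
  qed
  have e40: "exp (- (40 * ln (real n))) = 1 / real n ^ 40"
  proof -
    have "exp (40 * ln (real n)) = exp (ln (real n)) ^ 40" by (simp add: exp_of_nat_mult[symmetric])
    then show ?thesis using n2 by (simp add: exp_minus field_simps)
  qed
  have "prob (\<Union>i\<in>{1..n}. A i) \<le> (\<Sum>i\<in>{1..n}. prob (A i))"
    by (rule measure_UNION_le) (use Am in auto)
  also have "\<dots> \<le> (\<Sum>i\<in>{1..n}. 2 * Ups S * (1 / real n ^ 5))"
  proof (rule sum_mono)
    fix i assume i: "i \<in> {1..n}"
    have "prob (A i) \<le> 2 * Ups S * exp (- Omg S * \<tau> powr omg S)"
      unfolding A_def using noise_tail[of i \<tau>] i \<tau>0 by simp
    also have "\<dots> \<le> 2 * Ups S * (1 / real n ^ 5)" using noise_params by (intro mult_left_mono e5) auto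
    finally show "prob (A i) \<le> 2 * Ups S * (1 / real n ^ 5)" .
  qed
  also have "\<dots> = 2 * Ups S / real n ^ 4"
  proof -
    have "real n ^ 5 = real n * real n ^ 4" using power_Suc[of "real n" 4] by simp
    then show ?thesis using n2 by simp
  qed
  finally have pA: "prob (\<Union>i\<in>{1..n}. A i) \<le> 2 * Ups S / real n ^ 4" .
  have "prob (\<Union>s\<in>N. B s) \<le> (\<Sum>s\<in>N. prob (B s))"
    by (rule measure_UNION_le) (use Bm N(2) in auto)
  also have "\<dots> \<le> (\<Sum>s\<in>N. 2 * (1 / real n ^ 40))"
  proof (rule sum_mono)
    fix s assume "s \<in> N"
    then have s: "s \<in> main_params n \<union> pilot_params n" using N(1) by blast
    have "\<bar>F x\<bar> \<le> ms s" if "wt s x \<noteq> 0" for x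
      using main_params_window[OF n _ that] F_sup(2) F by (auto simp: ms_def)
    then show "prob (B s) \<le> 2 * (1 / real n ^ 40)"
      unfolding B_def e40[symmetric] using F_sup(1) M0 ln0 \<tau>0
      by (intro bernstein_phi[OF n s]) (auto simp: ms_def \<tau>_def)
  qed
  also have "\<dots> = real (card N) * (2 * (1 / real n ^ 40))" by simp
  also have "\<dots> \<le> 4802 * real n ^ 17 * (2 * (1 / real n ^ 40))" by (intro mult_right_mono N(3)) auto
  also have "\<dots> = 9604 / real n ^ 23"
  proof -
    have e: "4802 * u * (2 * (1 / (u * v))) = 9604 / v" if "u \<noteq> 0" for u v :: real using that by simp
    have "real n ^ 40 = real n ^ 17 * real n ^ 23" by (simp add: power_add[symmetric])
    then show ?thesis by (simp only:) (rule e, use n2 in simp)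
  qed
  also have "\<dots> \<le> 9604 / real n ^ 4" using n2 by (intro divide_left_mono power_increasing mult_pos_pos) auto
  finally have pB: "prob (\<Union>s\<in>N. B s) \<le> 9604 / real n ^ 4" .
  have "prob bad \<le> prob (\<Union>i\<in>{1..n}. A i) + prob (\<Union>s\<in>N. B s)"
    unfolding bad_def by (rule measure_Un_le[OF UA UB])
  also have "\<dots> \<le> (2 * Ups S + 9604) / real n ^ 4" using pA pB by (simp add: add_divide_distrib)
  finally have pbad: "prob bad \<le> (2 * Ups S + 9604) / real n ^ 4" .
  have bs: "bad \<subseteq> space P" using sets.sets_into_space[OF badm] .
  have good: "\<bar>F_hat_at n F w s - mean s F\<bar> \<le> dev (40 * ln n) n (ms s) s + net_err n M"
    if w: "w \<in> space P - bad" and s: "s \<in> main_params n \<union> pilot_params n" for w s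
  proof -
    obtain a t \<eta> \<zeta> where s1: "s = (a, t, \<eta>, \<zeta>)" by (cases s)
    obtain a' t' where s2: "(a', t', \<eta>, \<zeta>) \<in> N"
      "\<And>i. \<bar>a $ i - a' $ i\<bar> \<le> 1 / real n ^ 4" "\<And>i. \<bar>t $ i - t' $ i\<bar> \<le> 1 / real n ^ 4"
      using cov s unfolding s1 by blast
    define s' where "s' = (a', t', \<eta>, \<zeta>)"
    have s'N: "s' \<in> N" using s2 by (simp add: s'_def)
    then have s'p: "s' \<in> main_params n \<union> pilot_params n" using N(1) by blast
    have "\<bar>phi s x - phi s' x\<bar> \<le> lip_const * n ^ 3 * (1 / real n ^ 4)" for x
      unfolding s1 s'_def using s s'p by (intro phi_close[OF n] s2) (auto simp: s1 s'_def)
    then have cl: "\<bar>phi s x - phi s' x\<bar> \<le> lip_const / n" for x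
    proof -
      have "real n ^ 4 = real n * real n ^ 3" using power_Suc[of "real n" 3] by simp
      then show ?thesis using \<open>\<And>x. \<bar>phi s x - phi s' x\<bar> \<le> lip_const * n ^ 3 * (1 / real n ^ 4)\<close>[of x] n2 by simp
    qed
    have eps: "\<bar>\<epsilon> i w\<bar> \<le> \<tau>" if "i \<in> {1..n}" for i
      using w that by (auto simp: bad_def A_def not_less)
    have FZ: "F_hat_at n F w s = truncated_mean n F s w"
      unfolding F_hat_at_phi truncated_mean_def using eps by (intro arg_cong2[where f="(/)"] sum.cong refl) (simp add: trunc_def \<tau>_def)
    have z1: "\<bar>truncated_mean n F s w - truncated_mean n F s' w\<bar> \<le> lip_const / n * (M + tau S r n)"
      and z2: "\<bar>mean s F - mean s' F\<bar> \<le> lip_const / n * M"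
      using close_bounds[OF n s s'p cl _ F] by auto
    have z3: "lip_const / n * M \<le> lip_const / n * (M + tau S r n)"
      using lip_const_nonneg tau_nonneg by (intro mult_left_mono) auto
    have ms: "ms s' = ms s"
    proof -
      have "h_pilot S n \<noteq> 1" using n by (simp add: large_def)
      then show ?thesis using s s'p unfolding ms_def s1 s'_def by (auto simp: main_params_def pilot_params_def)
    qed
    have "\<bar>truncated_mean n F s' w - mean s' F\<bar> \<le> dev (40 * ln n) n (ms s') s'"
      using w s'N by (auto simp: bad_def B_def not_less)
    then have z4: "\<bar>truncated_mean n F s' w - mean s' F\<bar> \<le> dev (40 * ln n) n (ms s) s"
      unfolding ms by (simp add: dev_def scale_def s1 s'_def)
    have "\<bar>truncated_mean n F s w - mean s F\<bar> \<le>
        \<bar>truncated_mean n F s w - truncated_mean n F s' w\<bar> + \<bar>truncated_mean n F s' w - mean s' F\<bar> + \<bar>mean s F - mean s' F\<bar>" by linarith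
    also have "\<dots> \<le> lip_const / n * (M + tau S r n) + dev (40 * ln n) n (ms s) s + lip_const / n * (M + tau S r n)"
      by (intro add_mono z1 z4 order.trans[OF z2 z3])
    also have "\<dots> = dev (40 * ln n) n (ms s) s + net_err n M" by (simp add: net_err_def)
    finally show ?thesis unfolding FZ .
  qed
  show ?thesis
  proof (intro bexI[of _ "space P - bad"] conjI ballI)
    show "space P - bad \<in> events" using badm by auto
    have "space P - (space P - bad) = bad" using bs by auto
    then show "prob (space P - (space P - bad)) \<le> (2 * Ups S + 9604) / real n ^ 4" using pbad by simp
    fix w s assume w: "w \<in> space P - bad"
    show "\<bar>F_hat_at n F w s - mean s F\<bar> \<le> dev (40 * ln n) n F_sup s + net_err n M" if "s \<in> main_params n"
      using good[OF w, of s] that by (simp add: ms_def)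
    show "\<bar>F_hat_at n F w s - mean s F\<bar> \<le> dev (40 * ln n) n M s + net_err n M" if "s \<in> pilot_params n"
    proof -
      have "s \<notin> main_params n" using that n by (auto simp: main_params_def pilot_params_def large_def)
      then show ?thesis using good[OF w, of s] that by (simp add: ms_def)
    qed
  qed
qed

end

section \<open>Oracle inequality\<close>

text \<open>A multiple of the bisector of \<nu> and whichever of \<theta>, -\<theta> makes no obtuse
  angle with it; the length is the one that makes \<open>E_two\<close> an instance of
  \<open>E3\<close>.\<close>

definition mid :: "real^2 \<Rightarrow> real^2 \<Rightarrow> real^2" where
  "mid \<theta> \<nu> = (1 / (2 * (1 + \<bar>\<nu> \<bullet> \<theta>\<bar>))) *\<^sub>R ((if 0 \<le> \<nu> \<bullet> \<theta> then \<theta> else - \<theta>) + \<nu>)"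

lemma E_one_E3: "E_one \<theta> h = E3 \<theta> h 1"
  by (simp add: E_one_def E3_def)

lemma E_two_E3: "E_two \<theta> \<nu> h = E3 (mid \<theta> \<nu>) h 1"
proof -
  have "E_bar \<theta> \<nu> h = E3 ((1 / (2 * (1 + \<bar>\<nu> \<bullet> \<theta>\<bar>))) *\<^sub>R (\<theta> + \<nu>)) h 1" for \<theta>
    by (simp add: E_bar_def E3_def mult_ac)
  then show ?thesis by (simp add: E_two_def mid_def)
qed

lemma unit_inner: "\<theta> \<in> unit_circle \<Longrightarrow> \<theta> \<bullet> \<theta> = 1"
  by (simp add: dot_square_norm)

text \<open>The third identity is the purpose of the normalisation in \<open>E_bar\<close>: relative
  to \<theta>, the two-direction estimator has exactly the transverse window of the estimator with
  direction \<nu>. Only the inner bandwidth differs, with \<sigma> + \<nu> \<bullet> \<theta> in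
  place of \<nu> \<bullet> \<theta>.\<close>

lemma mid_props:
  assumes "\<theta> \<in> unit_circle" "\<nu> \<in> unit_circle"
  defines "\<sigma> \<equiv> (if 0 \<le> \<nu> \<bullet> \<theta> then 1 else - 1 :: real)"
  shows "mid \<theta> \<nu> \<bullet> mid \<theta> \<nu> = 1 / (2 * (1 + \<bar>\<nu> \<bullet> \<theta>\<bar>))"
    "mid \<theta> \<nu> \<bullet> \<theta> / (mid \<theta> \<nu> \<bullet> mid \<theta> \<nu>) = \<sigma> + \<nu> \<bullet> \<theta>"
    "cross (mid \<theta> \<nu>) \<theta> / (mid \<theta> \<nu> \<bullet> mid \<theta> \<nu>) = cross \<nu> \<theta>"
    "1/2 \<le> norm (mid \<theta> \<nu>)" "norm (mid \<theta> \<nu>) \<le> 1" "\<bar>\<sigma> + \<nu> \<bullet> \<theta>\<bar> \<le> 2" "\<bar>\<nu> \<bullet> \<theta>\<bar> \<le> 1" "\<bar>cross \<nu> \<theta>\<bar> \<le> 1"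
proof -
  define c where "c = \<nu> \<bullet> \<theta>"
  define D where "D = 2 * (1 + \<bar>c\<bar>)"
  have u: "\<theta> \<bullet> \<theta> = 1" "\<nu> \<bullet> \<nu> = 1" using assms unit_inner by auto
  have c1: "\<bar>c\<bar> \<le> 1" using Cauchy_Schwarz_ineq2[of \<nu> \<theta>] assms(1,2) by (simp add: c_def)
  then show "\<bar>\<nu> \<bullet> \<theta>\<bar> \<le> 1" by (simp add: c_def)
  show "\<bar>\<sigma> + \<nu> \<bullet> \<theta>\<bar> \<le> 2" using c1 by (auto simp: \<sigma>_def c_def[symmetric])
  have "(\<nu> \<bullet> \<theta>)\<^sup>2 + (cross \<nu> \<theta>)\<^sup>2 = 1" unfolding inner_cross_sq u by simp
  then have "(cross \<nu> \<theta>)\<^sup>2 \<le> 1" using zero_le_power2[of "\<nu> \<bullet> \<theta>"] by linarith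
  then show "\<bar>cross \<nu> \<theta>\<bar> \<le> 1" by (simp add: abs_square_le_1)
  have D: "2 \<le> D" "D \<le> 4" using c1 by (auto simp: D_def)
  have mid: "mid \<theta> \<nu> = (1 / D) *\<^sub>R (\<sigma> *\<^sub>R \<theta> + \<nu>)" by (simp add: mid_def D_def c_def \<sigma>_def)
  have s2: "\<sigma> * \<sigma> = 1" and sc: "\<sigma> * c = \<bar>c\<bar>" by (auto simp: \<sigma>_def c_def)
  have "(\<sigma> *\<^sub>R \<theta> + \<nu>) \<bullet> (\<sigma> *\<^sub>R \<theta> + \<nu>) = \<sigma> * \<sigma> + 2 * (\<sigma> * c) + 1"
    by (simp add: inner_add_left inner_add_right u c_def inner_commute[of \<theta> \<nu>] algebra_simps)
  then have dd: "(\<sigma> *\<^sub>R \<theta> + \<nu>) \<bullet> (\<sigma> *\<^sub>R \<theta> + \<nu>) = D" by (simp add: s2 sc D_def)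
  have mm: "mid \<theta> \<nu> \<bullet> mid \<theta> \<nu> = 1 / D" unfolding mid using D by (simp add: dd)
  then show "mid \<theta> \<nu> \<bullet> mid \<theta> \<nu> = 1 / (2 * (1 + \<bar>\<nu> \<bullet> \<theta>\<bar>))" by (simp add: D_def c_def)
  show "mid \<theta> \<nu> \<bullet> \<theta> / (mid \<theta> \<nu> \<bullet> mid \<theta> \<nu>) = \<sigma> + \<nu> \<bullet> \<theta>"
    unfolding mm using D by (simp add: mid inner_add_left u)
  have "cross (mid \<theta> \<nu>) \<theta> = (1 / D) * cross \<nu> \<theta>"
    by (simp add: mid cross_def add_divide_distrib algebra_simps diff_divide_distrib)
  then show "cross (mid \<theta> \<nu>) \<theta> / (mid \<theta> \<nu> \<bullet> mid \<theta> \<nu>) = cross \<nu> \<theta>" unfolding mm using D by simp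
  have nn: "(norm (mid \<theta> \<nu>))\<^sup>2 = 1 / D" by (simp add: power2_norm_eq_inner mm)
  have "1 / 4 \<le> 1 / D" using D by (intro divide_left_mono) auto
  then have "(1/2)\<^sup>2 \<le> (norm (mid \<theta> \<nu>))\<^sup>2" unfolding nn by (simp add: power2_eq_square)
  then show "1/2 \<le> norm (mid \<theta> \<nu>)" by (rule power2_le_imp_le) simp
  show "norm (mid \<theta> \<nu>) \<le> 1" by (rule power2_le_imp_le) (use D in \<open>auto simp: nn\<close>)
qed

section \<open>Kernel means and biases relative to the true direction\<close>

locale single_index_target = single_index_model P X \<epsilon> l S b r + nik_kernel p \<beta> L f "kern S" "kern_inf S" "strict_floor b" b0 M
  for P :: "'a measure" and X :: "nat \<Rightarrow> 'a \<Rightarrow> real^2" and \<epsilon> :: "nat \<Rightarrow> 'a \<Rightarrow> real"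
    and l :: "real \<Rightarrow> real" and S :: setting and b r p \<beta> L :: real and f :: "real \<Rightarrow> real" and b0 M :: real +
  fixes \<theta>0 :: "real^2"
  assumes \<theta>0: "\<theta>0 \<in> unit_circle"
begin

definition F :: "real^2 \<Rightarrow> real" where "F x = f (x \<bullet> \<theta>0)"

lemma F_meas [measurable]: "F \<in> borel_measurable borel"
  unfolding F_def by measurable

lemma F_le: "\<bar>F x\<bar> \<le> M" by (simp add: F_def f_le)

lemma mean_E3:
  assumes "a \<noteq> 0" "0 < \<eta>" "0 < \<zeta>"
  shows "mean (a, t, \<eta>, \<zeta>) F = (\<integral>y. kern S y * avg (\<eta> * (a \<bullet> \<theta>0) / (a \<bullet> a)) f (t \<bullet> \<theta>0 + \<zeta> * cross a \<theta>0 / (a \<bullet> a) * y) \<partial>W)"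
  using mean_formula[OF meas_f f_le assms] by (simp add: mean_def wt_def kern2_def F_def)

lemma mean_one:
  assumes "\<nu> \<in> unit_circle" "0 < \<eta>"
  shows "mean (\<nu>, t, \<eta>, 1) F = (\<integral>y. kern S y * avg (\<eta> * (\<nu> \<bullet> \<theta>0)) f (t \<bullet> \<theta>0 + cross \<nu> \<theta>0 * y) \<partial>W)"
proof -
  have "\<nu> \<noteq> 0" using assms by auto
  then show ?thesis using mean_E3[of \<nu> \<eta> 1 t] assms by (simp add: unit_inner)
qed

lemma mean_two:
  assumes "\<nu> \<in> unit_circle" "0 < \<eta>"
  shows "mean (mid \<theta>0 \<nu>, t, \<eta>, 1) F =
    (\<integral>y. kern S y * avg (\<eta> * ((if 0 \<le> \<nu> \<bullet> \<theta>0 then 1 else - 1) + \<nu> \<bullet> \<theta>0)) f (t \<bullet> \<theta>0 + cross \<nu> \<theta>0 * y) \<partial>W)"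
proof -
  note mp = mid_props[OF \<theta>0 assms(1)]
  have "mid \<theta>0 \<nu> \<noteq> 0" using mp(4) by auto
  then show ?thesis using mean_E3[of "mid \<theta>0 \<nu>" \<eta> 1 t] assms mp(3)
    by (simp add: mp(2) times_divide_eq_right[symmetric] del: times_divide_eq_right)
qed

lemma mean_truth: "F t = (\<integral>y. kern S y * avg 0 f (t \<bullet> \<theta>0 + 0 * y) \<partial>W)"
  by (simp add: F_def avg_zero K_int)

lemma int_diff:
  "(\<integral>y. kern S y * avg d f (u + s * y) \<partial>W) - (\<integral>y. kern S y * avg d' f (u + s * y) \<partial>W) =
   (\<integral>y. kern S y * (avg d f (u + s * y) - avg d' f (u + s * y)) \<partial>W)"
proof -
  have bd: "\<bar>avg d f x\<bar> \<le> k * M" for d x by (rule avg_le[OF meas_f f_le])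
  have "integrable W (\<lambda>y. kern S y * avg d f (u + s * y))" for d
    by (rule avg_integrable[OF avg_meas[OF meas_f] bd])
  then show ?thesis by (simp add: right_diff_distrib)
qed

text \<open>Bandwidth 0 is allowed and \<open>avg 0\<close> is the identity, so closeness to the
  true value of the regression function is a special case.\<close>

definition bias_ok :: "real \<Rightarrow> real \<Rightarrow> real \<Rightarrow> bool" where
  "bias_ok h lam u \<longleftrightarrow> (\<forall>s d d'. \<bar>s\<bar> \<le> 1 \<longrightarrow> \<bar>d\<bar> \<le> 2 * h \<longrightarrow> \<bar>d'\<bar> \<le> 2 * h \<longrightarrow>
     \<bar>\<integral>y. kern S y * (avg d f (u + s * y) - avg d' f (u + s * y)) \<partial>W\<bar> \<le> lam)"

text \<open>By \<open>mid_props\<close> both means use the transverse window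
  \<open>cross \<nu> \<theta>0\<close>, and both inner bandwidths lie in [-2 h, 2 h].\<close>

lemma bias_two_one:
  assumes ok: "bias_ok h lam (t \<bullet> \<theta>0)" and \<nu>: "\<nu> \<in> unit_circle" and \<eta>: "0 < \<eta>" "\<eta> \<le> h"
  shows "\<bar>mean (mid \<theta>0 \<nu>, t, \<eta>, 1) F - mean (\<nu>, t, \<eta>, 1) F\<bar> \<le> lam"
proof -
  note mp = mid_props[OF \<theta>0 \<nu>]
  have "\<eta> * \<bar>(if 0 \<le> \<nu> \<bullet> \<theta>0 then 1 else - 1) + \<nu> \<bullet> \<theta>0\<bar> \<le> h * 2" using \<eta> mp(6) by (intro mult_mono) auto
  moreover have "\<eta> * \<bar>\<nu> \<bullet> \<theta>0\<bar> \<le> h * 2" using \<eta> mp(7) by (intro mult_mono) auto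
  ultimately show ?thesis
    unfolding mean_two[OF \<nu> \<eta>(1)] mean_one[OF \<nu> \<eta>(1)] int_diff using ok mp(8) \<eta>
    unfolding bias_ok_def by (auto simp: abs_mult mult.commute)
qed

lemma bias_one_one:
  assumes ok: "bias_ok h lam (t \<bullet> \<theta>0)" and \<nu>: "\<nu> \<in> unit_circle" and \<eta>: "0 < \<eta>" "\<eta> \<le> h"
  shows "\<bar>mean (\<nu>, t, h, 1) F - mean (\<nu>, t, \<eta>, 1) F\<bar> \<le> lam"
proof -
  note mp = mid_props[OF \<theta>0 \<nu>]
  have h: "0 < h" using \<eta> by simp
  have "\<eta> * \<bar>\<nu> \<bullet> \<theta>0\<bar> \<le> h * 2" "h * \<bar>\<nu> \<bullet> \<theta>0\<bar> \<le> h * 2" using \<eta> h mp(7) by (intro mult_mono; simp)+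
  then show ?thesis
    unfolding mean_one[OF \<nu> \<eta>(1)] mean_one[OF \<nu> h] int_diff using ok mp(8) \<eta>
    unfolding bias_ok_def by (auto simp: abs_mult mult.commute)
qed

lemma bias_one_truth:
  assumes ok: "bias_ok h lam (t \<bullet> \<theta>0)" and h: "0 < h"
  shows "\<bar>mean (\<theta>0, t, h, 1) F - F t\<bar> \<le> lam"
proof -
  have "cross \<theta>0 \<theta>0 = 0" by (simp add: cross_def)
  moreover have "\<bar>\<integral>y. kern S y * (avg h f (t \<bullet> \<theta>0 + 0 * y) - avg 0 f (t \<bullet> \<theta>0 + 0 * y)) \<partial>W\<bar> \<le> lam"
  proof -
    have "\<bar>0 :: real\<bar> \<le> 1" "\<bar>h\<bar> \<le> 2 * h" "\<bar>0\<bar> \<le> 2 * h" using h by auto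
    then show ?thesis using ok unfolding bias_ok_def by blast
  qed
  ultimately show ?thesis
    using unit_inner[OF \<theta>0] by (simp add: mean_one[OF \<theta>0 h] mean_truth[of t] K_int)
qed

end

section \<open>Comparison of the selected pair with a reference pair\<close>

context single_index_model
begin

lemma F_hat_minus: "F_hat S n z (E3 (- a) \<eta> \<zeta>) t = F_hat S n z (E3 a \<eta> \<zeta>) t"
proof -
  have "K (- u) = K u" for u by (rule kernel_sym)
  moreover have "cross (- a) x = - cross a x" for x by (simp add: cross_def)
  ultimately show ?thesis by (simp add: F_hat_def det_E3 kern2_def E3_mult)
qed

text \<open>For an obtuse angle the bisectors taken in the two orders are opposite vectors;
  reversing \<open>a\<close> flips both kernel arguments, which a symmetric kernel does not
  see.\<close>

lemma F_hat_two_commute: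
  "F_hat S n z (E_two \<theta> \<nu> \<eta>) t = F_hat S n z (E_two \<nu> \<theta> \<eta>) t"
proof (cases "0 \<le> \<nu> \<bullet> \<theta>")
  case True
  then have "mid \<theta> \<nu> = mid \<nu> \<theta>" by (simp add: mid_def inner_commute add.commute)
  then show ?thesis by (simp add: E_two_E3)
next
  case False
  then have "mid \<theta> \<nu> = - mid \<nu> \<theta>" by (simp add: mid_def inner_commute algebra_simps)
  then show ?thesis by (simp add: E_two_E3 F_hat_minus)
qed

text \<open>The estimators with two directions are symmetric in them up to sign, so the selected and the
  true direction can be compared through the one that uses both.\<close>

lemma oracle_inequality:
  fixes z :: sample and t :: "real^2" and n :: nat
  defines "f1 \<equiv> \<lambda>\<nu> \<eta>. F_hat S n z (E_one \<nu> \<eta>) t"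
    and "f2 \<equiv> \<lambda>\<theta> \<nu> \<eta>. F_hat S n z (E_two \<theta> \<nu> \<eta>) t"
  assumes b1: "\<And>\<nu> \<eta>. \<nu> \<in> unit_circle \<Longrightarrow> \<eta> \<in> bandwidths S n \<Longrightarrow> \<bar>f1 \<nu> \<eta>\<bar> \<le> C"
    and b2: "\<And>\<theta> \<nu> \<eta>. \<theta> \<in> unit_circle \<Longrightarrow> \<nu> \<in> unit_circle \<Longrightarrow> \<eta> \<in> bandwidths S n \<Longrightarrow> \<bar>f2 \<theta> \<nu> \<eta>\<bar> \<le> C"
    and T: "\<And>\<eta>. \<eta> \<in> bandwidths S n \<Longrightarrow> 0 \<le> TH S r n z \<eta>"
    and sel: "\<theta>h \<in> unit_circle" "hh \<in> bandwidths S n"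
      "\<And>\<theta> h. \<theta> \<in> unit_circle \<Longrightarrow> h \<in> bandwidths S n \<Longrightarrow> criterion S r n z t (\<theta>h, hh) \<le> criterion S r n z t (\<theta>, h)"
    and \<theta>: "\<theta> \<in> unit_circle" and h: "h \<in> bandwidths S n"
    and R1: "\<And>\<nu> \<eta>. \<nu> \<in> unit_circle \<Longrightarrow> \<eta> \<in> bandwidths S n \<Longrightarrow> \<eta> \<le> h \<Longrightarrow> \<bar>f2 \<theta> \<nu> \<eta> - f1 \<nu> \<eta>\<bar> \<le> lam + TH S r n z \<eta>"
    and R2: "\<And>\<nu> \<eta>. \<nu> \<in> unit_circle \<Longrightarrow> \<eta> \<in> bandwidths S n \<Longrightarrow> \<eta> \<le> h \<Longrightarrow> \<bar>f1 \<nu> h - f1 \<nu> \<eta>\<bar> \<le> lam + TH S r n z \<eta>"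
    and lam: "0 \<le> lam"
  shows "\<bar>f1 \<theta>h hh - f1 \<theta> h\<bar> \<le> 8 * lam + 4 * TH S r n z h"
proof -
  let ?T = "TH S r n z"
  have ne: "unit_circle \<noteq> {}" using \<theta> by blast
  \<comment> \<open>The common bound C serves to make the suprema of the selection rule suprema of
    bounded sets; it does not reach the conclusion.\<close>
  have C0: "0 \<le> C" using order.trans[OF abs_ge_zero b1[OF \<theta> h]] .
  have d2: "\<bar>f2 \<theta>' \<nu> \<eta> - f1 \<nu> \<eta>\<bar> \<le> 2 * C" if "\<theta>' \<in> unit_circle" "\<nu> \<in> unit_circle" "\<eta> \<in> bandwidths S n" for \<theta>' \<nu> \<eta>
    using b1[OF that(2,3)] b2[OF that] by linarith
  have d1: "\<bar>f1 \<nu> h' - f1 \<nu> \<eta>\<bar> \<le> 2 * C" if "\<nu> \<in> unit_circle" "h' \<in> bandwidths S n" "\<eta> \<in> bandwidths S n" for \<nu> \<eta> h'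
    using b1[OF that(1,2)] b1[OF that(1,3)] by linarith
  have R1_ge: "\<bar>f2 \<theta>' \<nu> \<eta> - f1 \<nu> \<eta>\<bar> \<le> R_one S r n z t \<theta>' h' + ?T \<eta>"
    if "\<theta>' \<in> unit_circle" "\<nu> \<in> unit_circle" "\<eta> \<in> bandwidths S n" "\<eta> \<le> h'" for \<theta>' \<nu> \<eta> h'
  proof -
    let ?g = "\<lambda>\<eta>. max 0 ((SUP \<nu> \<in> unit_circle. \<bar>f2 \<theta>' \<nu> \<eta> - f1 \<nu> \<eta>\<bar>) - ?T \<eta>)"
    have "\<bar>f2 \<theta>' \<nu> \<eta> - f1 \<nu> \<eta>\<bar> \<le> (SUP \<nu> \<in> unit_circle. \<bar>f2 \<theta>' \<nu> \<eta> - f1 \<nu> \<eta>\<bar>)"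
      by (rule cSUP_upper[OF that(2)]) (auto intro!: bdd_aboveI2[where M="2 * C"] d2 that simp del: mem_sphere)
    then have "\<bar>f2 \<theta>' \<nu> \<eta> - f1 \<nu> \<eta>\<bar> - ?T \<eta> \<le> ?g \<eta>" by simp
    also have "?g \<eta> \<le> (SUP \<eta> \<in> {\<eta> \<in> bandwidths S n. \<eta> \<le> h'}. ?g \<eta>)"
    proof (rule cSUP_upper)
      show "\<eta> \<in> {\<eta> \<in> bandwidths S n. \<eta> \<le> h'}" using that by simp
      have "?g \<eta> \<le> 2 * C" if e: "\<eta> \<in> bandwidths S n" for \<eta>
      proof -
        have "(SUP \<nu> \<in> unit_circle. \<bar>f2 \<theta>' \<nu> \<eta> - f1 \<nu> \<eta>\<bar>) \<le> 2 * C"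
          by (rule cSUP_least[OF ne]) (rule d2[OF \<open>\<theta>' \<in> unit_circle\<close> _ e])
        then show ?thesis using T[OF e] C0 by simp
      qed
      then show "bdd_above (?g ` {\<eta> \<in> bandwidths S n. \<eta> \<le> h'})" by (intro bdd_aboveI2[where M="2 * C"]) auto
    qed
    finally show ?thesis by (simp add: R_one_def f1_def f2_def)
  qed
  have R2_ge: "\<bar>f1 \<nu> h' - f1 \<nu> \<eta>\<bar> \<le> R_two S r n z t h' + ?T \<eta>"
    if "\<nu> \<in> unit_circle" "h' \<in> bandwidths S n" "\<eta> \<in> bandwidths S n" "\<eta> \<le> h'" for \<nu> \<eta> h'
  proof -
    let ?g = "\<lambda>\<eta>. max 0 ((SUP \<nu> \<in> unit_circle. \<bar>f1 \<nu> h' - f1 \<nu> \<eta>\<bar>) - ?T \<eta>)"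
    have "\<bar>f1 \<nu> h' - f1 \<nu> \<eta>\<bar> \<le> (SUP \<nu> \<in> unit_circle. \<bar>f1 \<nu> h' - f1 \<nu> \<eta>\<bar>)"
      by (rule cSUP_upper[OF that(1)]) (auto intro!: bdd_aboveI2[where M="2 * C"] d1 that simp del: mem_sphere)
    then have "\<bar>f1 \<nu> h' - f1 \<nu> \<eta>\<bar> - ?T \<eta> \<le> ?g \<eta>" by simp
    also have "?g \<eta> \<le> (SUP \<eta> \<in> {\<eta> \<in> bandwidths S n. \<eta> \<le> h'}. ?g \<eta>)"
    proof (rule cSUP_upper)
      show "\<eta> \<in> {\<eta> \<in> bandwidths S n. \<eta> \<le> h'}" using that by simp
      have "?g \<eta> \<le> 2 * C" if e: "\<eta> \<in> bandwidths S n" for \<eta>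
      proof -
        have "(SUP \<nu> \<in> unit_circle. \<bar>f1 \<nu> h' - f1 \<nu> \<eta>\<bar>) \<le> 2 * C"
          by (rule cSUP_least[OF ne]) (rule d1[OF _ \<open>h' \<in> bandwidths S n\<close> e])
        then show ?thesis using T[OF e] C0 by simp
      qed
      then show "bdd_above (?g ` {\<eta> \<in> bandwidths S n. \<eta> \<le> h'})" by (intro bdd_aboveI2[where M="2 * C"]) auto
    qed
    finally show ?thesis by (simp add: R_two_def f1_def)
  qed
  have R1_nn: "0 \<le> R_one S r n z t \<theta>' h'" if "\<theta>' \<in> unit_circle" "h' \<in> bandwidths S n" for \<theta>' h'
  proof -
    let ?g = "\<lambda>\<eta>. max 0 ((SUP \<nu> \<in> unit_circle. \<bar>f2 \<theta>' \<nu> \<eta> - f1 \<nu> \<eta>\<bar>) - ?T \<eta>)"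
    have "?g \<eta> \<le> 2 * C" if e: "\<eta> \<in> bandwidths S n" for \<eta>
    proof -
      have "(SUP \<nu> \<in> unit_circle. \<bar>f2 \<theta>' \<nu> \<eta> - f1 \<nu> \<eta>\<bar>) \<le> 2 * C"
        by (rule cSUP_least[OF ne]) (rule d2[OF \<open>\<theta>' \<in> unit_circle\<close> _ e])
      then show ?thesis using T[OF e] C0 by simp
    qed
    then have "?g h' \<le> (SUP \<eta> \<in> {\<eta> \<in> bandwidths S n. \<eta> \<le> h'}. ?g \<eta>)"
      by (intro cSUP_upper bdd_aboveI2[where M="2 * C"]) (use that in auto)
    then show ?thesis by (simp add: R_one_def f1_def f2_def)
  qed
  have R2_nn: "0 \<le> R_two S r n z t h'" if "h' \<in> bandwidths S n" for h'
  proof -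
    let ?g = "\<lambda>\<eta>. max 0 ((SUP \<nu> \<in> unit_circle. \<bar>f1 \<nu> h' - f1 \<nu> \<eta>\<bar>) - ?T \<eta>)"
    have "?g \<eta> \<le> 2 * C" if e: "\<eta> \<in> bandwidths S n" for \<eta>
    proof -
      have "(SUP \<nu> \<in> unit_circle. \<bar>f1 \<nu> h' - f1 \<nu> \<eta>\<bar>) \<le> 2 * C"
        by (rule cSUP_least[OF ne]) (rule d1[OF _ \<open>h' \<in> bandwidths S n\<close> e])
      then show ?thesis using T[OF e] C0 by simp
    qed
    then have "?g h' \<le> (SUP \<eta> \<in> {\<eta> \<in> bandwidths S n. \<eta> \<le> h'}. ?g \<eta>)"
      by (intro cSUP_upper bdd_aboveI2[where M="2 * C"]) (use that in auto)
    then show ?thesis by (simp add: R_two_def f1_def)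
  qed
  have nes: "{\<eta> \<in> bandwidths S n. \<eta> \<le> h} \<noteq> {}" using h by auto
  have R1_le: "R_one S r n z t \<theta> h \<le> lam"
    unfolding R_one_def
  proof (rule cSUP_least[OF nes])
    fix \<eta> assume "\<eta> \<in> {\<eta> \<in> bandwidths S n. \<eta> \<le> h}"
    then have e: "\<eta> \<in> bandwidths S n" "\<eta> \<le> h" by auto
    have "(SUP \<nu> \<in> unit_circle. \<bar>f2 \<theta> \<nu> \<eta> - f1 \<nu> \<eta>\<bar>) \<le> lam + ?T \<eta>"
      by (rule cSUP_least[OF ne]) (rule R1[OF _ e])
    then show "max 0 ((SUP \<nu> \<in> unit_circle. \<bar>F_hat S n z (E_two \<theta> \<nu> \<eta>) t - F_hat S n z (E_one \<nu> \<eta>) t\<bar>) - ?T \<eta>) \<le> lam"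
      using lam by (simp add: f1_def f2_def)
  qed
  have R2_le: "R_two S r n z t h \<le> lam"
    unfolding R_two_def
  proof (rule cSUP_least[OF nes])
    fix \<eta> assume "\<eta> \<in> {\<eta> \<in> bandwidths S n. \<eta> \<le> h}"
    then have e: "\<eta> \<in> bandwidths S n" "\<eta> \<le> h" by auto
    have "(SUP \<nu> \<in> unit_circle. \<bar>f1 \<nu> h - f1 \<nu> \<eta>\<bar>) \<le> lam + ?T \<eta>"
      by (rule cSUP_least[OF ne]) (rule R2[OF _ e])
    then show "max 0 ((SUP \<theta> \<in> unit_circle. \<bar>F_hat S n z (E_one \<theta> h) t - F_hat S n z (E_one \<theta> \<eta>) t\<bar>) - ?T \<eta>) \<le> lam"
      using lam by (simp add: f1_def)
  qed
  have crit: "R_one S r n z t \<theta>h hh + R_two S r n z t hh + ?T hh \<le> R_one S r n z t \<theta> h + R_two S r n z t h + ?T h"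
    using sel(3)[OF \<theta> h] by (simp add: criterion_def)
  have comm: "f2 \<theta>h \<theta> \<eta> = f2 \<theta> \<theta>h \<eta>" for \<eta> unfolding f2_def by (rule F_hat_two_commute)
  note nn = R1_nn[OF sel(1,2)] R2_nn[OF sel(2)] T[OF h] T[OF sel(2)] R1_nn[OF \<theta> h] R2_nn[OF h]
  show ?thesis
  proof (cases "h \<le> hh")
    case True
    \<comment> \<open>Chain through bandwidth h: selected direction at hh and at h, both directions
      at h, reference direction at h. Three thresholds at h and one more from minimality give the
      4.\<close>
    have "\<bar>f1 \<theta>h hh - f1 \<theta>h h\<bar> \<le> R_two S r n z t hh + ?T h" by (rule R2_ge[OF sel(1,2) h True])
    moreover have "\<bar>f2 \<theta> \<theta>h h - f1 \<theta>h h\<bar> \<le> R_one S r n z t \<theta> h + ?T h" by (rule R1_ge[OF \<theta> sel(1) h order_refl])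
    moreover have "\<bar>f2 \<theta>h \<theta> h - f1 \<theta> h\<bar> \<le> R_one S r n z t \<theta>h hh + ?T h" by (rule R1_ge[OF sel(1) \<theta> h True])
    ultimately show ?thesis using nn crit R1_le R2_le lam unfolding comm by linarith
  next
    case False
    then have hl: "hh \<le> h" by simp
    \<comment> \<open>Chain through bandwidth hh. Minimality bounds the threshold at hh plus
      \<open>R_one\<close> of the selected pair by 2 lam plus the threshold at h; used for each of
      the three thresholds at hh, with 2 lam for the reference pair, this gives the 8 lam.\<close>
    have "\<bar>f2 \<theta> \<theta>h hh - f1 \<theta>h hh\<bar> \<le> R_one S r n z t \<theta> h + ?T hh" by (rule R1_ge[OF \<theta> sel(1,2) hl])
    moreover have "\<bar>f2 \<theta>h \<theta> hh - f1 \<theta> hh\<bar> \<le> R_one S r n z t \<theta>h hh + ?T hh" by (rule R1_ge[OF sel(1) \<theta> sel(2) order_refl])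
    moreover have "\<bar>f1 \<theta> h - f1 \<theta> hh\<bar> \<le> R_two S r n z t h + ?T hh" by (rule R2_ge[OF \<theta> h sel(2) hl])
    ultimately show ?thesis using nn crit R1_le R2_le lam unfolding comm by linarith
  qed
qed

text \<open>The lower end \<open>h0\<close> of the bandwidths is left free: 1 / n is used inside the
  oracle inequality, half of \<open>h_min\<close> for the bound on the loss at every sample size
  from 3 on.\<close>

lemma F_hat_bound:
  assumes a: "1/2 \<le> norm a" "norm a \<le> 1" and t: "t \<in> cube (1/2)" and \<eta>: "0 < h0" "h0 \<le> \<eta>" "\<eta> \<le> 1" and n: "0 < n"
  shows "\<bar>F_hat S n z (E3 a \<eta> 1) t\<bar> \<le> k\<^sup>2 / (dens_low S * h0) * (\<Sum>i=1..n. \<bar>snd (z i)\<bar>) / n"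
proof -
  have \<eta>0: "0 < \<eta>" using \<eta> by linarith
  have ph: "\<bar>phi (a, t, \<eta>, 1) x\<bar> \<le> k\<^sup>2 / (dens_low S * h0)" for x
  proof -
    have "\<bar>phi (a, t, \<eta>, 1) x\<bar> \<le> k\<^sup>2 / (dens_low S * (\<eta> * 1))"
      using main_window[OF a(1) t \<eta>0 \<eta>(3), of x] by (intro phi_le_window a \<eta>0) (auto intro: cube_mono)
    also have "\<dots> \<le> k\<^sup>2 / (dens_low S * h0)" using \<eta> design by (intro divide_left_mono) auto
    finally show ?thesis .
  qed
  have "\<bar>F_hat S n z (E3 a \<eta> 1) t\<bar> \<le> (\<Sum>i=1..n. \<bar>phi (a, t, \<eta>, 1) (fst (z i)) * snd (z i)\<bar>) / n"
    unfolding F_hat_phi abs_divide using n by (simp add: divide_right_mono)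
  also have "\<dots> \<le> (\<Sum>i=1..n. k\<^sup>2 / (dens_low S * h0) * \<bar>snd (z i)\<bar>) / n"
    unfolding abs_mult by (intro divide_right_mono sum_mono mult_right_mono ph) auto
  finally show ?thesis by (simp add: sum_distrib_left)
qed

end

context single_index_target
begin

text \<open>Each estimator is within half a threshold of its mean, so a difference of two estimators
  costs one threshold plus the bias. Passing from the true direction at h to the true value adds at
  most one lam and one threshold to the 8 and 4 of the oracle inequality.\<close>

lemma local_bound:
  fixes w :: 'a and t :: "real^2" and n :: nat
  defines "z \<equiv> observations X \<epsilon> n F w"
  assumes n: "large n" and t: "t \<in> cube (1/2)" and h: "h \<in> bandwidths S n" and lam: "0 \<le> lam"
    and dev: "\<And>s. s \<in> main_params n \<Longrightarrow> \<bar>F_hat_at n F w s - mean s F\<bar> \<le> TH S r n z (fst (snd (snd s))) / 2"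
    and T0: "0 \<le> TH S r n z h" and Tmono: "\<And>\<eta>. \<eta> \<in> bandwidths S n \<Longrightarrow> \<eta> \<le> h \<Longrightarrow> TH S r n z h \<le> TH S r n z \<eta>"
    and ok: "bias_ok h lam (t \<bullet> \<theta>0)"
    and T: "\<And>\<eta>. \<eta> \<in> bandwidths S n \<Longrightarrow> 0 \<le> TH S r n z \<eta>"
    and sel: "\<theta>h \<in> unit_circle" "hh \<in> bandwidths S n"
      "\<And>\<theta> h. \<theta> \<in> unit_circle \<Longrightarrow> h \<in> bandwidths S n \<Longrightarrow> criterion S r n z t (\<theta>h, hh) \<le> criterion S r n z t (\<theta>, h)"
  shows "\<bar>F_hat S n z (E_one \<theta>h hh) t - F t\<bar> \<le> 9 * lam + 5 * TH S r n z h"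
proof -
  have main1: "(\<nu>, t, \<eta>, 1) \<in> main_params n" if "\<nu> \<in> unit_circle" "\<eta> \<in> bandwidths S n" for \<nu> \<eta>
    using that t by (auto simp: main_params_def)
  have main2: "(mid \<theta> \<nu>, t, \<eta>, 1) \<in> main_params n" if "\<theta> \<in> unit_circle" "\<nu> \<in> unit_circle" "\<eta> \<in> bandwidths S n" for \<theta> \<nu> \<eta>
    using that t mid_props(4,5)[OF that(1,2)] by (auto simp: main_params_def)
  have n0: "0 < n" "0 < 1 / real n" using n by (auto simp: large_def)
  have bp: "1 / n \<le> \<eta>" "\<eta> \<le> 1" "0 < \<eta>" if "\<eta> \<in> bandwidths S n" for \<eta> using bandwidths_pos[OF n that] by auto
  have d1: "\<bar>F_hat S n z (E_one \<nu> \<eta>) t - mean (\<nu>, t, \<eta>, 1) F\<bar> \<le> TH S r n z \<eta> / 2"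
    if "\<nu> \<in> unit_circle" "\<eta> \<in> bandwidths S n" for \<nu> \<eta>
    using dev[OF main1[OF that]] by (simp add: F_hat_at_def E_one_E3 z_def)
  have d2: "\<bar>F_hat S n z (E_two \<theta> \<nu> \<eta>) t - mean (mid \<theta> \<nu>, t, \<eta>, 1) F\<bar> \<le> TH S r n z \<eta> / 2"
    if "\<theta> \<in> unit_circle" "\<nu> \<in> unit_circle" "\<eta> \<in> bandwidths S n" for \<theta> \<nu> \<eta>
    using dev[OF main2[OF that]] by (simp add: F_hat_at_def E_two_E3 z_def)
  have "\<bar>F_hat S n z (E_one \<theta>h hh) t - F_hat S n z (E_one \<theta>0 h) t\<bar> \<le> 8 * lam + 4 * TH S r n z h"
  proof (rule oracle_inequality[OF _ _ T sel \<theta>0 h _ _ lam])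
    let ?C = "k\<^sup>2 / (dens_low S * (1 / n)) * (\<Sum>i=1..n. \<bar>snd (z i)\<bar>) / n"
    show "\<bar>F_hat S n z (E_one \<nu> \<eta>) t\<bar> \<le> ?C" if "\<nu> \<in> unit_circle" "\<eta> \<in> bandwidths S n" for \<nu> \<eta>
      unfolding E_one_E3 using that bp[OF that(2)] n0 by (intro F_hat_bound t) auto
    show "\<bar>F_hat S n z (E_two \<theta> \<nu> \<eta>) t\<bar> \<le> ?C" if "\<theta> \<in> unit_circle" "\<nu> \<in> unit_circle" "\<eta> \<in> bandwidths S n" for \<theta> \<nu> \<eta>
      unfolding E_two_E3 using mid_props(4,5)[OF that(1,2)] bp[OF that(3)] n0 by (intro F_hat_bound t) auto
    show "\<bar>F_hat S n z (E_two \<theta>0 \<nu> \<eta>) t - F_hat S n z (E_one \<nu> \<eta>) t\<bar> \<le> lam + TH S r n z \<eta>"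
      if "\<nu> \<in> unit_circle" "\<eta> \<in> bandwidths S n" "\<eta> \<le> h" for \<nu> \<eta>
      using d1[OF that(1,2)] d2[OF \<theta>0 that(1,2)] bias_two_one[OF ok that(1) bp(3)[OF that(2)] that(3)] by linarith
    show "\<bar>F_hat S n z (E_one \<nu> h) t - F_hat S n z (E_one \<nu> \<eta>) t\<bar> \<le> lam + TH S r n z \<eta>"
      if "\<nu> \<in> unit_circle" "\<eta> \<in> bandwidths S n" "\<eta> \<le> h" for \<nu> \<eta>
      using d1[OF that(1,2)] d1[OF that(1) h] bias_one_one[OF ok that(1) bp(3)[OF that(2)] that(3)] Tmono[OF that(2,3)] by linarith
  qed
  moreover have "\<bar>F_hat S n z (E_one \<theta>0 h) t - F t\<bar> \<le> lam + TH S r n z h"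
    using d1[OF \<theta>0 h] bias_one_truth[OF ok bp(3)[OF h]] T0 by linarith
  ultimately show ?thesis by linarith
qed

end

section \<open>Orders of magnitude of the constants\<close>

lemma ln_ge_1: "3 \<le> n \<Longrightarrow> 1 \<le> ln (real n)"
proof -
  assume "3 \<le> n"
  then have "exp 1 \<le> real n" using exp_le by linarith
  then show ?thesis using ln_mono[of "exp 1" "real n"] by simp
qed

context single_index_model
begin

definition G where "G = dens_low S powr (-1/2)"

lemma G_ge_1: "1 \<le> G"
proof -
  have "1 = 1 powr (-1/2 :: real)" by simp
  also have "\<dots> \<le> dens_low S powr (-1/2)" using design by (intro powr_mono2') auto
  finally show ?thesis by (simp add: G_def)
qed

lemma lip_ge: "1/2 \<le> lip S" using k1 kern_inf_le by linarith

definition T0 where "T0 = (4 * r + 1) / Omg S"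

lemma T0_ge_1: "1 \<le> T0" using noise_params r by (simp add: T0_def)

lemma tau_eq: "3 \<le> n \<Longrightarrow> tau S r n = T0 powr (1 / omg S) * ln n powr (1 / omg S)"
proof -
  assume n: "3 \<le> n"
  have "tau S r n = (T0 * ln n) powr (1 / omg S)" by (simp add: tau_def T0_def)
  also have "\<dots> = T0 powr (1 / omg S) * ln n powr (1 / omg S)"
    by (rule powr_mult)
  finally show ?thesis .
qed

lemma tau_ge_1: "3 \<le> n \<Longrightarrow> 1 \<le> tau S r n"
proof -
  assume n: "3 \<le> n"
  have "1 * 1 \<le> T0 * ln n" using ln_ge_1[OF n] T0_ge_1 by (intro mult_mono) auto
  then show ?thesis using noise_params by (simp add: tau_def T0_def ge_one_powr_ge_zero)
qed

lemma ln_tau_le: "3 \<le> n \<Longrightarrow> ln (tau S r n) \<le> 1 / omg S * T0 * ln n"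
proof -
  assume n: "3 \<le> n"
  have p: "0 < T0 * ln n" using ln_ge_1[OF n] T0_ge_1 by (intro mult_pos_pos) auto
  have "ln (tau S r n) = 1 / omg S * ln (T0 * ln n)" using p by (simp add: tau_def T0_def ln_powr)
  also have "\<dots> \<le> 1 / omg S * (T0 * ln n)"
    using noise_params ln_le_minus_one[OF p] by (intro mult_left_mono) auto
  finally show ?thesis by simp
qed

lemma ln_sq_mult: "3 \<le> n \<Longrightarrow> 0 < A \<Longrightarrow> ln (real n ^ 2 * A) = 2 * ln n + ln A"
  by (simp add: ln_mult ln_realpow)

lemma c_forms:
  assumes n: "3 \<le> n"
  shows "c1 S r n = 730 * (2 * ln n + ln (16 * G * (12 * lip S + sqrt 2))) + 8 * r * ln n + 394"
    "c2 S r n = 730 * (2 * ln n + (ln (tau S r n) + ln (16 * G * (12 * lip S + sqrt 2)))) + 8 * r * ln n + 394"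
    "c3 S r n = 365 * (2 * ln n + ln (5 * lip S * G)) + 8 * r * ln n + 197"
    "c4 S r n = 365 * (2 * ln n + (ln (tau S r n) + ln (5 * lip S * G))) + 8 * r * ln n + 197"
proof -
  have t: "0 < tau S r n" using tau_ge_1[OF n] by linarith
  have p1: "0 < 16 * G * (12 * lip S + sqrt 2)" using G_ge_1 lip_ge by (intro mult_pos_pos add_pos_pos) auto
  have p2: "0 < 5 * lip S * G" using G_ge_1 lip_ge by (intro mult_pos_pos) auto
  have e1: "16 * real n ^ 2 * dens_low S powr (-1/2) * (12 * lip S + sqrt 2) = real n ^ 2 * (16 * G * (12 * lip S + sqrt 2))"
    by (simp add: G_def mult_ac)
  have e2: "16 * real n ^ 2 * tau S r n * dens_low S powr (-1/2) * (12 * lip S + sqrt 2) = real n ^ 2 * (tau S r n * (16 * G * (12 * lip S + sqrt 2)))"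
    by (simp add: G_def mult_ac)
  have e3: "5 * real n ^ 2 * lip S * dens_low S powr (-1/2) = real n ^ 2 * (5 * lip S * G)"
    by (simp add: G_def mult_ac)
  have e4: "5 * real n ^ 2 * tau S r n * lip S * dens_low S powr (-1/2) = real n ^ 2 * (tau S r n * (5 * lip S * G))"
    by (simp add: G_def mult_ac)
  show "c1 S r n = 730 * (2 * ln n + ln (16 * G * (12 * lip S + sqrt 2))) + 8 * r * ln n + 394"
    unfolding c1_def e1 ln_sq_mult[OF n p1] by simp
  show "c3 S r n = 365 * (2 * ln n + ln (5 * lip S * G)) + 8 * r * ln n + 197"
    unfolding c3_def e3 ln_sq_mult[OF n p2] by simp
  show "c2 S r n = 730 * (2 * ln n + (ln (tau S r n) + ln (16 * G * (12 * lip S + sqrt 2)))) + 8 * r * ln n + 394"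
    unfolding c2_def e2 ln_sq_mult[OF n mult_pos_pos[OF t p1]] ln_mult_pos[OF t p1] by simp
  show "c4 S r n = 365 * (2 * ln n + (ln (tau S r n) + ln (5 * lip S * G))) + 8 * r * ln n + 197"
    unfolding c4_def e4 ln_sq_mult[OF n mult_pos_pos[OF t p2]] ln_mult_pos[OF t p2] by simp
qed

lemma c_args: "1 \<le> 16 * G * (12 * lip S + sqrt 2)" "1 \<le> 5 * lip S * G"
proof -
  have "1 * 1 \<le> (16 * G) * (12 * lip S + sqrt 2)" using G_ge_1 lip_ge by (intro mult_mono add_increasing2) auto
  then show "1 \<le> 16 * G * (12 * lip S + sqrt 2)" by simp
  have "1 * 1 \<le> (5 * lip S) * G" using G_ge_1 lip_ge by (intro mult_mono) auto
  then show "1 \<le> 5 * lip S * G" by simp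
qed

text \<open>These bounds let the constants in the threshold absorb the exponent 40 ln n of the
  deviation bound.\<close>

lemma c_lower:
  assumes n: "3 \<le> n"
  shows "1460 * ln n \<le> c1 S r n" "1460 * ln n \<le> c2 S r n" "0 \<le> c3 S r n" "730 * ln n \<le> c4 S r n"
proof -
  have a: "0 \<le> ln (tau S r n)" using tau_ge_1[OF n] by simp
  have b: "0 \<le> ln (16 * G * (12 * lip S + sqrt 2))" "0 \<le> ln (5 * lip S * G)" using c_args by simp_all
  have "0 \<le> r * ln n" using r ln_ge_1[OF n] by (intro mult_nonneg_nonneg) auto
  then show "1460 * ln n \<le> c1 S r n" "1460 * ln n \<le> c2 S r n" "0 \<le> c3 S r n" "730 * ln n \<le> c4 S r n"
    unfolding c_forms[OF n] using a b ln_ge_1[OF n] by (simp_all add: mult.assoc)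
qed

lemma c_upper: "\<exists>C\<ge>0. \<forall>n\<ge>3. c1 S r n \<le> C * ln n \<and> c2 S r n \<le> C * ln n \<and> c3 S r n \<le> C * ln n \<and> c4 S r n \<le> C * ln n"
proof -
  define A where "A = ln (16 * G * (12 * lip S + sqrt 2)) + ln (5 * lip S * G)"
  define B where "B = 1 / omg S * T0"
  define C where "C = 730 * (2 + (B + A)) + 8 * r + 394"
  have b: "0 \<le> ln (16 * G * (12 * lip S + sqrt 2))" "0 \<le> ln (5 * lip S * G)" using c_args by simp_all
  have B: "0 \<le> B" using noise_params T0_ge_1 by (simp add: B_def)
  have C: "0 \<le> C" using b B r by (simp add: C_def A_def)
  have "c1 S r n \<le> C * ln n \<and> c2 S r n \<le> C * ln n \<and> c3 S r n \<le> C * ln n \<and> c4 S r n \<le> C * ln n" if n: "3 \<le> n" for n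
  proof -
    have L: "1 \<le> ln (real n)" by (rule ln_ge_1[OF n])
    have t: "ln (tau S r n) \<le> B * ln n" using ln_tau_le[OF n] by (simp add: B_def)
    have "A * 1 \<le> A * ln n" using b L by (intro mult_left_mono) (auto simp: A_def)
    then have A: "ln (16 * G * (12 * lip S + sqrt 2)) \<le> A * ln n" "ln (5 * lip S * G) \<le> A * ln n"
      using b by (auto simp: A_def)
    have AL: "0 \<le> A * ln n" using A b by linarith
    have BL: "0 \<le> B * ln n" using B L by (intro mult_nonneg_nonneg) auto
    have Cn: "C * ln n = 730 * (2 * ln n + (B * ln n + A * ln n)) + 8 * r * ln n + 394 * ln n"
      by (simp add: C_def algebra_simps)
    have gen: "730 * (2 * y + x) + q + 394 \<le> 730 * (2 * y + z) + q + 394 * y"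
      "365 * (2 * y + x) + q + 197 \<le> 730 * (2 * y + z) + q + 394 * y"
      if "x \<le> z" "1 \<le> y" "0 \<le> z" for x y z q :: real proof -
      have "730 * x \<le> 730 * z" "365 * x \<le> 365 * z" "0 \<le> 365 * z" "394 * 1 \<le> 394 * y" using that by simp_all
      then show "730 * (2 * y + x) + q + 394 \<le> 730 * (2 * y + z) + q + 394 * y"
        "365 * (2 * y + x) + q + 197 \<le> 730 * (2 * y + z) + q + 394 * y" using that unfolding distrib_left by simp_all
    qed
    show ?thesis unfolding c_forms[OF n] Cn using A AL BL t
      by (intro conjI gen L add_mono add_nonneg_nonneg) (auto intro: add_increasing)
  qed
  then show ?thesis using C by (intro exI[of _ C]) auto
qed

text \<open>The quantity n h^2 for the pilot bandwidth h. It is a power of ln n only, so the pilot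
  errors vanish at logarithmic speed.\<close>

definition U where "U n = ln (real n) powr (1 + 1 / omg S)"

lemma U_eq: "3 \<le> n \<Longrightarrow> real n * (h_pilot S n)\<^sup>2 = U n"
  by (simp add: h_pilot_def U_def)

lemma U_ge_1: "3 \<le> n \<Longrightarrow> 1 \<le> U n"
  using ln_ge_1[of n] noise_params by (simp add: U_def ge_one_powr_ge_zero)

lemma C_nonneg:
  assumes n: "3 \<le> n" shows "0 \<le> C1 S r n" "0 \<le> C2 S r n" "0 \<le> C3 S r n" "0 \<le> C4 S r n" "0 \<le> C5 S r n"
proof -
  have L: "1 \<le> ln (real n)" by (rule ln_ge_1[OF n])
  have "0 \<le> c1 S r n" "0 \<le> c2 S r n" "0 \<le> c3 S r n" "0 \<le> c4 S r n" using c_lower[OF n] L by linarith+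
  moreover have "0 \<le> max (sigma S) 1" by simp
  ultimately show "0 \<le> C1 S r n" "0 \<le> C2 S r n" "0 \<le> C3 S r n" and c4: "0 \<le> C4 S r n"
    unfolding C1_def C2_def C3_def C4_def using design tau_nonneg[of n] L
    by (intro add_nonneg_nonneg mult_nonneg_nonneg; simp)+
  show "0 \<le> C5 S r n" unfolding C5_def using c4 by (intro add_nonneg_nonneg mult_nonneg_nonneg) auto
qed

lemma powr_le_sqrt_ln:
  assumes n: "3 \<le> n" and e: "e \<le> 1/2" shows "ln (real n) powr e \<le> sqrt (ln n)"
  using powr_mono[OF e ln_ge_1[OF n]] ln_ge_1[OF n] by (simp add: powr_half_sqrt)

text \<open>\<open>C1\<close> and \<open>C2\<close> of order sqrt (ln n) and a bounded
  \<open>C5\<close> give the threshold the order sqrt (ln n / (\<eta> n)). The negative powers of ln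
  n compensate the linear Bernstein terms, in \<open>C4\<close> together with the factor
  \<open>tau\<close>. The decay of the last quantity is what makes the set behind \<open>n1\<close>
  nonempty.\<close>

lemma C_upper: "\<exists>C\<ge>0. \<forall>n\<ge>3. C1 S r n \<le> C * sqrt (ln n) \<and> C2 S r n \<le> C * sqrt (ln n) \<and>
   U n powr (-1/2) * C4 S r n \<le> C \<and> C5 S r n \<le> C \<and> U n powr (-1/2) * C3 S r n \<le> C * ln n powr (- 1 / (2 * omg S))"
proof -
  obtain c where c: "0 \<le> c" and cu: "\<And>n. 3 \<le> n \<Longrightarrow> c1 S r n \<le> c * ln n \<and> c2 S r n \<le> c * ln n \<and> c3 S r n \<le> c * ln n \<and> c4 S r n \<le> c * ln n"
    using c_upper by blast
  define g where "g = inverse (dens_low S)"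
  define T where "T = T0 powr (1 / omg S)"
  define s where "s = max (sigma S) 1"
  define D where "D = 2 * sqrt 2 * s * G * k\<^sup>2 * sqrt c + 8/3 * c * g * k\<^sup>2 * max 1 T"
  define C where "C = D + (kern_one S)\<^sup>2 + 1/2"
  have g: "0 \<le> g" and s: "1 \<le> s" and T: "0 \<le> T" using design by (auto simp: g_def s_def T_def)
  have om: "0 < omg S" using noise_params by simp
  have G0: "0 \<le> G" using G_ge_1 by simp
  have D0: "0 \<le> D" unfolding D_def using g s G0 c by (intro add_nonneg_nonneg mult_nonneg_nonneg) auto
  have C: "0 \<le> C" and DC: "D \<le> C" using D0 by (auto simp: C_def)
  \<comment> \<open>\<open>C1\<close> to \<open>C4\<close> share the shape of a square root term
    plus a linear term; this bounds the shape once for all of them.\<close>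
  have gen: "2 * sqrt 2 * s' * G * k\<^sup>2 * A + 8/3 * c * g * k\<^sup>2 * T' * B \<le> D * R"
    if "0 \<le> s'" "s' \<le> s" "A \<le> sqrt c * R" "B \<le> R" "0 \<le> R" "0 \<le> T'" "T' \<le> max 1 T" for s' A B R T'
  proof -
    have "2 * sqrt 2 * s' * G * k\<^sup>2 * A \<le> 2 * sqrt 2 * s * G * k\<^sup>2 * (sqrt c * R)"
      using that c G0 by (intro order.trans[OF mult_left_mono[OF that(3)]] mult_right_mono mult_left_mono mult_nonneg_nonneg) auto
    moreover have "8/3 * c * g * k\<^sup>2 * T' * B \<le> 8/3 * c * g * k\<^sup>2 * max 1 T * R"
      using that c g by (intro order.trans[OF mult_left_mono[OF that(4)]] mult_right_mono mult_left_mono mult_nonneg_nonneg) auto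
    ultimately have "2 * sqrt 2 * s' * G * k\<^sup>2 * A + 8/3 * c * g * k\<^sup>2 * T' * B \<le>
      2 * sqrt 2 * s * G * k\<^sup>2 * (sqrt c * R) + 8/3 * c * g * k\<^sup>2 * max 1 T * R" by (rule add_mono)
    also have "\<dots> = D * R" by (simp only: D_def distrib_right mult.assoc)
    finally show ?thesis .
  qed
  have "C1 S r n \<le> C * sqrt (ln n) \<and> C2 S r n \<le> C * sqrt (ln n) \<and>
   U n powr (-1/2) * C4 S r n \<le> C \<and> C5 S r n \<le> C \<and> U n powr (-1/2) * C3 S r n \<le> C * ln n powr (- 1 / (2 * omg S))"
    if n: "3 \<le> n" for n
  proof -
    let ?l = "ln (real n)"
    have L: "1 \<le> ?l" by (rule ln_ge_1[OF n])
    have L0: "0 < ?l" using L by linarith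
    have sq: "sqrt x \<le> sqrt c * sqrt ?l" if "x \<le> c * ?l" for x
      using real_sqrt_le_mono[OF that] by (simp add: real_sqrt_mult)
    note cu = cu[OF n]
    have U: "U n powr (-1/2) = ?l powr (- (1 + 1 / omg S) / 2)"
    proof -
      have e: "x * (- 1 / 2) = - x / 2" for x :: real by simp
      show ?thesis unfolding U_def powr_powr e ..
    qed
    have DCs: "D * sqrt ?l \<le> C * sqrt ?l" using DC L by (intro mult_right_mono) auto
    have ll: "x * ?l powr e \<le> c * ?l powr (1 + e)" if "x \<le> c * ?l" for x e
      using mult_right_mono[OF that powr_ge_zero[of ?l e]] L0 by (simp add: powr_add mult.assoc)
    have 1: "C1 S r n \<le> C * sqrt ?l"
    proof -
      define B where "B = ?l powr (1 + - (2 + omg S) / (2 * omg S))"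
      have "1 + - (2 + omg S) / (2 * omg S) \<le> 1/2" using om by (simp add: field_simps)
      then have B: "B \<le> sqrt ?l" unfolding B_def by (rule powr_le_sqrt_ln[OF n])
      have "c1 S r n * ?l powr (- (2 + omg S) / (2 * omg S)) \<le> c * B"
        unfolding B_def by (rule ll) (use cu in simp)
      then have "8/3 * (c1 S r n * ?l powr (- (2 + omg S) / (2 * omg S))) * (g * k\<^sup>2) \<le> 8/3 * (c * B) * (g * k\<^sup>2)"
        using g by (intro mult_right_mono mult_left_mono) auto
      then have "C1 S r n \<le> 2 * sqrt 2 * 1 * G * k\<^sup>2 * sqrt (c1 S r n) + 8/3 * c * g * k\<^sup>2 * 1 * B"
        unfolding C1_def G_def[symmetric] g_def[symmetric] by (simp add: mult_ac)
      also have "\<dots> \<le> D * sqrt ?l" by (rule gen) (use s sq[of "c1 S r n"] cu B L in auto)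
      finally show ?thesis using DCs by linarith
    qed
    have 2: "C2 S r n \<le> C * sqrt ?l"
    proof -
      define B where "B = ?l powr (1 + -1/2)"
      have B: "B \<le> sqrt ?l" unfolding B_def by (rule powr_le_sqrt_ln[OF n]) simp
      have "c2 S r n * ?l powr (-1/2) \<le> c * B"
        unfolding B_def by (rule ll) (use cu in simp)
      then have "8/3 * (c2 S r n * ?l powr (-1/2)) * (g * k\<^sup>2 * T) \<le> 8/3 * (c * B) * (g * k\<^sup>2 * T)"
        using g T by (intro mult_right_mono mult_left_mono) auto
      then have "C2 S r n \<le> 2 * sqrt 2 * s * G * k\<^sup>2 * sqrt (c2 S r n) + 8/3 * c * g * k\<^sup>2 * T * B"
        unfolding C2_def G_def[symmetric] g_def[symmetric] s_def[symmetric] T0_def[symmetric] T_def[symmetric] by (simp add: mult_ac)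
      also have "\<dots> \<le> D * sqrt ?l" by (rule gen) (use s sq[of "c2 S r n"] cu B L T in auto)
      finally show ?thesis using DCs by linarith
    qed
    have nU: "real n * (h_pilot S n)\<^sup>2 = U n" by (rule U_eq[OF n])
    have UU: "U n powr (-1/2) * U n powr (-1/2) = ?l powr (- (1 + 1 / omg S))"
    proof -
      have e: "- x / 2 + - x / 2 = - x" for x :: real by simp
      show ?thesis unfolding U powr_add[symmetric] e ..
    qed
    have half: "sqrt x * U n powr (-1/2) \<le> sqrt c * ?l powr (- 1 / (2 * omg S))" if "x \<le> c * ?l" for x
    proof -
      have "1/2 + - (1 + 1 / omg S) / 2 = - 1 / (2 * omg S)" using om by (simp add: field_simps)
      then have e: "sqrt ?l * U n powr (-1/2) = ?l powr (- 1 / (2 * omg S))"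
        unfolding U powr_half_sqrt[OF less_imp_le[OF L0], symmetric] powr_add[symmetric] by (simp only:)
      have "sqrt x * U n powr (-1/2) \<le> sqrt c * sqrt ?l * U n powr (-1/2)" by (intro mult_right_mono sq that) auto
      then show ?thesis unfolding mult.assoc e .
    qed
    have le1: "?l powr e \<le> 1" if "e \<le> 0" for e using powr_mono[OF that L] L0 by simp
    have 4: "U n powr (-1/2) * C4 S r n \<le> D"
    proof -
      have "tau S r n * c4 S r n * (U n powr (-1/2) * U n powr (-1/2)) \<le> T * c"
      proof -
        have "tau S r n * c4 S r n * (U n powr (-1/2) * U n powr (-1/2)) = T * (c4 S r n * ?l powr (1 / omg S + - (1 + 1 / omg S)))"
          unfolding UU tau_eq[OF n] T_def[symmetric] powr_add by (simp only: mult_ac)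
        also have "\<dots> \<le> T * (c * ?l powr (1 + (1 / omg S + - (1 + 1 / omg S))))"
          using T cu by (intro mult_left_mono ll) auto
        finally show ?thesis using L0 by simp
      qed
      then have e2: "8/3 * (tau S r n * c4 S r n * (U n powr (-1/2) * U n powr (-1/2))) * (g * k\<^sup>2) \<le> 8/3 * (T * c) * (g * k\<^sup>2)"
        using g by (intro mult_right_mono mult_left_mono) auto
      have "sqrt (c4 S r n) * U n powr (-1/2) \<le> sqrt c * 1"
        using c om le1[of "- 1 / (2 * omg S)"] cu by (intro order.trans[OF half] mult_left_mono) auto
      then have "2 * sqrt 2 * s * G * k\<^sup>2 * (sqrt (c4 S r n) * U n powr (-1/2)) + 8/3 * c * g * k\<^sup>2 * T * 1 \<le> D * 1"
        by (intro gen) (use s T in auto)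
      moreover have "U n powr (-1/2) * C4 S r n = 2 * sqrt 2 * s * G * k\<^sup>2 * (sqrt (c4 S r n) * U n powr (-1/2))
         + 8/3 * (tau S r n * c4 S r n * (U n powr (-1/2) * U n powr (-1/2))) * (g * k\<^sup>2)"
        unfolding C4_def nU G_def[symmetric] g_def[symmetric] s_def[symmetric] by (simp add: distrib_left mult_ac)
      ultimately show ?thesis using e2 by (simp add: mult_ac)
    qed
    have 5: "C5 S r n \<le> C" using 4 unfolding C5_def nU C_def by (simp add: mult.commute)
    have 3: "U n powr (-1/2) * C3 S r n \<le> C * ?l powr (- 1 / (2 * omg S))"
    proof -
      define R where "R = ?l powr (- 1 / (2 * omg S))"
      define B where "B = ?l powr (1 + - (1 + 1 / omg S))"
      have B: "B \<le> R" unfolding B_def R_def using L om by (intro powr_mono) (auto simp: field_simps)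
      have "c3 S r n * (U n powr (-1/2) * U n powr (-1/2)) \<le> c * B"
        unfolding UU B_def by (rule ll) (use cu in simp)
      then have e2: "8/3 * (c3 S r n * (U n powr (-1/2) * U n powr (-1/2))) * (g * k\<^sup>2) \<le> 8/3 * (c * B) * (g * k\<^sup>2)"
        using g by (intro mult_right_mono mult_left_mono) auto
      have "2 * sqrt 2 * 1 * G * k\<^sup>2 * (sqrt (c3 S r n) * U n powr (-1/2)) + 8/3 * c * g * k\<^sup>2 * 1 * B \<le> D * R"
        by (rule gen) (use s B half[of "c3 S r n"] cu in \<open>auto simp: R_def\<close>)
      moreover have "U n powr (-1/2) * C3 S r n = 2 * sqrt 2 * 1 * G * k\<^sup>2 * (sqrt (c3 S r n) * U n powr (-1/2))
         + 8/3 * (c3 S r n * (U n powr (-1/2) * U n powr (-1/2))) * (g * k\<^sup>2)"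
        unfolding C3_def nU G_def[symmetric] g_def[symmetric] by (simp add: distrib_left mult_ac)
      moreover have "D * R \<le> C * R" using DC by (intro mult_right_mono) (auto simp: R_def)
      ultimately show ?thesis using e2 unfolding R_def by (simp add: mult_ac)
    qed
    show ?thesis using 1 2 3 4 5 DC by auto
  qed
  then show ?thesis using C by (intro exI[of _ C]) auto
qed

text \<open>The part of the pilot error that is not covered by the \<open>C4\<close> summand of
  \<open>C5\<close>; it tends to 0 and has to fit under the summand 1/2 of
  \<open>C5\<close>.\<close>

definition pilot_err :: "real \<Rightarrow> real \<Rightarrow> nat \<Rightarrow> real" where
  "pilot_err M b0 n = 2 * sqrt (80 * k ^ 4 / dens_low S * (M\<^sup>2 + (sigma S)\<^sup>2) * (ln n / U n))
     + 160 * k\<^sup>2 / dens_low S * M * (ln n / U n) + net_err n M + k * (k + 1) * M * h_pilot S n powr b0"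

definition sample_size_ok :: "real \<Rightarrow> real \<Rightarrow> nat \<Rightarrow> bool" where
  "sample_size_ok M b0 n \<longleftrightarrow> 3 \<le> n \<and> large n \<and> pilot_err M b0 n \<le> 1/2 \<and> net_err n M \<le> 1 / sqrt n"

lemma eventually_large: "eventually large sequentially"
proof -
  define e where "e = 1 + 2 / omg S"
  define e' where "e' = 1 + 1 / omg S"
  have e: "0 < e" "0 < e'" using noise_params by (auto simp: e_def e'_def add_pos_pos)
  have 1: "eventually (\<lambda>n. 2 \<le> ln (real n) powr e) sequentially" using e by real_asymp
  have 2: "eventually (\<lambda>n. ln (real n) powr e' < real n) sequentially" using e by real_asymp
  have 3: "eventually (\<lambda>n. 1 \<le> ln (real n) powr e') sequentially" using e by real_asymp
  show ?thesis using 1 2 3 eventually_ge_at_top[of 3]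
  proof eventually_elim
    case (elim n)
    have n: "0 < real n" using elim by simp
    have hp: "(h_pilot S n)\<^sup>2 = ln n powr e' / n" by (simp add: h_pilot_def e'_def)
    have h0: "0 \<le> h_pilot S n" by (simp add: h_pilot_def)
    have "(h_pilot S n)\<^sup>2 < 1\<^sup>2" unfolding hp using elim n by simp
    then have h1: "h_pilot S n < 1" by (rule power2_less_imp_less) simp
    have h2: "1 / n \<le> (h_pilot S n)\<^sup>2" unfolding hp using elim n by (intro divide_right_mono) auto
    have "(h_pilot S n)\<^sup>2 \<le> h_pilot S n" using h0 h1 by (simp add: power2_eq_square mult_left_le_one_le)
    then have "1 / n \<le> h_pilot S n" using h2 by linarith
    moreover have "2 / n \<le> h_min S n" unfolding h_min_def e_def[symmetric] using elim n by (intro divide_right_mono) auto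
    ultimately show ?case using elim h1 h2 by (simp add: large_def)
  qed
qed

lemma tau_lim: "(\<lambda>n. tau S r n / n) \<longlonglongrightarrow> 0" "(\<lambda>n. tau S r n / sqrt n) \<longlonglongrightarrow> 0"
proof -
  define e where "e = 1 / omg S"
  have e: "0 < e" using noise_params by (simp add: e_def)
  have T: "0 < T0" using T0_ge_1 by linarith
  have "(\<lambda>n. (T0 * ln (real n)) powr e / real n) \<longlonglongrightarrow> 0" using e T by real_asymp
  then show "(\<lambda>n. tau S r n / n) \<longlonglongrightarrow> 0" by (simp add: tau_def T0_def e_def)
  have "(\<lambda>n. (T0 * ln (real n)) powr e / sqrt (real n)) \<longlonglongrightarrow> 0" using e T by real_asymp
  then show "(\<lambda>n. tau S r n / sqrt n) \<longlonglongrightarrow> 0" by (simp add: tau_def T0_def e_def)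
qed

lemma eventually_sample_size_ok:
  assumes b0: "0 < b0"
  shows "eventually (sample_size_ok M b0) sequentially"
proof -
  define e' where "e' = 1 / omg S"
  have e: "0 < e'" using noise_params by (simp add: e'_def)
  have "(\<lambda>n. ln (real n) / ln (real n) powr (1 + e')) \<longlonglongrightarrow> 0" using e by real_asymp
  then have lU: "(\<lambda>n. ln (real n) / U n) \<longlonglongrightarrow> 0" by (simp add: U_def e'_def)
  have "(\<lambda>n. 2 * lip_const * (M * (1 / real n) + tau S r n / n)) \<longlonglongrightarrow> 2 * lip_const * (M * 0 + 0)"
    by (intro tendsto_intros tau_lim lim_1_over_n)
  moreover have "(\<lambda>n. net_err n M) = (\<lambda>n. 2 * lip_const * (M * (1 / real n) + tau S r n / n))"
    by (rule ext) (simp add: net_err_def add_divide_distrib[symmetric])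
  ultimately have ne: "(\<lambda>n. net_err n M) \<longlonglongrightarrow> 0" by simp
  have "(\<lambda>n. sqrt (ln (real n) powr (1 + e') / real n)) \<longlonglongrightarrow> 0" using e by real_asymp
  then have hp: "h_pilot S \<longlonglongrightarrow> 0" by (simp add: h_pilot_def[abs_def] e'_def)
  have "(\<lambda>n. h_pilot S n powr b0) \<longlonglongrightarrow> 0 powr b0"
  proof (rule tendsto_powr'[OF hp tendsto_const])
    have "0 \<le> h_pilot S n" for n by (simp add: h_pilot_def)
    then show "0 \<noteq> 0 \<or> 0 < b0 \<and> (\<forall>\<^sub>F n in sequentially. 0 \<le> h_pilot S n)" using b0 by simp
  qed
  then have hb: "(\<lambda>n. h_pilot S n powr b0) \<longlonglongrightarrow> 0" by simp
  have "pilot_err M b0 \<longlonglongrightarrow> 2 * sqrt (80 * k ^ 4 / dens_low S * (M\<^sup>2 + (sigma S)\<^sup>2) * 0)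
     + 160 * k\<^sup>2 / dens_low S * M * 0 + 0 + k * (k + 1) * M * 0"
    unfolding pilot_err_def by (intro tendsto_intros lU ne hb)
  then have pe: "pilot_err M b0 \<longlonglongrightarrow> 0" by simp
  have 1: "eventually (\<lambda>n. pilot_err M b0 n < 1/2) sequentially" by (rule order_tendstoD(2)[OF pe]) simp
  have l1: "(\<lambda>n. 1 / sqrt (real n)) \<longlonglongrightarrow> 0" by real_asymp
  have "(\<lambda>n. 2 * lip_const * (M * (1 / sqrt (real n)) + tau S r n / sqrt n)) \<longlonglongrightarrow> 2 * lip_const * (M * 0 + 0)"
    by (intro tendsto_intros tau_lim l1)
  then have "(\<lambda>n. 2 * lip_const * (M * (1 / sqrt (real n)) + tau S r n / sqrt n)) \<longlonglongrightarrow> 0" by simp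
  then have 2: "eventually (\<lambda>n. 2 * lip_const * (M * (1 / sqrt (real n)) + tau S r n / sqrt n) < 1) sequentially"
    by (rule order_tendstoD(2)) simp
  show ?thesis using 1 2 eventually_large eventually_ge_at_top[of 3]
  proof eventually_elim
    case (elim n)
    have n: "0 < sqrt (real n)" using elim by simp
    have "net_err n M = (2 * lip_const * (M * (1 / sqrt (real n)) + tau S r n / sqrt n)) / sqrt n"
      using n by (simp add: net_err_def field_simps)
    also have "\<dots> \<le> 1 / sqrt n" using elim n by (intro divide_right_mono) auto
    finally show ?case using elim by (simp add: sample_size_ok_def)
  qed
qed

end

section \<open>Loss on the good event\<close>

context single_index_target
begin

lemma b0_pos: "0 < b0"
  using nik_kernel_axioms by (simp add: nik_kernel_def nik_kernel_axioms_def)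

definition F_sup :: real where "F_sup = (SUP x \<in> cube (5/2). \<bar>F x\<bar>)"

lemma cube_nonempty: "0 \<le> c \<Longrightarrow> 0 \<in> cube c"
  by (simp add: cube_def)

lemma F_le_F_sup: "x \<in> cube (5/2) \<Longrightarrow> \<bar>F x\<bar> \<le> F_sup"
  unfolding F_sup_def by (rule cSUP_upper) (auto intro!: bdd_aboveI2[where M=M] F_le)

lemma F_sup_nonneg: "0 \<le> F_sup"
  using order.trans[OF abs_ge_zero F_le_F_sup[OF cube_nonempty]] by simp

text \<open>The pilot mean averages f twice, over windows no longer than h. The inner average moves
  f by k times its Hoelder modulus, the transverse shift by the modulus itself, and the outer kernel
  multiplies the sum by k.\<close>

lemma pilot_mean:
  assumes h: "0 < h"
  shows "\<bar>mean (axis 1 1, t, h, h) F - F t\<bar> \<le> k * (k + 1) * M * h powr b0"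
proof -
  have ax: "axis 1 1 \<noteq> (0 :: real^2)" by (simp add: axis_eq_0_iff)
  have aa: "axis 1 1 \<bullet> (axis 1 1 :: real^2) = 1" "axis 1 1 \<bullet> \<theta>0 = \<theta>0 $ 1" "cross (axis 1 1) \<theta>0 = \<theta>0 $ 2"
    by (simp_all add: inner_2 axis_def cross_def)
  define u d s where "u = t \<bullet> \<theta>0" and "d = h * \<theta>0 $ 1" and "s = h * \<theta>0 $ 2"
  have th: "\<bar>\<theta>0 $ i\<bar> \<le> 1" for i using component_le_norm_cart[of \<theta>0 i] \<theta>0 by simp
  have ds: "\<bar>d\<bar> \<le> h" "\<bar>s\<bar> \<le> h" using th h by (simp_all add: d_def s_def abs_mult mult_left_le)
  have bd: "\<bar>avg d f x\<bar> \<le> k * M" for x by (rule avg_le[OF meas_f f_le])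
  have i1: "integrable W (\<lambda>y. kern S y * avg d f (u + s * y))" by (rule avg_integrable[OF avg_meas[OF meas_f] bd])
  have hb: "x powr b0 \<le> h powr b0" if "0 \<le> x" "x \<le> h" for x using that b0_pos by (intro powr_mono2) auto
  have "mean (axis 1 1, t, h, h) F - F t = (\<integral>y. kern S y * avg d f (u + s * y) \<partial>W) - (\<integral>y. kern S y * f u \<partial>W)"
    using mean_E3[OF ax h h, of t] by (simp add: aa u_def d_def s_def F_def K_int)
  also have "\<dots> = (\<integral>y. kern S y * avg d f (u + s * y) - kern S y * f u \<partial>W)"
    using i1 K_integrable by simp
  also have "\<bar>\<dots>\<bar> \<le> k * (k * (M * h powr b0) + M * h powr b0)"
  proof (rule integral_W_le)
    fix y :: real assume y: "y \<in> {-1/2..1/2}"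
    have "\<bar>avg d f (u + s * y) - f (u + s * y)\<bar> \<le> k * (M * \<bar>d\<bar> powr b0)"
      by (rule avg_Holder[OF meas_f f_le b0_pos f_Holder])
    also have "\<dots> \<le> k * (M * h powr b0)" using ds by (intro mult_left_mono hb M0 k0) auto
    finally have 1: "\<bar>avg d f (u + s * y) - f (u + s * y)\<bar> \<le> k * (M * h powr b0)" .
    have "\<bar>f (u + s * y) - f u\<bar> \<le> M * \<bar>s * y\<bar> powr b0" by (rule f_Holder)
    also have "\<dots> \<le> M * h powr b0"
    proof (intro mult_left_mono hb M0)
      have "\<bar>s\<bar> * \<bar>y\<bar> \<le> h * 1" using ds y by (intro mult_mono) auto
      then show "\<bar>s * y\<bar> \<le> h" by (simp add: abs_mult)
    qed auto
    finally have 2: "\<bar>avg d f (u + s * y) - f u\<bar> \<le> k * (M * h powr b0) + M * h powr b0" using 1 by linarith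
    have "\<bar>kern S y * avg d f (u + s * y) - kern S y * f u\<bar> = \<bar>kern S y\<bar> * \<bar>avg d f (u + s * y) - f u\<bar>"
      by (simp add: right_diff_distrib[symmetric] abs_mult)
    also have "\<dots> \<le> k * (k * (M * h powr b0) + M * h powr b0)"
      by (intro mult_mono kern_le 2 k0) auto
    finally show "\<bar>kern S y * avg d f (u + s * y) - kern S y * f u\<bar> \<le> k * (k * (M * h powr b0) + M * h powr b0)" .
  qed measurable
  also have "\<dots> = k * (k + 1) * M * h powr b0" by (simp add: algebra_simps)
  finally show ?thesis .
qed

end

context single_index_model
begin

text \<open>Identifies the pilot as a member of the \<open>E3\<close> family, to which the good
  event applies.\<close>

lemma F_inf_eq:
  assumes h: "0 < h_pilot S n"
  shows "F_inf S r n z = 2 * (SUP v \<in> cube (5/2). \<bar>F_hat S n z (E3 (axis 1 1) (h_pilot S n) (h_pilot S n)) v\<bar>) + 2 * C5 S r n"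
proof -
  let ?h = "h_pilot S n"
  have aa: "axis 1 1 \<bullet> (axis 1 1 :: real^2) = 1" "axis 1 1 \<bullet> x = x $ 1" "cross (axis 1 1) x = x $ 2" for x :: "real^2"
    by (simp_all add: inner_2 axis_def cross_def)
  have c: "((1 / ?h) *\<^sub>R x) $ i = x $ i / ?h" for x :: "real^2" and i by simp
  have e: "(\<Sum>i=1..n. inverse (dens S (fst (z i))) * (kern2 S ((1 / ?h) *\<^sub>R (fst (z i) - v)) / ?h\<^sup>2) * snd (z i)) / n
     = F_hat S n z (E3 (axis 1 1) ?h ?h) v" for v
    unfolding F_hat_def det_E3 kern2_def E3_mult aa c
    by (simp add: sum_distrib_left sum_divide_distrib field_simps power2_eq_square)
  show ?thesis unfolding F_inf_def e ..
qed

text \<open>Of the linear Bernstein term only the part with \<open>tau\<close> is charged to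
  \<open>C4\<close>, using 730 ln n <= \<open>c4\<close>. The other terms contain ln n / U n, which
  tends to 0, and go to \<open>pilot_err\<close>.\<close>

lemma dev_pilot:
  assumes n: "3 \<le> n" "large n" and s: "s \<in> pilot_params n" and M: "0 \<le> M"
  shows "dev (40 * ln n) n M s \<le> 2 * sqrt (80 * k ^ 4 / dens_low S * (M\<^sup>2 + (sigma S)\<^sup>2) * (ln n / U n))
     + 160 * k\<^sup>2 / dens_low S * M * (ln n / U n) + U n powr (-1/2) * C4 S r n"
proof -
  have L: "1 \<le> ln (real n)" by (rule ln_ge_1[OF n(1)])
  have U: "1 \<le> U n" by (rule U_ge_1[OF n(1)])
  have sc: "scale s * n = U n"
    using s U_eq[OF n(1)] by (auto simp: pilot_params_def scale_def power2_eq_square mult_ac)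
  have n0: "0 < real n" using n by simp
  have scale_pos: "0 < scale s" using sc U n0 by (metis less_le_trans mult_pos_pos zero_less_mult_pos2 zero_less_one)
  have g: "0 < dens_low S" using design by simp
  have e1: "40 * ln n * (2 * (k ^ 4 / (dens_low S * scale s)) * (M\<^sup>2 + (sigma S)\<^sup>2)) / n =
     80 * k ^ 4 / dens_low S * (M\<^sup>2 + (sigma S)\<^sup>2) * (ln n / U n)"
    unfolding sc[symmetric] using scale_pos n0 g by (simp add: field_simps)
  have e2: "4 * (k\<^sup>2 / (dens_low S * scale s) * (M + tau S r n)) * (40 * ln n) / n =
     160 * k\<^sup>2 / dens_low S * M * (ln n / U n) + 160 * k\<^sup>2 / dens_low S * tau S r n * (ln n / U n)"
    unfolding sc[symmetric] using scale_pos n0 g by (simp add: field_simps)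
  have "160 * k\<^sup>2 / dens_low S * tau S r n * (ln n / U n) \<le> U n powr (-1/2) * C4 S r n"
  proof -
    have v: "U n powr (-1/2) * U n powr (-1/2) = 1 / U n" using U by (simp add: powr_add[symmetric] powr_minus_divide)
    have "0 \<le> 2 * sqrt 2 * max (sigma S) 1 * dens_low S powr (-1/2) * k\<^sup>2 * sqrt (c4 S r n)"
      using c_lower(4)[OF n(1)] L by (intro mult_nonneg_nonneg) auto
    then have "U n powr (-1/2) * (8/3 * tau S r n * c4 S r n * U n powr (-1/2) * inverse (dens_low S) * k\<^sup>2) \<le> U n powr (-1/2) * C4 S r n"
      unfolding C4_def U_eq[OF n(1)] by (intro mult_left_mono) auto
    also have "U n powr (-1/2) * (8/3 * tau S r n * c4 S r n * U n powr (-1/2) * inverse (dens_low S) * k\<^sup>2)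
       = 8/3 * c4 S r n * (k\<^sup>2 / dens_low S * tau S r n) * (U n powr (-1/2) * U n powr (-1/2))"
      by (simp add: field_simps)
    also have "\<dots> = 8/3 * c4 S r n * (k\<^sup>2 / dens_low S * tau S r n * (1 / U n))" unfolding v by simp
    finally have 1: "8/3 * c4 S r n * (k\<^sup>2 / dens_low S * tau S r n * (1 / U n)) \<le> U n powr (-1/2) * C4 S r n" .
    have "160 * ln n * (k\<^sup>2 / dens_low S * tau S r n * (1 / U n)) \<le> 8/3 * c4 S r n * (k\<^sup>2 / dens_low S * tau S r n * (1 / U n))"
      using c_lower(4)[OF n(1)] L g U tau_nonneg[of n] by (intro mult_right_mono) auto
    then show ?thesis using 1 by (simp add: mult_ac)
  qed
  then show ?thesis unfolding dev_def e1 e2 by linarith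
qed

text \<open>With \<open>F_inf\<close> for A the right side is half of \<open>TH\<close>. The parts
  of both Bernstein terms with the signal bound go to \<open>C1\<close>, those with the noise to
  \<open>C2\<close>; for the linear parts the lower end of the bandwidth grid gives (\<eta>
  n)^(-1/2) <= 2 (ln n)^(-e). The summand k^2 sqrt (ln n) absorbs the error of the net.\<close>

lemma dev_main:
  assumes n: "3 \<le> n" "large n" and s: "s \<in> main_params n" and \<eta>: "\<eta> = fst (snd (snd s))" and mm: "0 \<le> mm" "mm \<le> A"
    and net: "net_err n M \<le> 1 / sqrt n"
  shows "dev (40 * ln n) n mm s + net_err n M \<le> (k\<^sup>2 * sqrt (ln n) + A * C1 S r n + C2 S r n) * (\<eta> * n) powr (-1/2)"
proof -
  let ?l = "ln (real n)"
  have L: "1 \<le> ?l" by (rule ln_ge_1[OF n(1)])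
  have eb: "\<eta> \<in> bandwidths S n" and sc: "scale s = \<eta>" using s \<eta> by (auto simp: main_params_def scale_def)
  have n0: "0 < real n" using n by simp
  have \<eta>0: "0 < \<eta>" "\<eta> \<le> 1" using bandwidths_pos[OF n(2) eb] by auto
  have g: "0 < dens_low S" using design by simp
  have om: "0 < omg S" using noise_params by simp
  define x where "x = \<eta> * n"
  define v where "v = x powr (-1/2)"
  have x0: "0 < x" using \<eta>0 n0 by (simp add: x_def)
  have v0: "0 < v" using x0 by (simp add: v_def)
  have vv: "v * v = 1 / x" using x0 by (simp add: v_def powr_add[symmetric] powr_minus_divide)
  have v_sqrt: "sqrt (1 / x) = v" using vv v0 by (metis real_sqrt_abs2 abs_of_pos)
  define e where "e = (2 + omg S) / (2 * omg S)"
  have "h_min S n / 2 \<le> \<eta>" using eb by (simp add: bandwidths_def)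
  then have "h_min S n / 2 * n \<le> x" unfolding x_def using n0 by (intro mult_right_mono) auto
  then have "?l powr (1 + 2 / omg S) / 2 \<le> x" using n0 by (simp add: h_min_def)
  then have "v \<le> (?l powr (1 + 2 / omg S) / 2) powr (-1/2)"
    unfolding v_def using L by (intro powr_mono2') auto
  also have "\<dots> = 2 powr (1/2) * ?l powr (- e)"
  proof -
    have "(1 + 2 / omg S) * (- 1 / 2) = - e" using om by (simp add: e_def field_simps)
    then show ?thesis by (simp add: powr_divide powr_powr powr_minus_divide)
  qed
  also have "\<dots> \<le> 2 * ?l powr (- e)"
  proof -
    have "2 powr (1/2) \<le> (2 :: real) powr 1" by (intro powr_mono) auto
    then show ?thesis by (intro mult_right_mono) auto
  qed
  finally have v_le: "v \<le> 2 * ?l powr (- e)" .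
  have tau: "tau S r n * ?l powr (- e) = T0 powr (1 / omg S) * ?l powr (-1/2)"
  proof -
    have "1 / omg S + - e = - 1 / 2" using om by (simp add: e_def field_simps)
    then have "?l powr (1 / omg S) * ?l powr (- e) = ?l powr (-1/2)" by (simp only: powr_add[symmetric])
    then show ?thesis unfolding tau_eq[OF n(1)] by (simp add: mult.assoc)
  qed
  have sg: "0 \<le> sigma S" by (rule sigma_nonneg)
  have G0: "0 \<le> G" using G_ge_1 by linarith
  have Gs: "sqrt (1 / dens_low S) = G" using g
    by (simp add: G_def powr_half_sqrt[symmetric] powr_minus_divide powr_divide)
  have r40: "sqrt 80 * sqrt ?l \<le> sqrt 2 * sqrt c" if "1460 * ?l \<le> c" for c
    unfolding real_sqrt_mult[symmetric] using that L by (intro real_sqrt_le_mono) linarith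
  note cl = c_lower[OF n(1)]
  have t1: "2 * sqrt (40 * ?l * (2 * (k ^ 4 / (dens_low S * scale s)) * (mm\<^sup>2 + (sigma S)\<^sup>2)) / n)
     \<le> (2 * (sqrt 80 * sqrt ?l) * G * k\<^sup>2 * mm + 2 * (sqrt 80 * sqrt ?l) * G * k\<^sup>2 * sigma S) * v"
  proof -
    have eq: "40 * ?l * (2 * (k ^ 4 / (dens_low S * scale s)) * (mm\<^sup>2 + (sigma S)\<^sup>2)) / n =
      80 * ?l * (k\<^sup>2)\<^sup>2 * (1 / dens_low S) * (mm\<^sup>2 + (sigma S)\<^sup>2) * (1 / x)"
      unfolding sc x_def using \<eta>0 n0 g by (simp add: field_simps)
    have s4: "sqrt ((k\<^sup>2)\<^sup>2) = k\<^sup>2" by (simp only: real_sqrt_abs) simp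
    have "sqrt (40 * ?l * (2 * (k ^ 4 / (dens_low S * scale s)) * (mm\<^sup>2 + (sigma S)\<^sup>2)) / n) =
       sqrt 80 * sqrt ?l * k\<^sup>2 * G * sqrt (mm\<^sup>2 + (sigma S)\<^sup>2) * v"
      unfolding eq real_sqrt_mult Gs v_sqrt s4 by simp
    also have "\<dots> \<le> sqrt 80 * sqrt ?l * k\<^sup>2 * G * (mm + sigma S) * v"
      using sqrt_sum_squares_le_sum[OF mm(1) sg] v0 G0 L by (intro mult_right_mono mult_left_mono) auto
    finally show ?thesis by (simp add: algebra_simps)
  qed
  have t2: "4 * (k\<^sup>2 / (dens_low S * scale s) * (mm + tau S r n)) * (40 * ?l) / n \<le>
     (320 * ?l * ?l powr (- e) * inverse (dens_low S) * k\<^sup>2 * mm + 320 * (?l * ?l powr (-1/2)) * inverse (dens_low S) * k\<^sup>2 * T0 powr (1 / omg S)) * v"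
  proof -
    have eq: "4 * (k\<^sup>2 / (dens_low S * scale s) * (mm + tau S r n)) * (40 * ?l) / n =
       (160 * ?l * inverse (dens_low S) * k\<^sup>2 * (mm + tau S r n)) * v * v"
      unfolding mult.assoc[of _ v v] vv unfolding sc x_def using \<eta>0 n0 g by (simp add: field_simps)
    have "(160 * ?l * inverse (dens_low S) * k\<^sup>2 * (mm + tau S r n)) * v * v \<le>
       (160 * ?l * inverse (dens_low S) * k\<^sup>2 * (mm + tau S r n)) * (2 * ?l powr (- e)) * v"
      using v0 L g mm tau_nonneg[of n] by (intro mult_right_mono mult_left_mono v_le mult_nonneg_nonneg add_nonneg_nonneg) auto
    also have "\<dots> = (320 * ?l * ?l powr (- e) * inverse (dens_low S) * k\<^sup>2 * mm + 320 * ?l * inverse (dens_low S) * k\<^sup>2 * (tau S r n * ?l powr (- e))) * v"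
      by (simp add: algebra_simps)
    finally show ?thesis unfolding eq tau by (simp add: mult_ac)
  qed
  have em: "- (2 + omg S) / (2 * omg S) = - e" by (simp only: e_def minus_divide_left)
  have C1': "2 * (sqrt 80 * sqrt ?l) * G * k\<^sup>2 + 320 * ?l * ?l powr (- e) * inverse (dens_low S) * k\<^sup>2 \<le> C1 S r n"
  proof -
    have "2 * (sqrt 80 * sqrt ?l) * G * k\<^sup>2 \<le> 2 * (sqrt 2 * sqrt (c1 S r n)) * G * k\<^sup>2"
      using r40[OF cl(1)] G0 by (intro mult_right_mono mult_left_mono) auto
    moreover have "320 * ?l * ?l powr (- e) * inverse (dens_low S) * k\<^sup>2 \<le> 8/3 * c1 S r n * ?l powr (- e) * inverse (dens_low S) * k\<^sup>2"
      using cl(1) L g by (intro mult_right_mono) auto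
    ultimately show ?thesis unfolding C1_def G_def[symmetric] em by (simp add: mult_ac)
  qed
  have C2': "2 * (sqrt 80 * sqrt ?l) * G * k\<^sup>2 * sigma S + 320 * (?l * ?l powr (-1/2)) * inverse (dens_low S) * k\<^sup>2 * T0 powr (1 / omg S) \<le> C2 S r n"
  proof -
    have "2 * (sqrt 80 * sqrt ?l) * G * k\<^sup>2 * sigma S \<le> 2 * (sqrt 2 * sqrt (c2 S r n)) * G * k\<^sup>2 * max (sigma S) 1"
    proof (rule mult_mono)
      show "2 * (sqrt 80 * sqrt ?l) * G * k\<^sup>2 \<le> 2 * (sqrt 2 * sqrt (c2 S r n)) * G * k\<^sup>2"
        using r40[OF cl(2)] G0 by (intro mult_right_mono mult_left_mono) auto
      have "0 \<le> c2 S r n" using cl(2) L by linarith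
      then show "0 \<le> 2 * (sqrt 2 * sqrt (c2 S r n)) * G * k\<^sup>2" using G0 by simp
    qed (use sg in auto)
    moreover have "320 * ?l * ?l powr (-1/2) * inverse (dens_low S) * k\<^sup>2 * T0 powr (1 / omg S)
        \<le> 8/3 * c2 S r n * ?l powr (-1/2) * inverse (dens_low S) * k\<^sup>2 * T0 powr (1 / omg S)"
      using cl(2) L g by (intro mult_right_mono) auto
    ultimately show ?thesis unfolding C2_def G_def[symmetric] T0_def[symmetric] by (simp add: mult_ac)
  qed
  have net': "net_err n M \<le> k\<^sup>2 * sqrt ?l * v"
  proof -
    have "1 / sqrt n = sqrt (1 / n)" by (simp add: real_sqrt_divide)
    also have "\<dots> \<le> sqrt (1 / x)" using \<eta>0 n0 x0 by (intro real_sqrt_le_mono) (simp add: x_def field_simps)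
    also have "\<dots> = 1 * v" by (simp add: v_sqrt)
    also have "\<dots> \<le> k\<^sup>2 * sqrt ?l * v"
    proof (rule mult_right_mono)
      have "1 * 1 \<le> k\<^sup>2 * sqrt ?l" using k1 L by (intro mult_mono) auto
      then show "1 \<le> k\<^sup>2 * sqrt ?l" by simp
    qed (use v0 in simp)
    finally show ?thesis using net by linarith
  qed
  have C1A: "(2 * (sqrt 80 * sqrt ?l) * G * k\<^sup>2 + 320 * ?l * ?l powr (- e) * inverse (dens_low S) * k\<^sup>2) * mm \<le> A * C1 S r n"
  proof -
    have "(2 * (sqrt 80 * sqrt ?l) * G * k\<^sup>2 + 320 * ?l * ?l powr (- e) * inverse (dens_low S) * k\<^sup>2) * mm \<le> C1 S r n * mm"
      using C1' mm by (intro mult_right_mono) auto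
    also have "\<dots> \<le> C1 S r n * A" using C_nonneg(1)[OF n(1)] mm by (intro mult_left_mono) auto
    finally show ?thesis by (simp add: mult.commute)
  qed
  have "dev (40 * ?l) n mm s \<le> ((2 * (sqrt 80 * sqrt ?l) * G * k\<^sup>2 + 320 * ?l * ?l powr (- e) * inverse (dens_low S) * k\<^sup>2) * mm
     + (2 * (sqrt 80 * sqrt ?l) * G * k\<^sup>2 * sigma S + 320 * (?l * ?l powr (-1/2)) * inverse (dens_low S) * k\<^sup>2 * T0 powr (1 / omg S))) * v"
    using add_mono[OF t1 t2] unfolding dev_def by (simp add: algebra_simps)
  also have "\<dots> \<le> (A * C1 S r n + C2 S r n) * v" using C1A C2' v0 by (intro mult_right_mono add_mono) auto
  finally show ?thesis using net' unfolding v_def x_def by (simp add: algebra_simps)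
qed

end

context single_index_target
begin

text \<open>The deviation grows with the unknown \<open>F_sup\<close>; the lower bound lets the
  computable threshold dominate it. The upper bound keeps the threshold at its intended
  order.\<close>

lemma F_inf_bounds:
  assumes n: "sample_size_ok M b0 n"
    and pil: "\<And>s. s \<in> pilot_params n \<Longrightarrow> \<bar>F_hat_at n F w s - mean s F\<bar> \<le> dev (40 * ln n) n M s + net_err n M"
  shows "F_sup \<le> F_inf S r n (observations X \<epsilon> n F w)" "F_inf S r n (observations X \<epsilon> n F w) \<le> 2 * M + 4 * C5 S r n"
proof -
  let ?z = "observations X \<epsilon> n F w"
  let ?h = "h_pilot S n"
  have n3: "3 \<le> n" and ln: "large n" and pe: "pilot_err M b0 n \<le> 1/2" using n by (auto simp: sample_size_ok_def)
  have "0 < 1 / real n" using n3 by simp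
  then have h: "0 < ?h" "?h < 1" using ln unfolding large_def by linarith+
  define H where "H v = F_hat S n ?z (E3 (axis 1 1) ?h ?h) v" for v
  define C where "C = U n powr (-1/2) * C4 S r n"
  have C5: "C + 1/2 \<le> C5 S r n" unfolding C5_def C_def U_eq[OF n3] by simp
  have cl: "\<bar>H v - F v\<bar> \<le> 1/2 + C" if v: "v \<in> cube (5/2)" for v
  proof -
    have s: "(axis 1 1, v, ?h, ?h) \<in> pilot_params n" using v by (simp add: pilot_params_def)
    have "\<bar>H v - mean (axis 1 1, v, ?h, ?h) F\<bar> \<le> dev (40 * ln n) n M (axis 1 1, v, ?h, ?h) + net_err n M"
      using pil[OF s] by (simp add: F_hat_at_def H_def)
    moreover have "\<bar>mean (axis 1 1, v, ?h, ?h) F - F v\<bar> \<le> k * (k + 1) * M * ?h powr b0" by (rule pilot_mean[OF h(1)])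
    moreover note dev_pilot[OF n3 ln s M0]
    ultimately show ?thesis using pe unfolding pilot_err_def C_def by linarith
  qed
  have Fi: "F_inf S r n ?z = 2 * (SUP v \<in> cube (5/2). \<bar>H v\<bar>) + 2 * C5 S r n"
    unfolding H_def by (rule F_inf_eq[OF h(1)])
  have Hle: "\<bar>H v\<bar> \<le> M + (1/2 + C)" if "v \<in> cube (5/2)" for v
    using cl[OF that] F_le[of v] by linarith
  have ne: "cube (5/2) \<noteq> {}" using cube_nonempty[of "5/2"] by auto
  have "(SUP v \<in> cube (5/2). \<bar>H v\<bar>) \<le> M + (1/2 + C)" by (rule cSUP_least[OF ne Hle])
  then show "F_inf S r n ?z \<le> 2 * M + 4 * C5 S r n" unfolding Fi using C5 by linarith
  show "F_sup \<le> F_inf S r n ?z" unfolding F_sup_def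
  proof (rule cSUP_least[OF ne])
    fix v assume v: "v \<in> cube (5/2)"
    have "\<bar>H v\<bar> \<le> (SUP v \<in> cube (5/2). \<bar>H v\<bar>)"
      by (rule cSUP_upper[OF v]) (auto intro!: bdd_aboveI2[where M="M + (1/2 + C)"] Hle)
    then have "\<bar>F v\<bar> \<le> (SUP v \<in> cube (5/2). \<bar>H v\<bar>) + C5 S r n" using cl[OF v] C5 by linarith
    moreover have "0 \<le> (SUP v \<in> cube (5/2). \<bar>H v\<bar>) + C5 S r n" using calculation by linarith
    ultimately show "\<bar>F v\<bar> \<le> F_inf S r n ?z" unfolding Fi by linarith
  qed
qed

text \<open>The 10 is the 5 of \<open>local_bound\<close> times the factor 2 in \<open>TH\<close>;
  the bracket bounds the sum inside \<open>TH\<close> divided by sqrt (ln n).\<close>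

lemma loss_on_good_event:
  assumes n: "sample_size_ok M b0 n" and sel: "measurable_minimizer S r n sel" and w: "w \<in> space P"
    and main_params: "\<And>s. s \<in> main_params n \<Longrightarrow> \<bar>F_hat_at n F w s - mean s F\<bar> \<le> dev (40 * ln n) n F_sup s + net_err n M"
    and pil: "\<And>s. s \<in> pilot_params n \<Longrightarrow> \<bar>F_hat_at n F w s - mean s F\<bar> \<le> dev (40 * ln n) n M s + net_err n M"
    and C: "C1 S r n \<le> C * sqrt (ln n)" "C2 S r n \<le> C * sqrt (ln n)" "C5 S r n \<le> C"
    and t: "t \<in> cube (1/2)" and h: "h \<in> bandwidths S n" and lam: "0 \<le> lam" and ok: "bias_ok h lam (t \<bullet> \<theta>0)"
  shows "\<bar>estimator S n sel (observations X \<epsilon> n F w) t - F t\<bar> \<le>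
     9 * lam + 10 * (k\<^sup>2 + (2 * M + 4 * C) * C + C) * (sqrt (ln n / n) * h powr (-1/2))"
proof -
  let ?z = "observations X \<epsilon> n F w"
  have n3: "3 \<le> n" and lg: "large n" and net: "net_err n M \<le> 1 / sqrt n" using n by (auto simp: sample_size_ok_def)
  have L: "1 \<le> ln (real n)" by (rule ln_ge_1[OF n3])
  have n0: "0 < real n" using n3 by simp
  define A where "A = k\<^sup>2 * sqrt (ln n) + F_inf S r n ?z * C1 S r n + C2 S r n"
  define B0 where "B0 = k\<^sup>2 + (2 * M + 4 * C) * C + C"
  note Fb = F_inf_bounds[OF n pil]
  have Fi0: "0 \<le> F_inf S r n ?z" using Fb(1) F_sup_nonneg by linarith
  note Cn = C_nonneg[OF n3]
  have A0: "0 \<le> A" unfolding A_def using Fi0 Cn L by (intro add_nonneg_nonneg mult_nonneg_nonneg) auto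
  have TH: "TH S r n ?z \<eta> = 2 * A * (\<eta> * n) powr (-1/2)" for \<eta> by (simp add: TH_def A_def)
  have T: "0 \<le> TH S r n ?z \<eta>" for \<eta> unfolding TH using A0 by simp
  have zs: "?z \<in> space (sample_space n)"
    by (auto simp: sample_space_def observations_def space_PiM)
  obtain \<theta>h hh where sel': "sel ?z t = (\<theta>h, hh)" by (cases "sel ?z t")
  have ms: "\<theta>h \<in> unit_circle" "hh \<in> bandwidths S n"
    "\<And>\<theta> h. \<theta> \<in> unit_circle \<Longrightarrow> h \<in> bandwidths S n \<Longrightarrow> criterion S r n ?z t (\<theta>h, hh) \<le> criterion S r n ?z t (\<theta>, h)"
    using sel zs t unfolding measurable_minimizer_def by (metis mem_Sigma_iff sel')+
  have hp: "0 < h" "h \<le> 1" using bandwidths_pos[OF lg h] by auto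
  have "\<bar>F_hat S n ?z (E_one \<theta>h hh) t - F t\<bar> \<le> 9 * lam + 5 * TH S r n ?z h"
  proof (rule local_bound[OF lg t h lam _ T _ ok T ms])
    show "\<bar>F_hat_at n F w s - mean s F\<bar> \<le> TH S r n ?z (fst (snd (snd s))) / 2" if s: "s \<in> main_params n" for s
    proof -
      have e: "2 * x * y / 2 = x * y" for x y :: real by simp
      show ?thesis unfolding TH e unfolding A_def
        by (rule order.trans[OF main_params[OF s] dev_main[OF n3 lg s refl F_sup_nonneg Fb(1) net]])
    qed
    show "TH S r n ?z h \<le> TH S r n ?z \<eta>" if "\<eta> \<in> bandwidths S n" "\<eta> \<le> h" for \<eta>
      unfolding TH using A0 n0 that bandwidths_pos[OF lg that(1)] by (intro mult_left_mono powr_mono2') auto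
  qed
  moreover have "TH S r n ?z h \<le> 2 * B0 * (sqrt (ln n / n) * h powr (-1/2))"
  proof -
    have C0: "0 \<le> C" using Cn(5) C(3) by linarith
    have "F_inf S r n ?z * C1 S r n \<le> (2 * M + 4 * C) * (C * sqrt (ln n))"
      using Fb(2) C Cn(1) M0 C0 by (intro mult_mono) auto
    then have "A \<le> B0 * sqrt (ln n)" unfolding A_def B0_def using C(2) by (simp add: algebra_simps)
    then have "TH S r n ?z h \<le> 2 * (B0 * sqrt (ln n)) * (h * n) powr (-1/2)"
      unfolding TH by (intro mult_right_mono mult_left_mono) auto
    also have "(h * n) powr (-1/2) = h powr (-1/2) * (1 / sqrt n)"
      using hp n0 by (simp add: powr_mult powr_minus_divide powr_half_sqrt)
    finally show ?thesis by (simp add: real_sqrt_divide mult_ac)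
  qed
  moreover have "10 * B0 * x = 5 * (2 * B0 * x)" for x by simp
  ultimately show ?thesis unfolding estimator_def sel' fst_conv snd_conv B0_def[symmetric] by linarith
qed

end

section \<open>Summation over dyadic bandwidths\<close>

lemma L_norm_leI:
  assumes "(\<integral>\<^sup>+x. ennreal (\<bar>f x\<bar> powr p) \<partial>M) \<le> ennreal c" "0 \<le> c" "0 < p"
  shows "L_norm p M f \<le> ennreal (c powr (1/p))"
proof -
  define I where "I = (\<integral>\<^sup>+x. ennreal (\<bar>f x\<bar> powr p) \<partial>M)"
  have I: "I \<noteq> \<infinity>" using assms by (auto simp: I_def[symmetric] top_unique)
  have "enn2real I \<le> c" using assms by (intro enn2real_leI) (auto simp: I_def)
  then have "enn2real I powr (1/p) \<le> c powr (1/p)" using assms by (intro powr_mono2) auto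
  then show ?thesis using I unfolding L_norm_def I_def[symmetric] Let_def by (simp add: ennreal_leI)
qed

lemma cube_borel [measurable]: "cube a \<in> sets borel"
proof -
  have "closed (cube a)" unfolding cube_def by (intro closed_Collect_all closed_Collect_le continuous_intros)
  then show ?thesis by (rule borel_closed)
qed

text \<open>\<open>strip_measure\<close> along the first axis; the crude value 2 instead of the area
  1 only affects constants.\<close>

lemma emeasure_cube_half: "emeasure lborel (cube (1/2)) \<le> 2"
proof -
  have a: "axis 1 1 \<in> unit_circle" by simp
  have ax: "t \<bullet> axis 1 (1::real) = t $ 1" for t :: "real^2" by (simp add: inner_axis)
  have "cube (1/2) = {t \<in> cube (1/2). t \<bullet> axis 1 1 \<in> {-1/2..1/2}}"
  proof -
    have "t $ 1 \<in> {-1/2..1/2}" if "t \<in> cube (1/2)" for t :: "real^2"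
    proof -
      have "\<bar>t $ 1\<bar> \<le> 1/2" using that unfolding cube_def by blast
      then show ?thesis by auto
    qed
    then show ?thesis unfolding ax by blast
  qed
  moreover have "emeasure lborel {t \<in> cube (1/2). t \<bullet> axis 1 1 \<in> {-1/2..1/2}} \<le> 2 * emeasure lborel {-1/2..1/2::real}"
    by (rule strip_measure[OF a]) simp
  moreover have "emeasure lborel {-1/2..1/2::real} = 1" by simp
  ultimately show ?thesis by simp
qed

lemma geometric_block:
  fixes x :: real
  assumes "i \<le> j"
  shows "(1 - x) * (\<Sum>k\<in>{i..<j}. x ^ k) = x ^ i - x ^ j"
  using assms
proof (induction j rule: dec_induct)
  case (step j)
  then show ?case by (simp add: distrib_left left_diff_distrib)
qed simp

text \<open>For \<open>\<rho> = sqrt (ln n / n)\<close> and \<open>T = ln n\<close> this is the \<open>r\<close>-th power of \<^const>\<open>rate\<close>, up to a power of \<open>L\<close>.\<close>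

definition rho_rate :: "real \<Rightarrow> real \<Rightarrow> real \<Rightarrow> real \<Rightarrow> real \<Rightarrow> real" where
  "rho_rate r \<beta> p T \<rho> =
     (if (2 * \<beta> + 1) * p > r then \<rho> powr (2 * \<beta> * r / (2 * \<beta> + 1))
      else if (2 * \<beta> + 1) * p = r then \<rho> powr (2 * \<beta> * r / (2 * \<beta> + 1)) * T
      else \<rho> powr ((2 * \<beta> * r - 2 * r / p + 2) / (2 * \<beta> - 2 / p + 1)))"

text \<open>The levels i to j stand for bandwidths 2^(-i) down to 2^(-j). The quantification over
  all \<rho> and T makes C independent of n. With D at least \<open>bias_const\<close>, the first
  condition empties the exceptional set at level j; the second keeps 2^(-j) above a power of \<rho>,
  which places it in the bandwidth grid for large n.\<close>

definition dyadic_sum_bound :: "real \<Rightarrow> real \<Rightarrow> real \<Rightarrow> real \<Rightarrow> real \<Rightarrow> bool" where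
  "dyadic_sum_bound r \<beta> p D C \<longleftrightarrow> (\<forall>\<rho> T. 0 < \<rho> \<longrightarrow> \<rho> \<le> 1 \<longrightarrow> 1 \<le> T \<longrightarrow> - log 2 \<rho> \<le> T \<longrightarrow>
    (\<exists>i j::nat. i \<le> j \<and> D * ((1/2) ^ j) powr (\<beta> - 1 / p) \<le> \<rho> * ((1/2) ^ j) powr (-1/2) \<and>
       2 ^ j \<le> 2 * (D / \<rho>) powr (2 / (2 * \<beta> - 2 / p + 1)) \<and>
       \<rho> powr r * 2 powr (real i * r / 2) + \<rho> powr (r - p) * (\<Sum>k\<in>{i..<j}. 2 powr (real k * ((r - p * (2 * \<beta> + 1)) / 2)))
         \<le> C * rho_rate r \<beta> p T \<rho>))"

text \<open>\<open>2\<^sup>-\<^sup>j\<close> balances the stochastic error with the uniform bias \<open>h\<^sup>\<beta>\<^sup>-\<^sup>1\<^sup>/\<^sup>p\<close>, and \<open>2\<^sup>-\<^sup>i\<close> with the bias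
  \<open>h\<^sup>\<beta>\<close>. The sum in between is geometric, and the sign of \<open>r - p (2 \<beta> + 1)\<close> decides which end
  dominates.\<close>

lemma dyadic_levels:
  fixes p \<beta> r D :: real
  assumes p: "1 < p" and \<beta>: "1 / p < \<beta>" and r: "1 \<le> r" and D: "1 \<le> D"
  shows "\<exists>C\<ge>0. dyadic_sum_bound r \<beta> p D C"
proof -
  define q where "q = 2 * \<beta> - 2 / p + 1"
  define w where "w = 2 * \<beta> + 1"
  define e where "e = (r - p * w) / 2"
  define d where "d = log 2 D"
  define C where "C = 1 + 2 powr (- e) / \<bar>1 - 2 powr e\<bar> + (1 + 2 / q * (d + 1)) + 2 powr (2 * e * d / q + e) / \<bar>1 - 2 powr e\<bar>"
  have p0: "0 < p" using p by simp
  have \<beta>0: "0 < \<beta>" using \<beta> p0 by (meson less_trans zero_less_divide_1_iff)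
  have q: "1 < q" "q \<le> w" using \<beta> p0 by (auto simp: q_def w_def)
  have q0: "0 < q" and w0: "0 < w" using q by linarith+
  have d: "0 \<le> d" using D by (simp add: d_def)
  have D2: "D = 2 powr d" using D by (simp add: d_def)
  have C0: "0 \<le> C" unfolding C_def using q0 d by (intro add_nonneg_nonneg divide_nonneg_nonneg mult_nonneg_nonneg) auto
  have C1: "1 \<le> C" "1 + 2 powr (- e) / \<bar>1 - 2 powr e\<bar> \<le> C" "1 + (1 + 2 / q * (d + 1)) \<le> C"
      "1 + 2 powr (2 * e * d / q + e) / \<bar>1 - 2 powr e\<bar> \<le> C"
  proof -
    have "0 \<le> 2 powr (- e) / \<bar>1 - 2 powr e\<bar>" "0 \<le> 2 powr (2 * e * d / q + e) / \<bar>1 - 2 powr e\<bar>" "0 \<le> 1 + 2 / q * (d + 1)"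
      using q0 d by (auto intro!: add_nonneg_nonneg mult_nonneg_nonneg)
    then show "1 \<le> C" "1 + 2 powr (- e) / \<bar>1 - 2 powr e\<bar> \<le> C" "1 + (1 + 2 / q * (d + 1)) \<le> C"
      "1 + 2 powr (2 * e * d / q + e) / \<bar>1 - 2 powr e\<bar> \<le> C" unfolding C_def by linarith+
  qed
  \<comment> \<open>Two identities between exponents: \<open>key\<close> evaluates the last term of
    the geometric sum, and \<open>key'\<close> shows that the sign of e decides which exponent of
    \<rho> is the smaller one.\<close>
  have key: "(r - p) * q - 2 * e = 2 * \<beta> * r - 2 * r / p + 2"
    using p0 by (simp add: q_def e_def w_def field_simps)
  have key': "2 * \<beta> * r * q - (2 * \<beta> * r - 2 * r / p + 2) * w = 4 * e / p"
    using p0 by (simp add: q_def e_def w_def field_simps)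
  have "\<exists>i j::nat. i \<le> j \<and> D * ((1/2) ^ j) powr (\<beta> - 1 / p) \<le> \<rho> * ((1/2) ^ j) powr (-1/2) \<and>
       2 ^ j \<le> 2 * (D / \<rho>) powr (2 / q) \<and>
       \<rho> powr r * 2 powr (real i * r / 2) + \<rho> powr (r - p) * (\<Sum>k\<in>{i..<j}. 2 powr (real k * e)) \<le> C * rho_rate r \<beta> p T \<rho>"
    if \<rho>: "0 < \<rho>" "\<rho> \<le> 1" and T: "1 \<le> T" "- log 2 \<rho> \<le> T" for \<rho> T
  proof -
    define a where "a = - log 2 \<rho>"
    have a: "0 \<le> a" "a \<le> T" using \<rho> T by (auto simp: a_def)
    have \<rho>2: "\<rho> = 2 powr (- a)" using \<rho> by (simp add: a_def)
    \<comment> \<open>2^i is \<rho>^(-2/w) and 2^j is (D / \<rho>)^(2/q), rounded down and up; the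
      roundings cost the constants 2^(-e) and 2^e in C.\<close>
    define i where "i = nat \<lfloor>2 * a / w\<rfloor>"
    define j where "j = nat \<lceil>2 / q * (d + a)\<rceil>"
    have pos: "0 \<le> 2 * a / w" "0 \<le> 2 / q * (d + a)" using a d q0 w0 by auto
    have i: "real i \<le> 2 * a / w" "2 * a / w - 1 \<le> real i" using pos(1) unfolding i_def by linarith+
    have j: "2 / q * (d + a) \<le> real j" "real j \<le> 2 / q * (d + a) + 1" using pos(2) unfolding j_def by linarith+
    have "2 * a / w \<le> 2 * a / q" using a q0 q by (intro divide_left_mono) auto
    also have "\<dots> = 2 / q * a" by simp
    also have "\<dots> \<le> 2 / q * (d + a)" using d q0 by (intro mult_left_mono) auto
    finally have ij: "i \<le> j" using i(1) j(1) by linarith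
    have hp: "((1/2) ^ m) powr x = 2 powr (- (real m * x))" for m :: nat and x :: real
    proof -
      have "((1/2::real) ^ m) = 2 powr (- real m)" by (simp add: powr_minus powr_realpow power_one_over inverse_eq_divide)
      then show ?thesis by (simp add: powr_powr)
    qed
    have "d + a = 2 / q * (d + a) * (q / 2)" using q0 by simp
    also have "\<dots> \<le> real j * (q / 2)" using j q0 by (intro mult_right_mono) auto
    also have "\<dots> = real j * (\<beta> - 1 / p) + real j / 2" by (simp add: q_def field_simps)
    finally have top: "d + - (real j * (\<beta> - 1 / p)) \<le> - a + - (real j * (-1/2))" by simp
    have t2: "(2::real) ^ j \<le> 2 * (D / \<rho>) powr (2 / q)"
    proof -
      have "(2::real) ^ j = 2 powr real j" by (simp add: powr_realpow)
      also have "\<dots> \<le> 2 powr (1 + (d + a) * (2 / q))" using j(2) by (intro powr_mono) (auto simp: mult.commute)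
      also have "\<dots> = 2 * (2 powr d / 2 powr (- a)) powr (2 / q)"
        unfolding powr_diff[symmetric] powr_powr by (simp add: powr_add)
      finally show ?thesis unfolding D2 \<rho>2 .
    qed
    define R where "R = 2 powr (- a * (2 * \<beta> * r / w))"
    have first: "\<rho> powr r * 2 powr (real i * r / 2) \<le> R"
    proof -
      have "- a * r + real i * r / 2 \<le> - a * r + 2 * a / w * r / 2"
        using i(1) r by (intro add_left_mono divide_right_mono mult_right_mono) auto
      also have "\<dots> = - a * (2 * \<beta> * r / w)" using w0 by (simp add: field_simps) (simp add: w_def algebra_simps)
      finally have "2 powr (- a * r + real i * r / 2) \<le> R" unfolding R_def by (intro powr_mono) auto
      then show ?thesis unfolding \<rho>2 powr_powr powr_add .
    qed
    have R: "0 \<le> R" by (simp add: R_def)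
    define \<Sigma> where "\<Sigma> = (\<Sum>k\<in>{i..<j}. 2 powr (real k * e))"
    have \<Sigma>0: "0 \<le> \<Sigma>" by (simp add: \<Sigma>_def sum_nonneg)
    have \<Sigma>: "\<Sigma> = (\<Sum>k\<in>{i..<j}. (2 powr e) ^ k)"
      unfolding \<Sigma>_def by (intro sum.cong) (auto simp: powr_realpow[symmetric] powr_powr mult.commute)
    have gb: "(1 - 2 powr e) * \<Sigma> = 2 powr (real i * e) - 2 powr (real j * e)"
      unfolding \<Sigma> geometric_block[OF ij] by (simp add: powr_realpow[symmetric] powr_powr mult.commute)
    have rp: "\<rho> powr x * 2 powr y = 2 powr (- a * x + y)" for x y unfolding \<rho>2 powr_powr powr_add ..
    have "\<rho> powr r * 2 powr (real i * r / 2) + \<rho> powr (r - p) * \<Sigma> \<le> C * rho_rate r \<beta> p T \<rho>"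
    proof -
      consider "e < 0" | "e = 0" | "0 < e" by linarith
      then show ?thesis
      proof cases
        case 1
        then have c: "(2 * \<beta> + 1) * p > r" by (simp add: e_def w_def mult.commute)
        have x: "2 powr e < 1" using 1 by (simp add: powr_less_one)
        have "(1 - 2 powr e) * \<Sigma> \<le> 2 powr (real i * e)" unfolding gb by simp
        then have "\<Sigma> \<le> 2 powr (real i * e) / \<bar>1 - 2 powr e\<bar>" using x by (simp add: pos_le_divide_eq mult.commute)
        then have "\<rho> powr (r - p) * \<Sigma> \<le> \<rho> powr (r - p) * (2 powr (real i * e) / \<bar>1 - 2 powr e\<bar>)" by (intro mult_left_mono) auto
        also have "\<dots> = 2 powr (- a * (r - p) + real i * e) / \<bar>1 - 2 powr e\<bar>" unfolding rp[symmetric] by (simp only: times_divide_eq_right)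
        also have "\<dots> \<le> 2 powr (- a * (2 * \<beta> * r / w) + - e) / \<bar>1 - 2 powr e\<bar>"
        proof (intro divide_right_mono powr_mono)
          have "real i * e \<le> (2 * a / w - 1) * e" using i(2) 1 by (intro mult_right_mono_neg) auto
          then have "- a * (r - p) + real i * e \<le> - a * (r - p) + (2 * a / w - 1) * e" by simp
          also have "\<dots> = - a * (2 * \<beta> * r / w) + - e" using w0 by (simp add: e_def field_simps) (simp add: w_def algebra_simps)
          finally show "- a * (r - p) + real i * e \<le> - a * (2 * \<beta> * r / w) + - e" .
        qed auto
        also have "\<dots> = 2 powr (- e) / \<bar>1 - 2 powr e\<bar> * R" unfolding powr_add R_def by simp
        finally have "\<rho> powr r * 2 powr (real i * r / 2) + \<rho> powr (r - p) * \<Sigma> \<le> (1 + 2 powr (- e) / \<bar>1 - 2 powr e\<bar>) * R"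
          using first by (simp add: distrib_right)
        also have "\<dots> \<le> C * R" by (rule mult_right_mono[OF C1(2) R])
        also have "R = rho_rate r \<beta> p T \<rho>" using c by (simp add: rho_rate_def R_def \<rho>2 powr_powr w_def)
        finally show ?thesis .
      next
        case 2
        then have c: "(2 * \<beta> + 1) * p = r" by (simp add: e_def w_def mult.commute)
        have rpx: "r - p = 2 * \<beta> * r / w" using c w0 by (simp add: w_def field_simps)
        \<comment> \<open>All terms equal 1, and their number is at most a constant times T: this is
          the extra logarithm of the critical case.\<close>
        have "\<Sigma> = real j - real i" using ij unfolding \<Sigma>_def 2 by simp
        also have "\<dots> \<le> 2 / q * (d + a) + 1" using j(2) by linarith
        also have "\<dots> \<le> 2 / q * ((d + 1) * T) + 1 * T"
        proof -
          have "d * 1 \<le> d * T" using d T by (intro mult_left_mono) auto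
          then have "d + a \<le> (d + 1) * T" using a by (simp add: distrib_right)
          then have "2 / q * (d + a) \<le> 2 / q * ((d + 1) * T)" using q0 by (intro mult_left_mono) auto
          then show ?thesis using T by linarith
        qed
        also have "\<dots> = (1 + 2 / q * (d + 1)) * T" by (simp add: distrib_right)
        finally have "\<rho> powr (r - p) * \<Sigma> \<le> \<rho> powr (r - p) * ((1 + 2 / q * (d + 1)) * T)" by (intro mult_left_mono) auto
        also have rR: "\<rho> powr (r - p) = R" unfolding rpx R_def \<rho>2 powr_powr ..
        finally have "\<rho> powr r * 2 powr (real i * r / 2) + \<rho> powr (r - p) * \<Sigma> \<le> R * T + R * ((1 + 2 / q * (d + 1)) * T)"
          using first mult_left_mono[OF T(1) R] unfolding rR by linarith
        also have "\<dots> = (1 + (1 + 2 / q * (d + 1))) * (R * T)" by (simp add: algebra_simps)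
        also have "\<dots> \<le> C * (R * T)" using R T by (intro mult_right_mono C1) auto
        also have "R * T = rho_rate r \<beta> p T \<rho>" using c by (simp add: rho_rate_def R_def \<rho>2 powr_powr w_def)
        finally show ?thesis .
      next
        case 3
        then have c: "\<not> (2 * \<beta> + 1) * p > r" "(2 * \<beta> + 1) * p \<noteq> r" by (auto simp: e_def w_def mult.commute)
        define v where "v = (2 * \<beta> * r - 2 * r / p + 2) / q"
        define R' where "R' = 2 powr (- a * v)"
        have R': "0 \<le> R'" by (simp add: R'_def)
        have "0 \<le> 4 * e / p" using 3 p0 by simp
        then have "(2 * \<beta> * r - 2 * r / p + 2) * w \<le> 2 * \<beta> * r * q" using key' by linarith
        then have "v \<le> 2 * \<beta> * r / w" unfolding v_def using q0 w0 by (simp add: divide_le_eq pos_le_divide_eq)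
        then have "R \<le> R'" unfolding R_def R'_def mult_minus_left using a by (intro powr_mono le_imp_neg_le mult_left_mono) auto
        then have first': "\<rho> powr r * 2 powr (real i * r / 2) \<le> R'" using first by linarith
        have x: "1 < 2 powr e" using 3 by simp
        have "(2 powr e - 1) * \<Sigma> = 2 powr (real j * e) - 2 powr (real i * e)" using gb by (simp add: left_diff_distrib)
        then have "(2 powr e - 1) * \<Sigma> \<le> 2 powr (real j * e)" by simp
        then have "\<Sigma> \<le> 2 powr (real j * e) / \<bar>1 - 2 powr e\<bar>" using x by (simp add: pos_le_divide_eq mult.commute)
        then have "\<rho> powr (r - p) * \<Sigma> \<le> \<rho> powr (r - p) * (2 powr (real j * e) / \<bar>1 - 2 powr e\<bar>)" by (intro mult_left_mono) auto
        also have "\<dots> = 2 powr (- a * (r - p) + real j * e) / \<bar>1 - 2 powr e\<bar>" unfolding rp[symmetric] by (simp only: times_divide_eq_right)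
        also have "\<dots> \<le> 2 powr (- a * v + (2 * e * d / q + e)) / \<bar>1 - 2 powr e\<bar>"
        proof (intro divide_right_mono powr_mono)
          have "real j * e \<le> (2 / q * (d + a) + 1) * e" using j(2) 3 by (intro mult_right_mono) auto
          then have "- a * (r - p) + real j * e \<le> - a * (r - p) + (2 / q * (d + a) + 1) * e" by simp
          also have "\<dots> = - a * (((r - p) * q - 2 * e) / q) + (2 * e * d / q + e)" using q0 by (simp add: field_simps)
          finally show "- a * (r - p) + real j * e \<le> - a * v + (2 * e * d / q + e)" unfolding key v_def .
        qed auto
        also have "\<dots> = 2 powr (2 * e * d / q + e) / \<bar>1 - 2 powr e\<bar> * R'" unfolding powr_add[of 2 "- a * v"] R'_def by simp
        finally have "\<rho> powr r * 2 powr (real i * r / 2) + \<rho> powr (r - p) * \<Sigma> \<le> (1 + 2 powr (2 * e * d / q + e) / \<bar>1 - 2 powr e\<bar>) * R'"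
          using first' by (simp add: distrib_right)
        also have "\<dots> \<le> C * R'" by (rule mult_right_mono[OF C1(4) R'])
        also have "R' = rho_rate r \<beta> p T \<rho>" using c by (simp add: rho_rate_def R'_def \<rho>2 powr_powr v_def q_def)
        finally show ?thesis .
      qed
    qed
    moreover have "D * ((1/2) ^ j) powr (\<beta> - 1 / p) \<le> \<rho> * ((1/2) ^ j) powr (-1/2)"
      unfolding hp D2 \<rho>2 powr_add[symmetric] using top by (intro powr_mono) auto
    ultimately show ?thesis using ij t2 unfolding \<Sigma>_def by blast
  qed
  then show ?thesis using C0 unfolding dyadic_sum_bound_def q_def e_def w_def by blast
qed

context single_index_target
begin

text \<open>Each t uses the first level m >= i at which it is not exceptional; level j has no
  exceptional points. If m > i, then t is exceptional at m - 1, so its loss is charged to that set,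
  and the shift by one level costs 2^(r/2). The measures of the exceptional sets then turn the
  layers into the stated sum.\<close>

lemma level_sum_bound:
  assumes ij: "i \<le> j" and \<rho>: "0 < \<rho>" and Z: "0 \<le> Z"
    and top: "bias_const * ((1/2) ^ j) powr (\<beta> - 1 / p) \<le> \<rho> * ((1/2) ^ j) powr (-1/2)"
    and err: "\<And>t m. t \<in> cube (1/2) \<Longrightarrow> i \<le> m \<Longrightarrow> m \<le> j \<Longrightarrow> bias_ok ((1/2) ^ m) (\<rho> * ((1/2) ^ m) powr (-1/2)) (t \<bullet> \<theta>0) \<Longrightarrow>
      \<bar>err t\<bar> \<le> Z * (\<rho> * ((1/2) ^ m) powr (-1/2))"
  shows "(\<integral>\<^sup>+t. ennreal (\<bar>err t\<bar> powr r) \<partial>restrict_space lborel (cube (1/2)))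
    \<le> ennreal (Z powr r * (2 + 2 * bias_const * 2 powr (r/2)) *
       (\<rho> powr r * 2 powr (real i * r / 2) + \<rho> powr (r - p) * (\<Sum>m\<in>{i..<j}. 2 powr (real m * ((r - p * (2 * \<beta> + 1)) / 2)))))"
proof -
  define lam where "lam m = \<rho> * 2 powr (real m / 2)" for m :: nat
  have hp: "((1/2::real) ^ m) powr x = 2 powr (- (real m * x))" for m :: nat and x :: real
  proof -
    have "((1/2::real) ^ m) = 2 powr (- real m)" by (simp add: powr_minus powr_realpow power_one_over inverse_eq_divide)
    then show ?thesis by (simp add: powr_powr)
  qed
  have lam: "\<rho> * ((1/2) ^ m) powr (-1/2) = lam m" for m :: nat unfolding hp lam_def by simp
  have lam0: "0 < lam m" for m using \<rho> by (simp add: lam_def)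
  have bc: "0 \<le> bias_const" by (rule bias_const_nonneg)
  define Q where "Q m V \<longleftrightarrow> V \<in> sets borel \<and> emeasure lborel V \<le> ennreal (bias_const * ((1/2) ^ m) powr (\<beta> * p) / lam m powr p) \<and>
    (bias_const * ((1/2) ^ m) powr (\<beta> - 1 / p) \<le> lam m \<longrightarrow> V = {}) \<and> (\<forall>u. u \<notin> V \<longrightarrow> bias_ok ((1/2) ^ m) (lam m) u)" for m :: nat and V
  have "\<forall>m. \<exists>V. Q m V"
  proof
    fix m :: nat
    have "0 < (1/2 :: real) ^ m" by simp
    from bias_level_set[OF this lam0[of m]] show "\<exists>V. Q m V" unfolding Q_def bias_ok_def by blast
  qed
  then obtain U where "\<forall>m. Q m (U m)" using choice by metis
  then have U [measurable]: "U m \<in> sets borel" and Ue: "emeasure lborel (U m) \<le> ennreal (bias_const * ((1/2) ^ m) powr (\<beta> * p) / lam m powr p)"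
    and Utop: "bias_const * ((1/2) ^ m) powr (\<beta> - 1 / p) \<le> lam m \<Longrightarrow> U m = {}"
    and Uok: "u \<notin> U m \<Longrightarrow> bias_ok ((1/2) ^ m) (lam m) u" for m u unfolding Q_def by blast+
  have Uj: "U j = {}" by (rule Utop) (use top in \<open>simp only: lam\<close>)
  define B where "B m = {t \<in> cube (1/2). t \<bullet> \<theta>0 \<in> U m}" for m
  have B [measurable]: "B m \<in> sets borel" for m
  proof -
    have [measurable]: "(\<lambda>t::real^2. t \<bullet> \<theta>0) \<in> borel_measurable borel" by measurable
    have "B m = cube (1/2) \<inter> ((\<lambda>t::real^2. t \<bullet> \<theta>0) -` U m \<inter> space borel)" by (auto simp: B_def)
    then show ?thesis by (simp only:) (intro sets.Int cube_borel measurable_sets[OF _ U], measurable)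
  qed
  define c where "c = Z powr r"
  define H where "H t = ennreal c * (ennreal (lam i powr r) * indicator (cube (1/2)) t + (\<Sum>m\<in>{i..<j}. ennreal (lam (Suc m) powr r) * indicator (B m) t))" for t :: "real^2"
  have pt: "ennreal (\<bar>err t\<bar> powr r) * indicator (cube (1/2)) t \<le> H t" for t
  proof (cases "t \<in> cube (1/2)")
    case True
    define m where "m = (LEAST m. i \<le> m \<and> t \<bullet> \<theta>0 \<notin> U m)"
    have ex: "i \<le> j \<and> t \<bullet> \<theta>0 \<notin> U j" using ij Uj by simp
    have m: "i \<le> m" "t \<bullet> \<theta>0 \<notin> U m" using LeastI[of "\<lambda>m. i \<le> m \<and> t \<bullet> \<theta>0 \<notin> U m", OF ex] by (auto simp: m_def)
    have mj: "m \<le> j" unfolding m_def by (rule Least_le) (rule ex)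
    have "\<bar>err t\<bar> \<le> Z * lam m" using err[OF True m(1) mj] Uok[OF m(2)] unfolding lam by blast
    then have "\<bar>err t\<bar> powr r \<le> (Z * lam m) powr r" using r by (intro powr_mono2) auto
    also have "\<dots> = c * lam m powr r" using Z lam0[of m] by (simp add: c_def powr_mult)
    finally have 1: "ennreal (\<bar>err t\<bar> powr r) \<le> ennreal c * ennreal (lam m powr r)"
      by (simp add: c_def ennreal_leI ennreal_mult'[symmetric])
    have "ennreal (lam m powr r) \<le> ennreal (lam i powr r) * indicator (cube (1/2)) t + (\<Sum>m\<in>{i..<j}. ennreal (lam (Suc m) powr r) * indicator (B m) t)"
    proof (cases "m = i")
      case True
      then show ?thesis using \<open>t \<in> cube (1/2)\<close> by simp
    next
      case False
      then obtain l where l: "m = Suc l" "i \<le> l" using m(1) by (cases m) auto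
      have "\<not> (i \<le> l \<and> t \<bullet> \<theta>0 \<notin> U l)" using l unfolding m_def by (intro not_less_Least) simp
      then have "t \<in> B l" using l True by (simp add: B_def)
      then have "ennreal (lam m powr r) = ennreal (lam (Suc l) powr r) * indicator (B l) t" using l by simp
      also have "\<dots> \<le> (\<Sum>m\<in>{i..<j}. ennreal (lam (Suc m) powr r) * indicator (B m) t)"
        using l mj by (intro member_le_sum) auto
      also have "\<dots> \<le> ennreal (lam i powr r) * indicator (cube (1/2)) t + \<dots>" by (rule add_increasing) auto
      finally show ?thesis .
    qed
    then have "ennreal c * ennreal (lam m powr r) \<le> H t" unfolding H_def by (rule mult_left_mono) simp
    then show ?thesis using 1 True by simp
  qed simp
  have "(\<integral>\<^sup>+t. ennreal (\<bar>err t\<bar> powr r) \<partial>restrict_space lborel (cube (1/2))) = (\<integral>\<^sup>+t. ennreal (\<bar>err t\<bar> powr r) * indicator (cube (1/2)) t \<partial>lborel)"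
    by (rule nn_integral_restrict_space) simp
  also have "\<dots> \<le> (\<integral>\<^sup>+t. H t \<partial>lborel)" by (rule nn_integral_mono) (rule pt)
  also have "\<dots> = ennreal c * (ennreal (lam i powr r) * emeasure lborel (cube (1/2)) + (\<Sum>m\<in>{i..<j}. ennreal (lam (Suc m) powr r) * emeasure lborel (B m)))"
  proof -
    have ind: "(\<integral>\<^sup>+t. ennreal x * indicator V t \<partial>lborel) = ennreal x * emeasure lborel V"
      "(\<lambda>t. ennreal x * indicator V t) \<in> borel_measurable lborel" if "V \<in> sets borel" for x and V :: "(real^2) set"
      using that by (auto intro!: nn_integral_cmult_indicator)
    define g where "g m t = ennreal (lam (Suc m) powr r) * indicator (B m) t" for m t
    have gm: "g m \<in> borel_measurable lborel" for m unfolding g_def[abs_def] by (rule ind(2)[OF B])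
    have gi: "(\<integral>\<^sup>+t. g m t \<partial>lborel) = ennreal (lam (Suc m) powr r) * emeasure lborel (B m)" for m
      unfolding g_def by (rule ind(1)[OF B])
    have s: "(\<integral>\<^sup>+t. (\<Sum>m\<in>{i..<j}. g m t) \<partial>lborel) = (\<Sum>m\<in>{i..<j}. ennreal (lam (Suc m) powr r) * emeasure lborel (B m))"
      unfolding gi[symmetric] by (rule nn_integral_sum) (rule gm)
    have sm: "(\<lambda>t. \<Sum>m\<in>{i..<j}. g m t) \<in> borel_measurable lborel" by (intro borel_measurable_sum gm)
    note add = nn_integral_add[OF ind(2)[OF cube_borel] sm, of "lam i powr r" "1/2"]
    have "(\<lambda>t. ennreal (lam i powr r) * indicator (cube (1/2)) t + (\<Sum>m\<in>{i..<j}. g m t)) \<in> borel_measurable lborel"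
      by (intro borel_measurable_add ind(2) cube_borel sm)
    from nn_integral_cmult[OF this, of "ennreal c"] show ?thesis
      unfolding add s ind(1)[OF cube_borel] unfolding H_def g_def .
  qed
  also have "\<dots> \<le> ennreal c * (ennreal (lam i powr r) * 2 + (\<Sum>m\<in>{i..<j}. ennreal (2 * bias_const * 2 powr (r/2) * (\<rho> powr (r - p) * 2 powr (real m * ((r - p * (2 * \<beta> + 1)) / 2))))))"
  proof (intro mult_left_mono add_mono sum_mono emeasure_cube_half)
    fix m
    have "emeasure lborel (B m) \<le> 2 * emeasure lborel (U m)" unfolding B_def by (rule strip_measure[OF \<theta>0 U])
    also have "\<dots> \<le> 2 * ennreal (bias_const * ((1/2) ^ m) powr (\<beta> * p) / lam m powr p)" by (intro mult_left_mono Ue) auto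
    also have "\<dots> = ennreal (2 * (bias_const * ((1/2) ^ m) powr (\<beta> * p) / lam m powr p))"
      using bc by (subst ennreal_mult') auto
    finally have "ennreal (lam (Suc m) powr r) * emeasure lborel (B m) \<le> ennreal (lam (Suc m) powr r) * ennreal (2 * (bias_const * ((1/2) ^ m) powr (\<beta> * p) / lam m powr p))"
      by (rule mult_left_mono) simp
    also have "\<dots> = ennreal (2 * bias_const * (lam (Suc m) powr r * ((1/2) ^ m) powr (\<beta> * p) / lam m powr p))"
      by (simp add: ennreal_mult'[symmetric] mult_ac)
    also have "lam (Suc m) powr r * ((1/2) ^ m) powr (\<beta> * p) / lam m powr p =
       2 powr (r/2) * (\<rho> powr (r - p) * 2 powr (real m * ((r - p * (2 * \<beta> + 1)) / 2)))"
    proof -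
      have a: "lam m powr x = \<rho> powr x * 2 powr (real m / 2 * x)" for m x using \<rho> by (simp add: lam_def powr_mult powr_powr)
      have "lam (Suc m) powr r * ((1/2) ^ m) powr (\<beta> * p) / lam m powr p =
        (\<rho> powr r / \<rho> powr p) * (2 powr (real (Suc m) / 2 * r) * 2 powr (- (real m * (\<beta> * p))) / 2 powr (real m / 2 * p))"
        unfolding a hp by simp
      also have "\<dots> = \<rho> powr (r - p) * 2 powr (real (Suc m) / 2 * r + - (real m * (\<beta> * p)) - real m / 2 * p)"
        by (simp only: powr_diff powr_add)
      also have "real (Suc m) / 2 * r + - (real m * (\<beta> * p)) - real m / 2 * p = r / 2 + real m * ((r - p * (2 * \<beta> + 1)) / 2)"
        by (simp add: field_simps)
      also have "\<rho> powr (r - p) * 2 powr (r / 2 + real m * ((r - p * (2 * \<beta> + 1)) / 2)) = 2 powr (r/2) * (\<rho> powr (r - p) * 2 powr (real m * ((r - p * (2 * \<beta> + 1)) / 2)))"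
        unfolding powr_add[of 2 "r / 2"] by simp
      finally show ?thesis .
    qed
    finally show "ennreal (lam (Suc m) powr r) * emeasure lborel (B m) \<le> ennreal (2 * bias_const * 2 powr (r/2) * (\<rho> powr (r - p) * 2 powr (real m * ((r - p * (2 * \<beta> + 1)) / 2))))"
      by (simp only: mult.assoc)
  qed simp_all
  also have "\<dots> = ennreal (c * (lam i powr r * 2 + (\<Sum>m\<in>{i..<j}. 2 * bias_const * 2 powr (r/2) * (\<rho> powr (r - p) * 2 powr (real m * ((r - p * (2 * \<beta> + 1)) / 2))))))"
  proof -
    have s0: "0 \<le> (\<Sum>m\<in>{i..<j}. 2 * bias_const * 2 powr (r/2) * (\<rho> powr (r - p) * 2 powr (real m * ((r - p * (2 * \<beta> + 1)) / 2))))"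
      using bc by (intro sum_nonneg) auto
    have e2: "ennreal (lam i powr r) * 2 = ennreal (lam i powr r * 2)" by (subst ennreal_mult) auto
    show ?thesis unfolding e2 using bc s0
      by (subst sum_ennreal) (auto simp: c_def ennreal_plus[symmetric] ennreal_mult'[symmetric] simp del: ennreal_plus)
  qed
  also have "\<dots> \<le> ennreal (c * (2 + 2 * bias_const * 2 powr (r/2)) *
       (\<rho> powr r * 2 powr (real i * r / 2) + \<rho> powr (r - p) * (\<Sum>m\<in>{i..<j}. 2 powr (real m * ((r - p * (2 * \<beta> + 1)) / 2)))))"
  proof (rule ennreal_leI)
    define A1 where "A1 = \<rho> powr r * 2 powr (real i * r / 2)"
    define A2 where "A2 = \<rho> powr (r - p) * (\<Sum>m\<in>{i..<j}. 2 powr (real m * ((r - p * (2 * \<beta> + 1)) / 2)))"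
    define b2 where "b2 = 2 * bias_const * 2 powr (r/2)"
    have A: "0 \<le> A1" "0 \<le> A2" "0 \<le> b2" using bc by (auto simp: A1_def A2_def b2_def sum_nonneg)
    have l: "lam i powr r = A1" using \<rho> by (simp add: lam_def A1_def powr_mult powr_powr)
    have s: "(\<Sum>m\<in>{i..<j}. b2 * (\<rho> powr (r - p) * 2 powr (real m * ((r - p * (2 * \<beta> + 1)) / 2)))) = b2 * A2"
      unfolding A2_def by (simp add: sum_distrib_left)
    have "0 \<le> b2 * A1" using A by simp
    then have "A1 * 2 + b2 * A2 \<le> (2 + b2) * (A1 + A2)" using A by (simp add: distrib_left distrib_right)
    then have "c * (A1 * 2 + b2 * A2) \<le> c * ((2 + b2) * (A1 + A2))" by (intro mult_left_mono) (auto simp: c_def)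
    then show "c * (lam i powr r * 2 + (\<Sum>m\<in>{i..<j}. 2 * bias_const * 2 powr (r/2) * (\<rho> powr (r - p) * 2 powr (real m * ((r - p * (2 * \<beta> + 1)) / 2)))))
      \<le> c * (2 + 2 * bias_const * 2 powr (r/2)) * (\<rho> powr r * 2 powr (real i * r / 2) + \<rho> powr (r - p) * (\<Sum>m\<in>{i..<j}. 2 powr (real m * ((r - p * (2 * \<beta> + 1)) / 2))))"
      unfolding b2_def[symmetric] l s A1_def[symmetric] A2_def[symmetric] by (simp only: mult.assoc)
  qed
  finally show ?thesis unfolding c_def .
qed

end

section \<open>Risk\<close>

text \<open>The factor of \<open>rate\<close> that carries L. The analysis tracks \<rho> only and
  divides by this factor at the end.\<close>

definition rate_const :: "real \<Rightarrow> real \<Rightarrow> real \<Rightarrow> real \<Rightarrow> real" where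
  "rate_const r \<beta> L p = (if r \<le> (2 * \<beta> + 1) * p then L powr (1 / (2 * \<beta> + 1)) else L powr ((1/2 - 1/r) / (\<beta> - 1/p + 1/2)))"

lemma rate_const_pos: "0 < L \<Longrightarrow> 0 < rate_const r \<beta> L p"
  by (simp add: rate_const_def)

lemma rate_eq:
  assumes n: "3 \<le> n" and p: "1 < p" and \<beta>: "1 / p < \<beta>" and r: "1 \<le> r"
  shows "rate r n \<beta> L p = rate_const r \<beta> L p * rho_rate r \<beta> p (ln n) (sqrt (ln n / n)) powr (1 / r)"
proof -
  have L: "1 \<le> ln (real n)" by (rule ln_ge_1[OF n])
  define x where "x = ln (real n) / real n"
  have x: "0 < x" using L n by (simp add: x_def)
  have s: "sqrt x powr y = x powr (y / 2)" for y using x by (simp add: powr_half_sqrt[symmetric] powr_powr)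
  have pp: "(x powr y) powr (1 / r) = x powr (y / r)" for y by (simp add: powr_powr)
  have e1: "2 * \<beta> * r / w / 2 / r = \<beta> / w" for w using r by simp
  have e2: "(2 * \<beta> * r - 2 * r / p + 2) / (2 * \<beta> - 2 / p + 1) / 2 / r = (\<beta> - 1 / p + 1 / r) / (2 * \<beta> - 2 / p + 1)"
  proof -
    have "(2 * \<beta> * r - 2 * r / p + 2) / 2 / r = \<beta> - 1 / p + 1 / r" using r by (simp add: field_simps)
    moreover have "(2 * \<beta> * r - 2 * r / p + 2) / (2 * \<beta> - 2 / p + 1) / 2 / r = ((2 * \<beta> * r - 2 * r / p + 2) / 2 / r) / (2 * \<beta> - 2 / p + 1)" by simp
    ultimately show ?thesis by simp
  qed
  consider "(2 * \<beta> + 1) * p > r" | "(2 * \<beta> + 1) * p = r" | "(2 * \<beta> + 1) * p < r" by linarith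
  then show ?thesis
  proof cases
    case 1
    then show ?thesis unfolding rate_def Let_def x_def[symmetric] rate_const_def rho_rate_def s
      by (simp only: if_True pp e1 less_imp_le)
  next
    case 2
    then have c: "\<not> (2 * \<beta> + 1) * p > r" "r \<le> (2 * \<beta> + 1) * p" by simp_all
    have "(x powr (2 * \<beta> * r / (2 * \<beta> + 1) / 2) * ln n) powr (1 / r) = x powr (\<beta> / (2 * \<beta> + 1)) * ln n powr (1 / r)"
      using L by (subst powr_mult) (simp_all only: pp e1)
    then show ?thesis using c 2 unfolding rate_def Let_def x_def[symmetric] rate_const_def rho_rate_def s
      by (simp only: simp_thms if_True if_False mult.assoc)
  next
    case 3
    then have c: "\<not> (2 * \<beta> + 1) * p > r" "(2 * \<beta> + 1) * p \<noteq> r" "\<not> r \<le> (2 * \<beta> + 1) * p" by simp_all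
    then show ?thesis unfolding rate_def Let_def x_def[symmetric] rate_const_def rho_rate_def s
      by (simp only: if_False pp e2)
  qed
qed

text \<open>The exponents of ln n / n in the rate are at most 1, so errors of order 1 / n are
  absorbed by the rate.\<close>

lemma rate_ge:
  assumes n: "3 \<le> n" and p: "1 < p" and \<beta>: "1 / p < \<beta>" and r: "1 \<le> r"
  shows "rate_const r \<beta> L p / n \<le> rate r n \<beta> L p"
proof -
  have L: "1 \<le> ln (real n)" by (rule ln_ge_1[OF n])
  define x where "x = ln (real n) / real n"
  have n0: "0 < real n" using n by simp
  have x: "0 < x" "x \<le> 1" using L n0 ln_le_minus_one[OF n0] by (auto simp: x_def)
  have nx: "1 / n \<le> x" unfolding x_def using L n0 by (intro divide_right_mono) auto
  have lo: "1 / n \<le> x powr e" if "e \<le> 1" for e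
    using nx powr_mono'[OF that, of x] x by simp
  have R: "0 \<le> rate_const r \<beta> L p" by (simp add: rate_const_def)
  have bp: "0 < 1 / p" using p by simp
  have e1: "\<beta> / (2 * \<beta> + 1) \<le> 1"
  proof -
    have "0 < 2 * \<beta> + 1" "\<beta> \<le> 2 * \<beta> + 1" using \<beta> bp by linarith+
    then show ?thesis by (simp only: divide_le_eq_1_pos)
  qed
  have e2: "(\<beta> - 1 / p + 1 / r) / (2 * \<beta> - 2 / p + 1) \<le> 1"
  proof -
    have "1 / r \<le> 1" using r by simp
    then have "\<beta> - 1 / p + 1 / r \<le> 2 * \<beta> - 2 / p + 1" using \<beta> by simp
    moreover have "0 < 2 * \<beta> - 2 / p + 1" using \<beta> by simp
    ultimately show ?thesis by (simp only: divide_le_eq_1_pos)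
  qed
  have l1: "1 \<le> ln (real n) powr (1 / r)" using L r by (intro ge_one_powr_ge_zero) auto
  have "rate_const r \<beta> L p * (1 / n) \<le> rate r n \<beta> L p"
  proof -
    consider "(2 * \<beta> + 1) * p > r" | "(2 * \<beta> + 1) * p = r" | "(2 * \<beta> + 1) * p < r" by linarith
    then show ?thesis
    proof cases
      case 1
      then have "rate r n \<beta> L p = rate_const r \<beta> L p * x powr (\<beta> / (2 * \<beta> + 1))"
        unfolding rate_def Let_def x_def[symmetric] rate_const_def by simp
      then show ?thesis using mult_left_mono[OF lo[OF e1] R] by simp
    next
      case 2
      then have e: "rate r n \<beta> L p = rate_const r \<beta> L p * (x powr (\<beta> / (2 * \<beta> + 1)) * ln n powr (1 / r))"
        unfolding rate_def Let_def x_def[symmetric] rate_const_def by simp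
      have "1 / n * 1 \<le> x powr (\<beta> / (2 * \<beta> + 1)) * ln n powr (1 / r)" using lo[OF e1] l1 by (intro mult_mono) auto
      then show ?thesis unfolding e using R by (intro mult_left_mono) auto
    next
      case 3
      then have "rate r n \<beta> L p = rate_const r \<beta> L p * x powr ((\<beta> - 1 / p + 1 / r) / (2 * \<beta> - 2 / p + 1))"
        unfolding rate_def Let_def x_def[symmetric] rate_const_def by simp
      then show ?thesis using mult_left_mono[OF lo[OF e2] R] by simp
    qed
  qed
  then show ?thesis by simp
qed

section \<open>Bounds away from the good event and for small samples\<close>

context single_index_model
begin

definition env_const :: real where "env_const = 2 * k\<^sup>2 / dens_low S + 1"

text \<open>An envelope of the loss that holds for every outcome. Bandwidths are at least h_min / 2
  >= 1 / (2 n), so a kernel weight is at most of order n, which the division by n in the estimator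
  cancels, leaving the sum of the |Y_i|.\<close>

definition env :: "nat \<Rightarrow> real \<Rightarrow> 'a \<Rightarrow> real" where
  "env n M w = env_const * (real n * M + (\<Sum>i=1..n. \<bar>\<epsilon> i w\<bar>))"

definition moment_const :: "real \<Rightarrow> real" where
  "moment_const M = 2 * env_const\<^sup>2 * (M\<^sup>2 + (sigma S)\<^sup>2)"

lemma env_const_ge: "1 \<le> env_const" using design by (simp add: env_const_def)

lemma env_nonneg: "0 \<le> M \<Longrightarrow> 0 \<le> env n M w"
  unfolding env_def using env_const_ge by (intro mult_nonneg_nonneg add_nonneg_nonneg sum_nonneg) auto

lemma env_measurable: "env n M \<in> borel_measurable P"
proof -
  have "(\<lambda>w. \<bar>\<epsilon> i w\<bar>) \<in> borel_measurable P" if "i \<in> {1..n}" for i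
  proof -
    have [measurable]: "\<epsilon> i \<in> borel_measurable P" using that by (intro \<epsilon>_meas) simp
    show ?thesis by measurable
  qed
  then show ?thesis unfolding env_def[abs_def] by (intro borel_measurable_times borel_measurable_add borel_measurable_sum) auto
qed

text \<open>By Cauchy-Schwarz the squared sum of n absolute noises is at most n times the sum of
  their squares, hence the order n^2.\<close>

lemma env_moment: "(\<integral>\<^sup>+w. ennreal ((env n M w)\<^sup>2) \<partial>P) \<le> ennreal (moment_const M * (real n)\<^sup>2)"
proof -
  define c where "c = 2 * env_const\<^sup>2"
  have c: "0 \<le> c" by (simp add: c_def)
  have em: "(\<lambda>w. ennreal ((\<epsilon> i w)\<^sup>2)) \<in> borel_measurable P" if "i \<in> {1..n}" for i
  proof -
    have [measurable]: "\<epsilon> i \<in> borel_measurable P" using that by (intro \<epsilon>_meas) simp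
    show ?thesis by measurable
  qed
  have le: "(env n M w)\<^sup>2 \<le> c * ((real n)\<^sup>2 * M\<^sup>2) + (\<Sum>i=1..n. c * n * (\<epsilon> i w)\<^sup>2)" for w
  proof -
    have a: "(x + y)\<^sup>2 \<le> 2 * x\<^sup>2 + 2 * y\<^sup>2" for x y :: real
      using zero_le_power2[of "x - y"] by (simp add: power2_sum power2_diff)
    have "(\<Sum>i=1..n. \<bar>\<epsilon> i w\<bar>)\<^sup>2 \<le> (\<Sum>i=1..n. \<bar>\<epsilon> i w\<bar>\<^sup>2) * real (card {1..n})"
      by (rule sum_squared_le_sum_of_squares)
    then have b: "(\<Sum>i=1..n. \<bar>\<epsilon> i w\<bar>)\<^sup>2 \<le> n * (\<Sum>i=1..n. (\<epsilon> i w)\<^sup>2)" by (simp add: mult.commute)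
    have "(env n M w)\<^sup>2 = env_const\<^sup>2 * (real n * M + (\<Sum>i=1..n. \<bar>\<epsilon> i w\<bar>))\<^sup>2" by (simp add: env_def power_mult_distrib)
    also have "\<dots> \<le> env_const\<^sup>2 * (2 * (real n * M)\<^sup>2 + 2 * (n * (\<Sum>i=1..n. (\<epsilon> i w)\<^sup>2)))"
      using a[of "real n * M" "\<Sum>i=1..n. \<bar>\<epsilon> i w\<bar>"] b by (intro mult_left_mono) auto
    also have "\<dots> = c * ((real n)\<^sup>2 * M\<^sup>2) + c * n * (\<Sum>i=1..n. (\<epsilon> i w)\<^sup>2)"
      by (simp add: c_def power_mult_distrib distrib_left)
    finally show ?thesis by (simp only: sum_distrib_left)
  qed
  have "(\<integral>\<^sup>+w. ennreal ((env n M w)\<^sup>2) \<partial>P) \<le> (\<integral>\<^sup>+w. ennreal (c * ((real n)\<^sup>2 * M\<^sup>2)) + (\<Sum>i=1..n. ennreal (c * n) * ennreal ((\<epsilon> i w)\<^sup>2)) \<partial>P)"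
  proof (rule nn_integral_mono)
    fix w
    have "ennreal ((env n M w)\<^sup>2) \<le> ennreal (c * ((real n)\<^sup>2 * M\<^sup>2) + (\<Sum>i=1..n. c * n * (\<epsilon> i w)\<^sup>2))" by (rule ennreal_leI[OF le])
    also have "\<dots> = ennreal (c * ((real n)\<^sup>2 * M\<^sup>2)) + (\<Sum>i=1..n. ennreal (c * n * (\<epsilon> i w)\<^sup>2))"
      using c by (subst ennreal_plus) (auto intro!: sum_nonneg simp: sum_ennreal)
    also have "(\<Sum>i=1..n. ennreal (c * n * (\<epsilon> i w)\<^sup>2)) = (\<Sum>i=1..n. ennreal (c * n) * ennreal ((\<epsilon> i w)\<^sup>2))"
      using c by (intro sum.cong refl ennreal_mult) auto
    finally show "ennreal ((env n M w)\<^sup>2) \<le> ennreal (c * ((real n)\<^sup>2 * M\<^sup>2)) + (\<Sum>i=1..n. ennreal (c * n) * ennreal ((\<epsilon> i w)\<^sup>2))" .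
  qed
  also have "\<dots> = ennreal (c * ((real n)\<^sup>2 * M\<^sup>2)) + (\<Sum>i=1..n. ennreal (c * n) * (\<integral>\<^sup>+w. ennreal ((\<epsilon> i w)\<^sup>2) \<partial>P))"
  proof -
    have "(\<integral>\<^sup>+w. (\<Sum>i=1..n. ennreal (c * n) * ennreal ((\<epsilon> i w)\<^sup>2)) \<partial>P) = (\<Sum>i=1..n. ennreal (c * n) * (\<integral>\<^sup>+w. ennreal ((\<epsilon> i w)\<^sup>2) \<partial>P))"
      using em by (subst nn_integral_sum) (auto intro!: sum.cong nn_integral_cmult)
    moreover have "(\<lambda>w. \<Sum>i=1..n. ennreal (c * n) * ennreal ((\<epsilon> i w)\<^sup>2)) \<in> borel_measurable P"
      using em by (intro borel_measurable_sum borel_measurable_times_ennreal) auto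
    ultimately show ?thesis by (subst nn_integral_add) (auto simp: emeasure_space_1)
  qed
  also have "\<dots> \<le> ennreal (c * ((real n)\<^sup>2 * M\<^sup>2)) + (\<Sum>i=1..n. ennreal (c * n) * ennreal ((sigma S)\<^sup>2))"
    by (intro add_left_mono sum_mono mult_left_mono noise_second_moment) auto
  also have "\<dots> = ennreal (moment_const M * (real n)\<^sup>2)"
  proof -
    have "(\<Sum>i=1..n. ennreal (c * n) * ennreal ((sigma S)\<^sup>2)) = (\<Sum>i=1..n. ennreal (c * n * (sigma S)\<^sup>2))"
      using c by (intro sum.cong refl ennreal_mult[symmetric]) auto
    also have "\<dots> = ennreal (\<Sum>i=1..n. c * n * (sigma S)\<^sup>2)" using c by (intro sum_ennreal) auto
    also have "(\<Sum>i=1..n. c * n * (sigma S)\<^sup>2) = c * ((real n)\<^sup>2 * (sigma S)\<^sup>2)" by (simp add: power2_eq_square)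
    finally have e: "(\<Sum>i=1..n. ennreal (c * n) * ennreal ((sigma S)\<^sup>2)) = ennreal (c * ((real n)\<^sup>2 * (sigma S)\<^sup>2))" .
    have "c * ((real n)\<^sup>2 * M\<^sup>2) + c * ((real n)\<^sup>2 * (sigma S)\<^sup>2) = moment_const M * (real n)\<^sup>2"
      by (simp add: moment_const_def c_def algebra_simps)
    then show ?thesis unfolding e using c by (simp add: ennreal_plus[symmetric] del: ennreal_plus)
  qed
  finally show ?thesis .
qed

lemma moment_const_nonneg: "0 \<le> moment_const M" by (simp add: moment_const_def)

text \<open>The infimum belongs to its set once the set is nonempty, which follows from the
  \<open>C3\<close> bound in \<open>C_upper\<close>. At n = 2 the defining inequality fails: ln 2 <
  1 makes the power with exponent -1/2 at least 1, and \<open>c3\<close> >= 197 makes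
  \<open>C3\<close> at least 1.\<close>

lemma n_ge_3:
  assumes n: "n1 S r \<le> n" shows "3 \<le> n"
proof -
  define A where "A = {m. 1 \<le> m \<and> (\<forall>n\<ge>m. (real n * h_pilot S n ^ 2) powr (-1/2) * C3 S r n \<le> 1/2)}"
  obtain C where C: "0 \<le> C" "\<And>n. 3 \<le> n \<Longrightarrow> U n powr (-1/2) * C3 S r n \<le> C * ln n powr (- 1 / (2 * omg S))"
    using C_upper by blast
  have "((\<lambda>n. C * ln (real n) powr (- 1 / (2 * omg S))) \<longlongrightarrow> 0) sequentially"
  proof -
    have om: "- 1 / (2 * omg S) < 0" using noise_params by (simp add: field_simps)
    have "((\<lambda>n. ln (real n) powr a) \<longlongrightarrow> 0) sequentially" if "a < 0" for a using that by real_asymp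
    from tendsto_mult_right_zero[OF this[OF om]] show ?thesis .
  qed
  then have "eventually (\<lambda>n. C * ln (real n) powr (- 1 / (2 * omg S)) < 1/2) sequentially"
    by (rule order_tendstoD) simp
  then obtain N where N: "\<And>n. N \<le> n \<Longrightarrow> C * ln (real n) powr (- 1 / (2 * omg S)) < 1/2"
    unfolding eventually_sequentially by blast
  have "max 3 N \<in> A"
    unfolding A_def
  proof (intro CollectI conjI allI impI)
    fix n assume "max 3 N \<le> n"
    then have n: "3 \<le> n" "N \<le> n" by auto
    show "(real n * h_pilot S n ^ 2) powr (-1/2) * C3 S r n \<le> 1/2"
      unfolding U_eq[OF n(1)] using C(2)[OF n(1)] N[OF n(2)] by linarith
  qed simp
  then have "Inf A \<in> A" by (intro Inf_nat_def1) auto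
  then have n1: "n1 S r \<in> A" by (simp add: n1_def A_def)
  have "\<not> n1 S r \<le> 2"
  proof
    assume "n1 S r \<le> 2"
    then have "(real 2 * h_pilot S 2 ^ 2) powr (-1/2) * C3 S r 2 \<le> 1/2" using n1 unfolding A_def by blast
    moreover have "1 * 1 \<le> (real 2 * h_pilot S 2 ^ 2) powr (-1/2) * C3 S r 2"
    proof (rule mult_mono)
      have l2: "0 < ln (2::real)" "ln (2::real) \<le> 1" using ln_2_less_1 by simp_all
      define y where "y = ln (2::real) powr (1 + 1 / omg S)"
      have "y \<le> 1 powr (1 + 1 / omg S)" unfolding y_def using l2 noise_params by (intro powr_mono2) auto
      then have y: "0 < y" "y \<le> 1" using l2 by (simp_all add: y_def)
      have hy: "real 2 * h_pilot S 2 ^ 2 = y" using y by (simp add: h_pilot_def y_def)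
      have "1 powr (-1/2 :: real) \<le> y powr (-1/2)" using y by (intro powr_mono2') auto
      then show "1 \<le> (real 2 * h_pilot S 2 ^ 2) powr (-1/2)" unfolding hy by simp
      have "1 * 1 \<le> 10 * G" using G_ge_1 by simp
      also have "10 * G \<le> 20 * lip S * G" using lip_ge G_ge_1 by (intro mult_right_mono) auto
      finally have "0 \<le> ln (5 * real 2 ^ 2 * lip S * G)" by simp
      then have c3: "197 \<le> c3 S r 2" unfolding c3_def G_def using r l2 by simp
      have "1 * 1 * 1 * 1 \<le> 2 * sqrt 2 * G * k\<^sup>2 * sqrt (c3 S r 2)"
      proof (intro mult_mono)
        have "1 \<le> sqrt (c3 S r 2)" using c3 by simp
        then show "1 \<le> sqrt (c3 S r 2)" .
        show "1 \<le> k\<^sup>2" using k1 by simp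
        show "1 \<le> 2 * sqrt (2::real)" by (simp add: order.trans[of 1 "sqrt 2"])
      qed (use G_ge_1 c3 in auto)
      moreover have "0 \<le> 8/3 * inverse (dens_low S) * k\<^sup>2 * c3 S r 2 * (real 2 * h_pilot S 2 ^ 2) powr (-1/2)"
        using c3 design by (intro mult_nonneg_nonneg) auto
      ultimately show "1 \<le> C3 S r 2" unfolding C3_def G_def by linarith
    qed auto
    ultimately show False by linarith
  qed
  then show ?thesis using n by linarith
qed

text \<open>\<open>h_min\<close> is 1 / n up to logarithms, while the right side is a constant times
  (ln n / n)^(1/q) with q > 1.\<close>

lemma eventually_level:
  assumes q: "1 < q" and D: "0 < D"
  shows "eventually (\<lambda>n. h_min S n \<le> (sqrt (ln (real n) / n) / D) powr (2 / q)) sequentially"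
proof -
  define a where "a = 1 / q"
  define c where "c = 1 + 2 / omg S"
  define d where "d = D powr (- (2 / q))"
  have a: "a < 1" and d: "0 < d" using q D by (auto simp: a_def d_def)
  have "((\<lambda>n. (ln (real n) powr c / n) / (ln (real n) / n) powr a) \<longlongrightarrow> 0) sequentially" using a by real_asymp
  then have "eventually (\<lambda>n. (ln (real n) powr c / n) / (ln (real n) / n) powr a < d) sequentially"
    by (rule order_tendstoD) (rule d)
  then show ?thesis using eventually_ge_at_top[of "3::nat"]
  proof eventually_elim
    case (elim n)
    have L: "1 \<le> ln (real n)" by (rule ln_ge_1[OF elim(2)])
    have x: "0 < ln (real n) / n" using L elim by simp
    have "(sqrt (ln (real n) / n) / D) powr (2 / q) = d * (ln (real n) / n) powr a"
    proof -
      define y where "y = ln (real n) / n"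
      have "(sqrt y / D) powr (2 / q) = sqrt y powr (2 / q) / D powr (2 / q)" using x D by (simp add: y_def powr_divide)
      also have "sqrt y powr (2 / q) = y powr a" using x by (simp add: y_def[symmetric] powr_half_sqrt[symmetric] powr_powr a_def)
      finally show ?thesis by (simp add: y_def d_def powr_minus_divide)
    qed
    moreover have "ln (real n) powr c / n \<le> d * (ln (real n) / n) powr a"
    proof -
      have "0 < (ln (real n) / n) powr a" using x by (metis powr_gt_zero less_irrefl)
      from elim(1)[unfolded pos_divide_less_eq[OF this]] show ?thesis by (rule less_imp_le)
    qed
    ultimately show ?case by (simp add: h_min_def c_def)
  qed
qed

end

context single_index_target
begin

lemma loss_everywhere:
  assumes n: "3 \<le> n" and sel: "measurable_minimizer S r n sel" and t: "t \<in> cube (1/2)"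
  shows "\<bar>estimator S n sel (observations X \<epsilon> n F w) t - F t\<bar> \<le> env n M w"
proof -
  let ?z = "observations X \<epsilon> n F w"
  have L: "1 \<le> ln (real n)" by (rule ln_ge_1[OF n])
  have n0: "0 < real n" using n by simp
  have zs: "?z \<in> space (sample_space n)"
    by (auto simp: sample_space_def observations_def space_PiM)
  obtain \<theta>h hh where sel': "sel ?z t = (\<theta>h, hh)" by (cases "sel ?z t")
  have ms: "\<theta>h \<in> unit_circle" "hh \<in> bandwidths S n"
    using sel zs t unfolding measurable_minimizer_def by (metis mem_Sigma_iff sel')+
  have hm: "1 \<le> h_min S n * n"
    unfolding h_min_def using L n0 noise_params by (simp add: ge_one_powr_ge_zero)
  then have h0: "0 < h_min S n" using n0 by (metis less_le_trans zero_less_mult_pos2 zero_less_one)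
  define s where "s = (\<Sum>i=1..n. \<bar>\<epsilon> i w\<bar>)"
  have s0: "0 \<le> s" by (simp add: s_def sum_nonneg)
  have "(\<Sum>i=1..n. \<bar>snd (?z i)\<bar>) \<le> (\<Sum>i=1..n. M + \<bar>\<epsilon> i w\<bar>)"
  proof (rule sum_mono)
    fix i assume "i \<in> {1..n}"
    then have "snd (?z i) = F (X i w) + \<epsilon> i w" by (simp add: observations_def)
    then show "\<bar>snd (?z i)\<bar> \<le> M + \<bar>\<epsilon> i w\<bar>" using F_le[of "X i w"] by linarith
  qed
  also have "\<dots> = n * M + s" by (simp add: sum.distrib s_def)
  finally have y: "(\<Sum>i=1..n. \<bar>snd (?z i)\<bar>) \<le> n * M + s" .
  have nM: "0 \<le> n * M + s" using s0 M0 by simp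
  have "\<bar>F_hat S n ?z (E3 \<theta>h hh 1) t\<bar> \<le> k\<^sup>2 / (dens_low S * (h_min S n / 2)) * (\<Sum>i=1..n. \<bar>snd (?z i)\<bar>) / n"
  proof (rule F_hat_bound[OF _ _ t])
    show "h_min S n / 2 \<le> hh" "hh \<le> 1" using ms(2) by (auto simp: bandwidths_def)
  qed (use ms(1) h0 n in auto)
  also have "\<dots> \<le> k\<^sup>2 / (dens_low S * (h_min S n / 2)) * (n * M + s) / n"
    using y design h0 by (intro divide_right_mono mult_left_mono) auto
  also have "\<dots> = 2 * k\<^sup>2 / dens_low S * (n * M + s) / (h_min S n * n)"
    using design h0 n0 by (simp add: field_simps)
  also have "\<dots> \<le> 2 * k\<^sup>2 / dens_low S * (n * M + s) / 1"
    using design hm nM by (intro divide_left_mono mult_nonneg_nonneg) auto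
  finally have 1: "\<bar>F_hat S n ?z (E3 \<theta>h hh 1) t\<bar> \<le> 2 * k\<^sup>2 / dens_low S * (n * M + s)" by simp
  have "1 * M \<le> n * M" using n M0 by (intro mult_right_mono) auto
  then have 2: "\<bar>F t\<bar> \<le> n * M + s" using F_le[of t] s0 by linarith
  have e: "env n M w = 2 * k\<^sup>2 / dens_low S * (n * M + s) + (n * M + s)"
    by (simp add: env_def env_const_def s_def distrib_right)
  show ?thesis unfolding estimator_def sel' fst_conv snd_conv E_one_E3 e using 1 2 by linarith
qed

lemma loss_norm_everywhere:
  assumes n: "3 \<le> n" and sel: "measurable_minimizer S r n sel"
  shows "L_norm r (restrict_space lborel (cube (1/2))) (\<lambda>t. estimator S n sel (observations X \<epsilon> n F w) t - F t) \<le> ennreal (2 * env n M w)"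
proof -
  let ?e = "env n M w"
  have e0: "0 \<le> ?e" by (rule env_nonneg[OF M0])
  have "(\<integral>\<^sup>+t. ennreal (\<bar>estimator S n sel (observations X \<epsilon> n F w) t - F t\<bar> powr r) \<partial>restrict_space lborel (cube (1/2)))
     \<le> (\<integral>\<^sup>+t. ennreal (?e powr r) \<partial>restrict_space lborel (cube (1/2)))"
  proof (rule nn_integral_mono)
    fix t assume "t \<in> space (restrict_space lborel (cube (1/2)))"
    then have t: "t \<in> cube (1/2)" by (simp add: space_restrict_space)
    show "ennreal (\<bar>estimator S n sel (observations X \<epsilon> n F w) t - F t\<bar> powr r) \<le> ennreal (?e powr r)"
      using loss_everywhere[OF n sel t, of w] r by (intro ennreal_leI powr_mono2) auto
  qed
  also have "\<dots> = ennreal (?e powr r) * emeasure lborel (cube (1/2))"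
    by (simp add: emeasure_restrict_space space_restrict_space)
  also have "\<dots> \<le> ennreal (?e powr r) * 2" by (intro mult_left_mono emeasure_cube_half) auto
  also have "\<dots> = ennreal (?e powr r * 2)" by (subst ennreal_mult) auto
  finally have "L_norm r (restrict_space lborel (cube (1/2))) (\<lambda>t. estimator S n sel (observations X \<epsilon> n F w) t - F t) \<le> ennreal ((?e powr r * 2) powr (1/r))"
    using r by (intro L_norm_leI) auto
  also have "(?e powr r * 2) powr (1/r) = ?e * 2 powr (1/r)" using e0 r by (simp add: powr_mult powr_powr)
  also have "ennreal \<dots> \<le> ennreal (2 * ?e)"
  proof (rule ennreal_leI)
    have "2 powr (1/r) \<le> (2::real) powr 1" using r by (intro powr_mono) auto
    then have "?e * 2 powr (1/r) \<le> ?e * 2" using e0 by (intro mult_left_mono) auto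
    then show "?e * 2 powr (1/r) \<le> 2 * ?e" by simp
  qed
  finally show ?thesis .
qed

text \<open>Off the event the loss is at most 2 x with x the envelope, and 2 x <= 2 \<delta> x^2 + 2
  / \<delta>. This weighted form of Cauchy-Schwarz puts the second moment of the envelope and the
  probability of the bad event into separate summands.\<close>

lemma risk_split:
  assumes n: "3 \<le> n" and sel: "measurable_minimizer S r n sel" and G: "good \<in> events" "prob (space P - good) \<le> q"
    and on_good: "\<And>w. w \<in> good \<Longrightarrow> L_norm r (restrict_space lborel (cube (1/2))) (\<lambda>t. estimator S n sel (observations X \<epsilon> n F w) t - F t) \<le> ennreal c"
    and c: "0 \<le> c" and \<delta>: "0 < \<delta>"
  shows "risk P X \<epsilon> r n (estimator S n sel) F \<le> ennreal (c + 2 * \<delta> * (moment_const M * (real n)\<^sup>2) + 2 / \<delta> * q)"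
proof -
  have q0: "0 \<le> q" using G(2) measure_nonneg[of P "space P - good"] by linarith
  have [measurable]: "env n M \<in> borel_measurable P" by (rule env_measurable)
  have [measurable]: "space P - good \<in> events" using G by auto
  have "risk P X \<epsilon> r n (estimator S n sel) F \<le> (\<integral>\<^sup>+w. ennreal c + ennreal (2 * \<delta>) * ennreal ((env n M w)\<^sup>2) + ennreal (2 / \<delta>) * indicator (space P - good) w \<partial>P)"
    unfolding risk_def
  proof (rule nn_integral_mono)
    fix w assume w: "w \<in> space P"
    let ?N = "L_norm r (restrict_space lborel (cube (1/2))) (\<lambda>t. estimator S n sel (observations X \<epsilon> n F w) t - F t)"
    show "?N \<le> ennreal c + ennreal (2 * \<delta>) * ennreal ((env n M w)\<^sup>2) + ennreal (2 / \<delta>) * indicator (space P - good) w"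
    proof (cases "w \<in> good")
      case True
      then have "?N \<le> ennreal c + 0 + 0" using on_good by simp
      also have "\<dots> \<le> ennreal c + ennreal (2 * \<delta>) * ennreal ((env n M w)\<^sup>2) + ennreal (2 / \<delta>) * indicator (space P - good) w"
        by (intro add_mono) auto
      finally show ?thesis .
    next
      case False
      define x where "x = env n M w"
      have x: "0 \<le> x" unfolding x_def by (rule env_nonneg[OF M0])
      have "0 \<le> (\<delta> * x - 1)\<^sup>2 / \<delta>" using \<delta> by simp
      also have "\<dots> = \<delta> * x\<^sup>2 + 1 / \<delta> - 2 * x" using \<delta> by (simp add: power2_eq_square field_simps)
      finally have le: "2 * x \<le> 2 * \<delta> * x\<^sup>2 + 2 / \<delta>" using x by simp
      have "?N \<le> ennreal (2 * x)" unfolding x_def by (rule loss_norm_everywhere[OF n sel])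
      also have "\<dots> \<le> ennreal (2 * \<delta> * x\<^sup>2 + 2 / \<delta>)" by (rule ennreal_leI[OF le])
      also have "\<dots> = 0 + ennreal (2 * \<delta>) * ennreal (x\<^sup>2) + ennreal (2 / \<delta>) * 1"
        using \<delta> by (simp add: ennreal_mult'[symmetric] ennreal_plus)
      also have "\<dots> \<le> ennreal c + ennreal (2 * \<delta>) * ennreal ((env n M w)\<^sup>2) + ennreal (2 / \<delta>) * indicator (space P - good) w"
        using False w unfolding x_def by (intro add_mono) auto
      finally show ?thesis .
    qed
  qed
  also have "\<dots> = ennreal c + ennreal (2 * \<delta>) * (\<integral>\<^sup>+w. ennreal ((env n M w)\<^sup>2) \<partial>P) + ennreal (2 / \<delta>) * emeasure P (space P - good)"
    by (simp add: nn_integral_add nn_integral_cmult emeasure_space_1)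
  also have "\<dots> \<le> ennreal c + ennreal (2 * \<delta>) * ennreal (moment_const M * (real n)\<^sup>2) + ennreal (2 / \<delta>) * ennreal q"
    using G(2) by (intro add_mono mult_left_mono env_moment order_refl) (auto simp: emeasure_eq_measure intro: ennreal_leI)
  also have "\<dots> = ennreal (c + 2 * \<delta> * (moment_const M * (real n)\<^sup>2) + 2 / \<delta> * q)"
  proof -
    have a: "0 \<le> 2 * \<delta> * (moment_const M * (real n)\<^sup>2)" "0 \<le> 2 / \<delta> * q" using \<delta> q0 moment_const_nonneg[of M] by simp_all
    have e: "ennreal (2 * \<delta>) * ennreal (moment_const M * (real n)\<^sup>2) = ennreal (2 * \<delta> * (moment_const M * (real n)\<^sup>2))"
      "ennreal (2 / \<delta>) * ennreal q = ennreal (2 / \<delta> * q)"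
      using \<delta> q0 moment_const_nonneg[of M] by (intro ennreal_mult[symmetric]; simp)+
    show ?thesis unfolding e using a c by (simp only: ennreal_plus[symmetric] add_nonneg_nonneg)
  qed
  finally show ?thesis .
qed

text \<open>\<open>risk_split\<close> with the empty set as good event and \<delta> = 1.\<close>

lemma risk_crude:
  assumes n: "3 \<le> n" and sel: "measurable_minimizer S r n sel"
  shows "risk P X \<epsilon> r n (estimator S n sel) F \<le> ennreal (2 * (moment_const M * (real n)\<^sup>2) + 2)"
proof -
  have "risk P X \<epsilon> r n (estimator S n sel) F \<le> ennreal (0 + 2 * 1 * (moment_const M * (real n)\<^sup>2) + 2 / 1 * 1)"
    by (rule risk_split[OF n sel, where good="{}"]) auto
  then show ?thesis by simp
qed

definition level_const :: real where "level_const = max 1 bias_const"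

definition loss_const :: "real \<Rightarrow> real" where
  "loss_const C = 9 + 10 * (k\<^sup>2 + (2 * M + 4 * C) * C + C)"

lemma loss_norm_good:
  assumes n: "sample_size_ok M b0 n" and sel: "measurable_minimizer S r n sel" and w: "w \<in> space P"
    and main_params: "\<And>s. s \<in> main_params n \<Longrightarrow> \<bar>F_hat_at n F w s - mean s F\<bar> \<le> dev (40 * ln n) n F_sup s + net_err n M"
    and pil: "\<And>s. s \<in> pilot_params n \<Longrightarrow> \<bar>F_hat_at n F w s - mean s F\<bar> \<le> dev (40 * ln n) n M s + net_err n M"
    and C: "C1 S r n \<le> C * sqrt (ln n)" "C2 S r n \<le> C * sqrt (ln n)" "C5 S r n \<le> C"
    and p1: "1 < p" and Cd: "0 \<le> Cd"
    and levels: "dyadic_sum_bound r \<beta> p level_const Cd"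
    and hm: "h_min S n \<le> (sqrt (ln (real n) / n) / level_const) powr (2 / (2 * \<beta> - 2 / p + 1))"
  shows "L_norm r (restrict_space lborel (cube (1/2))) (\<lambda>t. estimator S n sel (observations X \<epsilon> n F w) t - F t) \<le>
    ennreal (loss_const C * ((2 + 2 * level_const * 2 powr (r/2)) * Cd) powr (1/r) / rate_const r \<beta> L p * rate r n \<beta> L p)"
proof -
  have n3: "3 \<le> n" using n by (simp add: sample_size_ok_def)
  have Ln: "1 \<le> ln (real n)" by (rule ln_ge_1[OF n3])
  have n0: "0 < real n" using n3 by simp
  define \<rho> where "\<rho> = sqrt (ln (real n) / n)"
  have x: "0 < ln (real n) / n" "ln (real n) / n \<le> 1" using Ln n0 ln_le_minus_one[OF n0] by auto
  have \<rho>: "0 < \<rho>" "\<rho> \<le> 1" using x by (simp_all add: \<rho>_def)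
  have "- log 2 \<rho> \<le> ln n"
  proof -
    have l2: "0 < ln (2::real)" by simp
    have "\<rho> = (ln (real n) / n) powr (1/2)" using x by (simp add: \<rho>_def powr_half_sqrt)
    then have "ln \<rho> = ln (ln (real n) / n) / 2" using x by (simp add: ln_powr)
    also have "ln (ln (real n) / n) = ln (ln (real n)) - ln n" using Ln n0 by (simp add: ln_div)
    finally have "- ln \<rho> \<le> ln n * (1/2)" using Ln by simp
    also have "\<dots> \<le> ln n * ln 2" using Ln ln2_ge_two_thirds by (intro mult_left_mono) auto
    finally have "- ln \<rho> / ln 2 \<le> ln n" by (simp only: pos_divide_le_eq[OF l2])
    then show ?thesis by (simp add: log_def)
  qed
  from levels[unfolded dyadic_sum_bound_def, rule_format, OF \<rho> Ln this] obtain i j where ij: "i \<le> j"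
    and top: "level_const * ((1/2) ^ j) powr (\<beta> - 1 / p) \<le> \<rho> * ((1/2) ^ j) powr (-1/2)"
    and jj: "2 ^ j \<le> 2 * (level_const / \<rho>) powr (2 / (2 * \<beta> - 2 / p + 1))"
    and su: "\<rho> powr r * 2 powr (real i * r / 2) + \<rho> powr (r - p) * (\<Sum>k\<in>{i..<j}. 2 powr (real k * ((r - p * (2 * \<beta> + 1)) / 2)))
         \<le> Cd * rho_rate r \<beta> p (ln n) \<rho>" by blast
  have lc: "1 \<le> level_const" "bias_const \<le> level_const" by (auto simp: level_const_def)
  have C0: "0 \<le> C" using C_nonneg(5)[OF n3] C(3) by linarith
  define Z where "Z = loss_const C"
  have Z: "0 \<le> Z" unfolding Z_def loss_const_def using C0 M0 by (intro add_nonneg_nonneg mult_nonneg_nonneg) auto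
  have top': "bias_const * ((1/2) ^ j) powr (\<beta> - 1 / p) \<le> \<rho> * ((1/2) ^ j) powr (-1/2)"
    using lc by (intro order.trans[OF _ top] mult_right_mono) auto
  \<comment> \<open>Level j, and with it every level from i to j, stays in the bandwidth grid; the
    factor 2 lost in rounding j up is the one provided by the lower end h_min / 2.\<close>
  have hj: "h_min S n / 2 \<le> (1/2) ^ j"
  proof -
    define y where "y = (level_const / \<rho>) powr (2 / (2 * \<beta> - 2 / p + 1))"
    have y0: "0 < y" using lc \<rho> by (simp add: y_def)
    have "h_min S n \<le> 1 / y"
      using hm lc \<rho> unfolding \<rho>_def[symmetric] y_def by (simp add: powr_divide)
    then have "h_min S n / 2 \<le> 1 / (2 * y)" by simp
    also have "\<dots> \<le> 1 / 2 ^ j" using jj y0 unfolding y_def[symmetric] by (intro divide_left_mono) auto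
    finally show ?thesis by (simp add: power_one_over)
  qed
  have "(\<integral>\<^sup>+t. ennreal (\<bar>estimator S n sel (observations X \<epsilon> n F w) t - F t\<bar> powr r) \<partial>restrict_space lborel (cube (1/2)))
    \<le> ennreal (Z powr r * (2 + 2 * bias_const * 2 powr (r/2)) *
       (\<rho> powr r * 2 powr (real i * r / 2) + \<rho> powr (r - p) * (\<Sum>m\<in>{i..<j}. 2 powr (real m * ((r - p * (2 * \<beta> + 1)) / 2)))))"
  proof (rule level_sum_bound[OF ij \<rho>(1) Z top'])
    fix t m
    assume t: "t \<in> cube (1/2)" and m: "i \<le> m" "m \<le> j"
      and ok: "bias_ok ((1/2) ^ m) (\<rho> * ((1/2) ^ m) powr (-1/2)) (t \<bullet> \<theta>0)"
    have "h_min S n / 2 \<le> (1/2) ^ m" using m(2) by (intro order.trans[OF hj] power_decreasing) auto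
    moreover have "(1/2::real) ^ m \<le> 1" by (intro power_le_one) auto
    ultimately have h: "(1/2) ^ m \<in> bandwidths S n" by (auto simp: bandwidths_def)
    have "\<bar>estimator S n sel (observations X \<epsilon> n F w) t - F t\<bar> \<le>
      9 * (\<rho> * ((1/2) ^ m) powr (-1/2)) + 10 * (k\<^sup>2 + (2 * M + 4 * C) * C + C) * (sqrt (ln n / n) * ((1/2) ^ m) powr (-1/2))"
      by (rule loss_on_good_event[OF n sel w main_params pil C t h _ ok]) (use \<rho> in auto)
    also have "\<dots> = Z * (\<rho> * ((1/2) ^ m) powr (-1/2))"
      unfolding \<rho>_def[symmetric] Z_def loss_const_def by (simp only: distrib_right)
    finally show "\<bar>estimator S n sel (observations X \<epsilon> n F w) t - F t\<bar> \<le> Z * (\<rho> * ((1/2) ^ m) powr (-1/2))" .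
  qed
  also have "\<dots> \<le> ennreal (Z powr r * (2 + 2 * level_const * 2 powr (r/2)) * (Cd * rho_rate r \<beta> p (ln n) \<rho>))"
    using lc bias_const_nonneg by (intro ennreal_leI mult_mono su mult_left_mono add_left_mono mult_right_mono mult_nonneg_nonneg add_nonneg_nonneg sum_nonneg) auto
  finally have "L_norm r (restrict_space lborel (cube (1/2))) (\<lambda>t. estimator S n sel (observations X \<epsilon> n F w) t - F t) \<le>
     ennreal ((Z powr r * (2 + 2 * level_const * 2 powr (r/2)) * (Cd * rho_rate r \<beta> p (ln n) \<rho>)) powr (1/r))"
    using r lc Cd Ln by (intro L_norm_leI mult_nonneg_nonneg add_nonneg_nonneg) (auto simp: rho_rate_def)
  also have "(Z powr r * (2 + 2 * level_const * 2 powr (r/2)) * (Cd * rho_rate r \<beta> p (ln n) \<rho>)) powr (1/r) =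
      Z * ((2 + 2 * level_const * 2 powr (r/2)) * Cd) powr (1/r) * rho_rate r \<beta> p (ln n) \<rho> powr (1/r)"
  proof -
    have a: "0 \<le> (2 + 2 * level_const * 2 powr (r/2)) * Cd" using lc Cd by (intro mult_nonneg_nonneg add_nonneg_nonneg) auto
    have b: "0 \<le> rho_rate r \<beta> p (ln n) \<rho>" using Ln by (auto simp: rho_rate_def)
    have "(Z powr r * (2 + 2 * level_const * 2 powr (r/2)) * (Cd * rho_rate r \<beta> p (ln n) \<rho>)) =
       Z powr r * ((2 + 2 * level_const * 2 powr (r/2)) * Cd) * rho_rate r \<beta> p (ln n) \<rho>" by (simp only: mult.assoc)
    moreover have "(Z powr r) powr (1/r) = Z" using Z r by (simp add: powr_powr)
    ultimately show ?thesis using a b by (simp add: powr_mult)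
  qed
  also have "\<dots> = loss_const C * ((2 + 2 * level_const * 2 powr (r/2)) * Cd) powr (1/r) / rate_const r \<beta> L p * rate r n \<beta> L p"
    unfolding rate_eq[OF n3 p1 \<beta>p r] Z_def \<rho>_def using rate_const_pos[OF L, of r \<beta> p] by simp
  finally show ?thesis .
qed

lemma risk_asymptotic:
  assumes n: "sample_size_ok M b0 n" and sel: "measurable_minimizer S r n sel"
    and C: "C1 S r n \<le> C * sqrt (ln n)" "C2 S r n \<le> C * sqrt (ln n)" "C5 S r n \<le> C"
    and p1: "1 < p" and Cd: "0 \<le> Cd"
    and levels: "dyadic_sum_bound r \<beta> p level_const Cd"
    and hm: "h_min S n \<le> (sqrt (ln (real n) / n) / level_const) powr (2 / (2 * \<beta> - 2 / p + 1))"
  shows "risk P X \<epsilon> r n (estimator S n sel) F \<le>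
    ennreal ((loss_const C * ((2 + 2 * level_const * 2 powr (r/2)) * Cd) powr (1/r) + 2 * (moment_const M + (2 * Ups S + 9604))) / rate_const r \<beta> L p * rate r n \<beta> L p)"
proof -
  have n3: "3 \<le> n" and lg: "large n" using n by (simp_all add: sample_size_ok_def)
  have n0: "0 < real n" using n3 by simp
  define R where "R = rate r n \<beta> L p / rate_const r \<beta> L p"
  have rc: "0 < rate_const r \<beta> L p" by (rule rate_const_pos[OF L])
  have R: "1 / n \<le> R" using rate_ge[OF n3 p1 \<beta>p r, of L] rc by (simp add: R_def pos_le_divide_eq)
  have R0: "0 \<le> R" using R n0 by (meson order.trans zero_le_divide_1_iff of_nat_0_le_iff)
  define A where "A = loss_const C * ((2 + 2 * level_const * 2 powr (r/2)) * Cd) powr (1/r)"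
  have C0: "0 \<le> C" using C_nonneg(5)[OF n3] C(3) by linarith
  have A0: "0 \<le> A" unfolding A_def loss_const_def using C0 M0 by (intro mult_nonneg_nonneg add_nonneg_nonneg) auto
  define q where "q = (2 * Ups S + 9604) / real n ^ 4"
  obtain G0 where G0: "G0 \<in> events" "prob (space P - G0) \<le> q"
    "\<And>w s. w \<in> G0 \<Longrightarrow> s \<in> main_params n \<Longrightarrow> \<bar>F_hat_at n F w s - mean s F\<bar> \<le> dev (40 * ln n) n F_sup s + net_err n M"
    "\<And>w s. w \<in> G0 \<Longrightarrow> s \<in> pilot_params n \<Longrightarrow> \<bar>F_hat_at n F w s - mean s F\<bar> \<le> dev (40 * ln n) n M s + net_err n M"
    using good_event[OF lg F_meas F_le F_sup_nonneg F_le_F_sup] unfolding q_def by blast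
  \<comment> \<open>The choice \<delta> = n^(-3) balances the two error terms: \<delta> n^2 and
    n^(-4) / \<delta> both equal 1 / n.\<close>
  have "risk P X \<epsilon> r n (estimator S n sel) F \<le> ennreal (A * R + 2 * (1 / real n ^ 3) * (moment_const M * (real n)\<^sup>2) + 2 / (1 / real n ^ 3) * q)"
  proof (rule risk_split[OF n3 sel G0(1,2)])
    fix w assume w: "w \<in> G0"
    then have "w \<in> space P" using G0(1) sets.sets_into_space by blast
    from loss_norm_good[OF n sel this G0(3,4) C p1 Cd levels hm] w
    show "L_norm r (restrict_space lborel (cube (1/2))) (\<lambda>t. estimator S n sel (observations X \<epsilon> n F w) t - F t) \<le> ennreal (A * R)"
      by (simp add: A_def R_def)
  qed (use A0 R0 n0 in auto)
  also have "\<dots> \<le> ennreal ((A + 2 * (moment_const M + (2 * Ups S + 9604))) * R)"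
  proof (rule ennreal_leI)
    have e: "2 * (1 / real n ^ 3) * (moment_const M * (real n)\<^sup>2) = 2 * moment_const M * (1 / n)"
      "2 / (1 / real n ^ 3) * q = 2 * (2 * Ups S + 9604) * (1 / n)"
      using n0 by (simp_all add: q_def field_simps power_numeral_reduce)
    have gen: "A * R + 2 * m * u + 2 * s * u \<le> (A + 2 * (m + s)) * R" if "2 * (m + s) * u \<le> 2 * (m + s) * R" for m s u :: real
      using that by (simp add: algebra_simps)
    show "A * R + 2 * (1 / real n ^ 3) * (moment_const M * (real n)\<^sup>2) + 2 / (1 / real n ^ 3) * q \<le> (A + 2 * (moment_const M + (2 * Ups S + 9604))) * R"
      unfolding e using R moment_const_nonneg[of M] noise_params by (intro gen mult_left_mono) auto
  qed
  finally show ?thesis by (simp add: A_def R_def)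
qed

end

lemma holder_classD:
  assumes f: "f \<in> holder_class b M" and b: "0 < b" and M: "0 < M"
  shows "\<bar>f x\<bar> \<le> M" "\<bar>f (x + v) - f x\<bar> \<le> M * \<bar>v\<bar> powr b"
proof -
  let ?A = "SUP y. ennreal \<bar>f y\<bar>"
  let ?B = "SUP (y1, y2) \<in> {(y1, y2). y1 \<noteq> y2}. ennreal (\<bar>f y1 - f y2\<bar> / \<bar>y1 - y2\<bar> powr b)"
  have s: "?A + ?B \<le> ennreal M" using f by (simp add: holder_class_def)
  have "ennreal \<bar>f x\<bar> \<le> ?A" by (rule SUP_upper) simp
  also have "\<dots> \<le> ?A + ?B" by (rule add_increasing2) auto
  finally have "ennreal \<bar>f x\<bar> \<le> ennreal M" using s by (rule order.trans)
  then show "\<bar>f x\<bar> \<le> M" using M by (simp add: ennreal_le_iff)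
  show "\<bar>f (x + v) - f x\<bar> \<le> M * \<bar>v\<bar> powr b"
  proof (cases "v = 0")
    case False
    then have "(x + v, x) \<in> {(y1, y2). y1 \<noteq> y2}" by simp
    then have "(case (x + v, x) of (y1, y2) \<Rightarrow> ennreal (\<bar>f y1 - f y2\<bar> / \<bar>y1 - y2\<bar> powr b)) \<le> ?B"
      by (rule SUP_upper)
    also have "\<dots> \<le> ?A + ?B" by (rule add_increasing) auto
    finally have "ennreal (\<bar>f (x + v) - f x\<bar> / \<bar>v\<bar> powr b) \<le> ennreal M" using s by simp
    then have "\<bar>f (x + v) - f x\<bar> / \<bar>v\<bar> powr b \<le> M" using M by (simp add: ennreal_le_iff)
    then show ?thesis using False by (simp add: pos_divide_le_eq)
  qed simp
qed

context single_index_model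
begin

lemma single_index_target_instance:
  assumes L: "0 < L" and p: "1 < p" and \<beta>: "1 / p < \<beta>" "\<beta> \<le> b" and b0: "0 < b0" and M: "0 < M"
    and sub: "nikolskii p \<beta> L \<subseteq> holder_class b0 M" and f: "f \<in> nikolskii p \<beta> L" and \<theta>: "\<theta> \<in> unit_circle"
  shows "single_index_target P X \<epsilon> l S b r p \<beta> L f b0 M \<theta>"
proof -
  have "0 < 1 / p" using p by simp
  then have \<beta>0: "0 < \<beta>" using \<beta> by linarith
  have h: "f \<in> holder_class b0 M" using sub f by blast
  interpret nk: nikolskii_fun p \<beta> L f using p \<beta>0 L f by unfold_locales auto
  interpret nik_kernel p \<beta> L f "kern S" "kern_inf S" "strict_floor b" b0 M
    using strict_floor_mono[OF \<beta>0 \<beta>(2)] b0 holder_classD[OF h b0 M] \<beta>(1) by unfold_locales (auto simp: nk.m_def)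
  show ?thesis using \<theta> by unfold_locales
qed

text \<open>Every constant is fixed before a function of the class is chosen, which is what makes
  the bound uniform over f and the direction; it may depend on the Hoelder pair.\<close>

lemma uniform_risk:
  assumes L: "0 < L" and p: "1 < p" and \<beta>: "1 / p < \<beta>" "\<beta> \<le> b" and b0: "0 < b0" and M: "0 < M"
    and sub: "nikolskii p \<beta> L \<subseteq> holder_class b0 M"
  shows "\<exists>\<kappa>. \<forall>n sel. 3 \<le> n \<longrightarrow> measurable_minimizer S r n sel \<longrightarrow>
    (SUP F \<in> single_index_class p \<beta> L. risk P X \<epsilon> r n (estimator S n sel) F) \<le> ennreal (\<kappa> * rate r n \<beta> L p)"
proof -
  define q where "q = 2 * \<beta> - 2 / p + 1"
  have q: "1 < q" using \<beta> by (simp add: q_def)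
  \<comment> \<open>Outside its locale \<open>bias_const\<close> takes p, \<beta>, L and k as
    arguments, neither f nor the direction, so one D serves the whole class.\<close>
  define D where "D = max 1 (nik_kernel.bias_const p \<beta> L k)"
  have D: "1 \<le> D" by (simp add: D_def)
  obtain C where C: "0 \<le> C" "\<And>n. 3 \<le> n \<Longrightarrow> C1 S r n \<le> C * sqrt (ln n) \<and> C2 S r n \<le> C * sqrt (ln n) \<and> C5 S r n \<le> C"
    using C_upper by blast
  obtain Cd where Cd: "0 \<le> Cd" and levels: "dyadic_sum_bound r \<beta> p D Cd"
    using dyadic_levels[OF p \<beta>(1) r D] by blast
  have "eventually (\<lambda>n. sample_size_ok M b0 n \<and> h_min S n \<le> (sqrt (ln (real n) / n) / D) powr (2 / q)) sequentially"
    using eventually_sample_size_ok[OF b0] eventually_level[OF q less_le_trans[OF zero_less_one D]] by (rule eventually_conj)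
  then obtain N where N: "\<And>n. N \<le> n \<Longrightarrow> sample_size_ok M b0 n \<and> h_min S n \<le> (sqrt (ln (real n) / n) / D) powr (2 / q)"
    unfolding eventually_sequentially by blast
  define c where "c = rate_const r \<beta> L p"
  have c: "0 < c" unfolding c_def by (rule rate_const_pos[OF L])
  define A1 where "A1 = ((9 + 10 * (k\<^sup>2 + (2 * M + 4 * C) * C + C)) * ((2 + 2 * D * 2 powr (r/2)) * Cd) powr (1/r) + 2 * (moment_const M + (2 * Ups S + 9604))) / c"
  \<comment> \<open>For n < N the crude risk bound is at most its value at N, while the rate is at
    least c / n >= c / N; this is their quotient.\<close>
  define A2 where "A2 = (2 * (moment_const M * (real N)\<^sup>2) + 2) * N / c"
  have A: "0 \<le> A1" "0 \<le> A2" unfolding A1_def A2_def using c C M moment_const_nonneg[of M] noise_params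
    by (auto intro!: divide_nonneg_pos add_nonneg_nonneg mult_nonneg_nonneg)
  have "risk P X \<epsilon> r n (estimator S n sel) F \<le> ennreal ((A1 + A2) * rate r n \<beta> L p)"
    if n: "3 \<le> n" and sel: "measurable_minimizer S r n sel" and F: "F \<in> single_index_class p \<beta> L" for n sel F
  proof -
    obtain f \<theta> where f: "f \<in> nikolskii p \<beta> L" and \<theta>: "\<theta> \<in> unit_circle" and Ff: "\<And>z. F z = f (z \<bullet> \<theta>)"
      using F unfolding single_index_class_def by blast
    interpret sf: single_index_target P X \<epsilon> l S b r p \<beta> L f b0 M \<theta>
      by (rule single_index_target_instance[OF L p \<beta> b0 M sub f \<theta>])
    have F': "F = sf.F" by (rule ext) (simp add: Ff sf.F_def)
    have Dl: "sf.level_const = D" by (simp add: sf.level_const_def D_def)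
    have rt: "c / n \<le> rate r n \<beta> L p" unfolding c_def by (rule rate_ge[OF n p \<beta>(1) r])
    have rt0: "0 \<le> rate r n \<beta> L p" using rt c by (meson divide_nonneg_nonneg less_imp_le of_nat_0_le_iff order.trans)
    show ?thesis
    proof (cases "N \<le> n")
      case True
      note C' = C(2)[OF n]
      have "risk P X \<epsilon> r n (estimator S n sel) F \<le> ennreal (A1 * rate r n \<beta> L p)"
        unfolding F' A1_def c_def Dl[symmetric] sf.loss_const_def[symmetric]
      proof (rule sf.risk_asymptotic[OF _ sel _ _ _ p Cd])
        show "sample_size_ok M b0 n" "h_min S n \<le> (sqrt (ln (real n) / n) / sf.level_const) powr (2 / (2 * \<beta> - 2 / p + 1))"
          using N[OF True] unfolding Dl q_def by blast+
      qed (use C' levels in \<open>simp_all only: Dl\<close>)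
      also have "\<dots> \<le> ennreal ((A1 + A2) * rate r n \<beta> L p)" using A rt0 by (intro ennreal_leI mult_right_mono) auto
      finally show ?thesis .
    next
      case False
      then have nN: "real n \<le> real N" by simp
      have n0: "0 < real n" using n by simp
      have "2 * (moment_const M * (real n)\<^sup>2) + 2 \<le> 2 * (moment_const M * (real N)\<^sup>2) + 2"
        using nN moment_const_nonneg[of M] by (intro add_right_mono mult_left_mono power_mono) auto
      also have "\<dots> = A2 * (c / N)" using c nN n0 by (simp add: A2_def)
      also have "\<dots> \<le> A2 * (c / n)" using A c nN n0 by (intro mult_left_mono divide_left_mono mult_pos_pos) auto
      also have "\<dots> \<le> A2 * rate r n \<beta> L p" using A rt by (intro mult_left_mono) auto
      also have "\<dots> \<le> (A1 + A2) * rate r n \<beta> L p" using A rt0 by (intro mult_right_mono) auto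
      finally have "ennreal (2 * (moment_const M * (real n)\<^sup>2) + 2) \<le> ennreal ((A1 + A2) * rate r n \<beta> L p)" by (rule ennreal_leI)
      then show ?thesis unfolding F' by (rule order.trans[OF sf.risk_crude[OF n sel]])
    qed
  qed
  then show ?thesis by (intro exI[of _ "A1 + A2"] allI impI SUP_least)
qed

end

theorem theorem5:
  fixes P :: "'a measure"
    and X :: "nat \<Rightarrow> 'a \<Rightarrow> real^2" and \<epsilon> :: "nat \<Rightarrow> 'a \<Rightarrow> real"
    and l :: "real \<Rightarrow> real" and S :: setting
    and b L p \<beta> r :: real
  assumes model: "regression_model P X \<epsilon> (dens S) l"
    and noise_params: "0 < Ups S" "0 < Omg S" "Omg S \<le> 1" "0 < omg S"
    and noise: "l \<in> noise_class (Ups S) (Omg S) (omg S)"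
    and design: "0 < dens_low S" "dens_low S < 1" "\<And>x. x \<in> cube 3 \<Longrightarrow> dens_low S \<le> dens S x"
    and kernel_sym: "\<And>u. kern S (- u) = kern S u"
    and kernel_supp: "closure {u. kern S u \<noteq> 0} \<subseteq> {-1/2..1/2}"
    and kernel_int: "(LINT u|lborel. kern S u) = 1"
    and kernel_lip: "0 < lip S" "\<And>u v. \<bar>kern S u - kern S v\<bar> \<le> lip S * \<bar>u - v\<bar>"
    and b: "0 < b"
    and kernel_moments: "\<And>j. j \<in> {1..strict_floor b} \<Longrightarrow> (LINT u|lborel. u ^ j * kern S u) = 0"
    and L: "0 < L" and p: "1 < p" and \<beta>: "1 / p < \<beta>" "\<beta> \<le> b" and r: "1 \<le> r"
  shows "\<exists>\<kappa>::real. \<forall>\<beta>0 M n sel.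
           0 < \<beta>0 \<and> \<beta>0 < 1 \<and> 0 < M \<and> nikolskii p \<beta> L \<subseteq> holder_class \<beta>0 M \<and>
           max (n0 S \<beta>0 M) (n1 S r) \<le> n \<and> measurable_minimizer S r n sel \<longrightarrow>
           (SUP F \<in> single_index_class p \<beta> L. risk P X \<epsilon> r n (estimator S n sel) F)
             \<le> ennreal (\<kappa> * rate r n \<beta> L p)"
proof -
  interpret single_index_model P X \<epsilon> l S b r
    using assms by (intro single_index_model.intro single_index_model_axioms.intro) auto
  show ?thesis
  \<comment> \<open>The constant may not depend on the Hoelder pair. Any single admissible pair
    yields a \<kappa> for an inequality that no longer mentions the pair, and without an admissible
    pair the claim is vacuous.\<close>
  proof (cases "\<exists>b0 M. 0 < b0 \<and> 0 < M \<and> nikolskii p \<beta> L \<subseteq> holder_class b0 M")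
    case True
    then obtain b0 M where "0 < b0" "0 < M" "nikolskii p \<beta> L \<subseteq> holder_class b0 M" by blast
    from uniform_risk[OF L p \<beta> this] obtain \<kappa> where "\<forall>n sel. 3 \<le> n \<longrightarrow> measurable_minimizer S r n sel \<longrightarrow>
      (SUP F \<in> single_index_class p \<beta> L. risk P X \<epsilon> r n (estimator S n sel) F) \<le> ennreal (\<kappa> * rate r n \<beta> L p)" by blast
    moreover have "3 \<le> n" if "max (n0 S \<beta>0 M) (n1 S r) \<le> n" for \<beta>0 M n
      using that n_ge_3[of n] by simp
    ultimately show ?thesis by (intro exI[of _ \<kappa>]) blast
  qed blast
qed

end
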